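(* Let $m\in\mathbb{N}_0$, $T\in(0,\infty)$, assume that $V\in\mathcal{C}^{m+4}$ and let $u_0\in H^{m+4}$ be non-random. Let $(u(t))_{t\in[0,T]}$ be the solution of the stochastic Schrödinger equation with white noise dispersion and let $u_n$ be the numerical solution given by the splitting scheme with time-step size $\tau$, both with initial value $u_0$ (see context). Then: (1) One has convergence in probability of order one: $$\lim_{C\to\infty}\ \sup_{\tau\in(0,1)}\ \mathbb{P}\left(\|u_N-u(T)\|_{H^m}\ge C\tau\right)=0,$$ where $T=N\tau$ (the supremum being over $\tau\in(0,1)$ of the form $\tau=T/N$, $N\in\mathbb{N}$). (2) Consider the sequence of time-step sizes $\tau_L=\frac{T}{2^L}$, $L\in\mathbb{N}$. For every $\varepsilon\in(0,1)$, there exists an almost surely finite random variable $C_\varepsilon$ such that for all $L\in\mathbb{N}$ one has $$\|u_{2^L}-u(T)\|_{H^m}\le C_\varepsilon\left(\frac{T}{2^L}\right)^{1-\varepsilon},$$ where $u_{2^L}$ is computed by the splitting scheme with time-step size $\tau_L$.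
   Context: $\mathbb{N}=\{1,2,\ldots\}$, $\mathbb{N}_0=\{0,1,\ldots\}$, $d\in\mathbb{N}$. $L^2=L^2(\mathbb{R}^d,\mathbb{C})$; $H^m=H^m(\mathbb{R}^d,\mathbb{C})$ is the Sobolev space with norm $\|v\|_{H^m}^2=\sum_{|\alpha|\le m}\|\partial_\alpha v\|_{L^2}^2$ (so $H^0=L^2$). $\mathcal{C}^m=\mathcal{C}^m(\mathbb{R}^d,\mathbb{C})$ is the Banach space of functions of class $\mathcal{C}^m$ with finite norm $\|v\|_{\mathcal{C}^m}=\sup_{|\alpha|\le m}\sup_{x\in\mathbb{R}^d}|\partial_\alpha v(x)|$. The potential $V:\mathbb{R}^d\to\mathbb{R}$ is real-valued, and $V[u]=V\star|u|^2=\int_{\mathbb{R}^d}V(\cdot-x)|u(x)|^2\,dx$. $\beta=(\beta(t))_{t\ge0}$ is a standard real-valued Brownian motion on a filtered probability space $(\Omega,\mathcal{F},\mathbb{P},\{\mathcal{F}_t\}_{t\ge0})$ satisfying the usual conditions. For $t,s\ge0$, $S(t,s)=e^{i(\beta(t)-\beta(s))\Delta}$, i.e. in Fourier variables $\widehat{S(t,s)v}(\zeta)=\exp(-i|\zeta|^2(\beta(t)-\beta(s)))\,\widehat v(\zeta)$. The stochastic Schrödinger equation with white noise dispersion is (Stratonovich sense) $i\,du(t)+\Delta u(t)\circ d\beta(t)+V[u(t)]u(t)\,dt=0$, $u(0)=u_0$; its solution is the unique mild solution, satisfying $u(t)=S(t,0)u_0+i\int_0^tS(t,r)(V[u(r)]u(r))\,dr$.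 Splitting scheme: for $\tau=T/N$ and $t_n=n\tau$, starting from $u_0$, $u_{n+1}=S(t_{n+1},t_n)\Phi_\tau(u_n)$, where $\Phi_t(u)=e^{itV[u]}u$. *)

theory Defs
  imports "HOL-Probability.Probability"
begin

definition square_integrable :: "('a::euclidean_space \<Rightarrow> complex) \<Rightarrow> bool" where
  "square_integrable f \<longleftrightarrow>
     f \<in> borel_measurable lborel \<and> integrable lborel (\<lambda>x. (cmod (f x))\<^sup>2)"

lemma square_integrable_zero: "square_integrable (\<lambda>x. 0)"
  by (simp add: square_integrable_def)

lemma square_integrable_inner:
  assumes "square_integrable f" "square_integrable g"
  shows "integrable lborel (\<lambda>x. f x \<bullet> g x)"
proof (rule Bochner_Integration.integrable_bound)
  show "integrable lborel (\<lambda>x. (cmod (f x))\<^sup>2 + (cmod (g x))\<^sup>2)"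
    using assms by (auto simp: square_integrable_def)
  show "(\<lambda>x. f x \<bullet> g x) \<in> borel_measurable lborel"
    using assms by (auto simp: square_integrable_def)
  have "\<bar>f x \<bullet> g x\<bar> \<le> (cmod (f x))\<^sup>2 + (cmod (g x))\<^sup>2" for x
  proof -
    have "\<bar>f x \<bullet> g x\<bar> \<le> cmod (f x) * cmod (g x)"
      by (rule Cauchy_Schwarz_ineq2)
    also have "\<dots> \<le> (cmod (f x))\<^sup>2 + (cmod (g x))\<^sup>2"
      using sum_squares_bound[of "cmod (f x)" "cmod (g x)"]
        mult_nonneg_nonneg[OF norm_ge_zero norm_ge_zero, of "f x" "g x"] by linarith
    finally show ?thesis .
  qed
  then show "AE x in lborel. norm (f x \<bullet> g x) \<le> norm ((cmod (f x))\<^sup>2 + (cmod (g x))\<^sup>2)"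
    by auto
qed

lemma square_integrable_add:
  assumes "square_integrable f" "square_integrable g"
  shows "square_integrable (\<lambda>x. f x + g x)"
proof -
  have "(cmod (f x + g x))\<^sup>2 = (cmod (f x))\<^sup>2 + (cmod (g x))\<^sup>2 + 2 * (f x \<bullet> g x)" for x
    by (simp add: power2_norm_eq_inner inner_add inner_commute)
  then show ?thesis
    using assms square_integrable_inner[OF assms] by (auto simp: square_integrable_def)
qed

lemma square_integrable_scaleR:
  "square_integrable f \<Longrightarrow> square_integrable (\<lambda>x. r *\<^sub>R f x)"
  by (auto simp: square_integrable_def power_mult_distrib)

lemma square_integrable_uminus:
  "square_integrable f \<Longrightarrow> square_integrable (\<lambda>x. - f x)"
  by (auto simp: square_integrable_def)

lemma square_integrable_minus:
  "square_integrable f \<Longrightarrow> square_integrable g \<Longrightarrow> square_integrable (\<lambda>x. f x - g x)"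
  using square_integrable_add[of f "\<lambda>x. - g x"] square_integrable_uminus[of g] by simp

definition l2_rel :: "('a::euclidean_space \<Rightarrow> complex) \<Rightarrow> ('a \<Rightarrow> complex) \<Rightarrow> bool" where
  "l2_rel f g \<longleftrightarrow> square_integrable f \<and> square_integrable g \<and> (AE x in lborel. f x = g x)"

quotient_type (overloaded) 'a l2 = "'a::euclidean_space \<Rightarrow> complex" / partial: l2_rel
proof (rule part_equivpI)
  show "\<exists>f. l2_rel f f"
    using square_integrable_zero by (auto simp: l2_rel_def)
  show "symp l2_rel"
    by (auto simp: symp_def l2_rel_def)
  show "transp l2_rel"
    by (unfold transp_def l2_rel_def, safe, auto)
qed

instantiation l2 :: (euclidean_space) real_vector
begin

lift_definition zero_l2 :: "'a l2" is "\<lambda>x. 0"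
  by (simp add: l2_rel_def square_integrable_zero)

lift_definition plus_l2 :: "'a l2 \<Rightarrow> 'a l2 \<Rightarrow> 'a l2" is "\<lambda>f g x. f x + g x"
  by (auto simp: l2_rel_def square_integrable_add)

lift_definition minus_l2 :: "'a l2 \<Rightarrow> 'a l2 \<Rightarrow> 'a l2" is "\<lambda>f g x. f x - g x"
  by (auto simp: l2_rel_def square_integrable_minus)

lift_definition uminus_l2 :: "'a l2 \<Rightarrow> 'a l2" is "\<lambda>f x. - f x"
  by (auto simp: l2_rel_def square_integrable_uminus)

lift_definition scaleR_l2 :: "real \<Rightarrow> 'a l2 \<Rightarrow> 'a l2" is "\<lambda>r f x. r *\<^sub>R f x"
  by (auto simp: l2_rel_def square_integrable_scaleR)

instance
proof
  fix a b c :: "'a l2" and r s :: real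
  show "a + b + c = a + (b + c)" "a + b = b + a" "0 + a = a" "- a + a = 0" "a - b = a + - b"
    by (transfer; auto simp: l2_rel_def algebra_simps
          intro!: square_integrable_add square_integrable_uminus square_integrable_minus
            square_integrable_zero; fail)+
  show "r *\<^sub>R (a + b) = r *\<^sub>R a + r *\<^sub>R b" "(r + s) *\<^sub>R a = r *\<^sub>R a + s *\<^sub>R a"
    "r *\<^sub>R s *\<^sub>R a = (r * s) *\<^sub>R a" "1 *\<^sub>R a = a"
    by (transfer; auto simp: l2_rel_def algebra_simps
          intro!: square_integrable_add square_integrable_scaleR; fail)+
qed

end

instantiation l2 :: (euclidean_space) real_inner
begin

lift_definition inner_l2 :: "'a l2 \<Rightarrow> 'a l2 \<Rightarrow> real" is "\<lambda>f g. \<integral>x. f x \<bullet> g x \<partial>lborel"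
  by (rule integral_cong_AE) (auto simp: l2_rel_def square_integrable_def)

definition norm_l2 :: "'a l2 \<Rightarrow> real" where "norm_l2 v = sqrt (v \<bullet> v)"
definition dist_l2 :: "'a l2 \<Rightarrow> 'a l2 \<Rightarrow> real" where "dist_l2 v w = norm (v - w)"
definition sgn_l2 :: "'a l2 \<Rightarrow> 'a l2" where "sgn_l2 v = v /\<^sub>R norm v"
definition uniformity_l2 :: "('a l2 \<times> 'a l2) filter" where
  "uniformity_l2 = (INF e\<in>{0 <..}. principal {(v, w). dist v w < e})"
definition open_l2 :: "'a l2 set \<Rightarrow> bool" where
  "open_l2 U \<longleftrightarrow> (\<forall>v\<in>U. \<forall>\<^sub>F (v', w) in uniformity. v' = v \<longrightarrow> w \<in> U)"

instance
proof
  fix a b c :: "'a l2" and r :: real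
  show "dist a b = norm (a - b)" "sgn a = a /\<^sub>R norm a" "norm a = sqrt (a \<bullet> a)"
    by (simp_all add: dist_l2_def sgn_l2_def norm_l2_def)
  show "uniformity = (INF e\<in>{0 <..}. principal {(v, w). dist (v :: 'a l2) w < e})"
    by (rule uniformity_l2_def)
  show "open U \<longleftrightarrow> (\<forall>v\<in>U. \<forall>\<^sub>F (v', w) in uniformity. v' = v \<longrightarrow> w \<in> U)" for U :: "'a l2 set"
    by (rule open_l2_def)
  show "a \<bullet> b = b \<bullet> a"
    by transfer (simp add: inner_commute)
  show "(a + b) \<bullet> c = a \<bullet> c + b \<bullet> c"
    by transfer (auto simp: l2_rel_def inner_add_left square_integrable_inner
        intro!: Bochner_Integration.integral_add)
  show "(r *\<^sub>R a) \<bullet> b = r * (a \<bullet> b)"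
    by transfer simp
  show "0 \<le> a \<bullet> a"
    by transfer simp
  show "a \<bullet> a = 0 \<longleftrightarrow> a = 0"
  proof transfer
    fix f :: "'a \<Rightarrow> complex" assume "l2_rel f f"
    then have f: "square_integrable f" by (simp add: l2_rel_def)
    have "(\<integral>x. f x \<bullet> f x \<partial>lborel) = 0 \<longleftrightarrow> (AE x in lborel. f x \<bullet> f x = 0)"
      by (rule integral_nonneg_eq_0_iff_AE) (auto simp: square_integrable_inner f)
    then show "(\<integral>x. f x \<bullet> f x \<partial>lborel) = 0 \<longleftrightarrow> l2_rel f (\<lambda>x. 0)"
      using f by (simp add: l2_rel_def square_integrable_zero)
  qed
qed

end

text \<open>The value 0 of \<open>to_l2\<close> on functions that are not square integrable is a dummy.\<close>

definition fun_l2 :: "'a::euclidean_space l2 \<Rightarrow> 'a \<Rightarrow> complex" where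
  "fun_l2 = rep_l2"

definition to_l2 :: "('a::euclidean_space \<Rightarrow> complex) \<Rightarrow> 'a l2" where
  "to_l2 f = (if square_integrable f then abs_l2 f else 0)"

lemma square_integrable_fun_l2: "square_integrable (fun_l2 v)"
  using Quotient_rep_reflp[OF Quotient_l2, of v] by (simp add: fun_l2_def l2_rel_def)

lemma to_l2_fun_l2: "to_l2 (fun_l2 v) = v"
  using square_integrable_fun_l2[of v] Quotient_abs_rep[OF Quotient_l2, of v]
  by (simp add: to_l2_def fun_l2_def)

lemma fun_l2_to_l2:
  assumes "square_integrable f"
  shows "AE x in lborel. fun_l2 (to_l2 f) x = f x"
proof -
  have "l2_rel f f" using assms by (simp add: l2_rel_def)
  then have "l2_rel (rep_l2 (abs_l2 f)) f" by (rule Quotient_rep_abs[OF Quotient_l2])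
  then show ?thesis using assms by (simp add: to_l2_def fun_l2_def l2_rel_def)
qed

lemma norm_l2_eq: "norm v = sqrt (\<integral>x. (cmod (fun_l2 v x))\<^sup>2 \<partial>lborel)"
proof -
  have "v \<bullet> v = (\<integral>x. fun_l2 v x \<bullet> fun_l2 v x \<partial>lborel)"
    by (simp add: fun_l2_def inner_l2.rep_eq)
  then show ?thesis by (simp add: norm_l2_def power2_norm_eq_inner)
qed

definition partial_deriv ::
  "'n::finite \<Rightarrow> (real^'n \<Rightarrow> 'b::real_normed_vector) \<Rightarrow> real^'n \<Rightarrow> 'b" where
  "partial_deriv i f x = frechet_derivative f (at x) (axis i 1)"

definition iter_partial ::
  "'n::finite list \<Rightarrow> (real^'n \<Rightarrow> 'b::real_normed_vector) \<Rightarrow> real^'n \<Rightarrow> 'b" where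
  "iter_partial is f = foldr partial_deriv is f"

definition class_C :: "nat \<Rightarrow> (real^'n::finite \<Rightarrow> 'b::real_normed_vector) \<Rightarrow> bool" where
  "class_C m f \<longleftrightarrow>
     (\<forall>is. length is < m \<longrightarrow> iter_partial is f differentiable_on UNIV) \<and>
     (\<forall>is. length is \<le> m \<longrightarrow> continuous_on UNIV (iter_partial is f))"

definition bounded_C :: "nat \<Rightarrow> (real^'n::finite \<Rightarrow> 'b::real_normed_vector) set" where
  "bounded_C m = {f. class_C m f \<and>
     (\<forall>is. length is \<le> m \<longrightarrow> bounded (range (iter_partial is f)))}"

definition test_functions :: "(real^'n::finite \<Rightarrow> complex) set" where
  "test_functions =
     {\<phi>. (\<forall>m. class_C m \<phi>) \<and> (\<exists>K. compact K \<and> (\<forall>x. x \<notin> K \<longrightarrow> \<phi> x = 0))}"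

definition mi_order :: "('n::finite \<Rightarrow> nat) \<Rightarrow> nat" where
  "mi_order \<alpha> = (\<Sum>i\<in>UNIV. \<alpha> i)"

text \<open>The index type carries no order, so the directions are listed in an arbitrary sequence.
  The operator is applied to smooth functions only, where the sequence is immaterial.\<close>

definition mi_partial :: "('n::finite \<Rightarrow> nat) \<Rightarrow> (real^'n \<Rightarrow> complex) \<Rightarrow> real^'n \<Rightarrow> complex" where
  "mi_partial \<alpha> = iter_partial (SOME is. \<forall>i. count_list is i = \<alpha> i)"

definition has_weak_partial ::
  "('n::finite \<Rightarrow> nat) \<Rightarrow> (real^'n) l2 \<Rightarrow> (real^'n) l2 \<Rightarrow> bool" where
  "has_weak_partial \<alpha> v w \<longleftrightarrow>
     (\<forall>\<phi>\<in>test_functions. (\<integral>x. fun_l2 v x * mi_partial \<alpha> \<phi> x \<partial>lborel)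
        = (-1) ^ mi_order \<alpha> * (\<integral>x. fun_l2 w x * \<phi> x \<partial>lborel))"

definition weak_partial :: "('n::finite \<Rightarrow> nat) \<Rightarrow> (real^'n) l2 \<Rightarrow> (real^'n) l2" where
  "weak_partial \<alpha> v = (THE w. has_weak_partial \<alpha> v w)"

definition sobolev :: "nat \<Rightarrow> (real^'n::finite) l2 set" where
  "sobolev m = {v. \<forall>\<alpha>. mi_order \<alpha> \<le> m \<longrightarrow> (\<exists>w. has_weak_partial \<alpha> v w)}"

text \<open>The norm is extended by infinity, so that a finite bound includes membership in the
  Sobolev space.\<close>

definition sobolev_norm :: "nat \<Rightarrow> (real^'n::finite) l2 \<Rightarrow> ennreal" where
  "sobolev_norm m v =
     (if v \<in> sobolev m
      then ennreal (sqrt (\<Sum>\<alpha>\<in>{\<alpha>. mi_order \<alpha> \<le> m}. (norm (weak_partial \<alpha> v))\<^sup>2))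
      else \<infinity>)"

lemma finite_mi_order: "finite {\<alpha> :: 'n::finite \<Rightarrow> nat. mi_order \<alpha> \<le> m}"
proof (rule finite_subset)
  have "\<alpha> i \<le> mi_order \<alpha>" for \<alpha> :: "'n \<Rightarrow> nat" and i
    unfolding mi_order_def by (rule member_le_sum) auto
  then show "{\<alpha> :: 'n \<Rightarrow> nat. mi_order \<alpha> \<le> m} \<subseteq> (UNIV \<rightarrow>\<^sub>E {..m})"
    by (auto intro: order_trans)
  show "finite (UNIV \<rightarrow>\<^sub>E {..m} :: ('n \<Rightarrow> nat) set)"
    by (rule finite_PiE) auto
qed

definition fourier_integral :: "(real^'n::finite \<Rightarrow> complex) \<Rightarrow> real^'n \<Rightarrow> complex" where
  "fourier_integral f \<zeta> =
     complex_of_real ((2 * pi) powr (- real CARD('n) / 2)) *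
       (\<integral>x. exp (- \<i> * complex_of_real (\<zeta> \<bullet> x)) * f x \<partial>lborel)"

text \<open>The Fourier-Plancherel transform is the L2 limit of the transforms of the
  truncations, which are integrable.\<close>

definition fourier :: "(real^'n::finite) l2 \<Rightarrow> (real^'n) l2" where
  "fourier v = Lim at_top (\<lambda>R::real.
     to_l2 (fourier_integral (\<lambda>x. indicator (ball 0 R) x * fun_l2 v x)))"

definition free_group :: "real \<Rightarrow> (real^'n::finite) l2 \<Rightarrow> (real^'n) l2" where
  "free_group a v = (THE w. fourier w =
     to_l2 (\<lambda>\<zeta>. exp (- \<i> * complex_of_real ((norm \<zeta>)\<^sup>2 * a)) * fun_l2 (fourier v) \<zeta>))"

definition propagator ::
  "(real \<Rightarrow> real) \<Rightarrow> real \<Rightarrow> real \<Rightarrow> (real^'n::finite) l2 \<Rightarrow> (real^'n) l2" where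
  "propagator b t s = free_group (b t - b s)"

definition conv_potential :: "(real^'n::finite \<Rightarrow> real) \<Rightarrow> (real^'n) l2 \<Rightarrow> real^'n \<Rightarrow> real" where
  "conv_potential V u x = (\<integral>y. V (x - y) * (cmod (fun_l2 u y))\<^sup>2 \<partial>lborel)"

definition nonlinearity :: "(real^'n::finite \<Rightarrow> real) \<Rightarrow> (real^'n) l2 \<Rightarrow> (real^'n) l2" where
  "nonlinearity V u = to_l2 (\<lambda>x. complex_of_real (conv_potential V u x) * fun_l2 u x)"

definition nonlinear_flow ::
  "(real^'n::finite \<Rightarrow> real) \<Rightarrow> real \<Rightarrow> (real^'n) l2 \<Rightarrow> (real^'n) l2" where
  "nonlinear_flow V t u =
     to_l2 (\<lambda>x. exp (\<i> * complex_of_real (t * conv_potential V u x)) * fun_l2 u x)"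

primrec splitting ::
  "(real^'n::finite \<Rightarrow> real) \<Rightarrow> (real \<Rightarrow> real) \<Rightarrow> real \<Rightarrow> (real^'n) l2 \<Rightarrow> nat \<Rightarrow> (real^'n) l2" where
  "splitting V b \<tau> u\<^sub>0 0 = u\<^sub>0"
| "splitting V b \<tau> u\<^sub>0 (Suc n) =
     propagator b (real (Suc n) * \<tau>) (real n * \<tau>) (nonlinear_flow V \<tau> (splitting V b \<tau> u\<^sub>0 n))"

definition usual_conditions :: "'w measure \<Rightarrow> (real \<Rightarrow> 'w measure) \<Rightarrow> bool" where
  "usual_conditions M F \<longleftrightarrow>
     prob_space M \<and>
     complete_measure M \<and>
     (\<forall>t\<ge>0. subalgebra M (F t)) \<and>
     (\<forall>s t. 0 \<le> s \<and> s \<le> t \<longrightarrow> sets (F s) \<subseteq> sets (F t)) \<and>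
     null_sets M \<subseteq> sets (F 0) \<and>
     (\<forall>t\<ge>0. sets (F t) = (\<Inter>s\<in>{t<..}. sets (F s)))"

definition brownian_motion ::
  "'w measure \<Rightarrow> (real \<Rightarrow> 'w measure) \<Rightarrow> (real \<Rightarrow> 'w \<Rightarrow> real) \<Rightarrow> bool" where
  "brownian_motion M F \<beta> \<longleftrightarrow>
     (\<forall>t\<ge>0. \<beta> t \<in> borel_measurable (F t)) \<and>
     (AE \<omega> in M. \<beta> 0 \<omega> = 0) \<and>
     (AE \<omega> in M. continuous_on {0..} (\<lambda>t. \<beta> t \<omega>)) \<and>
     (\<forall>s t. 0 \<le> s \<and> s < t \<longrightarrow>
        distributed M lborel (\<lambda>\<omega>. \<beta> t \<omega> - \<beta> s \<omega>) (\<lambda>x. ennreal (normal_density 0 (sqrt (t - s)) x)) \<and>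
        prob_space.indep_set M (sets (F s))
          (sets (vimage_algebra (space M) (\<lambda>\<omega>. \<beta> t \<omega> - \<beta> s \<omega>) borel)))"

text \<open>Solutions are sought among adapted processes with paths continuous in L2, where they
  are unique for bounded continuous \<open>V\<close>; higher regularity is inherited from \<open>V\<close> and the
  initial value. Along almost every path the integrand is continuous in time, so the gauge
  integral below is the Bochner (indeed Riemann) integral in L2.\<close>

definition mild_solution ::
  "'w measure \<Rightarrow> (real \<Rightarrow> 'w measure) \<Rightarrow> (real \<Rightarrow> 'w \<Rightarrow> real) \<Rightarrow> (real^'n::finite \<Rightarrow> real) \<Rightarrow>
     real \<Rightarrow> (real^'n) l2 \<Rightarrow> (real \<Rightarrow> 'w \<Rightarrow> (real^'n) l2) \<Rightarrow> bool" where
  "mild_solution M F \<beta> V T u\<^sub>0 u \<longleftrightarrow>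
     (\<forall>t\<in>{0..T}. u t \<in> borel_measurable (F t)) \<and>
     (AE \<omega> in M.
        continuous_on {0..T} (\<lambda>t. u t \<omega>) \<and>
        (\<forall>t\<in>{0..T}. \<exists>J.
           ((\<lambda>r. propagator (\<lambda>t. \<beta> t \<omega>) t r (nonlinearity V (u r \<omega>))) has_integral J) {0..t} \<and>
           u t \<omega> = propagator (\<lambda>t. \<beta> t \<omega>) t 0 u\<^sub>0 + to_l2 (\<lambda>x. \<i> * fun_l2 J x)))"

end

theory Submission
  imports Defs
begin

text \<open>The solution is never expanded. Instead the scheme with \<open>N\<close> steps is compared with the
  scheme with \<open>2 N\<close> steps along the same path. Over one coarse step of length \<open>2 h\<close> the
  two differ, up to terms of order \<open>h\<^sup>2\<close>, by \<open>h\<close> times the commutator defect of the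
  nonlinearity with the free group at the Brownian increment \<open>a\<close>. This defect is of size
  \<open>\<bar>a\<bar>\<close>, hence only \<open>h\<^sup>1\<^sup>/\<^sup>2\<close> in mean square, but it is odd in \<open>a\<close> up to \<open>a\<^sup>2\<close>, and the
  increment is symmetric and independent of the past. The mean square difference is therefore
  \<open>O(h\<^sup>2)\<close> after a discrete Gronwall argument. The second order in \<open>a\<close> costs four
  derivatives. All bounds are deterministic because the scheme conserves the L2 norm, which
  bounds the convolution potential and thus all Sobolev norms of the iterates.

  The differences for \<open>N, 2 N, 4 N, \<dots>\<close> are summed with weights \<open>2\<^sup>j\<close>, which bounds the distance
  to the limit of the schemes with \<open>N 2\<^sup>j\<close> steps. That limit is the mild solution, path by path
  and in L2, by continuity of the path alone; the Sobolev bound passes to it by lower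
  semicontinuity. Both claims follow from the resulting second moment bound, by Markov's
  inequality and by summation over \<open>N = 2\<^sup>L\<close>.\<close>

section \<open>Square integrable functions\<close>

text \<open>Comparing two schemes keeps the probability finite dimensional: both are continuous
  functions of finitely many Brownian increments, so measurability, integrability and the change of
  sign of one increment concern real random variables, and no stochastic integral or conditional
  expectation appears. The price is a summation over j. At level j the mean square is of order
  \<open>4 ^ (- j)\<close>, so the weight \<open>2 ^ j\<close> still leaves a convergent series, and
  Cauchy-Schwarz against \<open>2 ^ (- j)\<close> turns it into a bound for the sum of the norms.
  The analytic obstacle is that the propagator is given by the Plancherel transform, the norm by
  weak derivatives and the nonlinearity by pointwise products. The three meet on the Fourier side:
  group differences are symbol estimates, difference quotients transfer the product rule, and test
  functions identify weak derivatives with multipliers. All derivatives of the convolution fall on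
  the potential, which is why the growth estimates are linear in the Sobolev norm.\<close>

lemma fun_l2_measurable [measurable]: "fun_l2 v \<in> borel_measurable borel"
  using square_integrable_fun_l2[of v] by (simp add: square_integrable_def)

lemma square_integrable_measurable: "square_integrable f \<Longrightarrow> f \<in> borel_measurable borel"
  by (simp add: square_integrable_def)

lemma to_l2_cong_AE:
  assumes "square_integrable f" "square_integrable g" "AE x in lborel. f x = g x"
  shows "to_l2 f = to_l2 g"
proof -
  have "l2_rel f g" using assms by (simp add: l2_rel_def)
  then show ?thesis using assms Quotient_rel_abs[OF Quotient_l2] by (simp add: to_l2_def)
qed

lemma l2_eqI:
  assumes "AE x in lborel. fun_l2 v x = fun_l2 w x"
  shows "v = w"
  using to_l2_cong_AE[OF square_integrable_fun_l2 square_integrable_fun_l2 assms]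
  by (simp add: to_l2_fun_l2)

lemma to_l2_eqI:
  assumes "square_integrable f" "AE x in lborel. f x = fun_l2 w x"
  shows "to_l2 f = w"
  using to_l2_cong_AE[OF assms(1) square_integrable_fun_l2 assms(2)] by (simp add: to_l2_fun_l2)

lemma fun_l2_add: "AE x in lborel. fun_l2 (v + w) x = fun_l2 v x + fun_l2 w x"
proof -
  have s: "square_integrable (\<lambda>x. fun_l2 v x + fun_l2 w x)"
    by (intro square_integrable_add square_integrable_fun_l2)
  have "v + w = to_l2 (\<lambda>x. fun_l2 v x + fun_l2 w x)"
    using s by (simp add: plus_l2_def to_l2_def fun_l2_def)
  then show ?thesis using fun_l2_to_l2[OF s] by simp
qed

lemma fun_l2_scaleR: "AE x in lborel. fun_l2 (r *\<^sub>R v) x = r *\<^sub>R fun_l2 v x"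
proof -
  have s: "square_integrable (\<lambda>x. r *\<^sub>R fun_l2 v x)"
    by (intro square_integrable_scaleR square_integrable_fun_l2)
  have "r *\<^sub>R v = to_l2 (\<lambda>x. r *\<^sub>R fun_l2 v x)"
    using s by (simp add: scaleR_l2_def to_l2_def fun_l2_def)
  then show ?thesis using fun_l2_to_l2[OF s] by simp
qed

lemma fun_l2_diff: "AE x in lborel. fun_l2 (v - w) x = fun_l2 v x - fun_l2 w x"
proof -
  have s: "square_integrable (\<lambda>x. fun_l2 v x - fun_l2 w x)"
    by (intro square_integrable_minus square_integrable_fun_l2)
  have "v - w = to_l2 (\<lambda>x. fun_l2 v x - fun_l2 w x)"
    using s by (simp add: minus_l2_def to_l2_def fun_l2_def)
  then show ?thesis using fun_l2_to_l2[OF s] by simp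
qed

lemma fun_l2_zero: "AE x in lborel. fun_l2 0 x = 0"
  using fun_l2_scaleR[of 0 0] by simp

lemma to_l2_zero: "to_l2 (\<lambda>x. 0) = 0"
  by (rule to_l2_eqI[OF square_integrable_zero]) (use fun_l2_zero in \<open>auto elim: eventually_mono\<close>)

lemma to_l2_add:
  assumes "square_integrable f" "square_integrable g"
  shows "to_l2 (\<lambda>x. f x + g x) = to_l2 f + to_l2 g"
  by (rule to_l2_eqI[OF square_integrable_add[OF assms]])
    (use fun_l2_add[of "to_l2 f" "to_l2 g"] fun_l2_to_l2[OF assms(1)] fun_l2_to_l2[OF assms(2)]
      in eventually_elim, simp)

lemma to_l2_diff:
  assumes "square_integrable f" "square_integrable g"
  shows "to_l2 (\<lambda>x. f x - g x) = to_l2 f - to_l2 g"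
  by (rule to_l2_eqI[OF square_integrable_minus[OF assms]])
    (use fun_l2_diff[of "to_l2 f" "to_l2 g"] fun_l2_to_l2[OF assms(1)] fun_l2_to_l2[OF assms(2)]
      in eventually_elim, simp)

lemma to_l2_scaleR:
  assumes "square_integrable f"
  shows "to_l2 (\<lambda>x. r *\<^sub>R f x) = r *\<^sub>R to_l2 f"
  by (rule to_l2_eqI[OF square_integrable_scaleR[OF assms]])
    (use fun_l2_scaleR[of r "to_l2 f"] fun_l2_to_l2[OF assms(1)]
      in eventually_elim, simp)

lemma inner_l2_eq: "v \<bullet> w = (\<integral>x. fun_l2 v x \<bullet> fun_l2 w x \<partial>lborel)"
  by (simp add: fun_l2_def inner_l2.rep_eq)

lemma inner_to_l2:
  assumes "square_integrable f" "square_integrable g"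
  shows "to_l2 f \<bullet> to_l2 g = (\<integral>x. f x \<bullet> g x \<partial>lborel)"
  unfolding inner_l2_eq
  by (rule integral_cong_AE)
    (use fun_l2_to_l2[OF assms(1)] fun_l2_to_l2[OF assms(2)]
       assms[THEN square_integrable_measurable] in \<open>auto elim: eventually_elim2\<close>)

lemma norm_l2_sq: "(norm v)\<^sup>2 = (\<integral>x. (cmod (fun_l2 v x))\<^sup>2 \<partial>lborel)"
  by (simp add: norm_l2_eq)

lemma norm_to_l2_sq:
  assumes "square_integrable f"
  shows "(norm (to_l2 f))\<^sup>2 = (\<integral>x. (cmod (f x))\<^sup>2 \<partial>lborel)"
  using inner_to_l2[OF assms assms] by (simp add: power2_norm_eq_inner)

lemma nn_norm_to_l2:
  assumes "square_integrable f"
  shows "(\<integral>\<^sup>+x. ennreal ((cmod (f x))\<^sup>2) \<partial>lborel) = ennreal ((norm (to_l2 f))\<^sup>2)"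
  unfolding norm_to_l2_sq[OF assms]
  by (rule nn_integral_eq_integral) (use assms in \<open>auto simp: square_integrable_def\<close>)

lemma square_integrable_iff_nn:
  "square_integrable f \<longleftrightarrow> f \<in> borel_measurable borel \<and>
     (\<integral>\<^sup>+x. ennreal ((cmod (f x))\<^sup>2) \<partial>lborel) < \<infinity>"
  by (auto simp: square_integrable_def integrable_iff_bounded)

lemma square_integrable_dominated:
  fixes f :: "'a::euclidean_space \<Rightarrow> complex" and w :: "'a \<Rightarrow> real"
  assumes "f \<in> borel_measurable borel" "AE x in lborel. cmod (f x) \<le> w x"
    "integrable lborel (\<lambda>x. (w x)\<^sup>2)"
  shows "square_integrable f"
  unfolding square_integrable_def
proof
  show "f \<in> borel_measurable lborel" using assms by simp
  show "integrable lborel (\<lambda>x. (cmod (f x))\<^sup>2)"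
    by (rule Bochner_Integration.integrable_bound[OF assms(3)])
      (use assms(1,2) in \<open>auto elim!: eventually_mono intro: power_mono\<close>)
qed

lemma square_integrable_bound:
  assumes "f \<in> borel_measurable borel" "square_integrable g"
    "AE x in lborel. cmod (f x) \<le> c * cmod (g x)"
  shows "square_integrable f"
  by (rule square_integrable_dominated[OF assms(1,3)])
    (use assms(2) in \<open>auto simp: power_mult_distrib square_integrable_def\<close>)

lemma norm_to_l2_mono:
  assumes "square_integrable f" "square_integrable g" "0 \<le> c"
    "AE x in lborel. cmod (f x) \<le> c * cmod (g x)"
  shows "norm (to_l2 f) \<le> c * norm (to_l2 g)"
proof (rule power2_le_imp_le)
  have "(norm (to_l2 f))\<^sup>2 \<le> (\<integral>x. c\<^sup>2 * (cmod (g x))\<^sup>2 \<partial>lborel)"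
    unfolding norm_to_l2_sq[OF assms(1)]
  proof (rule integral_mono_AE)
    show "AE x in lborel. (cmod (f x))\<^sup>2 \<le> c\<^sup>2 * (cmod (g x))\<^sup>2"
      using assms(4) by eventually_elim (simp add: power_mono flip: power_mult_distrib)
  qed (use assms in \<open>auto simp: square_integrable_def\<close>)
  then show "(norm (to_l2 f))\<^sup>2 \<le> (c * norm (to_l2 g))\<^sup>2"
    by (simp add: norm_to_l2_sq[OF assms(2)] power_mult_distrib)
qed (use assms in simp)

lemma norm_l2_mono:
  assumes "0 \<le> c" "AE x in lborel. cmod (fun_l2 v x) \<le> c * cmod (fun_l2 w x)"
  shows "norm v \<le> c * norm w"
  using norm_to_l2_mono[OF square_integrable_fun_l2 square_integrable_fun_l2 assms]
  by (simp add: to_l2_fun_l2)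

text \<open>The limit inherits the bound \<open>w\<close>, so four times the square of
  \<open>w\<close> dominates the squared difference.\<close>

lemma tendsto_to_l2_dominated:
  fixes f :: "nat \<Rightarrow> 'a::euclidean_space \<Rightarrow> complex" and w :: "'a \<Rightarrow> real"
  assumes f: "\<And>j. f j \<in> borel_measurable borel" and g: "g \<in> borel_measurable borel"
    and lim: "AE x in lborel. (\<lambda>j. f j x) \<longlonglongrightarrow> g x"
    and dom: "\<And>j. AE x in lborel. cmod (f j x) \<le> w x"
    and w: "integrable lborel (\<lambda>x. (w x)\<^sup>2)"
  shows "square_integrable g" "(\<lambda>j. to_l2 (f j)) \<longlonglongrightarrow> to_l2 g"
proof -
  have sf: "square_integrable (f j)" for j
    by (rule square_integrable_dominated[OF f dom w])
  have "AE x in lborel. \<forall>j. cmod (f j x) \<le> w x"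
    using dom by (simp add: AE_all_countable)
  then have gw: "AE x in lborel. cmod (g x) \<le> w x"
    using lim
  proof eventually_elim
    case (elim x)
    from elim(2) have "(\<lambda>j. cmod (f j x)) \<longlonglongrightarrow> cmod (g x)" by (rule tendsto_norm)
    then show ?case by (rule LIMSEQ_le_const2) (use elim in auto)
  qed
  show sg: "square_integrable g" by (rule square_integrable_dominated[OF g gw w])
  note [measurable] = f g
  have "(\<lambda>j. \<integral>x. (cmod (f j x - g x))\<^sup>2 \<partial>lborel) \<longlonglongrightarrow> (\<integral>x. 0 \<partial>(lborel :: 'a measure))"
  proof (rule integral_dominated_convergence[where w = "\<lambda>x. 4 * (w x)\<^sup>2"])
    show "integrable lborel (\<lambda>x. 4 * (w x)\<^sup>2)" using w by simp
    show "AE x in lborel. (\<lambda>j. (cmod (f j x - g x))\<^sup>2) \<longlonglongrightarrow> 0"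
      using lim
    proof eventually_elim
      case (elim x)
      then have "(\<lambda>j. (cmod (f j x - g x))\<^sup>2) \<longlonglongrightarrow> (cmod (g x - g x))\<^sup>2" by (intro tendsto_intros)
      then show ?case by simp
    qed
    show "AE x in lborel. norm ((cmod (f j x - g x))\<^sup>2) \<le> 4 * (w x)\<^sup>2" for j
      using dom[of j] gw
    proof eventually_elim
      case (elim x)
      have "cmod (f j x - g x) \<le> 2 * w x"
        using norm_triangle_ineq4[of "f j x" "g x"] elim by linarith
      then have "(cmod (f j x - g x))\<^sup>2 \<le> (2 * w x)\<^sup>2" by (rule power_mono) simp
      then show ?case by simp
    qed
  qed simp_all
  then have "(\<lambda>j. sqrt ((norm (to_l2 (f j) - to_l2 g))\<^sup>2)) \<longlonglongrightarrow> sqrt 0"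
    unfolding to_l2_diff[OF sf sg, symmetric] norm_to_l2_sq[OF square_integrable_minus[OF sf sg]]
    by (intro tendsto_intros) simp
  then have "(\<lambda>j. norm (to_l2 (f j) - to_l2 g)) \<longlonglongrightarrow> 0" by simp
  then show "(\<lambda>j. to_l2 (f j)) \<longlonglongrightarrow> to_l2 g"
    using LIM_zero_cancel tendsto_norm_zero_iff by blast
qed

text \<open>The squared differences tend to 0 in L1, where a subsequence converges almost
  everywhere. This lets a pointwise computation identify an L2 limit.\<close>

lemma l2_tendsto_AE_subseq:
  fixes v :: "nat \<Rightarrow> 'a::euclidean_space l2"
  assumes "v \<longlonglongrightarrow> w"
  shows "\<exists>r. strict_mono r \<and> (AE x in lborel. (\<lambda>j. fun_l2 (v (r j)) x) \<longlonglongrightarrow> fun_l2 w x)"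
proof -
  have i: "(norm (v j - w))\<^sup>2 = (\<integral>x. (cmod (fun_l2 (v j) x - fun_l2 w x))\<^sup>2 \<partial>lborel)" for j
    using norm_to_l2_sq[OF square_integrable_minus[OF square_integrable_fun_l2 square_integrable_fun_l2], of "v j" w]
    by (simp add: to_l2_diff square_integrable_fun_l2 to_l2_fun_l2)
  have "(\<lambda>j. (norm (v j - w))\<^sup>2) \<longlonglongrightarrow> (norm (w - w))\<^sup>2"
    by (intro tendsto_intros assms)
  then have *: "(\<lambda>j. (\<integral>x. norm ((cmod (fun_l2 (v j) x - fun_l2 w x))\<^sup>2) \<partial>lborel)) \<longlonglongrightarrow> 0"
    by (simp add: i)
  have "integrable lborel (\<lambda>x. (cmod (fun_l2 (v j) x - fun_l2 w x))\<^sup>2)" for j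
    using square_integrable_minus[OF square_integrable_fun_l2 square_integrable_fun_l2, of "v j" w]
    by (simp add: square_integrable_def)
  from tendsto_L1_AE_subseq[OF this *] obtain r where r: "strict_mono r"
    "AE x in lborel. (\<lambda>n. (cmod (fun_l2 (v (r n)) x - fun_l2 w x))\<^sup>2) \<longlonglongrightarrow> 0" by blast
  from r(2) have "AE x in lborel. (\<lambda>j. fun_l2 (v (r j)) x) \<longlonglongrightarrow> fun_l2 w x"
  proof eventually_elim
    case (elim x)
    then have "(\<lambda>n. sqrt ((cmod (fun_l2 (v (r n)) x - fun_l2 w x))\<^sup>2)) \<longlonglongrightarrow> sqrt 0"
      by (intro tendsto_intros)
    then have "(\<lambda>n. cmod (fun_l2 (v (r n)) x - fun_l2 w x)) \<longlonglongrightarrow> 0" by simp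
    then show ?case using LIM_zero_cancel tendsto_norm_zero_iff by blast
  qed
  then show ?thesis using r(1) by blast
qed

text \<open>Riesz-Fischer. Multiplied by a positive square integrable weight, an L2 Cauchy sequence
  is Cauchy in L1 by Cauchy-Schwarz, hence has a subsequence that converges almost everywhere.
  Fatou's lemma then makes the pointwise limit the L2 limit.\<close>

instance l2 :: (euclidean_space) complete_space
proof
  fix v :: "nat \<Rightarrow> 'a l2"
  assume C: "Cauchy v"
  obtain q :: "'a \<Rightarrow> real" where q: "q \<in> borel_measurable lborel" "\<And>x. q x > 0" "\<And>x. q x \<le> 1"
    "integrable lborel q" using sigma_finite_measure.obtain_positive_integrable_function[OF sigma_finite_lborel] by blast
  note [measurable] = q(1)
  have q2: "integrable lborel (\<lambda>x. (q x)\<^sup>2)"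
  proof (rule Bochner_Integration.integrable_bound[OF q(4)])
    have "(q x)\<^sup>2 \<le> q x" for x
      using mult_left_le[of "q x" "q x"] q(2,3)[of x] by (simp add: power2_eq_square)
    then show "AE x in lborel. norm ((q x)\<^sup>2) \<le> norm (q x)" using q(2) by (auto simp: less_imp_le)
  qed simp
  have sq: "square_integrable (\<lambda>x. complex_of_real (q x))"
    using q2 by (simp add: square_integrable_def)
  have iq: "integrable lborel (\<lambda>x. q x * cmod (fun_l2 w x))" for w :: "'a l2"
  proof -
    have "square_integrable (\<lambda>x. complex_of_real (cmod (fun_l2 w x)))"
      using square_integrable_fun_l2[of w] by (simp add: square_integrable_def)
    from square_integrable_inner[OF sq this] show ?thesis by (simp add: inner_complex_def)
  qed
  have bq: "(\<integral>x. q x * cmod (fun_l2 w x) \<partial>lborel) \<le> norm (to_l2 q) * norm w" for w :: "'a l2"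
  proof -
    have s: "square_integrable (\<lambda>x. complex_of_real (cmod (fun_l2 w x)))"
      using square_integrable_fun_l2[of w] by (simp add: square_integrable_def)
    have "(\<integral>x. q x * cmod (fun_l2 w x) \<partial>lborel) = to_l2 q \<bullet> to_l2 (\<lambda>x. complex_of_real (cmod (fun_l2 w x)))"
      by (simp add: inner_to_l2[OF sq s] inner_complex_def)
    also have "\<dots> \<le> norm (to_l2 q) * norm (to_l2 (\<lambda>x. complex_of_real (cmod (fun_l2 w x))))"
      by (rule norm_cauchy_schwarz)
    also have "norm (to_l2 (\<lambda>x. complex_of_real (cmod (fun_l2 w x)))) \<le> 1 * norm (to_l2 (fun_l2 w))"
      by (rule norm_to_l2_mono[OF s square_integrable_fun_l2]) auto
    finally show ?thesis by (simp add: to_l2_fun_l2 mult_left_mono)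
  qed
  define U where "U j x = q x *\<^sub>R fun_l2 (v j) x" for j x
  have iU: "integrable lborel (U j)" for j
    unfolding U_def by (rule Bochner_Integration.integrable_bound[OF iq[of "v j"]]) auto
  have dU: "(\<integral>x. norm (U i x - U j x) \<partial>lborel) \<le> norm (to_l2 q) * norm (v i - v j)" for i j
  proof -
    have "(\<integral>x. norm (U i x - U j x) \<partial>lborel) = (\<integral>x. q x * cmod (fun_l2 (v i - v j) x) \<partial>lborel)"
      apply (rule integral_cong_AE)
        apply (simp_all add: U_def)
      using fun_l2_diff[of "v i" "v j"]
      apply eventually_elim
      using q(2) by (simp add: U_def less_imp_le norm_mult flip: scaleR_diff_right)
    then show ?thesis using bq by simp
  qed
  have "\<exists>r. strict_mono r \<and> (AE x in lborel. Cauchy (\<lambda>i. U (r i) x))"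
  proof (rule cauchy_L1_AE_cauchy_subseq[OF iU])
    fix e :: real assume "e > 0"
    then have "e / (norm (to_l2 q) + 1) > 0" by (simp add: add_nonneg_pos)
    then obtain N where N: "\<And>i j. i \<ge> N \<Longrightarrow> j \<ge> N \<Longrightarrow> norm (v i - v j) < e / (norm (to_l2 q) + 1)"
      using C unfolding Cauchy_def dist_norm by blast
    show "\<exists>N. \<forall>i\<ge>N. \<forall>j\<ge>N. (\<integral>x. norm (U i x - U j x) \<partial>lborel) < e"
    proof (intro exI allI impI)
      fix i j assume "i \<ge> N" "j \<ge> N"
      have "norm (to_l2 q) * norm (v i - v j) \<le> (norm (to_l2 q) + 1) * norm (v i - v j)"
        by (simp add: mult_right_mono)
      also have "\<dots> < (norm (to_l2 q) + 1) * (e / (norm (to_l2 q) + 1))"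
        using N[OF \<open>i \<ge> N\<close> \<open>j \<ge> N\<close>] by (intro mult_strict_left_mono) (auto simp: add_nonneg_pos)
      also have "\<dots> = e" by (simp add: add_nonneg_eq_0_iff)
      finally show "(\<integral>x. norm (U i x - U j x) \<partial>lborel) < e" using dU[of i j] by simp
    qed
  qed blast
  then obtain r where r: "strict_mono r" "AE x in lborel. Cauchy (\<lambda>i. U (r i) x)" by blast
  define g where "g x = lim (\<lambda>i. fun_l2 (v (r i)) x)" for x
  have gm: "g \<in> borel_measurable borel" unfolding g_def by (rule borel_measurable_lim_metric) simp
  have lim: "AE x in lborel. (\<lambda>i. fun_l2 (v (r i)) x) \<longlonglongrightarrow> g x"
    using r(2)
  proof eventually_elim
    case (elim x)
    then obtain l where "(\<lambda>i. U (r i) x) \<longlonglongrightarrow> l" by (auto simp: Cauchy_convergent_iff convergent_def)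
    then have "(\<lambda>i. inverse (q x) *\<^sub>R U (r i) x) \<longlonglongrightarrow> inverse (q x) *\<^sub>R l" by (intro tendsto_intros)
    then have "(\<lambda>i. fun_l2 (v (r i)) x) \<longlonglongrightarrow> inverse (q x) *\<^sub>R l"
      using q(2)[of x] by (simp add: U_def)
    then show ?case unfolding g_def by (simp add: limI)
  qed
  \<comment> \<open>Fatou's lemma with a free reference point \<open>w\<close>. With
    \<open>w\<close> a member of the sequence it yields first that \<open>g\<close> is square
    integrable and later the convergence itself.\<close>
  have fat: "(\<integral>\<^sup>+x. ennreal ((cmod (g x - fun_l2 w x))\<^sup>2) \<partial>lborel) \<le> ennreal (e\<^sup>2)"
    if ev: "eventually (\<lambda>i. norm (v (r i) - w) \<le> e) sequentially" for w e
  proof -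
    have "(\<integral>\<^sup>+x. ennreal ((cmod (g x - fun_l2 w x))\<^sup>2) \<partial>lborel)
      = (\<integral>\<^sup>+x. liminf (\<lambda>i. ennreal ((cmod (fun_l2 (v (r i)) x - fun_l2 w x))\<^sup>2)) \<partial>lborel)"
    proof (rule nn_integral_cong_AE)
      show "AE x in lborel. ennreal ((cmod (g x - fun_l2 w x))\<^sup>2) =
         liminf (\<lambda>i. ennreal ((cmod (fun_l2 (v (r i)) x - fun_l2 w x))\<^sup>2))"
        using lim
      proof eventually_elim
        case (elim x)
        then have "(\<lambda>i. ennreal ((cmod (fun_l2 (v (r i)) x - fun_l2 w x))\<^sup>2)) \<longlonglongrightarrow> ennreal ((cmod (g x - fun_l2 w x))\<^sup>2)"
          by (intro tendsto_intros)
        then show ?case by (rule lim_imp_Liminf[OF sequentially_bot, symmetric])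
      qed
    qed
    also have "\<dots> \<le> liminf (\<lambda>i. \<integral>\<^sup>+x. ennreal ((cmod (fun_l2 (v (r i)) x - fun_l2 w x))\<^sup>2) \<partial>lborel)"
      by (rule nn_integral_liminf) simp
    also have "\<dots> = liminf (\<lambda>i. ennreal ((norm (v (r i) - w))\<^sup>2))"
      by (subst nn_norm_to_l2) (auto intro!: square_integrable_minus square_integrable_fun_l2
          simp: to_l2_diff square_integrable_fun_l2 to_l2_fun_l2)
    also have "\<dots> \<le> liminf (\<lambda>i::nat. ennreal (e\<^sup>2))"
      by (rule Liminf_mono) (use ev in \<open>auto elim!: eventually_mono intro!: ennreal_leI power_mono\<close>)
    finally show ?thesis by (simp add: Liminf_const)
  qed
  have rC: "\<exists>N. \<forall>i\<ge>N. \<forall>j\<ge>N. norm (v (r i) - v j) \<le> e" if e0: "e > 0" for e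
  proof -
    obtain N where N: "\<And>i j. i \<ge> N \<Longrightarrow> j \<ge> N \<Longrightarrow> norm (v i - v j) < e"
      using C e0 unfolding Cauchy_def dist_norm by blast
    have "\<forall>i\<ge>N. \<forall>j\<ge>N. norm (v (r i) - v j) \<le> e"
      using N r(1) by (meson less_imp_le order_trans seq_suble)
    then show ?thesis by blast
  qed
  have sg: "square_integrable g"
  proof -
    obtain N where "\<forall>i\<ge>N. \<forall>j\<ge>N. norm (v (r i) - v j) \<le> 1" using rC[of 1] by auto
    then have "eventually (\<lambda>i. norm (v (r i) - v N) \<le> 1) sequentially"
      by (auto simp: eventually_sequentially)
    from fat[OF this] have "square_integrable (\<lambda>x. g x - fun_l2 (v N) x)"
      unfolding square_integrable_iff_nn using gm by (auto simp: less_top[symmetric] top_unique)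
    from square_integrable_add[OF this square_integrable_fun_l2, of "v N"] show ?thesis by simp
  qed
  have "(\<lambda>j. v j) \<longlonglongrightarrow> to_l2 g"
    unfolding LIMSEQ_def dist_norm
  proof (intro allI impI)
    fix e :: real assume "e > 0"
    then have "0 < e / 2" by simp
    from rC[OF this] obtain N where N: "\<forall>i\<ge>N. \<forall>j\<ge>N. norm (v (r i) - v j) \<le> e/2"
      by blast
    have "norm (v j - to_l2 g) < e" if "j \<ge> N" for j
    proof -
      have "eventually (\<lambda>i. norm (v (r i) - v j) \<le> e/2) sequentially"
        using N that by (auto simp: eventually_sequentially)
      from fat[OF this] have "ennreal ((norm (to_l2 g - v j))\<^sup>2) \<le> ennreal ((e/2)\<^sup>2)"
        using nn_norm_to_l2[OF square_integrable_minus[OF sg square_integrable_fun_l2], of "v j"]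
        by (simp add: to_l2_diff sg square_integrable_fun_l2 to_l2_fun_l2)
      then have "(norm (to_l2 g - v j))\<^sup>2 \<le> (e/2)\<^sup>2" by (simp add: ennreal_le_iff)
      then have "norm (to_l2 g - v j) \<le> e/2" by (rule power2_le_imp_le) (use \<open>e > 0\<close> in simp)
      then show ?thesis using \<open>e > 0\<close> by (simp add: norm_minus_commute)
    qed
    then show "\<exists>no. \<forall>n\<ge>no. norm (v n - to_l2 g) < e" by blast
  qed
  then show "convergent v" by (auto simp: convergent_def)
qed

section \<open>Bounded multipliers and measure preserving substitutions\<close>

definition bounded_symbol :: "('a::euclidean_space \<Rightarrow> complex) \<Rightarrow> bool" where
  "bounded_symbol f \<longleftrightarrow> f \<in> borel_measurable borel \<and> (\<exists>c. \<forall>x. cmod (f x) \<le> c)"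

lemma bsymI: "f \<in> borel_measurable borel \<Longrightarrow> (\<And>x. cmod (f x) \<le> c) \<Longrightarrow> bounded_symbol f"
  by (auto simp: bounded_symbol_def)

lemma bounded_symbol_const [simp]: "bounded_symbol (\<lambda>x. c)"
  by (rule bsymI[of _ "cmod c"]) auto

lemma bounded_symbol_mult: "bounded_symbol f \<Longrightarrow> bounded_symbol g \<Longrightarrow> bounded_symbol (\<lambda>x. f x * g x)"
proof -
  assume "bounded_symbol f" "bounded_symbol g"
  then obtain c d where "\<And>x. cmod (f x) \<le> c" "\<And>x. cmod (g x) \<le> d"
    and [measurable]: "f \<in> borel_measurable borel" "g \<in> borel_measurable borel"
    by (auto simp: bounded_symbol_def)
  then show ?thesis
    by (intro bsymI[of _ "c * d"])
      (auto simp: norm_mult intro!: mult_mono intro: order_trans[OF norm_ge_zero])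
qed

lemma bounded_symbol_add: "bounded_symbol f \<Longrightarrow> bounded_symbol g \<Longrightarrow> bounded_symbol (\<lambda>x. f x + g x)"
proof -
  assume "bounded_symbol f" "bounded_symbol g"
  then obtain c d where "\<And>x. cmod (f x) \<le> c" "\<And>x. cmod (g x) \<le> d"
    and [measurable]: "f \<in> borel_measurable borel" "g \<in> borel_measurable borel"
    by (auto simp: bounded_symbol_def)
  then show ?thesis
    by (intro bsymI[of _ "c + d"]) (auto intro!: norm_triangle_mono)
qed

lemma bounded_symbol_power: "bounded_symbol f \<Longrightarrow> bounded_symbol (\<lambda>x. f x ^ k)"
  by (induction k) (auto intro: bounded_symbol_mult)

lemma bounded_symbol_sum: "(\<And>i. i \<in> I \<Longrightarrow> bounded_symbol (f i)) \<Longrightarrow> bounded_symbol (\<lambda>x. \<Sum>i\<in>I. f i x)"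
  by (induction I rule: infinite_finite_induct) (auto intro: bounded_symbol_add)

lemma bounded_symbol_diff: "bounded_symbol f \<Longrightarrow> bounded_symbol g \<Longrightarrow> bounded_symbol (\<lambda>x. f x - g x)"
  using bounded_symbol_add[of f "\<lambda>x. -1 * g x"] bounded_symbol_mult[of "\<lambda>x. -1" g] by simp

text \<open>Also applied to unbounded symbols such as \<open>brapow k\<close>; there the dummy value
  0 of \<open>to_l2\<close> is excluded by membership in \<open>Hs k\<close>.\<close>

definition mul :: "('a::euclidean_space \<Rightarrow> complex) \<Rightarrow> 'a l2 \<Rightarrow> 'a l2" where
  "mul f v = to_l2 (\<lambda>x. f x * fun_l2 v x)"

lemma square_integrable_bounded_symbol:
  assumes "bounded_symbol f" "square_integrable g"
  shows "square_integrable (\<lambda>x. f x * g x)"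
proof -
  obtain c where c: "\<And>x. cmod (f x) \<le> c" using assms by (auto simp: bounded_symbol_def)
  show ?thesis
  proof (rule square_integrable_bound[OF _ assms(2)])
    show "AE x in lborel. cmod (f x * g x) \<le> c * cmod (g x)"
      using c by (auto simp: norm_mult intro!: mult_right_mono)
  qed (use assms in \<open>auto simp: bounded_symbol_def square_integrable_def\<close>)
qed

lemma square_integrable_mul: "bounded_symbol f \<Longrightarrow> square_integrable (\<lambda>x. f x * fun_l2 v x)"
  by (intro square_integrable_bounded_symbol square_integrable_fun_l2)

lemma fun_l2_mul: "bounded_symbol f \<Longrightarrow> AE x in lborel. fun_l2 (mul f v) x = f x * fun_l2 v x"
  unfolding mul_def by (intro fun_l2_to_l2 square_integrable_mul)

lemma norm_mul_le:
  assumes "f \<in> borel_measurable borel" "\<And>x. cmod (f x) \<le> c"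
  shows "norm (mul f v) \<le> c * norm v"
proof (rule norm_l2_mono)
  show "0 \<le> c" using assms(2) norm_ge_zero order_trans by blast
  show "AE x in lborel. cmod (fun_l2 (mul f v) x) \<le> c * cmod (fun_l2 v x)"
    using fun_l2_mul[OF bsymI[OF assms], of v]
    by eventually_elim (simp add: norm_mult mult_right_mono assms)
qed

lemma norm_mul_unimodular:
  assumes "f \<in> borel_measurable borel" "\<And>x. cmod (f x) = 1"
  shows "norm (mul f v) = norm v"
proof (rule antisym)
  have b: "bounded_symbol f" by (rule bsymI[OF assms(1), of 1]) (simp add: assms)
  show "norm (mul f v) \<le> norm v" using norm_mul_le[OF assms(1), of 1 v] assms(2) by simp
  have "norm v \<le> 1 * norm (mul f v)"
    by (rule norm_l2_mono, simp, use fun_l2_mul[OF b, of v] in eventually_elim)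
      (simp add: norm_mult assms)
  then show "norm v \<le> norm (mul f v)" by simp
qed

lemma mul_add:
  assumes "bounded_symbol f" shows "mul f (v + w) = mul f v + mul f w"
  by (rule l2_eqI, use fun_l2_mul[OF assms, of v] fun_l2_mul[OF assms, of w]
      fun_l2_mul[OF assms, of "v + w"] fun_l2_add[of v w] fun_l2_add[of "mul f v" "mul f w"]
      in eventually_elim) (simp add: algebra_simps)

lemma mul_scaleR:
  assumes "bounded_symbol f" shows "mul f (r *\<^sub>R v) = r *\<^sub>R mul f v"
  by (rule l2_eqI, use fun_l2_mul[OF assms, of v] fun_l2_mul[OF assms, of "r *\<^sub>R v"]
      fun_l2_scaleR[of r v] fun_l2_scaleR[of r "mul f v"] in eventually_elim) simp

lemma bounded_linear_mul:
  assumes "bounded_symbol f" shows "bounded_linear (mul f)"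
proof -
  obtain c where c: "\<And>x. cmod (f x) \<le> c" "f \<in> borel_measurable borel"
    using assms by (auto simp: bounded_symbol_def)
  show ?thesis
    by (rule bounded_linear_intro[of _ c])
      (use norm_mul_le[OF c(2,1)] in \<open>auto simp: mul_add mul_scaleR assms mult.commute\<close>)
qed

lemma mul_diff: "bounded_symbol f \<Longrightarrow> mul f (v - w) = mul f v - mul f w"
  using linear_diff[OF bounded_linear.linear[OF bounded_linear_mul]] .

lemma mul_mul:
  assumes "bounded_symbol f" "bounded_symbol g"
  shows "mul f (mul g v) = mul (\<lambda>x. f x * g x) v"
  by (rule l2_eqI, use fun_l2_mul[OF assms(1), of "mul g v"] fun_l2_mul[OF assms(2), of v]
      fun_l2_mul[OF bounded_symbol_mult[OF assms], of v] in eventually_elim) simp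

lemma mul_add_sym:
  assumes "bounded_symbol f" "bounded_symbol g"
  shows "mul (\<lambda>x. f x + g x) v = mul f v + mul g v"
  by (rule l2_eqI, use fun_l2_mul[OF assms(1), of v] fun_l2_mul[OF assms(2), of v]
      fun_l2_mul[OF bounded_symbol_add[OF assms], of v] fun_l2_add[of "mul f v" "mul g v"] in eventually_elim)
    (simp add: algebra_simps)

lemma mul_diff_sym:
  assumes "bounded_symbol f" "bounded_symbol g"
  shows "mul (\<lambda>x. f x - g x) v = mul f v - mul g v"
  using mul_add_sym[OF bounded_symbol_diff[OF assms] assms(2), of v] by simp

lemma mul_of_real: "mul (\<lambda>x. of_real r) v = r *\<^sub>R v"
  by (rule l2_eqI, use fun_l2_mul[OF bounded_symbol_const, of "of_real r" v] fun_l2_scaleR[of r v] in eventually_elim)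
    (simp add: scaleR_conv_of_real)

lemma mul_one: "mul (\<lambda>x. 1) v = v"
  using mul_of_real[of 1 v] by simp

lemma mul_to_l2:
  assumes "bounded_symbol f" "square_integrable g"
  shows "mul f (to_l2 g) = to_l2 (\<lambda>x. f x * g x)"
  by (rule to_l2_eqI[symmetric, OF square_integrable_bounded_symbol[OF assms]],
      use fun_l2_mul[OF assms(1), of "to_l2 g"] fun_l2_to_l2[OF assms(2)] in eventually_elim) simp

lemma mul_tendsto_fixed:
  assumes "\<And>j. f j \<in> borel_measurable borel" "g \<in> borel_measurable borel"
    "\<And>j x. cmod (f j x) \<le> c" "\<And>x. (\<lambda>j. f j x) \<longlonglongrightarrow> g x"
  shows "(\<lambda>j::nat. mul (f j) v) \<longlonglongrightarrow> mul g v"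
  unfolding mul_def
proof (rule tendsto_to_l2_dominated(2))
  show "integrable lborel (\<lambda>x. (c * cmod (fun_l2 v x))\<^sup>2)"
    using square_integrable_fun_l2[of v] by (simp add: power_mult_distrib square_integrable_def)
qed (use assms in \<open>auto simp: norm_mult intro!: tendsto_intros mult_right_mono\<close>)

text \<open>The multipliers converge strongly, not in operator norm; their uniform bound
  \<open>c\<close> allows the argument to move as well.\<close>

lemma mul_tendsto:
  assumes "\<And>j. f j \<in> borel_measurable borel" "g \<in> borel_measurable borel"
    "\<And>j x. cmod (f j x) \<le> c" "\<And>x. (\<lambda>j. f j x) \<longlonglongrightarrow> g x" "v \<longlonglongrightarrow> w"
  shows "(\<lambda>j::nat. mul (f j) (v j)) \<longlonglongrightarrow> mul g w"
proof -
  have b: "bounded_symbol (f j)" for j using assms by (intro bsymI)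
  have "(\<lambda>j. mul (f j) (v j - w)) \<longlonglongrightarrow> 0"
  proof (rule Lim_null_comparison)
    show "\<forall>\<^sub>F j in sequentially. norm (mul (f j) (v j - w)) \<le> c * norm (v j - w)"
      using assms by (intro always_eventually allI norm_mul_le)
    have "(\<lambda>j. c * norm (v j - w)) \<longlonglongrightarrow> c * norm (w - w)" by (intro tendsto_intros assms)
    then show "(\<lambda>j. c * norm (v j - w)) \<longlonglongrightarrow> 0" by simp
  qed
  from tendsto_add[OF this mul_tendsto_fixed[OF assms(1-4), of w]]
  show ?thesis by (simp add: mul_diff b)
qed

section \<open>Reflection and translations acting on L2\<close>

definition mpres :: "('a::euclidean_space \<Rightarrow> 'a) \<Rightarrow> bool" where
  "mpres T \<longleftrightarrow> T \<in> borel_measurable borel \<and> distr lborel borel T = lborel"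

lemma mpres_uminus: "mpres uminus"
proof -
  have "lborel = density (distr lborel borel (\<lambda>x::'a. 0 + (-1) *\<^sub>R x)) (\<lambda>_. \<bar>-1::real\<bar> ^ DIM('a))"
    by (rule lborel_affine) simp
  then have "lborel = distr lborel borel (\<lambda>x::'a. - x)" by (simp add: density_1)
  then show ?thesis by (simp add: mpres_def)
qed

lemma mpres_translate: "mpres (\<lambda>x. x + y)"
proof -
  have "(\<lambda>x. x + y) = (+) y" by (auto simp: add.commute)
  then have "distr lborel borel (\<lambda>x. x + y) = lborel"
    using lborel_distr_plus[of y] by simp
  then show ?thesis by (simp add: mpres_def)
qed

lemma mpres_AE:
  assumes "mpres T" "AE x in lborel. P x"
  shows "AE x in lborel. P (T x)"
proof (rule AE_distrD[where f = T and P = P])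
  show "T \<in> lborel \<rightarrow>\<^sub>M borel" using assms(1) by (simp add: mpres_def)
  show "AE x in distr lborel borel T. P x" using assms unfolding mpres_def by metis
qed

lemma mpres_integral:
  fixes f :: "_ \<Rightarrow> 'b::{banach, second_countable_topology}"
  assumes "mpres T" "f \<in> borel_measurable borel"
  shows "(\<integral>x. f (T x) \<partial>lborel) = (\<integral>x. f x \<partial>lborel)"
    and "integrable lborel (\<lambda>x. f (T x)) \<longleftrightarrow> integrable lborel f"
proof -
  have T: "T \<in> lborel \<rightarrow>\<^sub>M borel" "distr lborel borel T = lborel"
    using assms(1) by (simp_all add: mpres_def)
  show "(\<integral>x. f (T x) \<partial>lborel) = (\<integral>x. f x \<partial>lborel)"
    using integral_distr[OF T(1) assms(2)] unfolding T(2) by (rule sym)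
  show "integrable lborel (\<lambda>x. f (T x)) \<longleftrightarrow> integrable lborel f"
    using integrable_distr_eq[OF T(1) assms(2)] unfolding T(2) by (rule sym)
qed

lemma mpres_square_integrable:
  assumes "mpres T" "square_integrable f"
  shows "square_integrable (\<lambda>x. f (T x))"
  using assms mpres_integral(2)[of T "\<lambda>x. (cmod (f x))\<^sup>2"]
  by (auto simp: square_integrable_def mpres_def)

definition comp_l2 :: "('a::euclidean_space \<Rightarrow> 'a) \<Rightarrow> 'a l2 \<Rightarrow> 'a l2" where
  "comp_l2 T v = to_l2 (\<lambda>x. fun_l2 v (T x))"

lemma fun_l2_comp: "mpres T \<Longrightarrow> AE x in lborel. fun_l2 (comp_l2 T v) x = fun_l2 v (T x)"
  unfolding comp_l2_def
  by (rule fun_l2_to_l2[OF mpres_square_integrable[OF _ square_integrable_fun_l2]])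

lemma comp_l2_to_l2:
  assumes "mpres T" "square_integrable f"
  shows "comp_l2 T (to_l2 f) = to_l2 (\<lambda>x. f (T x))"
  by (rule to_l2_eqI[symmetric, OF mpres_square_integrable[OF assms]],
      use fun_l2_comp[OF assms(1), of "to_l2 f"] mpres_AE[OF assms(1) fun_l2_to_l2[OF assms(2)]]
      in eventually_elim) simp

lemma norm_comp_l2:
  assumes "mpres T" shows "norm (comp_l2 T v) = norm v"
proof -
  have "(norm (comp_l2 T v))\<^sup>2 = (norm v)\<^sup>2"
    using mpres_integral(1)[OF assms, of "\<lambda>x. (cmod (fun_l2 v x))\<^sup>2"]
    unfolding comp_l2_def norm_to_l2_sq[OF mpres_square_integrable[OF assms square_integrable_fun_l2]]
    by (simp add: norm_l2_sq)
  then show ?thesis by simp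
qed

lemma bounded_linear_comp_l2:
  assumes "mpres T" shows "bounded_linear (comp_l2 T)"
proof (rule bounded_linear_intro[of _ 1])
  show "comp_l2 T (v + w) = comp_l2 T v + comp_l2 T w" for v w
    by (rule l2_eqI, use fun_l2_comp[OF assms, of v] fun_l2_comp[OF assms, of w]
      fun_l2_comp[OF assms, of "v + w"] mpres_AE[OF assms fun_l2_add[of v w]]
      fun_l2_add[of "comp_l2 T v" "comp_l2 T w"] in eventually_elim) simp
  show "comp_l2 T (r *\<^sub>R v) = r *\<^sub>R comp_l2 T v" for r v
    by (rule l2_eqI, use fun_l2_comp[OF assms, of v] fun_l2_comp[OF assms, of "r *\<^sub>R v"]
      mpres_AE[OF assms fun_l2_scaleR[of r v]] fun_l2_scaleR[of r "comp_l2 T v"] in eventually_elim) simp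
qed (simp add: norm_comp_l2 assms)

text \<open>Bilinear over the complex numbers, without conjugation: the form for which the Fourier
  transform is symmetric and in which weak derivatives are defined.\<close>

definition bil :: "'a::euclidean_space l2 \<Rightarrow> 'a l2 \<Rightarrow> complex" where
  "bil v w = (\<integral>x. fun_l2 v x * fun_l2 w x \<partial>lborel)"

lemma square_integrable_norm: "square_integrable f \<Longrightarrow> square_integrable (\<lambda>x. complex_of_real (cmod (f x)))"
  by (auto simp: square_integrable_def)

lemma square_integrable_mult:
  assumes "square_integrable f" "square_integrable g"
  shows "integrable lborel (\<lambda>x. f x * g x)"
  by (rule Bochner_Integration.integrable_bound[OF
        square_integrable_inner[OF square_integrable_norm[OF assms(1)] square_integrable_norm[OF assms(2)]]])
    (use assms in \<open>auto simp: inner_complex_def norm_mult square_integrable_def\<close>)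

lemma integral_norm_mult_le:
  assumes "square_integrable f" "square_integrable g"
  shows "(\<integral>x. cmod (f x) * cmod (g x) \<partial>lborel) \<le> norm (to_l2 f) * norm (to_l2 g)"
proof -
  note s = square_integrable_norm[OF assms(1)] square_integrable_norm[OF assms(2)]
  have "(\<integral>x. cmod (f x) * cmod (g x) \<partial>lborel) =
      to_l2 (\<lambda>x. complex_of_real (cmod (f x))) \<bullet> to_l2 (\<lambda>x. complex_of_real (cmod (g x)))"
    by (simp add: inner_to_l2[OF s] inner_complex_def)
  also have "\<dots> \<le> norm (to_l2 (\<lambda>x. complex_of_real (cmod (f x)))) * norm (to_l2 (\<lambda>x. complex_of_real (cmod (g x))))"
    by (rule norm_cauchy_schwarz)
  also have "\<dots> \<le> (1 * norm (to_l2 f)) * (1 * norm (to_l2 g))"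
    by (intro mult_mono norm_to_l2_mono s assms) auto
  finally show ?thesis by simp
qed

lemma bil_to_l2:
  assumes "square_integrable f" "square_integrable g"
  shows "bil (to_l2 f) (to_l2 g) = (\<integral>x. f x * g x \<partial>lborel)"
  unfolding bil_def
  by (rule integral_cong_AE)
    (use fun_l2_to_l2[OF assms(1)] fun_l2_to_l2[OF assms(2)]
       assms[THEN square_integrable_measurable] in \<open>auto elim: eventually_elim2\<close>)

lemma bil_cong_AE:
  assumes "AE x in lborel. fun_l2 v x * fun_l2 w x = f x" "f \<in> borel_measurable borel"
  shows "bil v w = (\<integral>x. f x \<partial>lborel)"
  unfolding bil_def by (rule integral_cong_AE) (use assms in auto)

lemma integrable_bil: "integrable lborel (\<lambda>x. fun_l2 v x * fun_l2 w x)"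
  by (intro square_integrable_mult square_integrable_fun_l2)

lemma bil_commute: "bil v w = bil w v"
  by (simp add: bil_def mult.commute)

lemma bil_add: "bil (u + v) w = bil u w + bil v w"
proof -
  have "bil (u + v) w = (\<integral>x. fun_l2 u x * fun_l2 w x + fun_l2 v x * fun_l2 w x \<partial>lborel)"
    by (rule bil_cong_AE) (use fun_l2_add[of u v] in \<open>auto simp: algebra_simps elim!: eventually_mono\<close>)
  then show ?thesis by (simp add: bil_def integrable_bil)
qed

lemma bil_scaleR: "bil (r *\<^sub>R v) w = r *\<^sub>R bil v w"
proof -
  have "bil (r *\<^sub>R v) w = (\<integral>x. r *\<^sub>R (fun_l2 v x * fun_l2 w x) \<partial>lborel)"
    by (rule bil_cong_AE) (use fun_l2_scaleR[of r v] in \<open>auto elim!: eventually_mono\<close>)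
  then show ?thesis by (simp add: bil_def)
qed

lemma norm_bil_le: "norm (bil v w) \<le> norm v * norm w"
proof -
  have "norm (bil v w) \<le> (\<integral>x. norm (fun_l2 v x * fun_l2 w x) \<partial>lborel)"
    unfolding bil_def by (rule integral_norm_bound)
  also have "\<dots> \<le> norm v * norm w"
    using integral_norm_mult_le[OF square_integrable_fun_l2 square_integrable_fun_l2, of v w]
    by (simp add: norm_mult to_l2_fun_l2)
  finally show ?thesis .
qed

lemma bounded_bilinear_bil: "bounded_bilinear bil"
proof
  show "bil a (b + b') = bil a b + bil a b'" for a b b' :: "'a l2"
    using bil_add[of b b' a] by (simp add: bil_commute)
  show "bil a (r *\<^sub>R b) = r *\<^sub>R bil a b" for a b :: "'a l2" and r
    using bil_scaleR[of r b a] by (simp add: bil_commute)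
  show "\<exists>K. \<forall>a b. norm (bil a b :: complex) \<le> norm (a :: 'a l2) * norm b * K"
    using norm_bil_le by (intro exI[of _ 1]) auto
qed (simp_all add: bil_add bil_scaleR)

text \<open>The class on which the Fourier integral converges absolutely and the L2 norm is finite;
  truncation to a ball brings every L2 function into it.\<close>

definition L12 :: "('a::euclidean_space \<Rightarrow> complex) \<Rightarrow> bool" where
  "L12 f \<longleftrightarrow> integrable lborel f \<and> square_integrable f"

lemma bounded_symbol_indicator_ball: "bounded_symbol (\<lambda>x. indicator (ball 0 R) x)"
  by (rule bsymI[of _ 1]) (auto simp: indicator_def)

lemma L12_truncation:
  assumes "square_integrable f" shows "L12 (\<lambda>x. indicator (ball 0 R) x * f x)"
proof -
  have "integrable lborel (\<lambda>x. indicator (ball 0 R) x * f x)"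
  proof (rule Bochner_Integration.integrable_bound)
    show "integrable lborel (\<lambda>x. indicator (ball 0 R) x + (cmod (f x))\<^sup>2 :: real)"
      by (intro Bochner_Integration.integrable_add integrable_real_indicator)
        (use assms emeasure_bounded_finite[OF bounded_ball, of "0::'a" R]
          in \<open>auto simp: square_integrable_def\<close>)
    have "norm (indicator (ball 0 R) x * f x) \<le> norm (indicator (ball 0 R) x + (cmod (f x))\<^sup>2 :: real)" for x
    proof -
      have "cmod (f x) * 2 \<le> 1 + (cmod (f x))\<^sup>2"
        using sum_squares_bound[of "cmod (f x)" 1] by (simp add: mult.commute)
      then have "cmod (f x) \<le> 1 + (cmod (f x))\<^sup>2"
        using norm_ge_zero[of "f x"] by linarith
      then show ?thesis by (simp add: indicator_def)
    qed
    then show "AE x in lborel. norm (indicator (ball 0 R) x * f x) \<le> norm (indicator (ball 0 R) x + (cmod (f x))\<^sup>2 :: real)"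
      by simp
  qed (use square_integrable_measurable[OF square_integrable_bounded_symbol[OF bounded_symbol_indicator_ball assms]] in simp)
  then show ?thesis using square_integrable_bounded_symbol[OF bounded_symbol_indicator_ball assms] by (simp add: L12_def)
qed

lemma truncation_tendsto:
  assumes "filterlim R at_top sequentially"
  shows "(\<lambda>j. mul (\<lambda>x. indicator (ball 0 (R j)) x) v) \<longlonglongrightarrow> v"
proof -
  have "(\<lambda>j. mul (\<lambda>x. indicator (ball 0 (R j)) x) v) \<longlonglongrightarrow> mul (\<lambda>x. 1) v"
  proof (rule mul_tendsto_fixed[where c = 1])
    fix x :: 'a
    have "eventually (\<lambda>j. R j > norm x) sequentially"
      using assms by (auto simp: filterlim_at_top_dense)
    then have "eventually (\<lambda>j. indicator (ball 0 (R j)) x = (1::complex)) sequentially"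
      by eventually_elim (simp add: indicator_def)
    then show "(\<lambda>j. indicator (ball 0 (R j)) x :: complex) \<longlonglongrightarrow> 1" by (rule tendsto_eventually)
  qed (auto simp: indicator_def)
  then show ?thesis by (simp add: mul_one)
qed

text \<open>Density principle: an identity between continuous maps extends from \<open>L12\<close>
  to all of L2, because truncations to growing balls converge.\<close>

lemma l2_closed_L12:
  fixes S :: "'a::euclidean_space l2 set"
  assumes "closed S" "\<And>f. L12 f \<Longrightarrow> to_l2 f \<in> S"
  shows "v \<in> S"
proof (rule closed_sequentially[OF assms(1)])
  show "(\<lambda>j. mul (\<lambda>x. indicator (ball 0 (real j)) x) v) \<longlonglongrightarrow> v"
    by (intro truncation_tendsto filterlim_real_sequentially)
  show "mul (\<lambda>x. indicator (ball 0 (real j)) x) v \<in> S" for j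
    unfolding mul_def by (intro assms(2) L12_truncation square_integrable_fun_l2)
qed

text \<open>A second density principle, for arguments that need a continuous function. The class
  grows from continuous functions to indicators of open sets, to indicators of Borel sets by outer
  regularity, to simple functions, and to L2 by dominated approximation.\<close>

lemma l2_closed_continuous:
  fixes S :: "'a::euclidean_space l2 set"
  assumes S: "closed S" "\<And>v w. v \<in> S \<Longrightarrow> w \<in> S \<Longrightarrow> v + w \<in> S"
    and C: "\<And>c f. continuous_on UNIV f \<Longrightarrow> (\<And>x. 0 \<le> f x \<and> f x \<le> 1) \<Longrightarrow> integrable lborel f \<Longrightarrow>
      to_l2 (\<lambda>x. c * complex_of_real (f x)) \<in> S"
  shows "v \<in> S"
proof -
  have sqi: "square_integrable (\<lambda>x. c * indicator A x)" if "A \<in> sets borel" "emeasure lborel A < \<infinity>"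
    for A :: "'a set" and c
  proof -
    have "integrable lborel (\<lambda>x. (cmod c)\<^sup>2 * indicator A x)"
      using that by simp
    moreover have "(\<lambda>x. (cmod (c * indicator A x))\<^sup>2) = (\<lambda>x. (cmod c)\<^sup>2 * indicator A x)"
      by (auto simp: indicator_def)
    ultimately show ?thesis using that by (simp add: square_integrable_def)
  qed
  have op: "to_l2 (\<lambda>x. c * indicator U x) \<in> S"
    if U: "open U" "emeasure lborel U < \<infinity>" for U and c
  proof -
    have Um [measurable]: "U \<in> sets borel" using U by simp
    \<comment> \<open>\<open>infdist\<close> to the empty set is 0, so the cut-off below would
      vanish for the whole space; that case is excluded by its infinite measure.\<close>
    have ne: "- U \<noteq> {}"
    proof
      assume "- U = {}"
      then have "U = UNIV" by auto
      then show False using U by simp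
    qed
    define f where "f j x = min 1 (real j * infdist x (- U))" for j x
    have f01: "0 \<le> f j x \<and> f j x \<le> 1" for j x
      by (simp add: f_def infdist_nonneg)
    have fU: "f j x \<le> indicator U x" for j x
      using f01[of j x] by (auto simp: f_def indicator_def)
    have cf: "continuous_on UNIV (f j)" for j unfolding f_def
      by (intro continuous_intros)
    have [measurable]: "f j \<in> borel_measurable borel" for j
      using cf by (rule borel_measurable_continuous_onI)
    have iU: "integrable lborel (indicator U :: 'a \<Rightarrow> real)" using U by simp
    have intf: "integrable lborel (f j)" for j
      by (rule Bochner_Integration.integrable_bound[OF iU]) (use fU f01 in \<open>auto simp: abs_of_nonneg\<close>)
    have "(\<lambda>j. to_l2 (\<lambda>x. c * complex_of_real (f j x))) \<longlonglongrightarrow> to_l2 (\<lambda>x. c * indicator U x)"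
    proof (rule tendsto_to_l2_dominated(2)[where w = "\<lambda>x. cmod c * indicator U x"])
      show "integrable lborel (\<lambda>x. (cmod c * indicator U x :: real)\<^sup>2)"
        by (rule Bochner_Integration.integrable_cong[THEN iffD1, OF refl _
            conjunct2[OF sqi[OF Um U(2), of c, unfolded square_integrable_def]]])
          (simp add: norm_mult indicator_def)
      have "(\<lambda>j. f j x) \<longlonglongrightarrow> indicator U x" for x
      proof (cases "x \<in> U")
        case True
        then have "infdist x (- U) > 0"
          using U ne in_closed_iff_infdist_zero[of "- U" x] infdist_nonneg[of x "- U"]
          by (auto simp: closed_Compl order_less_le)
        then obtain N where N: "1 < real N * infdist x (- U)" using ex_less_of_nat_mult by blast
        have "f j x = 1" if "j \<ge> N" for j
        proof -
          have "real N * infdist x (- U) \<le> real j * infdist x (- U)"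
            using that by (intro mult_right_mono infdist_nonneg) simp
          then show ?thesis using N by (simp add: f_def)
        qed
        then show ?thesis using True
          by (intro tendsto_eventually) (auto simp: eventually_sequentially)
      next
        case False
        then have "f j x = 0" for j by (simp add: f_def)
        then show ?thesis using False by simp
      qed
      then have "(\<lambda>j. c * complex_of_real (f j x)) \<longlonglongrightarrow> c * complex_of_real (indicator U x)" for x
        by (intro tendsto_intros)
      then show "AE x in lborel. (\<lambda>j. c * complex_of_real (f j x)) \<longlonglongrightarrow> c * indicator U x"
        unfolding of_real_indicator by (rule AE_I2)
      show "AE x in lborel. cmod (c * complex_of_real (f j x)) \<le> cmod c * indicator U x" for j
        using fU f01 by (auto simp: norm_mult abs_of_nonneg intro!: mult_left_mono)
    qed simp_all
    then show ?thesis by (rule closed_sequentially[OF S(1), rotated]) (intro C cf f01 intf)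
  qed
  \<comment> \<open>Replacing \<open>A\<close> by an open superset costs the square root of the
    measure of the difference in the L2 norm, times the modulus of \<open>c\<close>.\<close>
  have bo: "to_l2 (\<lambda>x. c * indicator A x) \<in> S"
    if A: "A \<in> sets borel" "emeasure lborel A < \<infinity>" for A and c
  proof -
    have "\<exists>U. open U \<and> A \<subseteq> U \<and> emeasure lborel (U - A) < ennreal (inverse (real (Suc j)))" for j
    proof -
      have "A \<in> sets lebesgue" using A by auto
      moreover have "0 < inverse (real (Suc j))" by simp
      ultimately obtain U where
        U: "open U" "A \<subseteq> U" "emeasure lebesgue (U - A) < ennreal (inverse (real (Suc j)))"
        by (rule sets_lebesgue_outer_open)
      have "emeasure lebesgue (U - A) = emeasure lborel (U - A)"
        using A U by (simp add: main_part_sets)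
      then show ?thesis using U by auto
    qed
    then obtain U where U: "\<And>j. open (U j)" "\<And>j. A \<subseteq> U j"
      "\<And>j. emeasure lborel (U j - A) < ennreal (inverse (real (Suc j)))" by metis
    have [measurable]: "A \<in> sets borel" "U j \<in> sets borel" for j using A U by auto
    have fd: "emeasure lborel (U j - A) < \<infinity>" for j
      using U(3)[of j] by (rule order.strict_trans) simp
    have fU: "emeasure lborel (U j) < \<infinity>" for j
    proof -
      have "U j = A \<union> (U j - A)" using U(2)[of j] by blast
      then have "emeasure lborel (U j) \<le> emeasure lborel A + emeasure lborel (U j - A)"
        using emeasure_subadditive[of A lborel "U j - A"] by simp
      also have "\<dots> < \<infinity>" using A(2) fd[of j] by (simp add: ennreal_add_less_top less_top[symmetric])
      finally show ?thesis .
    qed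
    have nd: "norm (to_l2 (\<lambda>x. c * indicator (U j) x) - to_l2 (\<lambda>x. c * indicator A x)) \<le> cmod c * sqrt (inverse (real (Suc j)))" for j
    proof -
      have eq: "(\<lambda>x. c * indicator (U j) x - c * indicator A x) = (\<lambda>x. c * indicator (U j - A) x)"
        using U(2)[of j] by (auto simp: indicator_def fun_eq_iff)
      have i: "(\<integral>x. indicator (U j - A) x \<partial>lborel) \<le> inverse (real (Suc j))"
      proof -
        have "ennreal (measure lborel (U j - A)) \<le> ennreal (inverse (real (Suc j)))"
          using U(3)[of j] fd[of j] by (simp add: emeasure_eq_ennreal_measure[symmetric] less_top)
        then show ?thesis by (simp add: ennreal_le_iff)
      qed
      have "(norm (to_l2 (\<lambda>x. c * indicator (U j) x) - to_l2 (\<lambda>x. c * indicator A x)))\<^sup>2 =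
        (\<integral>x. (cmod c)\<^sup>2 * indicator (U j - A) x \<partial>lborel)"
        unfolding to_l2_diff[OF sqi[OF \<open>U j \<in> sets borel\<close> fU] sqi[OF A], symmetric] eq
      proof (subst norm_to_l2_sq[OF sqi])
        have "(\<lambda>x. (cmod (c * indicator (U j - A) x))\<^sup>2) = (\<lambda>x. (cmod c)\<^sup>2 * indicator (U j - A) x)"
          by (auto simp: indicator_def)
        then show "(\<integral>x. (cmod (c * indicator (U j - A) x))\<^sup>2 \<partial>lborel) =
            (\<integral>x. (cmod c)\<^sup>2 * indicator (U j - A) x \<partial>lborel)" by simp
      qed (use fd in auto)
      also have "\<dots> \<le> (cmod c)\<^sup>2 * (inverse (real (Suc j)))"
        using i by (simp add: mult_left_mono)
      also have "\<dots> = (cmod c * sqrt (inverse (real (Suc j))))\<^sup>2" by (simp add: power_mult_distrib)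
      finally show ?thesis by (rule power2_le_imp_le) simp
    qed
    have "(\<lambda>j. to_l2 (\<lambda>x. c * indicator (U j) x)) \<longlonglongrightarrow> to_l2 (\<lambda>x. c * indicator A x)"
    proof (rule LIM_zero_cancel, rule Lim_null_comparison)
      show "\<forall>\<^sub>F j in sequentially. norm (to_l2 (\<lambda>x. c * indicator (U j) x) - to_l2 (\<lambda>x. c * indicator A x)) \<le> cmod c * sqrt (inverse (real (Suc j)))"
        using nd by simp
      have "(\<lambda>j. cmod c * sqrt (inverse (real (Suc j)))) \<longlonglongrightarrow> cmod c * sqrt 0"
        by (intro tendsto_mult tendsto_const tendsto_real_sqrt LIMSEQ_inverse_real_of_nat)
      then show "(\<lambda>j. cmod c * sqrt (inverse (real (Suc j)))) \<longlonglongrightarrow> 0" by simp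
    qed
    then show ?thesis by (rule closed_sequentially[OF S(1), rotated]) (intro op U fU)
  qed
  have S0: "0 \<in> S" using bo[of "{}" 0] by (simp add: to_l2_zero)
  have fs: "to_l2 (\<lambda>x. \<Sum>y\<in>Y. g y x) \<in> S \<and> square_integrable (\<lambda>x. \<Sum>y\<in>Y. g y x)"
    if "finite Y" "\<And>y. y \<in> Y \<Longrightarrow> square_integrable (g y) \<and> to_l2 (g y) \<in> S" for Y :: "complex set" and g
    using that by (induction Y) (auto simp: S0 to_l2_zero square_integrable_zero to_l2_add square_integrable_add S(2))
  have sf: "to_l2 f \<in> S" if "simple_function borel f" "square_integrable f" for f :: "'a \<Rightarrow> complex"
  proof -
    have fm [measurable]: "f \<in> borel_measurable borel" using that by (simp add: square_integrable_def)
    have fin: "finite (range f)" using that(1) by (simp add: simple_function_def)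
    have eq: "f = (\<lambda>x. \<Sum>y\<in>range f. y * indicator (f -` {y}) x)"
    proof
      fix x
      have "(\<Sum>y\<in>range f. y * indicator (f -` {y}) x) = (\<Sum>y\<in>{f x}. y * indicator (f -` {y}) x)"
        by (rule sum.mono_neutral_right[OF fin]) (auto simp: indicator_def)
      then show "f x = (\<Sum>y\<in>range f. y * indicator (f -` {y}) x)" by simp
    qed
    have "square_integrable (\<lambda>x. y * indicator (f -` {y}) x) \<and> to_l2 (\<lambda>x. y * indicator (f -` {y}) x) \<in> S" for y
    proof (cases "y = 0")
      case True then show ?thesis by (simp add: square_integrable_zero to_l2_zero S0)
    next
      case False
      have m: "f -` {y} \<in> sets borel" using measurable_sets[OF fm, of "{y}"] by simp
      have "ennreal ((cmod y)\<^sup>2) * emeasure lborel (f -` {y}) = (\<integral>\<^sup>+x. ennreal ((cmod y)\<^sup>2) * indicator (f -` {y}) x \<partial>lborel)"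
        using m by (simp add: nn_integral_cmult_indicator)
      also have "\<dots> \<le> (\<integral>\<^sup>+x. ennreal ((cmod (f x))\<^sup>2) \<partial>lborel)"
        by (rule nn_integral_mono) (auto simp: indicator_def)
      also have "\<dots> < \<infinity>" using that(2) by (simp add: square_integrable_iff_nn)
      finally have "emeasure lborel (f -` {y}) < \<infinity>"
        using False by (auto simp: ennreal_mult_less_top)
      then show ?thesis using sqi[OF m] bo[OF m] by blast
    qed
    then have "to_l2 (\<lambda>x. \<Sum>y\<in>range f. y * indicator (f -` {y}) x) \<in> S"
      by (intro conjunct1[OF fs[OF fin]]) blast
    then show ?thesis by (subst eq)
  qed
  obtain F where F: "\<And>i. simple_function borel (F i)" "\<And>x. (\<lambda>i. F i x) \<longlonglongrightarrow> fun_l2 v x"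
    "\<And>i x. cmod (F i x) \<le> 2 * cmod (fun_l2 v x)"
    using borel_measurable_implies_sequence_metric[OF fun_l2_measurable[of v], of 0] by auto
  have Fm: "F i \<in> borel_measurable borel" for i using F(1) by (rule borel_measurable_simple_function)
  have i2: "integrable lborel (\<lambda>x. (2 * cmod (fun_l2 v x))\<^sup>2)"
    using square_integrable_fun_l2[of v] by (simp add: power_mult_distrib square_integrable_def)
  have "(\<lambda>i. to_l2 (F i)) \<longlonglongrightarrow> to_l2 (fun_l2 v)"
    by (rule tendsto_to_l2_dominated(2)[OF Fm fun_l2_measurable _ _ i2]) (use F in auto)
  moreover have "to_l2 (F i) \<in> S" for i
    by (rule sf[OF F(1)], rule square_integrable_dominated[OF Fm _ i2]) (use F in auto)
  ultimately show ?thesis using closed_sequentially[OF S(1)] by (metis to_l2_fun_l2)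
qed

section \<open>Gaussian integrals\<close>

text \<open>After scaling by the square root of \<epsilon> this is the characteristic function of
  the standard normal distribution, evaluated at \<open>- t / s\<close>.\<close>

lemma gaussian_integral_real:
  assumes "0 < \<epsilon>"
  shows "integrable lborel (\<lambda>x. exp (- (\<i> * complex_of_real (t * x))) * complex_of_real (exp (- \<epsilon> * x\<^sup>2 / 2)))"
    and "(\<integral>x. exp (- (\<i> * complex_of_real (t * x))) * complex_of_real (exp (- \<epsilon> * x\<^sup>2 / 2)) \<partial>lborel)
      = complex_of_real (sqrt (2 * pi / \<epsilon>) * exp (- t\<^sup>2 / (2 * \<epsilon>)))"
proof -
  define s where "s = sqrt \<epsilon>"
  have s: "s > 0" "s\<^sup>2 = \<epsilon>" using assms by (auto simp: s_def)
  define g where "g x = exp (- (\<i> * complex_of_real (t / s * x))) * complex_of_real (exp (- x\<^sup>2 / 2))" for x :: real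
  have dens: "integrable lborel (\<lambda>x. std_normal_density x *\<^sub>R iexp (- t / s * x))"
    by (rule Bochner_Integration.integrable_bound[OF integrable_normal_density[of 1 0]]) (auto simp: norm_mult)
  have "(\<integral>x. std_normal_density x *\<^sub>R iexp (- t / s * x) \<partial>lborel) = char std_normal_distribution (- t / s)"
    unfolding char_def by (subst integral_density) (auto simp: normal_density_nonneg)
  also have "\<dots> = complex_of_real (exp (- (t / s)\<^sup>2 / 2))"
    by (simp add: char_std_normal_distribution)
  finally have I: "(\<integral>x. std_normal_density x *\<^sub>R iexp (- t / s * x) \<partial>lborel) = complex_of_real (exp (- (t / s)\<^sup>2 / 2))" .
  have geq: "g x = sqrt (2 * pi) *\<^sub>R (std_normal_density x *\<^sub>R iexp (- t / s * x))" for x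
    by (simp add: g_def std_normal_density_def scaleR_conv_of_real mult.commute real_sqrt_mult)
  have gi: "integrable lborel g" and gI: "(\<integral>x. g x \<partial>lborel) = complex_of_real (sqrt (2 * pi) * exp (- (t / s)\<^sup>2 / 2))"
    using dens I unfolding geq by (simp_all add: scaleR_conv_of_real)
  have eq: "exp (- (\<i> * complex_of_real (t * x))) * complex_of_real (exp (- \<epsilon> * x\<^sup>2 / 2)) = g (0 + s * x)" for x
    using s by (simp add: g_def power_mult_distrib)
  show "integrable lborel (\<lambda>x. exp (- (\<i> * complex_of_real (t * x))) * complex_of_real (exp (- \<epsilon> * x\<^sup>2 / 2)))"
    unfolding eq using lborel_integrable_real_affine[OF gi, of s 0] s by simp
  have "(\<integral>x. g x \<partial>lborel) = \<bar>s\<bar> *\<^sub>R (\<integral>x. g (0 + s * x) \<partial>lborel)"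
    by (rule lborel_integral_real_affine) (use s in simp)
  then have "(\<integral>x. g (0 + s * x) \<partial>lborel) = (1 / s) *\<^sub>R (\<integral>x. g x \<partial>lborel)"
    using s by simp
  also have "\<dots> = complex_of_real (sqrt (2 * pi / \<epsilon>) * exp (- t\<^sup>2 / (2 * \<epsilon>)))"
  proof -
    have a: "(t / s)\<^sup>2 / 2 = t\<^sup>2 / (2 * \<epsilon>)" using s by (simp add: power_divide)
    have b: "1 / s * sqrt (2 * pi) = sqrt (2 * pi / \<epsilon>)" by (simp add: s_def real_sqrt_divide)
    have "(1 / s) *\<^sub>R (\<integral>x. g x \<partial>lborel) = complex_of_real ((1 / s * sqrt (2 * pi)) * exp (- ((t / s)\<^sup>2 / 2)))"
      by (simp add: gI scaleR_conv_of_real)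
    then show ?thesis unfolding a b by simp
  qed
  finally show "(\<integral>x. exp (- (\<i> * complex_of_real (t * x))) * complex_of_real (exp (- \<epsilon> * x\<^sup>2 / 2)) \<partial>lborel)
      = complex_of_real (sqrt (2 * pi / \<epsilon>) * exp (- t\<^sup>2 / (2 * \<epsilon>)))" unfolding eq .
qed

text \<open>Lebesgue measure is the image of the product measure of the coordinates, so a product of
  functions of single coordinates integrates factor by factor.\<close>

lemma integral_prod_Basis:
  fixes f :: "'a::euclidean_space \<Rightarrow> real \<Rightarrow> complex"
  assumes "\<And>b. b \<in> Basis \<Longrightarrow> integrable lborel (f b)"
  shows "integrable lborel (\<lambda>x. \<Prod>b\<in>Basis. f b (x \<bullet> b))"
    and "(\<integral>x. (\<Prod>b\<in>Basis. f b (x \<bullet> b)) \<partial>lborel) = (\<Prod>b\<in>Basis. \<integral>x. f b x \<partial>lborel)"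
proof -
  interpret product_sigma_finite "\<lambda>_::'a. lborel :: real measure"
    by (simp add: product_sigma_finite_def sigma_finite_lborel)
  have [measurable]: "f b \<in> borel_measurable borel" if "b \<in> Basis" for b
    using assms[OF that] by auto
  have m: "(\<lambda>x. \<Prod>b\<in>Basis. f b (x \<bullet> b)) \<in> borel_measurable borel" by measurable
  have t: "(\<lambda>f::'a \<Rightarrow> real. \<Sum>b\<in>Basis. f b *\<^sub>R b) \<in> measurable (\<Pi>\<^sub>M b\<in>Basis. lborel) borel" by measurable
  have e: "(\<lambda>y. \<Prod>b\<in>Basis. f b ((\<Sum>b\<in>Basis. y b *\<^sub>R b) \<bullet> b)) = (\<lambda>y. \<Prod>b\<in>Basis. f b (y b))"
    by (intro ext prod.cong) (auto simp: inner_sum_left_Basis)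
  define N where "N = distr (\<Pi>\<^sub>M b\<in>(Basis :: 'a set). lborel :: real measure) borel (\<lambda>f. \<Sum>b\<in>Basis. f b *\<^sub>R b)"
  have LN: "(lborel :: 'a measure) = N" unfolding N_def by (rule lborel_eq)
  have "integrable N (\<lambda>x. \<Prod>b\<in>Basis. f b (x \<bullet> b))"
    unfolding N_def integrable_distr_eq[OF t m] e
    by (rule product_integrable_prod) (use assms in auto)
  then show "integrable lborel (\<lambda>x. \<Prod>b\<in>Basis. f b (x \<bullet> b))" by (simp only: LN)
  have "(\<integral>x. (\<Prod>b\<in>Basis. f b (x \<bullet> b)) \<partial>N) = (\<Prod>b\<in>Basis. \<integral>x. f b x \<partial>lborel)"
    unfolding N_def integral_distr[OF t m] e
    by (rule product_integral_prod) (use assms in auto)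
  then show "(\<integral>x. (\<Prod>b\<in>Basis. f b (x \<bullet> b)) \<partial>lborel) = (\<Prod>b\<in>Basis. \<integral>x. f b x \<partial>lborel)"
    by (simp only: LN)
qed

lemma gaussian_integral:
  fixes \<zeta> :: "'a::euclidean_space"
  assumes "0 < \<epsilon>"
  shows "integrable lborel (\<lambda>x. exp (- (\<i> * complex_of_real (\<zeta> \<bullet> x))) * complex_of_real (exp (- \<epsilon> * (norm x)\<^sup>2 / 2)))"
    and "(\<integral>x. exp (- (\<i> * complex_of_real (\<zeta> \<bullet> x))) * complex_of_real (exp (- \<epsilon> * (norm x)\<^sup>2 / 2)) \<partial>lborel)
      = complex_of_real (sqrt (2 * pi / \<epsilon>) ^ DIM('a) * exp (- (norm \<zeta>)\<^sup>2 / (2 * \<epsilon>)))"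
proof -
  define f where "f b x = exp (- (\<i> * complex_of_real ((\<zeta> \<bullet> b) * x))) * complex_of_real (exp (- \<epsilon> * x\<^sup>2 / 2))"
    for b :: 'a and x :: real
  have n2: "(norm x)\<^sup>2 = (\<Sum>b\<in>Basis. (x \<bullet> b)\<^sup>2)" for x :: 'a
    by (subst power2_norm_eq_inner, subst euclidean_inner) (simp add: power2_eq_square)
  have eq: "exp (- (\<i> * complex_of_real (\<zeta> \<bullet> x))) * complex_of_real (exp (- \<epsilon> * (norm x)\<^sup>2 / 2))
    = (\<Prod>b\<in>Basis. f b (x \<bullet> b))" for x
  proof -
    have "- (\<i> * complex_of_real (\<zeta> \<bullet> x)) = (\<Sum>b\<in>Basis. - (\<i> * complex_of_real ((\<zeta> \<bullet> b) * (x \<bullet> b))))"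
      by (subst euclidean_inner) (simp add: sum_distrib_left sum_negf)
    moreover have "- \<epsilon> * (norm x)\<^sup>2 / 2 = (\<Sum>b\<in>Basis. - \<epsilon> * (x \<bullet> b)\<^sup>2 / 2)"
      by (simp only: n2 sum_distrib_left sum_divide_distrib)
    ultimately show ?thesis
      by (simp add: f_def exp_sum prod.distrib)
  qed
  have fi: "integrable lborel (f b)" for b
    unfolding f_def by (rule gaussian_integral_real[OF assms])
  have fI: "(\<integral>x. f b x \<partial>lborel) = complex_of_real (sqrt (2 * pi / \<epsilon>) * exp (- (\<zeta> \<bullet> b)\<^sup>2 / (2 * \<epsilon>)))" for b
    unfolding f_def by (rule gaussian_integral_real[OF assms])
  show "integrable lborel (\<lambda>x. exp (- (\<i> * complex_of_real (\<zeta> \<bullet> x))) * complex_of_real (exp (- \<epsilon> * (norm x)\<^sup>2 / 2)))"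
    unfolding eq by (rule integral_prod_Basis) (rule fi)
  have "(\<integral>x. (\<Prod>b\<in>Basis. f b (x \<bullet> b)) \<partial>lborel)
      = complex_of_real (\<Prod>b\<in>Basis. sqrt (2 * pi / \<epsilon>) * exp (- (\<zeta> \<bullet> b)\<^sup>2 / (2 * \<epsilon>)))"
    by (subst integral_prod_Basis(2)[OF fi]) (simp add: fI)
  also have "(\<Prod>b\<in>Basis. sqrt (2 * pi / \<epsilon>) * exp (- (\<zeta> \<bullet> b)\<^sup>2 / (2 * \<epsilon>))) =
      sqrt (2 * pi / \<epsilon>) ^ DIM('a) * exp (- (norm \<zeta>)\<^sup>2 / (2 * \<epsilon>))"
  proof -
    have "(\<Prod>b\<in>Basis. exp (- (\<zeta> \<bullet> b)\<^sup>2 / (2 * \<epsilon>))) = exp (\<Sum>b\<in>Basis. - (\<zeta> \<bullet> b)\<^sup>2 / (2 * \<epsilon>))"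
      by (rule exp_sum[symmetric]) simp
    also have "(\<Sum>b\<in>Basis. - (\<zeta> \<bullet> b)\<^sup>2 / (2 * \<epsilon>)) = - (norm \<zeta>)\<^sup>2 / (2 * \<epsilon>)"
      by (simp only: n2 sum_negf[symmetric] sum_divide_distrib)
    finally show ?thesis by (simp add: prod.distrib)
  qed
  finally show "(\<integral>x. exp (- (\<i> * complex_of_real (\<zeta> \<bullet> x))) * complex_of_real (exp (- \<epsilon> * (norm x)\<^sup>2 / 2)) \<partial>lborel)
      = complex_of_real (sqrt (2 * pi / \<epsilon>) ^ DIM('a) * exp (- (norm \<zeta>)\<^sup>2 / (2 * \<epsilon>)))"
    unfolding eq .
qed

lemma integrable_gaussian:
  assumes "0 < \<epsilon>" shows "integrable lborel (\<lambda>x::'a::euclidean_space. exp (- \<epsilon> * (norm x)\<^sup>2 / 2))"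
proof -
  have "integrable lborel (\<lambda>x::'a. complex_of_real (exp (- \<epsilon> * (norm x)\<^sup>2 / 2)))"
    using gaussian_integral(1)[OF assms, of "0 :: 'a"] by simp
  then show ?thesis by (simp only: complex_of_real_integrable_eq)
qed

section \<open>Integrals against a bounded kernel\<close>

lemma integrable_kernel:
  fixes f g :: "'a::euclidean_space \<Rightarrow> complex" and k :: "'a \<Rightarrow> 'a \<Rightarrow> complex"
  assumes f: "integrable lborel f" and g: "integrable lborel g"
    and k: "(\<lambda>(x, y). k x y) \<in> borel_measurable (borel \<Otimes>\<^sub>M borel)" and b: "\<And>x y. cmod (k x y) \<le> B"
  shows "integrable (lborel \<Otimes>\<^sub>M lborel) (\<lambda>(x, y). k x y * f x * g y)"
proof -
  have [measurable]: "f \<in> borel_measurable borel" "g \<in> borel_measurable borel" using f g by auto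
  have [measurable]: "(\<lambda>p. k (fst p) (snd p)) \<in> borel_measurable (borel \<Otimes>\<^sub>M borel)" using k by (simp add: case_prod_beta')
  have meas: "(\<lambda>p. f (fst p) * g (snd p)) \<in> borel_measurable (lborel \<Otimes>\<^sub>M lborel)" by measurable
  have fg: "integrable (lborel \<Otimes>\<^sub>M lborel) (\<lambda>p. f (fst p) * g (snd p))"
  proof (rule lborel_pair.Fubini_integrable[OF meas])
    have "(\<lambda>x. \<integral>y. norm (f (fst (x, y)) * g (snd (x, y))) \<partial>lborel) = (\<lambda>x. norm (f x) * (\<integral>y. norm (g y) \<partial>lborel))"
      by (simp add: norm_mult)
    then show "integrable lborel (\<lambda>x. \<integral>y. norm (f (fst (x, y)) * g (snd (x, y))) \<partial>lborel)"
      using f by (simp add: integrable_norm)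
    show "AE x in lborel. integrable lborel (\<lambda>y. f (fst (x, y)) * g (snd (x, y)))"
      using g by simp
  qed
  have "integrable (lborel \<Otimes>\<^sub>M lborel) (\<lambda>p. k (fst p) (snd p) * f (fst p) * g (snd p))"
  proof (rule Bochner_Integration.integrable_bound)
    show "integrable (lborel \<Otimes>\<^sub>M lborel) (\<lambda>p. B *\<^sub>R (f (fst p) * g (snd p)))" using fg by simp
    have B: "0 \<le> B" using b[of undefined undefined] norm_ge_zero order_trans by blast
    have "norm (k (fst p) (snd p) * f (fst p) * g (snd p)) \<le> norm (B *\<^sub>R (f (fst p) * g (snd p)))" for p
      using mult_right_mono[OF b[of "fst p" "snd p"], of "cmod (f (fst p)) * cmod (g (snd p))"] B
      by (simp add: norm_mult mult.assoc)
    then show "AE p in lborel \<Otimes>\<^sub>M lborel. norm (k (fst p) (snd p) * f (fst p) * g (snd p)) \<le> norm (B *\<^sub>R (f (fst p) * g (snd p)))"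
      by simp
  qed measurable
  then show ?thesis by (simp add: case_prod_beta')
qed

text \<open>One exchange of integrals for three uses: the exponential in the multiplication formula
  and in the regularized pairing, and the heat kernel in the proof of Plancherel's theorem.\<close>

lemma fubini_kernel:
  fixes f g :: "'a::euclidean_space \<Rightarrow> complex" and k :: "'a \<Rightarrow> 'a \<Rightarrow> complex"
  assumes f: "integrable lborel f" and g: "integrable lborel g"
    and k: "(\<lambda>(x, y). k x y) \<in> borel_measurable (borel \<Otimes>\<^sub>M borel)" and b: "\<And>x y. cmod (k x y) \<le> B"
  shows "(\<integral>y. (\<integral>x. k x y * f x \<partial>lborel) * g y \<partial>lborel) = (\<integral>x. f x * (\<integral>y. k x y * g y \<partial>lborel) \<partial>lborel)"
proof -
  have "(\<integral>y. (\<integral>x. k x y * f x * g y \<partial>lborel) \<partial>lborel) = (\<integral>x. (\<integral>y. k x y * f x * g y \<partial>lborel) \<partial>lborel)"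
    by (rule lborel_pair.Fubini_integral[OF integrable_kernel[OF assms]])
  also have "(\<lambda>x. \<integral>y. k x y * f x * g y \<partial>lborel) = (\<lambda>x. f x * (\<integral>y. k x y * g y \<partial>lborel))"
  proof
    fix x
    have "(\<integral>y. k x y * f x * g y \<partial>lborel) = (\<integral>y. f x * (k x y * g y) \<partial>lborel)"
      by (rule Bochner_Integration.integral_cong) auto
    then show "(\<integral>y. k x y * f x * g y \<partial>lborel) = f x * (\<integral>y. k x y * g y \<partial>lborel)" by simp
  qed
  finally show ?thesis by simp
qed

abbreviation fconst :: "'n::finite itself \<Rightarrow> real" where
  "fconst _ \<equiv> (2 * pi) powr (- real CARD('n) / 2)"

lemma fourier_integral_measurable [measurable]:
  assumes [measurable]: "f \<in> borel_measurable borel"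
  shows "fourier_integral f \<in> borel_measurable borel"
proof -
  have "(\<lambda>\<zeta>. \<integral>x. exp (- \<i> * complex_of_real (\<zeta> \<bullet> x)) * f x \<partial>lborel) \<in> borel_measurable borel"
    by (rule lborel.borel_measurable_lebesgue_integral) measurable
  then show ?thesis unfolding fourier_integral_def[abs_def] by measurable
qed

section \<open>The Fourier integral\<close>

lemma cmod_expi [simp]: "cmod (exp (- (\<i> * complex_of_real r))) = 1" "cmod (exp (\<i> * complex_of_real r)) = 1"
  by (simp_all add: norm_exp_eq_Re)

lemma integrable_phase:
  fixes f :: "'a::euclidean_space \<Rightarrow> complex"
  assumes "integrable lborel f"
  shows "integrable lborel (\<lambda>x. exp (- (\<i> * complex_of_real (\<zeta> \<bullet> x))) * f x)"
    "integrable lborel (\<lambda>x. exp (\<i> * complex_of_real (\<zeta> \<bullet> x)) * f x)"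
proof -
  have [measurable]: "f \<in> borel_measurable borel" using assms by auto
  show "integrable lborel (\<lambda>x. exp (- (\<i> * complex_of_real (\<zeta> \<bullet> x))) * f x)"
    by (rule Bochner_Integration.integrable_bound[OF assms]) (auto simp: norm_mult)
  show "integrable lborel (\<lambda>x. exp (\<i> * complex_of_real (\<zeta> \<bullet> x)) * f x)"
    by (rule Bochner_Integration.integrable_bound[OF assms]) (auto simp: norm_mult)
qed

lemma fourier_integral_add:
  assumes "integrable lborel f" "integrable lborel g"
  shows "fourier_integral (\<lambda>x. f x + g x) \<zeta> = fourier_integral f \<zeta> + fourier_integral g \<zeta>"
  using integrable_phase(1)[OF assms(1), of \<zeta>] integrable_phase(1)[OF assms(2), of \<zeta>]
  by (simp add: fourier_integral_def distrib_left)

lemma fourier_integral_cmult: "fourier_integral (\<lambda>x. c * f x) \<zeta> = c * fourier_integral f \<zeta>"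
proof -
  have "(\<lambda>x. exp (- \<i> * complex_of_real (\<zeta> \<bullet> x)) * (c * f x)) = (\<lambda>x. c * (exp (- \<i> * complex_of_real (\<zeta> \<bullet> x)) * f x))"
    by (auto simp: algebra_simps)
  then show ?thesis by (simp add: fourier_integral_def)
qed

lemma fourier_integral_diff:
  assumes "integrable lborel f" "integrable lborel g"
  shows "fourier_integral (\<lambda>x. f x - g x) \<zeta> = fourier_integral f \<zeta> - fourier_integral g \<zeta>"
  using fourier_integral_add[OF assms(1), of "\<lambda>x. -1 * g x" \<zeta>] fourier_integral_cmult[of "-1" g \<zeta>] assms(2)
  by simp

lemma fourier_integral_bound:
  fixes f :: "real^'n::finite \<Rightarrow> complex"
  shows "cmod (fourier_integral f \<zeta>) \<le> fconst TYPE('n) * (\<integral>x. cmod (f x) \<partial>lborel)"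
proof -
  have "cmod (\<integral>x. exp (- \<i> * complex_of_real (\<zeta> \<bullet> x)) * f x \<partial>lborel) \<le> (\<integral>x. cmod (exp (- \<i> * complex_of_real (\<zeta> \<bullet> x)) * f x) \<partial>lborel)"
    by (rule integral_norm_bound)
  then show ?thesis by (simp add: fourier_integral_def norm_mult mult_left_mono)
qed

lemma fourier_integral_mult_formula:
  fixes f g :: "real^'n::finite \<Rightarrow> complex"
  assumes "integrable lborel f" "integrable lborel g"
  shows "(\<integral>x. fourier_integral f x * g x \<partial>lborel) = (\<integral>x. f x * fourier_integral g x \<partial>lborel)"
proof -
  let ?k = "\<lambda>x y :: real^'n. complex_of_real (fconst TYPE('n)) * exp (- \<i> * complex_of_real (x \<bullet> y))"
  have m: "(\<lambda>(x, y). ?k x y) \<in> borel_measurable (borel \<Otimes>\<^sub>M borel)" by measurable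
  have "(\<integral>y. (\<integral>x. ?k x y * f x \<partial>lborel) * g y \<partial>lborel) = (\<integral>x. f x * (\<integral>y. ?k x y * g y \<partial>lborel) \<partial>lborel)"
    by (rule fubini_kernel[OF assms m, where B = "fconst TYPE('n)"]) (simp add: norm_mult)
  moreover have "(\<integral>x. ?k x y * f x \<partial>lborel) = fourier_integral f y" for y
    by (simp add: fourier_integral_def mult.assoc inner_commute)
  moreover have "(\<integral>y. ?k x y * g y \<partial>lborel) = fourier_integral g x" for x
    by (simp add: fourier_integral_def mult.assoc)
  ultimately show ?thesis by simp
qed

text \<open>The Gaussian density of variance \<epsilon> in each coordinate, with the constants left
  in the form in which the Fourier integral of a Gaussian produces them.\<close>

definition heat_kernel :: "real \<Rightarrow> real^'n::finite \<Rightarrow> real" where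
  "heat_kernel \<epsilon> z = (fconst TYPE('n))\<^sup>2 * (sqrt (2 * pi / \<epsilon>) ^ CARD('n) * exp (- (norm z)\<^sup>2 / (2 * \<epsilon>)))"

lemma heat_kernel_nonneg: "0 < \<epsilon> \<Longrightarrow> 0 \<le> heat_kernel \<epsilon> z"
  by (simp add: heat_kernel_def)

lemma heat_kernel_measurable [measurable]: "heat_kernel \<epsilon> \<in> borel_measurable borel"
  unfolding heat_kernel_def[abs_def] by measurable

lemma heat_kernel_integral:
  assumes "0 < \<epsilon>"
  shows "integrable lborel (heat_kernel \<epsilon> :: real^'n::finite \<Rightarrow> real)"
    "(\<integral>z. heat_kernel \<epsilon> (z :: (real, 'n::finite) vec) \<partial>lborel) = 1"
proof -
  have e: "1 / \<epsilon> > 0" using assms by simp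
  have eq: "heat_kernel \<epsilon> z = (fconst TYPE('n))\<^sup>2 * sqrt (2 * pi / \<epsilon>) ^ CARD('n) * exp (- (1 / \<epsilon>) * (norm z)\<^sup>2 / 2)" for z :: "real^'n"
    by (simp add: heat_kernel_def)
  show "integrable lborel (heat_kernel \<epsilon> :: real^'n \<Rightarrow> real)"
    unfolding eq[abs_def] by (intro integrable_mult_right integrable_gaussian e)
  have "complex_of_real (\<integral>z. exp (- (1 / \<epsilon>) * (norm (z :: real^'n))\<^sup>2 / 2) \<partial>lborel)
      = (\<integral>z. complex_of_real (exp (- (1 / \<epsilon>) * (norm (z :: real^'n))\<^sup>2 / 2)) \<partial>lborel)"
    by (rule integral_complex_of_real[symmetric])
  also have "\<dots> = complex_of_real (sqrt (2 * pi / (1 / \<epsilon>)) ^ CARD('n))"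
    using gaussian_integral(2)[OF e, of "0 :: real^'n"] by simp
  finally have I: "(\<integral>z. exp (- (1 / \<epsilon>) * (norm (z :: real^'n))\<^sup>2 / 2) \<partial>lborel) = sqrt (2 * pi * \<epsilon>) ^ CARD('n)"
    by (simp only: of_real_eq_iff) simp
  have "(fconst TYPE('n))\<^sup>2 = (2 * pi) powr (- real CARD('n))"
    by (simp add: power2_eq_square flip: powr_add)
  also have "\<dots> = inverse ((2 * pi) ^ CARD('n))"
    by (simp add: powr_minus powr_realpow)
  finally have c: "(fconst TYPE('n))\<^sup>2 = inverse ((2 * pi) ^ CARD('n))" .
  have s: "sqrt (2 * pi / \<epsilon>) * sqrt (2 * pi * \<epsilon>) = 2 * pi"
  proof -
    have "2 * pi / \<epsilon> * (2 * pi * \<epsilon>) = (2 * pi)\<^sup>2" using assms by (simp add: power2_eq_square)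
    then show ?thesis by (metis real_sqrt_mult real_sqrt_abs abs_of_pos zero_less_mult_iff zero_less_numeral pi_gt_zero)
  qed
  have "(\<integral>z. heat_kernel \<epsilon> (z :: real^'n) \<partial>lborel) = inverse ((2 * pi) ^ CARD('n)) * (sqrt (2 * pi / \<epsilon>) * sqrt (2 * pi * \<epsilon>)) ^ CARD('n)"
    unfolding eq integral_mult_right_zero I c power_mult_distrib by (simp only: mult.assoc)
  also have "\<dots> = 1" unfolding s by (rule left_inverse) simp
  finally show "(\<integral>z. heat_kernel \<epsilon> (z :: real^'n) \<partial>lborel) = 1" .
qed

lemma fourier_integral_gaussian:
  assumes "0 < \<epsilon>"
  shows "complex_of_real (fconst TYPE('n)) * fourier_integral (\<lambda>\<zeta>. exp (\<i> * complex_of_real (y \<bullet> \<zeta>)) * complex_of_real (exp (- \<epsilon> * (norm \<zeta>)\<^sup>2 / 2))) x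
    = complex_of_real (heat_kernel \<epsilon> (x - y :: (real, 'n::finite) vec))"
proof -
  have "(\<lambda>\<zeta>. exp (- \<i> * complex_of_real (x \<bullet> \<zeta>)) * (exp (\<i> * complex_of_real (y \<bullet> \<zeta>)) * complex_of_real (exp (- \<epsilon> * (norm \<zeta>)\<^sup>2 / 2))))
    = (\<lambda>\<zeta>. exp (- (\<i> * complex_of_real ((x - y) \<bullet> \<zeta>))) * complex_of_real (exp (- \<epsilon> * (norm \<zeta>)\<^sup>2 / 2)))"
    by (auto simp: inner_diff_left algebra_simps exp_diff exp_minus divide_simps simp flip: exp_add)
  then show ?thesis
    using gaussian_integral(2)[OF assms, of "x - y"]
    by (simp add: fourier_integral_def heat_kernel_def power2_eq_square)
qed

text \<open>The transform of an integrable function need not be integrable, so Fubini's theorem does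
  not apply to the plain pairing; the Gaussian factor repairs this. Two exchanges of integrals carry
  the factor to physical space, where it becomes smoothing by the heat kernel.\<close>

lemma fourier_regularized:
  fixes f k :: "real^'n::finite \<Rightarrow> complex"
  assumes e: "0 < \<epsilon>" and f: "integrable lborel f" and k: "integrable lborel k"
  shows "(\<integral>\<zeta>. fourier_integral f \<zeta> * cnj (fourier_integral k \<zeta>) * complex_of_real (exp (- \<epsilon> * (norm \<zeta>)\<^sup>2 / 2)) \<partial>lborel)
    = (\<integral>y. (\<integral>x. complex_of_real (heat_kernel \<epsilon> (x - y)) * f x \<partial>lborel) * cnj (k y) \<partial>lborel)"
proof -
  have [measurable]: "f \<in> borel_measurable borel" "k \<in> borel_measurable borel" using f k by auto
  let ?c = "complex_of_real (fconst TYPE('n))"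
  let ?g = "\<lambda>\<zeta>::real^'n. complex_of_real (exp (- \<epsilon> * (norm \<zeta>)\<^sup>2 / 2))"
  have gi: "integrable lborel ?g" using integrable_gaussian[OF e, where 'a = "real^'n"] by simp
  define h where "h \<zeta> = fourier_integral f \<zeta> * ?g \<zeta>" for \<zeta>
  have hi: "integrable lborel h"
  proof (rule Bochner_Integration.integrable_bound)
    show "integrable lborel (\<lambda>\<zeta>. (fconst TYPE('n) * (\<integral>x. cmod (f x) \<partial>lborel)) *\<^sub>R ?g \<zeta>)" using gi by simp
    have "cmod (h \<zeta>) \<le> norm ((fconst TYPE('n) * (\<integral>x. cmod (f x) \<partial>lborel)) *\<^sub>R ?g \<zeta>)" for \<zeta>
      using mult_right_mono[OF fourier_integral_bound[of f \<zeta>], of "cmod (?g \<zeta>)"]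
      by (simp add: h_def norm_mult abs_of_nonneg)
    then show "AE \<zeta> in lborel. norm (h \<zeta>) \<le> norm ((fconst TYPE('n) * (\<integral>x. cmod (f x) \<partial>lborel)) *\<^sub>R ?g \<zeta>)" by simp
  qed (simp add: h_def[abs_def])
  have ki: "integrable lborel (\<lambda>y. cnj (k y))" using k by simp
  let ?k = "\<lambda>x y :: real^'n. ?c * exp (\<i> * complex_of_real (x \<bullet> y))"
  have m: "(\<lambda>(x, y). ?k x y) \<in> borel_measurable (borel \<Otimes>\<^sub>M borel)" by measurable
  have "(\<integral>y. (\<integral>x. ?k x y * h x \<partial>lborel) * cnj (k y) \<partial>lborel) = (\<integral>x. h x * (\<integral>y. ?k x y * cnj (k y) \<partial>lborel) \<partial>lborel)"
    by (rule fubini_kernel[OF hi ki m, where B = "fconst TYPE('n)"]) (simp add: norm_mult)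
  moreover have "(\<integral>y. ?k x y * cnj (k y) \<partial>lborel) = cnj (fourier_integral k x)" for x
  proof -
    have "(\<integral>y. ?k x y * cnj (k y) \<partial>lborel) = ?c * (\<integral>y. cnj (exp (- \<i> * complex_of_real (x \<bullet> y)) * k y) \<partial>lborel)"
      by (simp add: mult.assoc exp_cnj)
    also have "\<dots> = ?c * cnj (\<integral>y. exp (- \<i> * complex_of_real (x \<bullet> y)) * k y \<partial>lborel)"
      by (simp del: complex_cnj_mult)
    finally show ?thesis by (simp add: fourier_integral_def)
  qed
  moreover have "(\<integral>x. ?k x y * h x \<partial>lborel) = (\<integral>x. complex_of_real (heat_kernel \<epsilon> (x - y)) * f x \<partial>lborel)" for y
  proof -
    have "(\<integral>x. ?k x y * h x \<partial>lborel) = ?c * (\<integral>x. fourier_integral f x * (exp (\<i> * complex_of_real (y \<bullet> x)) * ?g x) \<partial>lborel)"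
      by (subst integral_mult_right_zero[symmetric], rule Bochner_Integration.integral_cong)
        (simp_all add: h_def mult_ac inner_commute)
    also have "\<dots> = ?c * (\<integral>x. f x * fourier_integral (\<lambda>\<zeta>. exp (\<i> * complex_of_real (y \<bullet> \<zeta>)) * ?g \<zeta>) x \<partial>lborel)"
      by (subst fourier_integral_mult_formula[OF f integrable_phase(2)[OF gi]]) simp
    also have "\<dots> = (\<integral>x. (?c * fourier_integral (\<lambda>\<zeta>. exp (\<i> * complex_of_real (y \<bullet> \<zeta>)) * ?g \<zeta>) x) * f x \<partial>lborel)"
      by (subst integral_mult_right_zero[symmetric]) (simp only: mult_ac)
    finally show ?thesis unfolding fourier_integral_gaussian[OF e] .
  qed
  ultimately show ?thesis by (simp add: h_def mult_ac)
qed

lemma nn_integral_heat_kernel: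
  assumes "0 < \<epsilon>"
  shows "(\<integral>\<^sup>+y. ennreal (heat_kernel \<epsilon> (x - y :: (real, 'n::finite) vec)) \<partial>lborel) = 1"
    "(\<integral>\<^sup>+x. ennreal (heat_kernel \<epsilon> (x - y :: (real, 'n::finite) vec)) \<partial>lborel) = 1"
proof -
  have e: "heat_kernel \<epsilon> (- z) = heat_kernel \<epsilon> z" for z :: "real^'n" by (simp add: heat_kernel_def)
  have N: "(\<integral>\<^sup>+z. ennreal (heat_kernel \<epsilon> (z :: real^'n)) \<partial>lborel) = 1"
    using nn_integral_eq_integral[OF heat_kernel_integral(1)[OF assms, where 'n = 'n]]
    by (simp add: heat_kernel_integral(2)[OF assms] heat_kernel_nonneg[OF assms])
  have T: "(\<integral>\<^sup>+x. ennreal (heat_kernel \<epsilon> (x + y :: real^'n)) \<partial>lborel) = 1" for y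
  proof -
    have "(\<integral>\<^sup>+x. ennreal (heat_kernel \<epsilon> (x :: real^'n)) \<partial>distr lborel borel (\<lambda>x. x + y)) =
       (\<integral>\<^sup>+x. ennreal (heat_kernel \<epsilon> (x + y)) \<partial>lborel)"
      by (rule nn_integral_distr) auto
    moreover have "distr lborel borel (\<lambda>x. x + y) = lborel" using mpres_translate[of y] by (simp add: mpres_def)
    ultimately show ?thesis using N by simp
  qed
  show "(\<integral>\<^sup>+x. ennreal (heat_kernel \<epsilon> (x - y :: real^'n)) \<partial>lborel) = 1" using T[of "- y"] by simp
  have "heat_kernel \<epsilon> (x - y) = heat_kernel \<epsilon> (y + (- x))" for y using e[of "x - y"] by simp
  then show "(\<integral>\<^sup>+y. ennreal (heat_kernel \<epsilon> (x - y :: real^'n)) \<partial>lborel) = 1" using T[of "- x"] by simp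
qed

lemma norm_integral_le_nn_integral:
  fixes f :: "'a \<Rightarrow> 'b::{banach, second_countable_topology}"
  shows "ennreal (norm (integral\<^sup>L M f)) \<le> (\<integral>\<^sup>+x. ennreal (norm (f x)) \<partial>M)"
proof (cases "integrable M f")
  case True
  then show ?thesis by (rule integral_norm_bound_ennreal)
next
  case False
  then show ?thesis by (simp add: not_integrable_integral_eq)
qed

lemma ennreal_add_self_half: "((a::ennreal) + a) / 2 = a"
proof (cases a)
  case (real r)
  then have "(a + a) / 2 = ennreal (r + r) / ennreal 2" by (simp only: ennreal_plus ennreal_numeral)
  also have "\<dots> = ennreal ((r + r) / 2)" using real by (intro divide_ennreal) auto
  finally show ?thesis using real by simp
next
  case top
  then show ?thesis by (simp add: ennreal_top_divide)
qed

text \<open>The regularized identity for \<open>k = f\<close> bounds the damped norm by a double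
  integral against the heat kernel; Fatou's lemma removes the damping. The inequality suffices to
  extend the transform to L2, and equality follows later by polarization and density.\<close>

lemma fourier_integral_contraction:
  fixes f :: "real^'n::finite \<Rightarrow> complex"
  assumes "L12 f"
  shows "(\<integral>\<^sup>+\<zeta>. ennreal ((cmod (fourier_integral f \<zeta>))\<^sup>2) \<partial>lborel) \<le> (\<integral>\<^sup>+x. ennreal ((cmod (f x))\<^sup>2) \<partial>lborel)"
proof -
  have f: "integrable lborel f" and s: "square_integrable f" using assms by (auto simp: L12_def)
  have [measurable]: "f \<in> borel_measurable borel" using f by auto
  let ?F = "\<integral>\<^sup>+x. ennreal ((cmod (f x))\<^sup>2) \<partial>lborel"
  have reg: "(\<integral>\<^sup>+\<zeta>. ennreal ((cmod (fourier_integral f \<zeta>))\<^sup>2 * exp (- \<epsilon> * (norm \<zeta>)\<^sup>2 / 2)) \<partial>lborel) \<le> ?F" if e: "0 < \<epsilon>" for \<epsilon>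
  proof -
    let ?h = "\<lambda>\<zeta>. (cmod (fourier_integral f \<zeta>))\<^sup>2 * exp (- \<epsilon> * (norm \<zeta>)\<^sup>2 / 2)"
    define B where "B = (fconst TYPE('n) * (\<integral>x. cmod (f x) \<partial>lborel))\<^sup>2"
    have hi: "integrable lborel ?h"
    proof (rule Bochner_Integration.integrable_bound)
      show "integrable lborel (\<lambda>\<zeta>::real^'n. B * exp (- \<epsilon> * (norm \<zeta>)\<^sup>2 / 2))" using integrable_gaussian[OF e, where 'a = "real^'n"] by simp
      have "(cmod (fourier_integral f \<zeta>))\<^sup>2 \<le> B" for \<zeta>
        unfolding B_def by (rule power_mono[OF fourier_integral_bound]) simp
      then show "AE \<zeta> in lborel. norm (?h \<zeta>) \<le> norm (B * exp (- \<epsilon> * (norm \<zeta>)\<^sup>2 / 2))"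
        by (simp add: B_def abs_mult mult_right_mono)
    qed simp
    have "complex_of_real (\<integral>\<zeta>. ?h \<zeta> \<partial>lborel) = (\<integral>\<zeta>. fourier_integral f \<zeta> * cnj (fourier_integral f \<zeta>) * complex_of_real (exp (- \<epsilon> * (norm \<zeta>)\<^sup>2 / 2)) \<partial>lborel)"
      by (simp only: complex_norm_square[symmetric] of_real_mult[symmetric] integral_complex_of_real)
    also have "\<dots> = (\<integral>y. (\<integral>x. complex_of_real (heat_kernel \<epsilon> (x - y)) * f x \<partial>lborel) * cnj (f y) \<partial>lborel)"
      by (rule fourier_regularized[OF e f f])
    finally have E: "complex_of_real (\<integral>\<zeta>. ?h \<zeta> \<partial>lborel) = (\<integral>y. (\<integral>x. complex_of_real (heat_kernel \<epsilon> (x - y)) * f x \<partial>lborel) * cnj (f y) \<partial>lborel)" .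
    have "ennreal (\<integral>\<zeta>. ?h \<zeta> \<partial>lborel) \<le> ennreal (cmod (\<integral>y. (\<integral>x. complex_of_real (heat_kernel \<epsilon> (x - y)) * f x \<partial>lborel) * cnj (f y) \<partial>lborel))"
      unfolding E[symmetric] norm_of_real by (rule ennreal_leI) (rule abs_ge_self)
    also have "\<dots> \<le> (\<integral>\<^sup>+y. ennreal (cmod ((\<integral>x. complex_of_real (heat_kernel \<epsilon> (x - y)) * f x \<partial>lborel) * cnj (f y))) \<partial>lborel)"
      by (rule norm_integral_le_nn_integral)
    also have "\<dots> \<le> (\<integral>\<^sup>+y. (\<integral>\<^sup>+x. ennreal (heat_kernel \<epsilon> (x - y) * cmod (f x)) \<partial>lborel) * ennreal (cmod (f y)) \<partial>lborel)"
    proof (rule nn_integral_mono)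
      fix y :: "real^'n"
      have "ennreal (cmod (\<integral>x. complex_of_real (heat_kernel \<epsilon> (x - y)) * f x \<partial>lborel)) \<le> (\<integral>\<^sup>+x. ennreal (cmod (complex_of_real (heat_kernel \<epsilon> (x - y)) * f x)) \<partial>lborel)"
        by (rule norm_integral_le_nn_integral)
      also have "\<dots> = (\<integral>\<^sup>+x. ennreal (heat_kernel \<epsilon> (x - y) * cmod (f x)) \<partial>lborel)"
        by (rule nn_integral_cong) (simp add: norm_mult heat_kernel_nonneg[OF e])
      finally show "ennreal (cmod ((\<integral>x. complex_of_real (heat_kernel \<epsilon> (x - y)) * f x \<partial>lborel) * cnj (f y))) \<le> (\<integral>\<^sup>+x. ennreal (heat_kernel \<epsilon> (x - y) * cmod (f x)) \<partial>lborel) * ennreal (cmod (f y))"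
        unfolding norm_mult complex_mod_cnj by (subst ennreal_mult) (auto intro: mult_right_mono)
    qed
    also have "\<dots> = (\<integral>\<^sup>+y. (\<integral>\<^sup>+x. ennreal (heat_kernel \<epsilon> (x - y) * cmod (f x)) * ennreal (cmod (f y)) \<partial>lborel) \<partial>lborel)"
      by (rule nn_integral_cong, rule nn_integral_multc[symmetric]) measurable
    \<comment> \<open>As in Schur's test: the product is split into two squares, and each half sees
      a kernel of total mass 1 in the variable that it does not contain.\<close>
    also have "\<dots> \<le> (\<integral>\<^sup>+y. (\<integral>\<^sup>+x. (ennreal (heat_kernel \<epsilon> (x - y)) * ennreal ((cmod (f x))\<^sup>2) + ennreal (heat_kernel \<epsilon> (x - y)) * ennreal ((cmod (f y))\<^sup>2)) / 2 \<partial>lborel) \<partial>lborel)"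
    proof (intro nn_integral_mono)
      fix x y :: "real^'n"
      let ?k = "heat_kernel \<epsilon> (x - y)"
      have k0: "0 \<le> ?k" by (rule heat_kernel_nonneg[OF e])
      have "cmod (f x) * cmod (f y) \<le> ((cmod (f x))\<^sup>2 + (cmod (f y))\<^sup>2) / 2"
        using sum_squares_bound[of "cmod (f x)" "cmod (f y)"] by simp
      from mult_left_mono[OF this k0]
      have "?k * cmod (f x) * cmod (f y) \<le> (?k * (cmod (f x))\<^sup>2 + ?k * (cmod (f y))\<^sup>2) / 2"
        by (simp add: algebra_simps)
      then have "ennreal (?k * cmod (f x) * cmod (f y)) \<le> ennreal ((?k * (cmod (f x))\<^sup>2 + ?k * (cmod (f y))\<^sup>2) / 2)"
        by (rule ennreal_leI)
      also have "\<dots> = (ennreal ?k * ennreal ((cmod (f x))\<^sup>2) + ennreal ?k * ennreal ((cmod (f y))\<^sup>2)) / 2"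
        using k0 by (subst divide_ennreal[symmetric]) (simp_all only: ennreal_mult ennreal_plus
            ennreal_numeral zero_le_power2 mult_nonneg_nonneg add_nonneg_nonneg zero_less_numeral)
      finally show "ennreal (?k * cmod (f x)) * ennreal (cmod (f y)) \<le> (ennreal ?k * ennreal ((cmod (f x))\<^sup>2) + ennreal ?k * ennreal ((cmod (f y))\<^sup>2)) / 2"
        using k0 by (simp add: ennreal_mult)
    qed
    also have "\<dots> = ((\<integral>\<^sup>+y. (\<integral>\<^sup>+x. ennreal (heat_kernel \<epsilon> (x - y)) * ennreal ((cmod (f x))\<^sup>2) \<partial>lborel) \<partial>lborel) +
        (\<integral>\<^sup>+y. (\<integral>\<^sup>+x. ennreal (heat_kernel \<epsilon> (x - y)) * ennreal ((cmod (f y))\<^sup>2) \<partial>lborel) \<partial>lborel)) / 2"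
      by (simp add: nn_integral_divide nn_integral_add)
    also have "(\<integral>\<^sup>+y. (\<integral>\<^sup>+x. ennreal (heat_kernel \<epsilon> (x - y)) * ennreal ((cmod (f y))\<^sup>2) \<partial>lborel) \<partial>lborel) = ?F"
      by (simp add: nn_integral_multc nn_integral_heat_kernel[OF e])
    also have "(\<integral>\<^sup>+y. (\<integral>\<^sup>+x. ennreal (heat_kernel \<epsilon> (x - y)) * ennreal ((cmod (f x))\<^sup>2) \<partial>lborel) \<partial>lborel) = ?F"
      by (subst lborel_pair.Fubini') (simp_all add: nn_integral_multc nn_integral_heat_kernel[OF e])
    also have "(?F + ?F) / 2 = ?F"
      by (rule ennreal_add_self_half)
    finally show ?thesis using hi by (subst nn_integral_eq_integral) auto
  qed
  have "(\<integral>\<^sup>+\<zeta>. ennreal ((cmod (fourier_integral f \<zeta>))\<^sup>2) \<partial>lborel) =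
     (\<integral>\<^sup>+\<zeta>. liminf (\<lambda>j. ennreal ((cmod (fourier_integral f \<zeta>))\<^sup>2 * exp (- inverse (real (Suc j)) * (norm \<zeta>)\<^sup>2 / 2))) \<partial>lborel)"
  proof (rule nn_integral_cong)
    fix \<zeta> :: "real^'n"
    have "(\<lambda>j. ennreal ((cmod (fourier_integral f \<zeta>))\<^sup>2 * exp (- inverse (real (Suc j)) * (norm \<zeta>)\<^sup>2 / 2))) \<longlonglongrightarrow> ennreal ((cmod (fourier_integral f \<zeta>))\<^sup>2 * exp (- 0 * (norm \<zeta>)\<^sup>2 / 2))"
      by (intro tendsto_intros LIMSEQ_inverse_real_of_nat) simp
    from lim_imp_Liminf[OF sequentially_bot this]
    show "ennreal ((cmod (fourier_integral f \<zeta>))\<^sup>2) = liminf (\<lambda>j. ennreal ((cmod (fourier_integral f \<zeta>))\<^sup>2 * exp (- inverse (real (Suc j)) * (norm \<zeta>)\<^sup>2 / 2)))"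
      by simp
  qed
  also have "\<dots> \<le> liminf (\<lambda>j. \<integral>\<^sup>+\<zeta>. ennreal ((cmod (fourier_integral f \<zeta>))\<^sup>2 * exp (- inverse (real (Suc j)) * (norm \<zeta>)\<^sup>2 / 2)) \<partial>lborel)"
    by (rule nn_integral_liminf) measurable
  also have "\<dots> \<le> liminf (\<lambda>j::nat. ?F)"
    by (intro Liminf_mono always_eventually allI reg) simp
  finally show ?thesis by (simp add: Liminf_const)
qed

lemma inner_complex_Re: "z \<bullet> w = Re (z * cnj w)"
  by (simp add: inner_complex_def)

lemma measurable_cnj [measurable]:
  "f \<in> borel_measurable M \<Longrightarrow> (\<lambda>x. cnj (f x)) \<in> borel_measurable M"
  by (rule borel_measurable_continuous_on[where f = cnj]) (intro continuous_intros)

lemma L12_add: "L12 f \<Longrightarrow> L12 g \<Longrightarrow> L12 (\<lambda>x. f x + g x)"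
  by (simp add: L12_def square_integrable_add)

lemma L12_diff: "L12 f \<Longrightarrow> L12 g \<Longrightarrow> L12 (\<lambda>x. f x - g x)"
  by (simp add: L12_def square_integrable_minus)

lemma L12_bounded_symbol:
  assumes "L12 f" "bounded_symbol g" shows "L12 (\<lambda>x. g x * f x)"
proof -
  obtain c where c: "\<And>x. cmod (g x) \<le> c" and [measurable]: "g \<in> borel_measurable borel"
    using assms by (auto simp: bounded_symbol_def)
  have [measurable]: "f \<in> borel_measurable borel" using assms by (auto simp: L12_def)
  have "integrable lborel (\<lambda>x. g x * f x)"
  proof (rule Bochner_Integration.integrable_bound)
    show "integrable lborel (\<lambda>x. \<bar>c\<bar> * cmod (f x))" using assms by (auto simp: L12_def)
    have "norm (g x * f x) \<le> norm (\<bar>c\<bar> * cmod (f x))" for x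
      using mult_right_mono[OF order_trans[OF c[of x] abs_ge_self], of "cmod (f x)"] by (simp add: norm_mult)
    then show "AE x in lborel. norm (g x * f x) \<le> norm (\<bar>c\<bar> * cmod (f x))" by simp
  qed simp
  then show ?thesis using assms by (auto simp: L12_def intro: square_integrable_bounded_symbol)
qed

lemma L12_mpres:
  assumes "L12 f" "mpres T" shows "L12 (\<lambda>x. f (T x))"
  using assms mpres_integral(2)[OF assms(2), of f] mpres_square_integrable[OF assms(2), of f]
  by (simp add: L12_def square_integrable_def)

section \<open>Extension of the Fourier integral to L2\<close>

definition fourier_L12 :: "(real^'n::finite \<Rightarrow> complex) \<Rightarrow> (real^'n) l2" where
  "fourier_L12 f = to_l2 (fourier_integral f)"

lemma fourier_integral_square_integrable:
  assumes "L12 f" shows "square_integrable (fourier_integral f)"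
proof -
  have [measurable]: "f \<in> borel_measurable borel" using assms by (auto simp: L12_def)
  have "(\<integral>\<^sup>+x. ennreal ((cmod (f x))\<^sup>2) \<partial>lborel) < \<infinity>"
    using assms by (simp add: L12_def square_integrable_iff_nn)
  then show ?thesis
    using fourier_integral_contraction[OF assms] by (auto simp: square_integrable_iff_nn intro: le_less_trans)
qed

lemma norm_fourier_L12_le: assumes "L12 f" shows "norm (fourier_L12 f) \<le> norm (to_l2 f)"
proof -
  have "ennreal ((norm (fourier_L12 f))\<^sup>2) \<le> ennreal ((norm (to_l2 f))\<^sup>2)"
    using fourier_integral_contraction[OF assms] assms
    by (simp add: fourier_L12_def L12_def nn_norm_to_l2 fourier_integral_square_integrable[OF assms])
  then have "(norm (fourier_L12 f))\<^sup>2 \<le> (norm (to_l2 f))\<^sup>2" by (simp add: ennreal_le_iff)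
  then show ?thesis by (rule power2_le_imp_le) simp
qed

lemma fourier_L12_add: assumes "L12 f" "L12 g" shows "fourier_L12 (\<lambda>x. f x + g x) = fourier_L12 f + fourier_L12 g"
proof -
  have "fourier_integral (\<lambda>x. f x + g x) = (\<lambda>\<zeta>. fourier_integral f \<zeta> + fourier_integral g \<zeta>)"
    using assms by (intro ext fourier_integral_add) (simp_all add: L12_def)
  then show ?thesis
    using to_l2_add[OF assms[THEN fourier_integral_square_integrable]] by (simp add: fourier_L12_def)
qed

lemma fourier_L12_diff: assumes "L12 f" "L12 g" shows "fourier_L12 (\<lambda>x. f x - g x) = fourier_L12 f - fourier_L12 g"
proof -
  have "fourier_integral (\<lambda>x. f x - g x) = (\<lambda>\<zeta>. fourier_integral f \<zeta> - fourier_integral g \<zeta>)"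
    using assms by (intro ext fourier_integral_diff) (simp_all add: L12_def)
  then show ?thesis
    using to_l2_diff[OF assms[THEN fourier_integral_square_integrable]] by (simp add: fourier_L12_def)
qed

lemma norm_fourier_L12_diff_le:
  assumes "L12 f" "L12 g" shows "norm (fourier_L12 f - fourier_L12 g) \<le> norm (to_l2 f - to_l2 g)"
  using norm_fourier_L12_le[OF L12_diff[OF assms]] assms
  by (simp add: fourier_L12_diff L12_def to_l2_diff)

lemma fourier_L12_scaleR: assumes "L12 f" shows "fourier_L12 (\<lambda>x. r *\<^sub>R f x) = r *\<^sub>R fourier_L12 f"
proof -
  have "fourier_integral (\<lambda>x. r *\<^sub>R f x) = (\<lambda>\<zeta>. r *\<^sub>R fourier_integral f \<zeta>)"
    unfolding scaleR_conv_of_real by (intro ext fourier_integral_cmult)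
  then show ?thesis
    using to_l2_scaleR[OF fourier_integral_square_integrable[OF assms]] by (simp add: fourier_L12_def)
qed

text \<open>The truncations converge in L2, so the contraction makes their transforms a Cauchy
  sequence. The limit is first taken along the integers; the estimate \<open>b\<close> carries it to
  the continuous radius in the definition of \<open>fourier\<close>.\<close>

lemma fourier_ex:
  "\<exists>l. ((\<lambda>R. fourier_L12 (\<lambda>x. indicator (ball 0 R) x * fun_l2 v x)) \<longlongrightarrow> l) at_top"
proof -
  define t where "t R = (\<lambda>x. indicator (ball 0 R) x * fun_l2 v x)" for R :: real
  have tL: "L12 (t R)" for R unfolding t_def by (rule L12_truncation[OF square_integrable_fun_l2])
  have tt: "to_l2 (t R) = mul (\<lambda>x. indicator (ball 0 R) x) v" for R by (simp add: t_def mul_def)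
  have lim: "(\<lambda>j. to_l2 (t (R j))) \<longlonglongrightarrow> v" if "filterlim R at_top sequentially" for R
    unfolding tt by (rule truncation_tendsto[OF that])
  have "Cauchy (\<lambda>j. to_l2 (t (real j)))"
    using lim[OF filterlim_real_sequentially] by (rule LIMSEQ_imp_Cauchy)
  then have "Cauchy (\<lambda>j. fourier_L12 (t (real j)))"
    using norm_fourier_L12_diff_le[OF tL tL] unfolding Cauchy_def dist_norm
    by (meson le_less_trans)
  then obtain l where l: "(\<lambda>j. fourier_L12 (t (real j))) \<longlonglongrightarrow> l"
    by (auto simp: Cauchy_convergent_iff convergent_def)
  have b: "norm (fourier_L12 (t R) - l) \<le> norm (to_l2 (t R) - v)" for R
  proof (rule LIMSEQ_le)
    show "(\<lambda>j. norm (fourier_L12 (t R) - fourier_L12 (t (real j)))) \<longlonglongrightarrow> norm (fourier_L12 (t R) - l)"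
      by (intro tendsto_intros l)
    show "(\<lambda>j. norm (to_l2 (t R) - to_l2 (t (real j)))) \<longlonglongrightarrow> norm (to_l2 (t R) - v)"
      by (intro tendsto_intros lim filterlim_real_sequentially)
  qed (use norm_fourier_L12_diff_le[OF tL tL] in blast)
  have "((\<lambda>R. fourier_L12 (t R)) \<longlongrightarrow> l) at_top"
  proof (rule tendsto_at_topI_sequentially)
    fix X :: "nat \<Rightarrow> real" assume X: "filterlim X at_top sequentially"
    show "(\<lambda>n. fourier_L12 (t (X n))) \<longlonglongrightarrow> l"
    proof (rule LIM_zero_cancel, rule Lim_null_comparison)
      show "\<forall>\<^sub>F n in sequentially. norm (fourier_L12 (t (X n)) - l) \<le> norm (to_l2 (t (X n)) - v)"
        using b by simp
      have "(\<lambda>n. norm (to_l2 (t (X n)) - v)) \<longlonglongrightarrow> norm (v - v)" by (intro tendsto_intros lim X)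
      then show "(\<lambda>n. norm (to_l2 (t (X n)) - v)) \<longlonglongrightarrow> 0" by simp
    qed
  qed
  then show ?thesis unfolding t_def by blast
qed

lemma fourier_tendsto:
  "((\<lambda>R. fourier_L12 (\<lambda>x. indicator (ball 0 R) x * fun_l2 v x)) \<longlongrightarrow> fourier v) at_top"
proof -
  obtain l where l: "((\<lambda>R. fourier_L12 (\<lambda>x. indicator (ball 0 R) x * fun_l2 v x)) \<longlongrightarrow> l) at_top"
    using fourier_ex by blast
  have "fourier v = l" unfolding fourier_def fourier_L12_def[symmetric]
    by (rule tendsto_Lim[OF _ l]) simp
  then show ?thesis using l by simp
qed

text \<open>The contraction in the limit of one argument. Taking \<open>v = to_l2 f\<close> shows
  that \<open>fourier\<close> extends the Fourier integral; approximating a second argument gives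
  Lipschitz continuity on L2.\<close>

lemma norm_fourier_fourier_L12_le:
  assumes "L12 f" shows "norm (fourier v - fourier_L12 f) \<le> norm (v - to_l2 f)"
proof (rule LIMSEQ_le)
  show "(\<lambda>j. norm (fourier_L12 (\<lambda>x. indicator (ball 0 (real j)) x * fun_l2 v x) - fourier_L12 f)) \<longlonglongrightarrow> norm (fourier v - fourier_L12 f)"
    by (intro tendsto_intros filterlim_compose[OF fourier_tendsto] filterlim_real_sequentially)
  show "(\<lambda>j. norm (mul (\<lambda>x. indicator (ball 0 (real j)) x) v - to_l2 f)) \<longlonglongrightarrow> norm (v - to_l2 f)"
    by (intro tendsto_intros truncation_tendsto filterlim_real_sequentially)
qed (use norm_fourier_L12_diff_le[OF L12_truncation[OF square_integrable_fun_l2] assms] in \<open>auto simp: mul_def\<close>)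

lemma fourier_to_l2: "L12 f \<Longrightarrow> fourier (to_l2 f) = fourier_L12 f"
  using norm_fourier_fourier_L12_le[of f "to_l2 f"] by simp

lemma norm_fourier_diff_le: "norm (fourier v - fourier w) \<le> norm (v - w)"
proof -
  let ?t = "\<lambda>j x. indicator (ball 0 (real j)) x * fun_l2 w x"
  have "norm (fourier v - fourier w) \<le> norm (v - w)"
  proof (rule LIMSEQ_le)
    show "(\<lambda>j. norm (fourier v - fourier_L12 (?t j))) \<longlonglongrightarrow> norm (fourier v - fourier w)"
      by (intro tendsto_intros filterlim_compose[OF fourier_tendsto] filterlim_real_sequentially)
    show "(\<lambda>j. norm (v - mul (\<lambda>x. indicator (ball 0 (real j)) x) w)) \<longlonglongrightarrow> norm (v - w)"
      by (intro tendsto_intros truncation_tendsto filterlim_real_sequentially)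
  qed (use norm_fourier_fourier_L12_le[OF L12_truncation[OF square_integrable_fun_l2]] in \<open>auto simp: mul_def\<close>)
  then show ?thesis .
qed

lemma continuous_on_fourier [continuous_intros]:
  assumes "continuous_on S f" shows "continuous_on S (\<lambda>x. fourier (f x))"
proof -
  have "continuous_on UNIV (fourier :: (real^'b) l2 \<Rightarrow> _)"
    unfolding continuous_on_iff dist_norm using norm_fourier_diff_le le_less_trans by blast
  from continuous_on_compose2[OF this assms] show ?thesis by simp
qed

lemma fourier_add:
  fixes v w :: "(real^'n::finite) l2"
  shows "fourier (v + w) = fourier v + fourier w"
proof -
  have *: "fourier (v + to_l2 g) = fourier v + fourier (to_l2 g)" if g: "L12 g" for v :: "(real^'n) l2" and g
  proof -
    have "v \<in> {v. fourier (v + to_l2 g) = fourier v + fourier (to_l2 g)}"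
    proof (rule l2_closed_L12)
      show "closed {v. fourier (v + to_l2 g) = fourier v + fourier (to_l2 g)}"
        by (intro closed_Collect_eq continuous_intros)
      fix f :: "real^'n \<Rightarrow> complex" assume f: "L12 f"
      then show "to_l2 f \<in> {v. fourier (v + to_l2 g) = fourier v + fourier (to_l2 g)}"
        using g fourier_to_l2[OF L12_add[OF f g]]
        by (simp add: to_l2_add[symmetric] L12_def fourier_to_l2 fourier_L12_add)
    qed
    then show ?thesis by simp
  qed
  have "w \<in> {w. fourier (v + w) = fourier v + fourier w}"
    by (rule l2_closed_L12) (auto intro!: closed_Collect_eq continuous_intros *)
  then show ?thesis by simp
qed

lemma fourier_scaleR:
  fixes v :: "(real^'n::finite) l2"
  shows "fourier (r *\<^sub>R v) = r *\<^sub>R fourier v"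
proof -
  have "v \<in> {v. fourier (r *\<^sub>R v) = r *\<^sub>R fourier v}"
  proof (rule l2_closed_L12)
    show "closed {v. fourier (r *\<^sub>R v) = r *\<^sub>R fourier v}"
      by (intro closed_Collect_eq continuous_intros)
    fix f :: "real^'n \<Rightarrow> complex" assume f: "L12 f"
    then have "L12 (\<lambda>x. r *\<^sub>R f x)" by (simp add: L12_def square_integrable_scaleR)
    then show "to_l2 f \<in> {v. fourier (r *\<^sub>R v) = r *\<^sub>R fourier v}"
      using f fourier_to_l2[of "\<lambda>x. r *\<^sub>R f x"]
      by (simp add: to_l2_scaleR[symmetric] L12_def fourier_to_l2 fourier_L12_scaleR)
  qed
  then show ?thesis by simp
qed

lemma bounded_linear_fourier: "bounded_linear fourier"
proof (rule bounded_linear_intro[where K = 1])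
  show "norm (fourier v) \<le> norm v * 1" for v :: "(real^'a) l2"
    using norm_fourier_diff_le[of v 0] fourier_scaleR[of 0 "0 :: (real^'a) l2"] by simp
qed (simp_all add: fourier_add fourier_scaleR)

lemma lborel_integral_affine:
  fixes f :: "'a::euclidean_space \<Rightarrow> complex"
  assumes [measurable]: "f \<in> borel_measurable borel" and "c \<noteq> 0"
  shows "(\<integral>x. f x \<partial>lborel) = (\<bar>c\<bar> ^ DIM('a)) *\<^sub>R (\<integral>x. f (t + c *\<^sub>R x) \<partial>lborel)"
proof -
  define N where "N = density (distr lborel borel (\<lambda>x::'a. t + c *\<^sub>R x)) (\<lambda>_. ennreal (\<bar>c\<bar> ^ DIM('a)))"
  have LN: "lborel = N" unfolding N_def using assms(2) by (subst lborel_affine[OF assms(2), of t]) simp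
  have m: "(\<lambda>x::'a. t + c *\<^sub>R x) \<in> lborel \<rightarrow>\<^sub>M borel" by measurable
  have "(\<integral>x. f x \<partial>N) = (\<integral>x. \<bar>c\<bar> ^ DIM('a) *\<^sub>R f x \<partial>distr lborel borel (\<lambda>x::'a. t + c *\<^sub>R x))"
    unfolding N_def by (rule integral_density) auto
  also have "\<dots> = (\<integral>x. \<bar>c\<bar> ^ DIM('a) *\<^sub>R f (t + c *\<^sub>R x) \<partial>lborel)"
    by (rule integral_distr[OF m]) measurable
  finally show ?thesis unfolding LN[symmetric] by simp
qed

text \<open>Substituting \<open>y = x + s j *\<^sub>R z\<close>, with \<open>s j\<close> the square
  root of the variance, moves the parameter from the kernel into the argument of \<open>k\<close>.
  The kernel is then a fixed density, and continuity with dominated convergence finishes.\<close>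

lemma heat_smoothing_tendsto:
  fixes k :: "real^'n::finite \<Rightarrow> complex"
  assumes k: "continuous_on UNIV k" and B: "\<And>x. cmod (k x) \<le> B"
  shows "(\<lambda>j. \<integral>y. complex_of_real (heat_kernel (inverse (real (Suc j))) (x - y)) * k y \<partial>lborel) \<longlonglongrightarrow> k x"
    and "\<And>j. cmod (\<integral>y. complex_of_real (heat_kernel (inverse (real (Suc j))) (x - y)) * k y \<partial>lborel) \<le> B"
proof -
  have [measurable]: "k \<in> borel_measurable borel" using k by (rule borel_measurable_continuous_onI)
  define s where "s j = sqrt (inverse (real (Suc j)))" for j
  have s: "s j > 0" "(s j)\<^sup>2 = inverse (real (Suc j))" for j by (auto simp: s_def)
  have s0: "s \<longlonglongrightarrow> 0" unfolding s_def
    using tendsto_real_sqrt[OF LIMSEQ_inverse_real_of_nat] by simp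
  have hk: "(s j ^ CARD('n)) * heat_kernel (inverse (real (Suc j))) (- (s j *\<^sub>R z)) = heat_kernel 1 z" for j and z :: "real^'n"
  proof -
    have a: "s j ^ CARD('n) * sqrt (2 * pi / inverse (real (Suc j))) ^ CARD('n) = sqrt (2 * pi) ^ CARD('n)"
    proof -
      have "a * (2 * pi / a) = 2 * pi" if "a > 0" for a :: real using that by simp
      from this[of "inverse (real (Suc j))"] show ?thesis
        unfolding s_def power_mult_distrib[symmetric] real_sqrt_mult[symmetric] by simp
    qed
    have b: "- (norm (- (s j *\<^sub>R z)))\<^sup>2 / (2 * inverse (real (Suc j))) = - (norm z)\<^sup>2 / (2 * 1)"
      unfolding s(2)[of j, symmetric] using s(1)[of j] by (simp add: power_mult_distrib)
    show ?thesis unfolding heat_kernel_def b using a by (simp add: algebra_simps)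
  qed
  have eq: "(\<integral>y. complex_of_real (heat_kernel (inverse (real (Suc j))) (x - y)) * k y \<partial>lborel) =
     (\<integral>z. complex_of_real (heat_kernel 1 z) * k (x + s j *\<^sub>R z) \<partial>lborel)" for j
  proof -
    have "(\<integral>y. complex_of_real (heat_kernel (inverse (real (Suc j))) (x - y)) * k y \<partial>lborel) =
      (\<bar>s j\<bar> ^ DIM(real^'n)) *\<^sub>R (\<integral>z. complex_of_real (heat_kernel (inverse (real (Suc j))) (x - (x + s j *\<^sub>R z))) * k (x + s j *\<^sub>R z) \<partial>lborel)"
      by (rule lborel_integral_affine) (use s(1)[of j] in auto)
    also have "\<dots> = (\<integral>z. complex_of_real (s j ^ CARD('n) * heat_kernel (inverse (real (Suc j))) (- (s j *\<^sub>R z))) * k (x + s j *\<^sub>R z) \<partial>lborel)"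
      using s(1)[of j] by (simp add: scaleR_conv_of_real mult.assoc flip: integral_mult_right_zero)
    finally show ?thesis unfolding hk .
  qed
  have hB: "integrable lborel (\<lambda>z. heat_kernel 1 (z :: real^'n) * B)" "(\<integral>z. heat_kernel 1 (z :: real^'n) * B \<partial>lborel) = B"
    using heat_kernel_integral[of 1, where 'n = 'n] by simp_all
  have bd: "cmod (complex_of_real (heat_kernel 1 z) * k y) \<le> heat_kernel 1 z * B" for z :: "real^'n" and y
    using heat_kernel_nonneg[of 1 z] B[of y] by (simp add: norm_mult mult_left_mono)
  show "cmod (\<integral>y. complex_of_real (heat_kernel (inverse (real (Suc j))) (x - y)) * k y \<partial>lborel) \<le> B" for j
    unfolding eq
  proof (rule order_trans[OF integral_norm_bound])
    have "0 \<le> B" using B norm_ge_zero order_trans by blast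
    then have "(\<integral>z. cmod (complex_of_real (heat_kernel 1 z) * k (x + s j *\<^sub>R z)) \<partial>lborel) \<le> (\<integral>z. heat_kernel 1 (z :: real^'n) * B \<partial>lborel)"
      by (intro integral_mono'[OF hB(1)] bd mult_nonneg_nonneg heat_kernel_nonneg) auto
    then show "(\<integral>z. cmod (complex_of_real (heat_kernel 1 z) * k (x + s j *\<^sub>R z)) \<partial>lborel) \<le> B"
      by (simp only: hB(2))
  qed
  have "(\<lambda>j. \<integral>z. complex_of_real (heat_kernel 1 z) * k (x + s j *\<^sub>R z) \<partial>lborel) \<longlonglongrightarrow>
      (\<integral>z. complex_of_real (heat_kernel 1 (z :: real^'n)) * k x \<partial>lborel)"
  proof (rule integral_dominated_convergence[where w = "\<lambda>z. heat_kernel 1 (z :: real^'n) * B"])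
    show "integrable lborel (\<lambda>z. heat_kernel 1 (z :: real^'n) * B)" by (rule hB)
    have "(\<lambda>j. complex_of_real (heat_kernel 1 z) * k (x + s j *\<^sub>R z)) \<longlonglongrightarrow> complex_of_real (heat_kernel 1 z) * k x" for z
    proof (intro tendsto_mult tendsto_const)
      have "(\<lambda>j. x + s j *\<^sub>R z) \<longlonglongrightarrow> x + 0 *\<^sub>R z" by (intro tendsto_intros s0)
      then have "(\<lambda>j. x + s j *\<^sub>R z) \<longlonglongrightarrow> x" by simp
      from continuous_on_tendsto_compose[OF k this] show "(\<lambda>j. k (x + s j *\<^sub>R z)) \<longlonglongrightarrow> k x" by simp
    qed
    then show "AE z in lborel. (\<lambda>j. complex_of_real (heat_kernel 1 z) * k (x + s j *\<^sub>R z)) \<longlonglongrightarrow> complex_of_real (heat_kernel 1 z) * k x"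
      by simp
  qed (use bd in auto)
  moreover have "(\<integral>z. complex_of_real (heat_kernel 1 (z :: real^'n)) * k x \<partial>lborel) = k x"
    using heat_kernel_integral(2)[of 1, where 'n = 'n] by (simp add: integral_complex_of_real)
  ultimately show "(\<lambda>j. \<integral>y. complex_of_real (heat_kernel (inverse (real (Suc j))) (x - y)) * k y \<partial>lborel) \<longlonglongrightarrow> k x"
    unfolding eq by (simp only:)
qed

text \<open>The damping is removed in \<open>fourier_regularized\<close>. On the left the product of
  the two transforms dominates, integrable because both are in L2 by the contraction; on the right
  the smoothed function converges pointwise because \<open>k\<close> is continuous and
  bounded.\<close>

lemma fourier_L12_inner_continuous:
  fixes f k :: "real^'n::finite \<Rightarrow> complex"
  assumes f: "L12 f" and k: "L12 k" "continuous_on UNIV k" "\<And>x. cmod (k x) \<le> B"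
  shows "fourier_L12 f \<bullet> fourier_L12 k = to_l2 f \<bullet> to_l2 k"
proof -
  have fi: "integrable lborel f" "integrable lborel k" "square_integrable f" "square_integrable k"
    using f k by (auto simp: L12_def)
  have [measurable]: "f \<in> borel_measurable borel" "k \<in> borel_measurable borel" using fi by auto
  define e where "e j = inverse (real (Suc j))" for j
  have e: "0 < e j" for j by (simp add: e_def)
  note sF = fourier_integral_square_integrable[OF f] fourier_integral_square_integrable[OF k(1)]
  have "square_integrable (\<lambda>\<zeta>. cnj (fourier_integral k \<zeta>))"
    using sF(2) unfolding square_integrable_def complex_mod_cnj by (auto intro!: measurable_cnj)
  from square_integrable_mult[OF sF(1) this]
  have FF: "integrable lborel (\<lambda>\<zeta>. fourier_integral f \<zeta> * cnj (fourier_integral k \<zeta>))" .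
  have sk: "square_integrable (\<lambda>x. cnj (k x))"
    using fi(4) by (auto simp: square_integrable_def)
  from square_integrable_mult[OF fi(3) this] have fk: "integrable lborel (\<lambda>x. f x * cnj (k x))" .
  have L: "(\<lambda>j. \<integral>\<zeta>. fourier_integral f \<zeta> * cnj (fourier_integral k \<zeta>) * complex_of_real (exp (- e j * (norm \<zeta>)\<^sup>2 / 2)) \<partial>lborel)
     \<longlonglongrightarrow> (\<integral>\<zeta>. fourier_integral f \<zeta> * cnj (fourier_integral k \<zeta>) \<partial>lborel)"
  proof (rule integral_dominated_convergence[where w = "\<lambda>\<zeta>. cmod (fourier_integral f \<zeta> * cnj (fourier_integral k \<zeta>))"])
    show "integrable lborel (\<lambda>\<zeta>. cmod (fourier_integral f \<zeta> * cnj (fourier_integral k \<zeta>)))"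
      using FF by (rule integrable_norm)
    have "(\<lambda>j. fourier_integral f \<zeta> * cnj (fourier_integral k \<zeta>) * complex_of_real (exp (- e j * (norm \<zeta>)\<^sup>2 / 2)))
      \<longlonglongrightarrow> fourier_integral f \<zeta> * cnj (fourier_integral k \<zeta>) * complex_of_real (exp (- 0 * (norm \<zeta>)\<^sup>2 / 2))" for \<zeta> :: "real^'n"
      unfolding e_def by (intro tendsto_intros LIMSEQ_inverse_real_of_nat) simp
    then show "AE \<zeta> in lborel. (\<lambda>j. fourier_integral f \<zeta> * cnj (fourier_integral k \<zeta>) * complex_of_real (exp (- e j * (norm \<zeta>)\<^sup>2 / 2)))
      \<longlonglongrightarrow> fourier_integral f \<zeta> * cnj (fourier_integral k \<zeta>)" by simp
    have "exp (- e j * (norm \<zeta>)\<^sup>2 / 2) \<le> 1" for j and \<zeta> :: "real^'n"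
      using e[of j] by simp
    then have "cmod (fourier_integral f \<zeta> * cnj (fourier_integral k \<zeta>) * complex_of_real (exp (- e j * (norm \<zeta>)\<^sup>2 / 2)))
      \<le> cmod (fourier_integral f \<zeta> * cnj (fourier_integral k \<zeta>))" for j and \<zeta> :: "real^'n"
      unfolding norm_mult[of "_ * _" "complex_of_real _"] by (intro mult_left_le) auto
    then show "AE \<zeta> in lborel. norm (fourier_integral f \<zeta> * cnj (fourier_integral k \<zeta>) * complex_of_real (exp (- e j * (norm \<zeta>)\<^sup>2 / 2)))
      \<le> cmod (fourier_integral f \<zeta> * cnj (fourier_integral k \<zeta>))" for j by simp
  qed measurable
  have ck: "continuous_on UNIV (\<lambda>x. cnj (k x))" "\<And>x. cmod (cnj (k x)) \<le> B" using k by (auto intro: continuous_intros)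
  have R: "(\<lambda>j. \<integral>x. f x * (\<integral>y. complex_of_real (heat_kernel (e j) (x - y)) * cnj (k y) \<partial>lborel) \<partial>lborel)
     \<longlonglongrightarrow> (\<integral>x. f x * cnj (k x) \<partial>lborel)"
  proof (rule integral_dominated_convergence[where w = "\<lambda>x. cmod (f x) * B"])
    have m: "(\<lambda>x. \<integral>y. complex_of_real (heat_kernel (e j) (x - y)) * cnj (k y) \<partial>lborel) \<in> borel_measurable borel" for j
      by (rule lborel.borel_measurable_lebesgue_integral) measurable
    show "(\<lambda>x. f x * (\<integral>y. complex_of_real (heat_kernel (e j) (x - y)) * cnj (k y) \<partial>lborel)) \<in> borel_measurable lborel" for j
      using m[of j] by simp
    show "integrable lborel (\<lambda>x. cmod (f x) * B)" using fi by simp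
    show "AE x in lborel. (\<lambda>j. f x * (\<integral>y. complex_of_real (heat_kernel (e j) (x - y)) * cnj (k y) \<partial>lborel)) \<longlonglongrightarrow> f x * cnj (k x)"
      unfolding e_def by (intro AE_I2 tendsto_mult tendsto_const heat_smoothing_tendsto(1)[OF ck])
    show "AE x in lborel. norm (f x * (\<integral>y. complex_of_real (heat_kernel (e j) (x - y)) * cnj (k y) \<partial>lborel)) \<le> cmod (f x) * B" for j
      unfolding e_def norm_mult by (intro AE_I2 mult_left_mono heat_smoothing_tendsto(2)[OF ck]) simp
  qed measurable
  \<comment> \<open>Here the smoothing changes sides, from \<open>f\<close> to the continuous factor
    \<open>k\<close>.\<close>
  have eq: "(\<integral>\<zeta>. fourier_integral f \<zeta> * cnj (fourier_integral k \<zeta>) * complex_of_real (exp (- e j * (norm \<zeta>)\<^sup>2 / 2)) \<partial>lborel)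
     = (\<integral>x. f x * (\<integral>y. complex_of_real (heat_kernel (e j) (x - y)) * cnj (k y) \<partial>lborel) \<partial>lborel)" for j
  proof -
    define C where "C = (fconst TYPE('n))\<^sup>2 * (sqrt (2 * pi / e j) ^ CARD('n))"
    have C: "0 \<le> C" using e[of j] by (simp add: C_def)
    have m: "(\<lambda>(x, y). complex_of_real (heat_kernel (e j) (x - y :: real^'n))) \<in> borel_measurable (borel \<Otimes>\<^sub>M borel)"
      by measurable
    have bd: "cmod (complex_of_real (heat_kernel (e j) (x - y :: real^'n))) \<le> C" for x y
    proof -
      have "heat_kernel (e j) (x - y) = C * exp (- (norm (x - y))\<^sup>2 / (2 * e j))"
        by (simp add: heat_kernel_def C_def)
      also have "\<dots> \<le> C * 1" using C e[of j] by (intro mult_left_mono) auto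
      finally show ?thesis using heat_kernel_nonneg[OF e[of j], of "x - y"] by simp
    qed
    have kc: "integrable lborel (\<lambda>y. cnj (k y))" using fi by simp
    show ?thesis
      unfolding fourier_regularized[OF e fi(1,2)]
      by (rule fubini_kernel[OF fi(1) kc m bd])
  qed
  have "(\<integral>\<zeta>. fourier_integral f \<zeta> * cnj (fourier_integral k \<zeta>) \<partial>lborel) = (\<integral>x. f x * cnj (k x) \<partial>lborel)"
    using LIMSEQ_unique[OF L[unfolded eq] R] .
  then have "(\<integral>\<zeta>. Re (fourier_integral f \<zeta> * cnj (fourier_integral k \<zeta>)) \<partial>lborel) = (\<integral>x. Re (f x * cnj (k x)) \<partial>lborel)"
    using integral_Re[OF FF] integral_Re[OF fk] by simp
  then show ?thesis
    unfolding fourier_L12_def inner_to_l2[OF sF] inner_to_l2[OF fi(3,4)] inner_complex_Re .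
qed

section \<open>Plancherel's theorem and the free group\<close>

lemma L12_continuous_cmult:
  fixes f :: "'a::euclidean_space \<Rightarrow> real"
  assumes f: "continuous_on UNIV f" "\<And>x. 0 \<le> f x \<and> f x \<le> 1" "integrable lborel f"
  shows "L12 (\<lambda>x. c * complex_of_real (f x))"
proof -
  have [measurable]: "f \<in> borel_measurable borel" using f(3) by auto
  have "square_integrable (\<lambda>x. complex_of_real (f x))"
    unfolding square_integrable_def
  proof
    show "integrable lborel (\<lambda>x. (cmod (complex_of_real (f x)))\<^sup>2)"
    proof (rule Bochner_Integration.integrable_bound[OF f(3)])
      have "(f x)\<^sup>2 \<le> f x" for x
        using mult_left_le[of "f x" "f x"] f(2)[of x] by (simp add: power2_eq_square)
      then show "AE x in lborel. norm ((cmod (complex_of_real (f x)))\<^sup>2) \<le> norm (f x)"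
        using f(2) by simp
    qed simp
  qed simp
  then have "L12 (\<lambda>x. complex_of_real (f x))" using f(3) by (simp add: L12_def)
  then show ?thesis by (rule L12_bounded_symbol) simp
qed

text \<open>Two density arguments: truncations reach every \<open>v\<close>, while \<open>w\<close>
  is reached from continuous functions, the only ones to which the heat smoothing argument
  applies.\<close>

lemma fourier_inner: "fourier v \<bullet> fourier w = v \<bullet> (w :: (real^'n::finite) l2)"
proof -
  have A: "fourier v \<bullet> fourier_L12 k = v \<bullet> to_l2 k"
    if "L12 k" "continuous_on UNIV k" "\<And>x. cmod (k x) \<le> B" for k B
  proof -
    have "v \<in> {v. fourier v \<bullet> fourier_L12 k = v \<bullet> to_l2 k}"
    proof (rule l2_closed_L12)
      show "closed {v. fourier v \<bullet> fourier_L12 k = v \<bullet> to_l2 k}"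
        by (intro closed_Collect_eq continuous_intros)
      fix f :: "real^'n \<Rightarrow> complex" assume f: "L12 f"
      then show "to_l2 f \<in> {v. fourier v \<bullet> fourier_L12 k = v \<bullet> to_l2 k}"
        using fourier_L12_inner_continuous[OF f that] by (simp add: fourier_to_l2)
    qed
    then show ?thesis by simp
  qed
  have "w \<in> {w. fourier v \<bullet> fourier w = v \<bullet> w}"
  proof (rule l2_closed_continuous)
    show "closed {w. fourier v \<bullet> fourier w = v \<bullet> w}"
      by (intro closed_Collect_eq continuous_intros)
    fix c and f :: "real^'n \<Rightarrow> real"
    assume f: "continuous_on UNIV f" "\<And>x. 0 \<le> f x \<and> f x \<le> 1" "integrable lborel f"
    have b: "cmod (c * complex_of_real (f x)) \<le> cmod c" for x
      using f(2)[of x] by (simp add: norm_mult mult_left_le)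
    have "continuous_on UNIV (\<lambda>x. c * complex_of_real (f x))"
      by (intro continuous_intros f)
    from A[OF L12_continuous_cmult[OF f] this b]
    show "to_l2 (\<lambda>x. c * complex_of_real (f x)) \<in> {w. fourier v \<bullet> fourier w = v \<bullet> w}"
      by (simp add: fourier_to_l2[OF L12_continuous_cmult[OF f]])
  qed (simp add: fourier_add inner_add_right)
  then show ?thesis by simp
qed

lemma norm_fourier [simp]: "norm (fourier v) = norm v"
  by (simp add: norm_eq_sqrt_inner fourier_inner)

lemma fourier_diff: "fourier (v - w) = fourier v - fourier w"
  using linear_diff[OF bounded_linear.linear[OF bounded_linear_fourier]] .

lemma fourier_integral_comp_uminus:
  assumes "f \<in> borel_measurable borel"
  shows "fourier_integral (\<lambda>x. f (- x)) \<zeta> = fourier_integral f (- \<zeta>)"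
  using mpres_integral(1)[OF mpres_uminus, of "\<lambda>x. exp (- \<i> * complex_of_real (- \<zeta> \<bullet> x)) * f x"] assms
  by (simp add: fourier_integral_def)

lemma fourier_integral_cnj: "fourier_integral (\<lambda>x. cnj (f x)) \<zeta> = cnj (fourier_integral f (- \<zeta>))"
proof -
  have "(\<integral>x. exp (- \<i> * complex_of_real (\<zeta> \<bullet> x)) * cnj (f x) \<partial>lborel) = (\<integral>x. cnj (exp (- \<i> * complex_of_real (- \<zeta> \<bullet> x)) * f x) \<partial>lborel)"
    by (simp add: exp_cnj)
  also have "\<dots> = cnj (\<integral>x. exp (- \<i> * complex_of_real (- \<zeta> \<bullet> x)) * f x \<partial>lborel)"
    by (simp del: complex_cnj_mult)
  finally show ?thesis by (simp add: fourier_integral_def)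
qed

lemma fourier_comp_uminus: "fourier (comp_l2 uminus v) = comp_l2 uminus (fourier (v :: (real^'n::finite) l2))"
proof -
  note bl = bounded_linear.continuous_on[OF bounded_linear_comp_l2[OF mpres_uminus]]
  have "v \<in> {v. fourier (comp_l2 uminus v) = comp_l2 uminus (fourier v)}"
  proof (rule l2_closed_L12)
    show "closed {v :: (real^'n) l2. fourier (comp_l2 uminus v) = comp_l2 uminus (fourier v)}"
      by (intro closed_Collect_eq continuous_intros bl)
    fix f :: "real^'n \<Rightarrow> complex" assume f: "L12 f"
    have fm: "f \<in> borel_measurable borel" and fs: "square_integrable f" using f by (auto simp: L12_def)
    have "fourier (comp_l2 uminus (to_l2 f)) = fourier_L12 (\<lambda>x. f (- x))"
      unfolding comp_l2_to_l2[OF mpres_uminus fs] by (rule fourier_to_l2[OF L12_mpres[OF f mpres_uminus]])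
    also have "\<dots> = comp_l2 uminus (fourier_L12 f)"
      unfolding fourier_L12_def comp_l2_to_l2[OF mpres_uminus fourier_integral_square_integrable[OF f]]
      by (simp add: fourier_integral_comp_uminus[OF fm, abs_def])
    finally show "to_l2 f \<in> {v. fourier (comp_l2 uminus v) = comp_l2 uminus (fourier v)}"
      by (simp add: fourier_to_l2[OF f])
  qed
  then show ?thesis by simp
qed

text \<open>The multiplication formula with the second function conjugated: conjugation reflects the
  frequency, so the adjoint is the reflected transform. Density extends this to L2 in each
  argument.\<close>

lemma fourier_adjoint: "fourier v \<bullet> w = v \<bullet> comp_l2 uminus (fourier (w :: (real^'n::finite) l2))"
proof -
  note bl = bounded_linear.continuous_on[OF bounded_linear_comp_l2[OF mpres_uminus]]
  have A: "fourier_L12 f \<bullet> to_l2 k = to_l2 f \<bullet> comp_l2 uminus (fourier_L12 k)" if f: "L12 f" and k: "L12 k"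
    for f k :: "real^'n \<Rightarrow> complex"
  proof -
    have fi: "integrable lborel f" "square_integrable f" "integrable lborel (\<lambda>x. cnj (k x))" "square_integrable k"
      "square_integrable (\<lambda>x. cnj (k x))"
      using f k unfolding L12_def square_integrable_def by (auto intro!: measurable_cnj)
    note sF = fourier_integral_square_integrable[OF f] fourier_integral_square_integrable[OF k]
    have sm: "square_integrable (\<lambda>x. fourier_integral k (- x))"
      by (rule mpres_square_integrable[OF mpres_uminus sF(2)])
    have sc: "square_integrable (\<lambda>x. cnj (fourier_integral k (- x)))"
      using sm unfolding square_integrable_def complex_mod_cnj by (auto intro!: measurable_cnj)
    have "fourier_L12 f \<bullet> to_l2 k = (\<integral>x. Re (fourier_integral f x * cnj (k x)) \<partial>lborel)"
      unfolding fourier_L12_def inner_to_l2[OF sF(1) fi(4)] inner_complex_Re ..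
    also have "\<dots> = Re (\<integral>x. fourier_integral f x * cnj (k x) \<partial>lborel)"
      by (rule integral_Re[OF square_integrable_mult[OF sF(1) fi(5)]])
    also have "\<dots> = Re (\<integral>x. f x * cnj (fourier_integral k (- x)) \<partial>lborel)"
      unfolding fourier_integral_mult_formula[OF fi(1,3)] fourier_integral_cnj ..
    also have "\<dots> = (\<integral>x. Re (f x * cnj (fourier_integral k (- x))) \<partial>lborel)"
      by (rule integral_Re[symmetric, OF square_integrable_mult[OF fi(2) sc]])
    also have "\<dots> = to_l2 f \<bullet> comp_l2 uminus (fourier_L12 k)"
      unfolding fourier_L12_def comp_l2_to_l2[OF mpres_uminus sF(2)] inner_to_l2[OF fi(2) sm] inner_complex_Re ..
    finally show ?thesis .
  qed
  have B: "fourier v \<bullet> to_l2 k = v \<bullet> comp_l2 uminus (fourier_L12 k)" if k: "L12 k" for k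
  proof -
    have "v \<in> {v. fourier v \<bullet> to_l2 k = v \<bullet> comp_l2 uminus (fourier_L12 k)}"
    proof (rule l2_closed_L12)
      show "closed {v. fourier v \<bullet> to_l2 k = v \<bullet> comp_l2 uminus (fourier_L12 k)}"
        by (intro closed_Collect_eq continuous_intros)
    qed (simp add: A k fourier_to_l2)
    then show ?thesis by simp
  qed
  have "w \<in> {w. fourier v \<bullet> w = v \<bullet> comp_l2 uminus (fourier w)}"
  proof (rule l2_closed_L12)
    show "closed {w. fourier v \<bullet> w = v \<bullet> comp_l2 uminus (fourier w)}"
      by (intro closed_Collect_eq continuous_intros bl)
  qed (simp add: B fourier_to_l2)
  then show ?thesis by simp
qed

definition ifourier :: "(real^'n::finite) l2 \<Rightarrow> (real^'n) l2" where
  "ifourier v = comp_l2 uminus (fourier v)"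

text \<open>An isometry followed by its adjoint is the identity, so inversion follows from
  Plancherel's identity without an inversion integral.\<close>

lemma ifourier_fourier [simp]: "ifourier (fourier v) = v"
proof -
  have "u \<bullet> ifourier (fourier v) = u \<bullet> v" for u
    using fourier_adjoint[of u "fourier v"] by (simp add: fourier_inner ifourier_def)
  then have "ifourier (fourier v) \<bullet> u = v \<bullet> u" for u by (simp add: inner_commute)
  then show ?thesis using vector_eq_rdot by blast
qed

text \<open>The transform commutes with reflection, which turns the left inverse into a right
  inverse and gives surjectivity.\<close>

lemma fourier_ifourier [simp]: "fourier (ifourier v) = v"
proof -
  have "fourier (ifourier v) = comp_l2 uminus (fourier (fourier v))"
    unfolding ifourier_def by (rule fourier_comp_uminus)
  also have "\<dots> = ifourier (fourier v)" by (simp add: ifourier_def)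
  finally show ?thesis by simp
qed

lemma norm_ifourier [simp]: "norm (ifourier v) = norm v"
  using norm_fourier[of "ifourier v"] by simp

lemma bounded_linear_ifourier: "bounded_linear ifourier"
  unfolding ifourier_def[abs_def]
  by (rule bounded_linear_compose[OF bounded_linear_comp_l2[OF mpres_uminus] bounded_linear_fourier])

lemma fourier_eq_iff: "fourier v = fourier w \<longleftrightarrow> v = w"
  by (metis ifourier_fourier)

lemma fourier_mul_const: "fourier (mul (\<lambda>x. c) v) = mul (\<lambda>x. c) (fourier (v :: (real^'n::finite) l2))"
proof -
  note bl = bounded_linear.continuous_on[OF bounded_linear_mul[OF bounded_symbol_const]]
  have "v \<in> {v. fourier (mul (\<lambda>x. c) v) = mul (\<lambda>x. c) (fourier v)}"
  proof (rule l2_closed_L12)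
    show "closed {v. fourier (mul (\<lambda>x. c) v) = mul (\<lambda>x. c) (fourier (v :: (real^'n) l2))}"
      by (intro closed_Collect_eq continuous_intros bl)
    fix f :: "real^'n \<Rightarrow> complex" assume f: "L12 f"
    have "fourier (mul (\<lambda>x. c) (to_l2 f)) = fourier_L12 (\<lambda>x. c * f x)"
      using f by (subst mul_to_l2) (auto simp: L12_def intro!: fourier_to_l2 L12_bounded_symbol[of _ "\<lambda>x. c"])
    also have "\<dots> = mul (\<lambda>x. c) (fourier_L12 f)"
      unfolding fourier_L12_def by (subst mul_to_l2[OF bounded_symbol_const fourier_integral_square_integrable[OF f]])
        (simp add: fourier_integral_cmult[abs_def])
    finally show "to_l2 f \<in> {v. fourier (mul (\<lambda>x. c) v) = mul (\<lambda>x. c) (fourier v)}"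
      by (simp add: fourier_to_l2[OF f])
  qed
  then show ?thesis by simp
qed

lemma bounded_symbol_phase: "bounded_symbol (\<lambda>\<zeta>. exp (\<i> * complex_of_real (\<zeta> \<bullet> y)))"
  by (rule bsymI[of _ 1]) auto

lemma fourier_integral_translate:
  fixes f :: "real^'n::finite \<Rightarrow> complex"
  assumes [measurable]: "f \<in> borel_measurable borel"
  shows "fourier_integral (\<lambda>x. f (x + y)) \<zeta> = exp (\<i> * complex_of_real (\<zeta> \<bullet> y)) * fourier_integral f \<zeta>"
proof -
  let ?g = "\<lambda>x. exp (- \<i> * complex_of_real (\<zeta> \<bullet> x)) * f x"
  have eq: "exp (- \<i> * complex_of_real (\<zeta> \<bullet> x)) * f (x + y) = exp (\<i> * complex_of_real (\<zeta> \<bullet> y)) * ?g (x + y)" for x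
  proof -
    have "exp (- \<i> * complex_of_real (\<zeta> \<bullet> x)) = exp (\<i> * complex_of_real (\<zeta> \<bullet> y)) * exp (- \<i> * complex_of_real (\<zeta> \<bullet> (x + y)))"
      unfolding exp_add[symmetric] by (simp add: inner_add_right distrib_left)
    then show ?thesis by (simp only: mult.assoc)
  qed
  have "(\<integral>x. exp (- \<i> * complex_of_real (\<zeta> \<bullet> x)) * f (x + y) \<partial>lborel) = exp (\<i> * complex_of_real (\<zeta> \<bullet> y)) * (\<integral>x. ?g (x + y) \<partial>lborel)"
    unfolding eq by (rule integral_mult_right_zero)
  also have "(\<integral>x. ?g (x + y) \<partial>lborel) = (\<integral>x. ?g x \<partial>lborel)"
    by (rule mpres_integral(1)[OF mpres_translate]) measurable
  finally show ?thesis by (simp add: fourier_integral_def)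
qed

lemma fourier_translate:
  "fourier (comp_l2 (\<lambda>x. x + y) v) = mul (\<lambda>\<zeta>. exp (\<i> * complex_of_real (\<zeta> \<bullet> y))) (fourier (v :: (real^'n::finite) l2))"
proof -
  note bl = bounded_linear.continuous_on[OF bounded_linear_mul[OF bounded_symbol_phase]]
  note bc = bounded_linear.continuous_on[OF bounded_linear_comp_l2[OF mpres_translate]]
  let ?S = "{v. fourier (comp_l2 (\<lambda>x. x + y) v) = mul (\<lambda>\<zeta>. exp (\<i> * complex_of_real (\<zeta> \<bullet> y))) (fourier (v :: (real^'n::finite) l2))}"
  have "v \<in> ?S"
  proof (rule l2_closed_L12)
    show "closed ?S" by (intro closed_Collect_eq continuous_intros bl bc)
    fix f :: "real^'n \<Rightarrow> complex" assume f: "L12 f"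
    have fm: "f \<in> borel_measurable borel" and fs: "square_integrable f" using f by (auto simp: L12_def)
    have "fourier (comp_l2 (\<lambda>x. x + y) (to_l2 f)) = fourier_L12 (\<lambda>x. f (x + y))"
      unfolding comp_l2_to_l2[OF mpres_translate fs] by (rule fourier_to_l2[OF L12_mpres[OF f mpres_translate]])
    also have "\<dots> = mul (\<lambda>\<zeta>. exp (\<i> * complex_of_real (\<zeta> \<bullet> y))) (fourier_L12 f)"
      unfolding fourier_L12_def mul_to_l2[OF bounded_symbol_phase fourier_integral_square_integrable[OF f]]
      by (simp add: fourier_integral_translate[OF fm, abs_def])
    finally show "to_l2 f \<in> ?S" by (simp add: fourier_to_l2[OF f])
  qed
  then show ?thesis by simp
qed

text \<open>The multiplication formula, extended from \<open>L12\<close> to L2 one argument at a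
  time.\<close>

lemma bil_fourier: "bil (fourier v) w = bil v (fourier (w :: (real^'n::finite) l2))"
proof -
  note cb = bounded_bilinear.continuous_on[OF bounded_bilinear_bil]
  have B: "bil (fourier v) (to_l2 k) = bil v (fourier_L12 k)" if k: "L12 k" for k
  proof -
    have "v \<in> {v. bil (fourier v) (to_l2 k) = bil v (fourier_L12 k)}"
    proof (rule l2_closed_L12)
      show "closed {v. bil (fourier v) (to_l2 k) = bil v (fourier_L12 k)}"
        by (intro closed_Collect_eq continuous_intros cb)
      fix f :: "real^'n \<Rightarrow> complex" assume f: "L12 f"
      show "to_l2 f \<in> {v. bil (fourier v) (to_l2 k) = bil v (fourier_L12 k)}"
        using f k fourier_integral_mult_formula[of f k]
        by (simp add: fourier_to_l2 fourier_L12_def bil_to_l2 fourier_integral_square_integrable L12_def)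
    qed
    then show ?thesis by simp
  qed
  have "w \<in> {w. bil (fourier v) w = bil v (fourier w)}"
  proof (rule l2_closed_L12)
    show "closed {w. bil (fourier v) w = bil v (fourier w)}"
      by (intro closed_Collect_eq continuous_intros cb)
  qed (simp add: B fourier_to_l2)
  then show ?thesis by simp
qed

section \<open>The free group as a unimodular Fourier multiplier\<close>

definition schsym :: "real \<Rightarrow> 'a::real_normed_vector \<Rightarrow> complex" where
  "schsym a \<zeta> = exp (- \<i> * complex_of_real ((norm \<zeta>)\<^sup>2 * a))"

lemma schsym_measurable [measurable]: "schsym a \<in> borel_measurable (borel :: 'a::euclidean_space measure)"
  unfolding schsym_def[abs_def] by measurable

lemma norm_schsym [simp]: "cmod (schsym a \<zeta>) = 1"
  by (simp add: schsym_def norm_exp_eq_Re)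

lemma bounded_symbol_schsym: "bounded_symbol (schsym a)"
  by (rule bsymI[of _ 1]) auto

text \<open>The description in the definition of \<open>free_group\<close> denotes because the
  transform is bijective.\<close>

lemma fourier_free_group: "fourier (free_group a v) = mul (schsym a) (fourier v)"
proof -
  let ?P = "\<lambda>w. fourier w = mul (schsym a) (fourier v)"
  have "free_group a v = (THE w. ?P w)"
    unfolding free_group_def mul_def schsym_def ..
  also have "?P \<dots>"
  proof (rule theI)
    show "?P (ifourier (mul (schsym a) (fourier v)))" by simp
    show "w = ifourier (mul (schsym a) (fourier v))" if "?P w" for w
      using that by (metis ifourier_fourier)
  qed
  finally show ?thesis .
qed

lemma free_group_eq: "free_group a v = ifourier (mul (schsym a) (fourier v))"
  by (metis fourier_free_group ifourier_fourier)

lemma norm_free_group [simp]: "norm (free_group a v) = norm v"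
  by (simp add: free_group_eq norm_mul_unimodular)

lemma bounded_linear_free_group: "bounded_linear (free_group a)"
  unfolding free_group_eq[abs_def]
  by (intro bounded_linear_compose[OF bounded_linear_ifourier] bounded_linear_compose[OF bounded_linear_mul]
      bounded_linear_fourier bounded_symbol_schsym)

lemma free_group_free_group:
  fixes v :: "(real^'n::finite) l2"
  shows "free_group a (free_group b v) = free_group (a + b) v"
proof -
  have "(\<lambda>\<zeta> :: real^'n. schsym a \<zeta> * schsym b \<zeta>) = schsym (a + b)"
    by (auto simp: schsym_def distrib_left exp_add[symmetric] algebra_simps)
  then have "fourier (free_group a (free_group b v)) = fourier (free_group (a + b) v)"
    by (simp add: fourier_free_group mul_mul bounded_symbol_schsym)
  then show ?thesis by (simp add: fourier_eq_iff)
qed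

lemma free_group_0 [simp]: "free_group 0 v = v"
  by (simp add: free_group_eq schsym_def[abs_def] mul_one)

lemma free_group_mul_const: "free_group a (mul (\<lambda>x. c) v) = mul (\<lambda>x. c) (free_group a v)"
proof -
  have "fourier (free_group a (mul (\<lambda>x. c) v)) = fourier (mul (\<lambda>x. c) (free_group a v))"
    by (simp add: fourier_free_group fourier_mul_const mul_mul bounded_symbol_schsym mult.commute)
  then show ?thesis by (simp add: fourier_eq_iff)
qed

text \<open>Joint strong continuity; in the time parameter alone the group is not norm continuous on
  L2, so the argument goes through the pointwise convergence of the symbols.\<close>

lemma free_group_tendsto:
  assumes "a \<longlonglongrightarrow> b" "v \<longlonglongrightarrow> w"
  shows "(\<lambda>j. free_group (a j) (v j)) \<longlonglongrightarrow> free_group b w"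
  unfolding free_group_eq
proof (rule bounded_linear.tendsto[OF bounded_linear_ifourier], rule mul_tendsto[where c = 1])
  show "(\<lambda>j. schsym (a j) x) \<longlonglongrightarrow> schsym b x" for x :: "real^'a"
    unfolding schsym_def by (intro tendsto_intros assms)
  show "(\<lambda>j. fourier (v j)) \<longlonglongrightarrow> fourier w"
    by (rule bounded_linear.tendsto[OF bounded_linear_fourier assms(2)])
qed auto

lemma continuous_on_free_group [continuous_intros]:
  fixes f :: "'b::metric_space \<Rightarrow> real"
  assumes "continuous_on S f" "continuous_on S g"
  shows "continuous_on S (\<lambda>x. free_group (f x) (g x))"
  unfolding continuous_on_sequentially comp_def
proof (intro allI ballI impI, elim conjE)
  fix x a assume x: "\<forall>n. x n \<in> S" and a: "a \<in> S" and l: "x \<longlonglongrightarrow> a"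
  have "(\<lambda>n. f (x n)) \<longlonglongrightarrow> f a" "(\<lambda>n. g (x n)) \<longlonglongrightarrow> g a"
    using assms x a l unfolding continuous_on_sequentially comp_def by simp_all
  then show "(\<lambda>n. free_group (f (x n)) (g (x n))) \<longlonglongrightarrow> free_group (f a) (g a)"
    by (rule free_group_tendsto)
qed

section \<open>Sobolev spaces in Fourier variables\<close>

definition bra :: "'a::real_normed_vector \<Rightarrow> real" where
  "bra \<zeta> = sqrt (1 + (norm \<zeta>)\<^sup>2)"

lemma bra_sq: "(bra \<zeta>)\<^sup>2 = 1 + (norm \<zeta>)\<^sup>2"
  by (simp add: bra_def)

lemma bra_ge1: "1 \<le> bra \<zeta>"
  by (simp add: bra_def)

lemma bra_nonneg [simp]: "0 \<le> bra \<zeta>"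
  using bra_ge1[of \<zeta>] by linarith

lemma bra_measurable [measurable]: "bra \<in> borel_measurable (borel :: 'a::euclidean_space measure)"
  unfolding bra_def[abs_def] by measurable

definition brapow :: "nat \<Rightarrow> 'a::real_normed_vector \<Rightarrow> complex" where
  "brapow k \<zeta> = complex_of_real (bra \<zeta> ^ k)"

lemma brapow_measurable [measurable]: "brapow k \<in> borel_measurable (borel :: 'a::euclidean_space measure)"
  unfolding brapow_def[abs_def] by measurable

lemma cmod_brapow [simp]: "cmod (brapow k \<zeta>) = bra \<zeta> ^ k"
  unfolding brapow_def norm_of_real by (rule abs_of_nonneg) simp

text \<open>Sobolev regularity is measured by the weight \<open>bra \<zeta> ^ k\<close> on the Fourier side; it is
  compared with the norm of the statement only at the end.\<close>

definition Hs :: "nat \<Rightarrow> (real^'n::finite) l2 set" where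
  "Hs k = {v. square_integrable (\<lambda>\<zeta>. brapow k \<zeta> * fun_l2 (fourier v) \<zeta>)}"

definition wfourier :: "nat \<Rightarrow> (real^'n::finite) l2 \<Rightarrow> (real^'n) l2" where
  "wfourier k v = mul (brapow k) (fourier v)"

definition hs_norm :: "nat \<Rightarrow> (real^'n::finite) l2 \<Rightarrow> real" where
  "hs_norm k v = norm (wfourier k v)"

lemma hs_norm_nonneg [simp]: "0 \<le> hs_norm k v" by (simp add: hs_norm_def)

lemma fun_l2_wfourier: "v \<in> Hs k \<Longrightarrow> AE \<zeta> in lborel. fun_l2 (wfourier k v) \<zeta> = brapow k \<zeta> * fun_l2 (fourier v) \<zeta>"
  unfolding wfourier_def mul_def by (rule fun_l2_to_l2) (simp add: Hs_def)

text \<open>A formula for the weighted transform that holds almost everywhere gives membership and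
  identifies \<open>wfourier\<close> at the same time; outside \<open>Hs k\<close> the latter is a
  dummy value.\<close>

lemma Hs_eqI:
  assumes "AE \<zeta> in lborel. fun_l2 u \<zeta> = brapow k \<zeta> * fun_l2 (fourier v) \<zeta>"
  shows "v \<in> Hs k" "wfourier k v = u"
proof -
  have s: "square_integrable (\<lambda>\<zeta>. brapow k \<zeta> * fun_l2 (fourier v) \<zeta>)"
  proof (rule square_integrable_bound[OF _ square_integrable_fun_l2])
    show "AE \<zeta> in lborel. cmod (brapow k \<zeta> * fun_l2 (fourier v) \<zeta>) \<le> 1 * cmod (fun_l2 u \<zeta>)"
      using assms by eventually_elim simp
  qed measurable
  then show "v \<in> Hs k" by (simp add: Hs_def)
  show "wfourier k v = u" unfolding wfourier_def mul_def
    by (rule to_l2_eqI[OF s]) (use assms in eventually_elim, simp)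
qed

lemma Hs_add:
  assumes "v \<in> Hs k" "w \<in> Hs k"
  shows "v + w \<in> Hs k" "wfourier k (v + w) = wfourier k v + wfourier k w"
proof -
  have *: "AE \<zeta> in lborel. fun_l2 (wfourier k v + wfourier k w) \<zeta> = brapow k \<zeta> * fun_l2 (fourier (v + w)) \<zeta>"
    using fun_l2_wfourier[OF assms(1)] fun_l2_wfourier[OF assms(2)] fun_l2_add[of "wfourier k v" "wfourier k w"]
      fun_l2_add[of "fourier v" "fourier w"]
    by eventually_elim (simp add: fourier_add distrib_left)
  show "v + w \<in> Hs k" "wfourier k (v + w) = wfourier k v + wfourier k w"
    using Hs_eqI[OF *] by auto
qed

lemma Hs_mul_const:
  assumes "v \<in> Hs k"
  shows "mul (\<lambda>x. c) v \<in> Hs k" "wfourier k (mul (\<lambda>x. c) v) = mul (\<lambda>x. c) (wfourier k v)"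
proof -
  have *: "AE \<zeta> in lborel. fun_l2 (mul (\<lambda>x. c) (wfourier k v)) \<zeta> = brapow k \<zeta> * fun_l2 (fourier (mul (\<lambda>x. c) v)) \<zeta>"
    using fun_l2_wfourier[OF assms(1)] fun_l2_mul[OF bounded_symbol_const, of c "wfourier k v"]
      fun_l2_mul[OF bounded_symbol_const, of c "fourier v"]
    by eventually_elim (simp add: fourier_mul_const)
  show "mul (\<lambda>x. c) v \<in> Hs k" "wfourier k (mul (\<lambda>x. c) v) = mul (\<lambda>x. c) (wfourier k v)"
    using Hs_eqI[OF *] by auto
qed

lemma norm_mul_const: "norm (mul (\<lambda>x. c) v) = cmod c * norm v"
proof (rule antisym)
  show "norm (mul (\<lambda>x. c) v) \<le> cmod c * norm v" by (rule norm_mul_le) auto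
  show "cmod c * norm v \<le> norm (mul (\<lambda>x. c) v)"
  proof (cases "c = 0")
    case False
    have "norm v = norm (mul (\<lambda>x. inverse c) (mul (\<lambda>x. c) v))"
      using False by (simp add: mul_mul mul_one)
    also have "\<dots> \<le> cmod (inverse c) * norm (mul (\<lambda>x. c) v)" by (rule norm_mul_le) auto
    finally show ?thesis using False by (simp add: norm_divide field_simps)
  qed simp
qed

lemma hs_norm_mul_const: "v \<in> Hs k \<Longrightarrow> hs_norm k (mul (\<lambda>x. c) v) = cmod c * hs_norm k v"
  by (simp add: hs_norm_def Hs_mul_const norm_mul_const)

lemma Hs_scaleR:
  assumes "v \<in> Hs k"
  shows "r *\<^sub>R v \<in> Hs k" "wfourier k (r *\<^sub>R v) = r *\<^sub>R wfourier k v"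
  using Hs_mul_const[OF assms, of "of_real r"] by (simp_all add: mul_of_real)

lemma Hs_diff:
  assumes "v \<in> Hs k" "w \<in> Hs k"
  shows "v - w \<in> Hs k" "wfourier k (v - w) = wfourier k v - wfourier k w"
  using Hs_add[OF assms(1) Hs_scaleR(1)[OF assms(2), of "-1"]] Hs_scaleR(2)[OF assms(2), of "-1"] by simp_all

lemma hs_norm_triangle: "v \<in> Hs k \<Longrightarrow> w \<in> Hs k \<Longrightarrow> hs_norm k (v + w) \<le> hs_norm k v + hs_norm k w"
  by (simp add: hs_norm_def Hs_add norm_triangle_ineq)

lemma hs_norm_triangle_diff: "v \<in> Hs k \<Longrightarrow> w \<in> Hs k \<Longrightarrow> hs_norm k (v - w) \<le> hs_norm k v + hs_norm k w"
  by (simp add: hs_norm_def Hs_diff norm_triangle_ineq4)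

lemma Hs_0 [simp]: "v \<in> Hs 0" and wfourier_0 [simp]: "wfourier 0 v = fourier v" and hs_norm_0 [simp]: "hs_norm 0 v = norm v"
  by (simp_all add: Hs_def hs_norm_def wfourier_def brapow_def[abs_def] square_integrable_fun_l2 mul_one)

lemma fourier_zero [simp]: "fourier (0 :: (real^'n::finite) l2) = 0"
  using fourier_scaleR[of 0 "0 :: (real^'n) l2"] by simp

lemma zero_Hs [simp]: "0 \<in> Hs k" and wfourier_zero [simp]: "wfourier k 0 = 0" and hs_norm_zero [simp]: "hs_norm k 0 = 0"
proof -
  have *: "AE \<zeta> in lborel. fun_l2 0 \<zeta> = brapow k \<zeta> * fun_l2 (fourier 0) \<zeta>"
    using fun_l2_zero unfolding fourier_zero by eventually_elim simp
  show "0 \<in> Hs k" "wfourier k 0 = 0" "hs_norm k 0 = 0" using Hs_eqI[OF *] by (auto simp: hs_norm_def)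
qed

lemma Hs_sum:
  assumes "\<And>i. i \<in> I \<Longrightarrow> v i \<in> Hs k"
  shows "(\<Sum>i\<in>I. v i) \<in> Hs k \<and> hs_norm k (\<Sum>i\<in>I. v i) \<le> (\<Sum>i\<in>I. hs_norm k (v i))"
  using assms
proof (induction I rule: infinite_finite_induct)
  case (insert i I)
  then show ?case using hs_norm_triangle[of "v i" k "sum v I"] Hs_add(1)[of "v i" k "sum v I"] by auto
qed auto

text \<open>A pointwise bound for transforms that grows like the weight to the power
  \<open>j\<close> costs \<open>j\<close> derivatives. The losses of the group differences below are
  all counted through this lemma.\<close>

lemma Hs_dominated:
  assumes v: "v \<in> Hs (k + j)" and c: "0 \<le> c"
    and le: "AE \<zeta> in lborel. cmod (fun_l2 (fourier w) \<zeta>) \<le> c * bra \<zeta> ^ j * cmod (fun_l2 (fourier v) \<zeta>)"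
  shows "w \<in> Hs k" "hs_norm k w \<le> c * hs_norm (k + j) v"
proof -
  let ?f = "\<lambda>\<zeta>. brapow k \<zeta> * fun_l2 (fourier w) \<zeta>"
  let ?g = "\<lambda>\<zeta>. brapow (k + j) \<zeta> * fun_l2 (fourier v) \<zeta>"
  have sg: "square_integrable ?g" using v by (simp add: Hs_def)
  have b: "AE \<zeta> in lborel. cmod (?f \<zeta>) \<le> c * cmod (?g \<zeta>)"
    using le
  proof eventually_elim
    case (elim \<zeta>)
    have "bra \<zeta> ^ k * cmod (fun_l2 (fourier w) \<zeta>) \<le> bra \<zeta> ^ k * (c * bra \<zeta> ^ j * cmod (fun_l2 (fourier v) \<zeta>))"
      by (rule mult_left_mono[OF elim]) simp
    then show ?case by (simp add: norm_mult power_add mult_ac)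
  qed
  have sf: "square_integrable ?f" by (rule square_integrable_bound[OF _ sg b]) measurable
  then show "w \<in> Hs k" by (simp add: Hs_def)
  show "hs_norm k w \<le> c * hs_norm (k + j) v"
    unfolding hs_norm_def wfourier_def mul_def by (rule norm_to_l2_mono[OF sf sg c b])
qed

lemma Hs_mono:
  assumes "k \<le> l" "v \<in> Hs l" shows "v \<in> Hs k" "hs_norm k v \<le> hs_norm l v"
proof -
  have v: "v \<in> Hs (k + (l - k))" using assms by simp
  have "AE \<zeta> in lborel. cmod (fun_l2 (fourier v) \<zeta>) \<le> 1 * bra \<zeta> ^ (l - k) * cmod (fun_l2 (fourier v) \<zeta>)"
  proof (rule AE_I2)
    fix \<zeta> :: "real^'a"
    show "cmod (fun_l2 (fourier v) \<zeta>) \<le> 1 * bra \<zeta> ^ (l - k) * cmod (fun_l2 (fourier v) \<zeta>)"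
      using mult_right_mono[OF one_le_power[OF bra_ge1, of \<zeta> "l - k"], of "cmod (fun_l2 (fourier v) \<zeta>)"] by simp
  qed
  from Hs_dominated[OF v _ this] show "v \<in> Hs k" "hs_norm k v \<le> hs_norm l v" using assms by auto
qed

lemma norm_le_hs_norm: "v \<in> Hs k \<Longrightarrow> norm v \<le> hs_norm k v"
  using Hs_mono[of 0 k v] by simp

lemma free_group_Hs:
  assumes "v \<in> Hs k"
  shows "free_group a v \<in> Hs k" "wfourier k (free_group a v) = mul (schsym a) (wfourier k v)" "hs_norm k (free_group a v) = hs_norm k v"
proof -
  have *: "AE \<zeta> in lborel. fun_l2 (mul (schsym a) (wfourier k v)) \<zeta> = brapow k \<zeta> * fun_l2 (fourier (free_group a v)) \<zeta>"
    using fun_l2_wfourier[OF assms(1)] fun_l2_mul[OF bounded_symbol_schsym, of a "wfourier k v"]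
      fun_l2_mul[OF bounded_symbol_schsym, of a "fourier v"]
    by eventually_elim (simp add: fourier_free_group)
  show "free_group a v \<in> Hs k" "wfourier k (free_group a v) = mul (schsym a) (wfourier k v)"
    using Hs_eqI[OF *] by auto
  then show "hs_norm k (free_group a v) = hs_norm k v" by (simp add: hs_norm_def norm_mul_unimodular)
qed

section \<open>First and second differences of the free group\<close>

lemma cmod_iexp_minus_1: "cmod (iexp x - 1) \<le> \<bar>x\<bar>"
  using iexp_approx1[of x 0] by simp

text \<open>The exponential minus 1 is bounded by its phase, which is quadratic in the frequency:
  order one in \<open>a\<close> costs two derivatives.\<close>

lemma free_group_diff_Hs:
  assumes "v \<in> Hs (k + 2)"
  shows "free_group a v - v \<in> Hs k" "hs_norm k (free_group a v - v) \<le> \<bar>a\<bar> * hs_norm (k + 2) v"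
proof -
  have "AE \<zeta> in lborel. cmod (fun_l2 (fourier (free_group a v - v)) \<zeta>) \<le> \<bar>a\<bar> * bra \<zeta> ^ 2 * cmod (fun_l2 (fourier v) \<zeta>)"
    using fun_l2_diff[of "fourier (free_group a v)" "fourier v"] fun_l2_mul[OF bounded_symbol_schsym, of a "fourier v"]
  proof eventually_elim
    case (elim \<zeta>)
    have "fun_l2 (fourier (free_group a v - v)) \<zeta> = (iexp (- ((norm \<zeta>)\<^sup>2 * a)) - 1) * fun_l2 (fourier v) \<zeta>"
      using elim by (simp add: fourier_diff fourier_free_group schsym_def algebra_simps)
    moreover have "cmod (iexp (- ((norm \<zeta>)\<^sup>2 * a)) - 1) \<le> \<bar>a\<bar> * bra \<zeta> ^ 2"
      by (rule order_trans[OF cmod_iexp_minus_1]) (simp add: abs_mult bra_sq mult.commute mult_left_mono)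
    ultimately show ?case by (simp add: norm_mult mult_right_mono)
  qed
  from Hs_dominated[OF assms _ this] show "free_group a v - v \<in> Hs k" "hs_norm k (free_group a v - v) \<le> \<bar>a\<bar> * hs_norm (k + 2) v"
    by auto
qed

lemma cmod_iexp_second_diff: "cmod (iexp x + iexp (- x) - 2) \<le> x\<^sup>2"
proof -
  have "iexp x + iexp (- x) - 2 = iexp (- x) * (iexp x - 1)\<^sup>2"
  proof -
    have "a + b - 2 = b * (a - 1)\<^sup>2" if "a * b = 1" for a b :: complex
    proof -
      have "b * (a - 1)\<^sup>2 = (a * b) * a - 2 * (a * b) + b" by (simp add: power2_eq_square algebra_simps)
      then show ?thesis using that by simp
    qed
    moreover have "iexp x * iexp (- x) = 1" by (simp flip: exp_add)
    ultimately show ?thesis by blast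
  qed
  then have "cmod (iexp x + iexp (- x) - 2) = (cmod (iexp x - 1))\<^sup>2"
    by (simp only: norm_mult norm_power norm_exp_i_times mult_1)
  also have "\<dots> \<le> \<bar>x\<bar>\<^sup>2" by (rule power_mono[OF cmod_iexp_minus_1]) simp
  finally show ?thesis by simp
qed

text \<open>In the symmetric second difference the terms odd in \<open>a\<close> cancel on the
  symbol. Order two in \<open>a\<close> costs the square of a quadratic phase, hence four
  derivatives; this is the origin of the number 4 in the theorem.\<close>

lemma free_group_second_diff_Hs:
  assumes "v \<in> Hs (k + 4)"
  shows "free_group a v + free_group (- a) v - 2 *\<^sub>R v \<in> Hs k"
    "hs_norm k (free_group a v + free_group (- a) v - 2 *\<^sub>R v) \<le> a\<^sup>2 * hs_norm (k + 4) v"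
proof -
  let ?w = "free_group a v + free_group (- a) v - 2 *\<^sub>R v"
  have "AE \<zeta> in lborel. cmod (fun_l2 (fourier ?w) \<zeta>) \<le> a\<^sup>2 * bra \<zeta> ^ 4 * cmod (fun_l2 (fourier v) \<zeta>)"
    using fun_l2_diff[of "fourier (free_group a v) + fourier (free_group (- a) v)" "2 *\<^sub>R fourier v"]
      fun_l2_add[of "fourier (free_group a v)" "fourier (free_group (- a) v)"] fun_l2_scaleR[of 2 "fourier v"]
      fun_l2_mul[OF bounded_symbol_schsym, of a "fourier v"] fun_l2_mul[OF bounded_symbol_schsym, of "- a" "fourier v"]
  proof eventually_elim
    case (elim \<zeta>)
    let ?x = "(norm \<zeta>)\<^sup>2 * a"
    have "fun_l2 (fourier ?w) \<zeta> = (iexp ?x + iexp (- ?x) - 2) * fun_l2 (fourier v) \<zeta>"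
      using elim by (simp add: fourier_diff fourier_add fourier_scaleR fourier_free_group schsym_def algebra_simps scaleR_conv_of_real)
    moreover have "cmod (iexp ?x + iexp (- ?x) - 2) \<le> a\<^sup>2 * bra \<zeta> ^ 4"
    proof (rule order_trans[OF cmod_iexp_second_diff])
      have "((norm \<zeta>)\<^sup>2)\<^sup>2 \<le> ((bra \<zeta>)\<^sup>2)\<^sup>2" by (rule power_mono) (auto simp: bra_sq)
      then have "((norm \<zeta>)\<^sup>2)\<^sup>2 \<le> bra \<zeta> ^ 4" by simp
      then show "?x\<^sup>2 \<le> a\<^sup>2 * bra \<zeta> ^ 4" unfolding power_mult_distrib by (simp only: mult.commute mult_left_mono zero_le_power2)
    qed
    ultimately show ?case by (simp add: norm_mult mult_right_mono)
  qed
  from Hs_dominated[OF assms _ this] show "?w \<in> Hs k" "hs_norm k ?w \<le> a\<^sup>2 * hs_norm (k + 4) v"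
    by auto
qed

text \<open>A substitute for \<open>wfourier\<close> that is bounded on L2 and hence continuous
  there. It carries norm bounds to L2 limits and gives measurability.\<close>

definition wfourier_trunc :: "nat \<Rightarrow> nat \<Rightarrow> (real^'n::finite) l2 \<Rightarrow> (real^'n) l2" where
  "wfourier_trunc k R v = mul (\<lambda>\<zeta>. indicator (ball 0 (real R)) \<zeta> * brapow k \<zeta>) (fourier v)"

lemma bounded_symbol_trunc: "bounded_symbol (\<lambda>\<zeta>. indicator (ball 0 (real R)) \<zeta> * brapow k \<zeta> :: complex)"
proof (rule bsymI[of _ "sqrt (1 + (real R)\<^sup>2) ^ k"])
  fix \<zeta> :: 'a
  have "bra \<zeta> ^ k \<le> sqrt (1 + (real R)\<^sup>2) ^ k" if "norm \<zeta> < real R"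
    using that by (intro power_mono) (auto simp: bra_def intro!: power_mono)
  then show "cmod (indicator (ball 0 (real R)) \<zeta> * brapow k \<zeta>) \<le> sqrt (1 + (real R)\<^sup>2) ^ k"
    by (simp add: indicator_def norm_mult)
qed (intro borel_measurable_times borel_measurable_indicator, auto)

lemma bounded_linear_wfourier_trunc: "bounded_linear (wfourier_trunc k R)"
  unfolding wfourier_trunc_def[abs_def]
  by (rule bounded_linear_compose[OF bounded_linear_mul[OF bounded_symbol_trunc] bounded_linear_fourier])

lemma wfourier_trunc_wfourier: "v \<in> Hs k \<Longrightarrow> wfourier_trunc k R v = mul (\<lambda>x. indicator (ball 0 (real R)) x) (wfourier k v)"
proof -
  assume v: "v \<in> Hs k"
  show ?thesis
    unfolding wfourier_trunc_def
    by (rule l2_eqI, use fun_l2_wfourier[OF v] fun_l2_mul[OF bounded_symbol_trunc, of R k "fourier v"]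
        fun_l2_mul[OF bounded_symbol_indicator_ball, of "real R" "wfourier k v"] in eventually_elim) simp
qed

lemma wfourier_trunc_tendsto: "v \<in> Hs k \<Longrightarrow> (\<lambda>R. wfourier_trunc k R v) \<longlonglongrightarrow> wfourier k v"
  by (simp add: wfourier_trunc_wfourier truncation_tendsto filterlim_real_sequentially)

lemma norm_wfourier_trunc_le: assumes "v \<in> Hs k" shows "norm (wfourier_trunc k R v) \<le> hs_norm k v"
proof -
  have "norm (wfourier_trunc k R v) \<le> 1 * norm (wfourier k v)"
    unfolding wfourier_trunc_wfourier[OF assms]
  proof (rule norm_mul_le)
    show "(\<lambda>x. indicator (ball 0 (real R)) x) \<in> borel_measurable borel"
      by (rule borel_measurable_indicator) simp
  qed (simp add: indicator_def)
  then show ?thesis by (simp add: hs_norm_def)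
qed

text \<open>Fatou's lemma over growing balls of frequencies: a uniform bound for the truncated norms
  yields membership as well as the bound.\<close>

lemma Hs_wfourier_trunc_bound:
  assumes "\<And>R. norm (wfourier_trunc k R v) \<le> B"
  shows "v \<in> Hs k" "hs_norm k v \<le> B"
proof -
  have B: "0 \<le> B" using assms norm_ge_zero order_trans by blast
  let ?f = "\<lambda>\<zeta>. brapow k \<zeta> * fun_l2 (fourier v) \<zeta>"
  define g where "g R \<zeta> = indicator (ball 0 (real R)) \<zeta> * brapow k \<zeta> * fun_l2 (fourier v) \<zeta>" for R \<zeta>
  have sg: "square_integrable (g R)" for R unfolding g_def by (rule square_integrable_mul[OF bounded_symbol_trunc])
  note [measurable] = square_integrable_measurable[OF sg]
  have lim: "(\<lambda>R. ennreal ((cmod (g R \<zeta>))\<^sup>2)) \<longlonglongrightarrow> ennreal ((cmod (?f \<zeta>))\<^sup>2)" for \<zeta> :: "real^'a"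
  proof (rule tendsto_eventually)
    have "eventually (\<lambda>R. real R > norm \<zeta>) sequentially"
      using filterlim_real_sequentially by (auto simp: filterlim_at_top_dense)
    then show "eventually (\<lambda>R. ennreal ((cmod (g R \<zeta>))\<^sup>2) = ennreal ((cmod (?f \<zeta>))\<^sup>2)) sequentially"
      by eventually_elim (simp add: indicator_def g_def)
  qed
  have "(\<integral>\<^sup>+\<zeta>. ennreal ((cmod (?f \<zeta>))\<^sup>2) \<partial>lborel) = (\<integral>\<^sup>+\<zeta>. liminf (\<lambda>R. ennreal ((cmod (g R \<zeta>))\<^sup>2)) \<partial>lborel)"
    by (rule nn_integral_cong) (rule lim_imp_Liminf[OF sequentially_bot lim, symmetric])
  also have "\<dots> \<le> liminf (\<lambda>R. \<integral>\<^sup>+\<zeta>. ennreal ((cmod (g R \<zeta>))\<^sup>2) \<partial>lborel)"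
    by (rule nn_integral_liminf) measurable
  also have "\<dots> = liminf (\<lambda>R. ennreal ((norm (wfourier_trunc k R v))\<^sup>2))"
    unfolding nn_norm_to_l2[OF sg] by (simp add: wfourier_trunc_def mul_def g_def[abs_def])
  also have "\<dots> \<le> liminf (\<lambda>R::nat. ennreal (B\<^sup>2))"
    by (intro Liminf_mono always_eventually allI ennreal_leI power_mono assms) simp
  finally have *: "(\<integral>\<^sup>+\<zeta>. ennreal ((cmod (?f \<zeta>))\<^sup>2) \<partial>lborel) \<le> ennreal (B\<^sup>2)"
    by (simp add: Liminf_const)
  then have sf: "square_integrable ?f"
    unfolding square_integrable_iff_nn by (auto intro: le_less_trans)
  then show "v \<in> Hs k" by (simp add: Hs_def)
  have "ennreal ((hs_norm k v)\<^sup>2) \<le> ennreal (B\<^sup>2)"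
    using * nn_norm_to_l2[OF sf] by (simp add: hs_norm_def wfourier_def mul_def)
  then have "(hs_norm k v)\<^sup>2 \<le> B\<^sup>2" by (simp add: ennreal_le_iff)
  then show "hs_norm k v \<le> B" by (rule power2_le_imp_le) (rule B)
qed

text \<open>Lower semicontinuity of the Sobolev norm under mere L2 convergence: each truncated norm
  is continuous, and the full norm is bounded by their common bound.\<close>

lemma Hs_limit:
  assumes "v \<longlonglongrightarrow> w" "\<And>j. v j \<in> Hs k" "\<And>j. hs_norm k (v j) \<le> B"
  shows "w \<in> Hs k" "hs_norm k w \<le> B"
proof -
  have "norm (wfourier_trunc k R w) \<le> B" for R
  proof (rule LIMSEQ_le_const2)
    show "(\<lambda>j. norm (wfourier_trunc k R (v j))) \<longlonglongrightarrow> norm (wfourier_trunc k R w)"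
      by (intro tendsto_norm bounded_linear.tendsto[OF bounded_linear_wfourier_trunc] assms)
    show "\<exists>N. \<forall>n\<ge>N. norm (wfourier_trunc k R (v n)) \<le> B"
      using norm_wfourier_trunc_le[OF assms(2)] assms(3) order_trans by blast
  qed
  then show "w \<in> Hs k" "hs_norm k w \<le> B" using Hs_wfourier_trunc_bound by blast+
qed

text \<open>Difference quotients along the fixed null sequence \<open>1 / (j + 1)\<close>, so that no limit in a
  continuous parameter is needed.\<close>

definition has_dir :: "'n::finite \<Rightarrow> (real^'n) l2 \<Rightarrow> (real^'n) l2 \<Rightarrow> bool" where
  "has_dir i v w \<longleftrightarrow>
     (\<lambda>j. real (Suc j) *\<^sub>R (comp_l2 (\<lambda>x. x + axis i (inverse (real (Suc j)))) v - v)) \<longlonglongrightarrow> w"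

text \<open>The Fourier symbol of the difference quotient with step
  \<open>1 / (j + 1)\<close>.\<close>

definition diffq :: "nat \<Rightarrow> real \<Rightarrow> complex" where
  "diffq j \<theta> = complex_of_real (real (Suc j)) * (iexp (\<theta> * inverse (real (Suc j))) - 1)"

lemma cmod_diffq: "cmod (diffq j \<theta>) \<le> \<bar>\<theta>\<bar>"
proof -
  have "cmod (diffq j \<theta>) \<le> real (Suc j) * \<bar>\<theta> * inverse (real (Suc j))\<bar>"
    unfolding diffq_def norm_mult norm_of_real by (intro mult_mono cmod_iexp_minus_1) auto
  also have "\<dots> = \<bar>\<theta>\<bar>" by (simp add: abs_mult)
  finally show ?thesis .
qed

lemma cmod_iexp_first_order: "cmod (iexp x - 1 - \<i> * complex_of_real x) \<le> x\<^sup>2"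
proof -
  have "cmod (iexp x - (1 + \<i> * complex_of_real x)) * 2 \<le> x\<^sup>2"
    using iexp_approx1[of x 1] by (simp add: numeral_2_eq_2)
  then show ?thesis
    using norm_ge_zero[of "iexp x - (1 + \<i> * complex_of_real x)"] unfolding diff_diff_eq by linarith
qed

lemma diffq_tendsto: "(\<lambda>j. diffq j \<theta>) \<longlonglongrightarrow> \<i> * complex_of_real \<theta>"
proof (rule LIM_zero_cancel, rule Lim_null_comparison)
  have "cmod (diffq j \<theta> - \<i> * complex_of_real \<theta>) \<le> \<theta>\<^sup>2 * inverse (real (Suc j))" for j
  proof -
    let ?x = "\<theta> * inverse (real (Suc j))"
    have "real (Suc j) * ?x = \<theta>" by simp
    then have "\<i> * complex_of_real \<theta> = complex_of_real (real (Suc j)) * (\<i> * complex_of_real ?x)"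
      by (metis mult.left_commute of_real_mult)
    then have "diffq j \<theta> - \<i> * complex_of_real \<theta> = complex_of_real (real (Suc j)) * (iexp ?x - 1 - \<i> * complex_of_real ?x)"
      unfolding diffq_def by (simp only: right_diff_distrib)
    then have "cmod (diffq j \<theta> - \<i> * complex_of_real \<theta>) = real (Suc j) * cmod (iexp ?x - 1 - \<i> * complex_of_real ?x)"
      by (simp only: norm_mult norm_of_real)
    also have "cmod (iexp ?x - 1 - \<i> * complex_of_real ?x) \<le> ?x\<^sup>2"
      by (rule cmod_iexp_first_order)
    also have "real (Suc j) * ?x\<^sup>2 = \<theta>\<^sup>2 * inverse (real (Suc j))" by (simp add: power2_eq_square)
    finally show ?thesis by (simp add: mult_left_mono)
  qed
  then show "\<forall>\<^sub>F j in sequentially. norm (diffq j \<theta> - \<i> * complex_of_real \<theta>) \<le> \<theta>\<^sup>2 * inverse (real (Suc j))" by simp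
  have "(\<lambda>j. \<theta>\<^sup>2 * inverse (real (Suc j))) \<longlonglongrightarrow> \<theta>\<^sup>2 * 0"
    by (intro tendsto_mult tendsto_const LIMSEQ_inverse_real_of_nat)
  then show "(\<lambda>j. \<theta>\<^sup>2 * inverse (real (Suc j))) \<longlonglongrightarrow> 0" by simp
qed

lemma fourier_diffq:
  "AE \<zeta> in lborel. fun_l2 (fourier (real (Suc j) *\<^sub>R (comp_l2 (\<lambda>x. x + axis i (inverse (real (Suc j)))) v - v))) \<zeta>
     = diffq j (\<zeta> $ i) * fun_l2 (fourier v) \<zeta>"
  using fun_l2_scaleR[of "real (Suc j)" "fourier (comp_l2 (\<lambda>x. x + axis i (inverse (real (Suc j)))) v) - fourier v"]
    fun_l2_diff[of "fourier (comp_l2 (\<lambda>x. x + axis i (inverse (real (Suc j)))) v)" "fourier v"]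
    fun_l2_mul[OF bounded_symbol_phase, of "axis i (inverse (real (Suc j)))" "fourier v"]
proof eventually_elim
  case (elim \<zeta>)
  have "\<zeta> \<bullet> axis i (inverse (real (Suc j))) = \<zeta> $ i * inverse (real (Suc j))"
    by (simp add: inner_axis)
  then show ?case
    unfolding fourier_scaleR fourier_diff elim(1) elim(2) elim(3)[folded fourier_translate]
    by (simp add: diffq_def scaleR_conv_of_real right_diff_distrib left_diff_distrib mult.assoc del: of_nat_Suc)
qed

text \<open>From left to right the limit is identified along a subsequence that converges almost
  everywhere. From right to left the symbols are bounded by the modulus of their limit, so the
  transform of \<open>w\<close> itself dominates the sequence.\<close>

lemma has_dir_iff:
  "has_dir i v w \<longleftrightarrow> (AE \<zeta> in lborel. fun_l2 (fourier w) \<zeta> = \<i> * complex_of_real (\<zeta> $ i) * fun_l2 (fourier v) \<zeta>)"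
proof
  let ?d = "\<lambda>j. real (Suc j) *\<^sub>R (comp_l2 (\<lambda>x. x + axis i (inverse (real (Suc j)))) v - v)"
  have all: "AE \<zeta> in lborel. \<forall>j. fun_l2 (fourier (?d j)) \<zeta> = diffq j (\<zeta> $ i) * fun_l2 (fourier v) \<zeta>"
    using fourier_diffq[of _ i v] by (simp add: AE_all_countable)
  {
    assume "has_dir i v w"
    then have "(\<lambda>j. fourier (?d j)) \<longlonglongrightarrow> fourier w"
      unfolding has_dir_def by (rule bounded_linear.tendsto[OF bounded_linear_fourier])
    from l2_tendsto_AE_subseq[OF this] obtain r where r: "strict_mono r"
      "AE \<zeta> in lborel. (\<lambda>j. fun_l2 (fourier (?d (r j))) \<zeta>) \<longlonglongrightarrow> fun_l2 (fourier w) \<zeta>" by blast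
    from r(2) all show "AE \<zeta> in lborel. fun_l2 (fourier w) \<zeta> = \<i> * complex_of_real (\<zeta> $ i) * fun_l2 (fourier v) \<zeta>"
    proof eventually_elim
      case (elim \<zeta>)
      have "(\<lambda>j. diffq (r j) (\<zeta> $ i) * fun_l2 (fourier v) \<zeta>) \<longlonglongrightarrow> \<i> * complex_of_real (\<zeta> $ i) * fun_l2 (fourier v) \<zeta>"
        using LIMSEQ_subseq_LIMSEQ[OF diffq_tendsto r(1), of "\<zeta> $ i"]
        by (intro tendsto_mult tendsto_const) (simp add: comp_def)
      with elim show ?case using LIMSEQ_unique by auto
    qed
  }
  assume w: "AE \<zeta> in lborel. fun_l2 (fourier w) \<zeta> = \<i> * complex_of_real (\<zeta> $ i) * fun_l2 (fourier v) \<zeta>"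
  let ?f = "\<lambda>j \<zeta>. diffq j (\<zeta> $ i) * fun_l2 (fourier v) \<zeta>"
  have wm: "AE \<zeta> in lborel. cmod (fun_l2 (fourier w) \<zeta>) = \<bar>\<zeta> $ i\<bar> * cmod (fun_l2 (fourier v) \<zeta>)"
    using w by eventually_elim (simp add: norm_mult)
  have fm: "?f j \<in> borel_measurable borel" for j unfolding diffq_def by measurable
  have "(\<lambda>j. to_l2 (?f j)) \<longlonglongrightarrow> to_l2 (fun_l2 (fourier w))"
  proof (rule tendsto_to_l2_dominated(2)[where w = "\<lambda>\<zeta>. cmod (fun_l2 (fourier w) \<zeta>)", OF fm fun_l2_measurable])
    show "AE \<zeta> in lborel. (\<lambda>j. ?f j \<zeta>) \<longlonglongrightarrow> fun_l2 (fourier w) \<zeta>"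
      using w by eventually_elim (simp, intro tendsto_mult tendsto_const diffq_tendsto)
    show "AE \<zeta> in lborel. cmod (?f j \<zeta>) \<le> cmod (fun_l2 (fourier w) \<zeta>)" for j
      using wm by eventually_elim (simp add: norm_mult mult_right_mono cmod_diffq)
    show "integrable lborel (\<lambda>\<zeta>. (cmod (fun_l2 (fourier w) \<zeta>))\<^sup>2)"
      using square_integrable_fun_l2[of "fourier w"] by (simp add: square_integrable_def)
  qed
  moreover have "to_l2 (?f j) = fourier (?d j)" for j
  proof (rule to_l2_eqI)
    show "square_integrable (?f j)"
      by (rule square_integrable_bound[OF fm square_integrable_fun_l2, of _ 1 "fourier w"])
        (use wm in eventually_elim, simp add: norm_mult mult_right_mono cmod_diffq)
    show "AE \<zeta> in lborel. ?f j \<zeta> = fun_l2 (fourier (?d j)) \<zeta>"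
      using fourier_diffq[of j i v] by eventually_elim (rule sym)
  qed
  ultimately have "(\<lambda>j. fourier (?d j)) \<longlonglongrightarrow> fourier w" by (simp add: to_l2_fun_l2)
  from bounded_linear.tendsto[OF bounded_linear_ifourier this]
  show "has_dir i v w" unfolding has_dir_def by simp
qed

lemma has_dir_ex:
  assumes "v \<in> Hs (Suc k)"
  shows "\<exists>w. has_dir i v w \<and> w \<in> Hs k"
proof -
  let ?f = "\<lambda>\<zeta>. \<i> * complex_of_real (\<zeta> $ i) * fun_l2 (fourier v) \<zeta>"
  have le: "cmod (?f \<zeta>) \<le> 1 * bra \<zeta> ^ 1 * cmod (fun_l2 (fourier v) \<zeta>)" for \<zeta>
  proof -
    have "\<bar>\<zeta> $ i\<bar> \<le> norm \<zeta>" by (rule component_le_norm_cart)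
    also have "\<dots> \<le> bra \<zeta>" unfolding bra_def by (rule real_le_rsqrt) simp
    finally show ?thesis by (simp add: norm_mult mult_right_mono)
  qed
  have s1: "square_integrable (\<lambda>\<zeta>. brapow 1 \<zeta> * fun_l2 (fourier v) \<zeta>)"
    using Hs_mono(1)[of 1 "Suc k" v] assms by (simp add: Hs_def)
  have s: "square_integrable ?f"
  proof (rule square_integrable_bound[OF _ s1, of _ 1])
    show "AE \<zeta> in lborel. cmod (?f \<zeta>) \<le> 1 * cmod (brapow 1 \<zeta> * fun_l2 (fourier v) \<zeta>)"
      using le by (simp add: norm_mult)
  qed measurable
  have w: "AE \<zeta> in lborel. fun_l2 (fourier (ifourier (to_l2 ?f))) \<zeta> = ?f \<zeta>"
    using fun_l2_to_l2[OF s] by simp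
  have v: "v \<in> Hs (k + 1)" using assms by simp
  have "AE \<zeta> in lborel. cmod (fun_l2 (fourier (ifourier (to_l2 ?f))) \<zeta>) \<le> 1 * bra \<zeta> ^ 1 * cmod (fun_l2 (fourier v) \<zeta>)"
    using w by eventually_elim (use le in simp)
  from Hs_dominated(1)[OF v _ this] have "ifourier (to_l2 ?f) \<in> Hs k" by simp
  then show ?thesis using w has_dir_iff by blast
qed

text \<open>The square of \<open>bra \<zeta>\<close> is 1 plus the sum of the squared components, so
  the norm of order \<open>k + 1\<close> splits into norms of order \<open>k\<close> of
  \<open>v\<close> and its derivatives. This opens an induction over the order in which products are
  differentiated in physical space.\<close>

lemma Hs_Suc:
  assumes v: "v \<in> Hs k" and w: "\<And>i. has_dir i v (w i)" "\<And>i. w i \<in> Hs k"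
  shows "v \<in> Hs (Suc k)" "(hs_norm (Suc k) v)\<^sup>2 = (hs_norm k v)\<^sup>2 + (\<Sum>i\<in>UNIV. (hs_norm k (w i))\<^sup>2)"
proof -
  let ?f = "\<lambda>\<zeta>. brapow (Suc k) \<zeta> * fun_l2 (fourier v) \<zeta>"
  let ?g = "\<lambda>\<zeta>. (cmod (fun_l2 (wfourier k v) \<zeta>))\<^sup>2 + (\<Sum>i\<in>UNIV. (cmod (fun_l2 (wfourier k (w i)) \<zeta>))\<^sup>2)"
  have "AE \<zeta> in lborel. \<forall>i. fun_l2 (wfourier k (w i)) \<zeta> = brapow k \<zeta> * (\<i> * complex_of_real (\<zeta> $ i) * fun_l2 (fourier v) \<zeta>)"
  proof -
    have "AE \<zeta> in lborel. fun_l2 (wfourier k (w i)) \<zeta> = brapow k \<zeta> * (\<i> * complex_of_real (\<zeta> $ i) * fun_l2 (fourier v) \<zeta>)" for i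
      using fun_l2_wfourier[OF w(2)[of i]] w(1)[of i, unfolded has_dir_iff] by eventually_elim simp
    then show ?thesis by (subst AE_all_countable) simp
  qed
  with fun_l2_wfourier[OF v] have eq: "AE \<zeta> in lborel. (cmod (?f \<zeta>))\<^sup>2 = ?g \<zeta>"
  proof eventually_elim
    case (elim \<zeta>)
    have n: "(norm \<zeta>)\<^sup>2 = (\<Sum>i\<in>UNIV. (\<zeta> $ i)\<^sup>2)"
      by (simp add: norm_vec_def L2_set_def sum_nonneg)
    have "(cmod (?f \<zeta>))\<^sup>2 = (bra \<zeta> ^ k)\<^sup>2 * (cmod (fun_l2 (fourier v) \<zeta>))\<^sup>2 * (1 + (\<Sum>i\<in>UNIV. (\<zeta> $ i)\<^sup>2))"
      unfolding n[symmetric] bra_sq[symmetric] by (simp add: norm_mult power_mult_distrib)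
    also have "\<dots> = ?g \<zeta>"
      using elim by (simp add: norm_mult power_mult_distrib distrib_left sum_distrib_left mult_ac)
    finally show ?case .
  qed
  have "integrable lborel (\<lambda>\<zeta>. (cmod (fun_l2 u \<zeta>))\<^sup>2)" for u :: "(real^'a) l2"
    using square_integrable_fun_l2[of u] by (simp add: square_integrable_def)
  then have ig: "integrable lborel ?g" and Ig: "(\<integral>\<zeta>. ?g \<zeta> \<partial>lborel) = (hs_norm k v)\<^sup>2 + (\<Sum>i\<in>UNIV. (hs_norm k (w i))\<^sup>2)"
    by (simp_all add: hs_norm_def norm_l2_sq)
  have sf: "square_integrable ?f"
    unfolding square_integrable_def
  proof
    show "integrable lborel (\<lambda>\<zeta>. (cmod (?f \<zeta>))\<^sup>2)"
      by (rule integrable_cong_AE_imp[OF ig]) (use eq in \<open>auto elim: eventually_mono\<close>)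
  qed measurable
  then show "v \<in> Hs (Suc k)" by (simp add: Hs_def)
  have "(hs_norm (Suc k) v)\<^sup>2 = (\<integral>\<zeta>. (cmod (?f \<zeta>))\<^sup>2 \<partial>lborel)"
    unfolding hs_norm_def wfourier_def mul_def by (rule norm_to_l2_sq[OF sf])
  also have "\<dots> = (\<integral>\<zeta>. ?g \<zeta> \<partial>lborel)"
    by (rule integral_cong_AE[OF _ _ eq]) measurable
  finally show "(hs_norm (Suc k) v)\<^sup>2 = (hs_norm k v)\<^sup>2 + (\<Sum>i\<in>UNIV. (hs_norm k (w i))\<^sup>2)" using Ig by simp
qed

section \<open>Test functions and weak derivatives\<close>

text \<open>The derivative along one axis at every point. It asks for no joint differentiability, so
  differentiation under a convolution integral preserves it directly.\<close>

definition dird :: "'n::finite \<Rightarrow> (real^'n \<Rightarrow> 'b::real_normed_vector) \<Rightarrow> (real^'n \<Rightarrow> 'b) \<Rightarrow> bool" where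
  "dird i g g' \<longleftrightarrow> (\<forall>x. ((\<lambda>t. g (x + t *\<^sub>R axis i 1)) has_vector_derivative g' x) (at 0))"

lemma axis_scaleR: "axis i (t::real) = t *\<^sub>R axis i 1"
  by (simp add: vec_eq_iff axis_def)

lemma dird_at:
  assumes "dird i g g'"
  shows "((\<lambda>t. g (x + t *\<^sub>R axis i 1)) has_vector_derivative g' (x + t *\<^sub>R axis i 1)) (at t)"
proof -
  have "((\<lambda>s. g ((x + t *\<^sub>R axis i 1) + s *\<^sub>R axis i 1)) has_vector_derivative g' (x + t *\<^sub>R axis i 1)) (at (t - t))"
    using assms by (simp add: dird_def)
  then have "((\<lambda>s. g ((x + t *\<^sub>R axis i 1) + s *\<^sub>R axis i 1)) \<circ> (\<lambda>s. s - t) has_vector_derivative 1 *\<^sub>R g' (x + t *\<^sub>R axis i 1)) (at t)"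
    by (intro vector_diff_chain_at) (auto intro!: derivative_eq_intros)
  then show ?thesis by (simp add: comp_def algebra_simps)
qed

lemma dird_diffq_tendsto:
  assumes "dird i g g'"
  shows "(\<lambda>j. real (Suc j) *\<^sub>R (g (x + axis i (inverse (real (Suc j)))) - g x)) \<longlonglongrightarrow> g' x"
proof -
  let ?h = "\<lambda>j. inverse (real (Suc j))"
  let ?f = "\<lambda>t. g (x + t *\<^sub>R axis i 1)"
  have "(?f has_derivative (\<lambda>h. h *\<^sub>R g' x)) (at 0)"
    using assms by (simp add: dird_def has_vector_derivative_def)
  then have L: "((\<lambda>h. norm (?f (0 + h) - ?f 0 - h *\<^sub>R g' x) / norm h) \<longlongrightarrow> 0) (at 0)"
    unfolding has_derivative_at by blast
  have "filterlim ?h (at 0) sequentially"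
    by (rule filterlim_atI[OF LIMSEQ_inverse_real_of_nat]) simp
  from filterlim_compose[OF L this]
  have L2: "(\<lambda>j. norm (?f (0 + ?h j) - ?f 0 - ?h j *\<^sub>R g' x) / norm (?h j)) \<longlonglongrightarrow> 0" .
  show ?thesis
  proof (rule LIM_zero_cancel, rule Lim_null_comparison[OF always_eventually L2], rule allI)
    fix j
    have "real (Suc j) *\<^sub>R (g (x + axis i (?h j)) - g x) - g' x = real (Suc j) *\<^sub>R (?f (0 + ?h j) - ?f 0 - ?h j *\<^sub>R g' x)"
      by (simp add: scaleR_diff_right axis_scaleR[of i "?h j"] del: of_nat_Suc)
    then show "norm (real (Suc j) *\<^sub>R (g (x + axis i (?h j)) - g x) - g' x) \<le> norm (?f (0 + ?h j) - ?f 0 - ?h j *\<^sub>R g' x) / norm (?h j)"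
      by (simp only: norm_scaleR) (simp add: divide_inverse mult.commute del: of_nat_Suc)
  qed
qed

lemma dird_diffq_bound:
  fixes g g' :: "real^'n::finite \<Rightarrow> 'b::real_normed_vector"
  assumes "dird i g g'" "\<And>x. norm (g' x) \<le> B"
  shows "norm (real (Suc j) *\<^sub>R (g (x + axis i (inverse (real (Suc j)))) - g x)) \<le> B"
proof -
  let ?h = "inverse (real (Suc j))"
  have "norm (g (x + ?h *\<^sub>R axis i 1) - g (x + 0 *\<^sub>R axis i 1)) \<le> B * norm (?h - 0)"
  proof (rule differentiable_bound[where S = UNIV and f = "\<lambda>t. g (x + t *\<^sub>R axis i 1)" and f' = "\<lambda>t h. h *\<^sub>R g' (x + t *\<^sub>R axis i 1)"])
    show "((\<lambda>t. g (x + t *\<^sub>R axis i 1)) has_derivative (\<lambda>h. h *\<^sub>R g' (x + t *\<^sub>R axis i 1))) (at t within UNIV)" for t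
      using dird_at[OF assms(1), of x t] by (simp add: has_vector_derivative_def)
    show "onorm (\<lambda>h. h *\<^sub>R g' (x + t *\<^sub>R axis i 1)) \<le> B" for t
    proof (rule onorm_le)
      show "norm (h *\<^sub>R g' (x + t *\<^sub>R axis i 1)) \<le> B * norm h" for h
        using mult_right_mono[OF assms(2)[of "x + t *\<^sub>R axis i 1"], of "\<bar>h\<bar>"] by (simp add: mult.commute)
    qed
  qed auto
  then have "real (Suc j) * norm (g (x + ?h *\<^sub>R axis i 1) - g x) \<le> real (Suc j) * (B * ?h)"
    by (intro mult_left_mono) auto
  also have "real (Suc j) * (B * ?h) = B" by simp
  finally show ?thesis by (simp only: axis_scaleR[of i ?h] norm_scaleR abs_of_nat)
qed

section \<open>Derivatives of test functions and their transforms\<close>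

lemma test_function_partial:
  assumes "\<phi> \<in> test_functions" shows "partial_deriv i \<phi> \<in> test_functions"
proof -
  have it: "iter_partial is (partial_deriv i \<phi>) = iter_partial (is @ [i]) \<phi>" for "is"
    by (simp add: iter_partial_def)
  have C: "class_C m (partial_deriv i \<phi>)" for m
  proof -
    have "class_C (Suc m) \<phi>" using assms by (simp add: test_functions_def)
    then show ?thesis unfolding class_C_def it by simp
  qed
  obtain K where K: "compact K" "\<And>x. x \<notin> K \<Longrightarrow> \<phi> x = 0" using assms by (auto simp: test_functions_def)
  have "partial_deriv i \<phi> x = 0" if "x \<notin> K" for x
  proof -
    have "open (- K)" using K(1) by (simp add: compact_imp_closed open_Compl)
    then have "(\<phi> has_derivative (\<lambda>_. 0)) (at x)"
      by (rule has_derivative_transform_within_open[OF has_derivative_const[of 0]]) (use that K in auto)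
    from frechet_derivative_at[OF this] show ?thesis by (simp add: partial_deriv_def fun_eq_iff)
  qed
  then show ?thesis using C K(1) by (auto simp: test_functions_def)
qed

lemma test_function_iter: "\<phi> \<in> test_functions \<Longrightarrow> iter_partial is \<phi> \<in> test_functions"
  by (induction "is") (auto simp: iter_partial_def intro: test_function_partial)

lemma test_function_continuous:
  assumes "\<phi> \<in> test_functions" shows "continuous_on UNIV \<phi>" "\<phi> differentiable (at x)"
proof -
  have "class_C 1 \<phi>" using assms by (simp add: test_functions_def)
  then have "iter_partial [] \<phi> differentiable_on UNIV" "continuous_on UNIV (iter_partial [] \<phi>)"
    unfolding class_C_def by (metis list.size(3) less_one, metis list.size(3) zero_le)
  then show "continuous_on UNIV \<phi>" "\<phi> differentiable (at x)"
    by (simp_all add: iter_partial_def differentiable_on_def)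
qed

lemma differentiable_dird:
  assumes "\<And>x. \<phi> differentiable (at x)"
  shows "dird i \<phi> (partial_deriv i \<phi>)"
  unfolding dird_def
proof
  fix x
  have "(\<phi> has_derivative frechet_derivative \<phi> (at x)) (at (x + 0 *\<^sub>R axis i 1))"
    using assms[of x] by (simp add: frechet_derivative_works)
  moreover have "((\<lambda>t. x + t *\<^sub>R axis i 1) has_derivative (\<lambda>t. t *\<^sub>R axis i 1)) (at (0::real))"
    by (auto intro!: derivative_eq_intros)
  ultimately have "((\<lambda>t. \<phi> (x + t *\<^sub>R axis i 1)) has_derivative (\<lambda>t. frechet_derivative \<phi> (at x) (t *\<^sub>R axis i 1))) (at 0)"
    by (rule has_derivative_compose[rotated])
  then show "((\<lambda>t. \<phi> (x + t *\<^sub>R axis i 1)) has_vector_derivative partial_deriv i \<phi> x) (at 0)"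
    using linear_frechet_derivative[OF assms[of x]]
    by (simp add: has_vector_derivative_def partial_deriv_def linear_cmul)
qed

lemma test_function_support:
  assumes "\<phi> \<in> test_functions"
  obtains r where "0 \<le> r" "\<And>x. r < norm x \<Longrightarrow> \<phi> x = 0"
proof -
  obtain K where K: "compact K" "\<And>x. x \<notin> K \<Longrightarrow> \<phi> x = 0" using assms by (auto simp: test_functions_def)
  then obtain r where "\<And>x. x \<in> K \<Longrightarrow> norm x \<le> r" using compact_imp_bounded bounded_iff by metis
  then have "\<phi> x = 0" if "max 0 r < norm x" for x using K(2)[of x] that by fastforce
  then show ?thesis using that[of "max 0 r"] by simp
qed

lemma continuous_support_bounded:
  fixes f :: "real^'n::finite \<Rightarrow> complex"
  assumes "continuous_on UNIV f" "\<And>x. r < norm x \<Longrightarrow> f x = 0"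
  shows "\<exists>B\<ge>0. \<forall>x. cmod (f x) \<le> B"
proof -
  have "compact (f ` cball 0 r)"
    by (intro compact_continuous_image continuous_on_subset[OF assms(1)]) auto
  then obtain B where B: "\<And>y. y \<in> f ` cball 0 r \<Longrightarrow> cmod y \<le> B" using compact_imp_bounded bounded_iff by metis
  have "cmod (f x) \<le> max 0 B" for x
    using B[of "f x"] assms(2)[of x] by (cases "norm x \<le> r") (auto simp: max.coboundedI2)
  then show ?thesis by (intro exI[of _ "max 0 B"]) auto
qed

lemma integrable_indicator_cball: "integrable lborel (\<lambda>x. c * indicator (cball 0 r) (x::'a::euclidean_space) :: real)"
  using emeasure_bounded_finite[OF bounded_cball, of "0::'a" r]
  by (intro integrable_mult_right integrable_real_indicator) auto

lemma L12_compact_support: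
  fixes f :: "real^'n::finite \<Rightarrow> complex"
  assumes "continuous_on UNIV f" "\<And>x. r < norm x \<Longrightarrow> f x = 0"
  shows "L12 f"
proof -
  obtain B where B: "0 \<le> B" "\<And>x. cmod (f x) \<le> B" using continuous_support_bounded[OF assms] by blast
  have m [measurable]: "f \<in> borel_measurable borel" using assms(1) by (rule borel_measurable_continuous_onI)
  have le: "cmod (f x) \<le> B * indicator (cball 0 r) x" for x
    using B assms(2)[of x] by (cases "norm x \<le> r") auto
  have "integrable lborel f"
    by (rule Bochner_Integration.integrable_bound[OF integrable_indicator_cball[of B r]])
      (use le B in \<open>auto simp: abs_mult\<close>)
  moreover have "square_integrable f"
  proof (rule square_integrable_dominated[OF m])
    show "AE x in lborel. cmod (f x) \<le> B * indicator (cball 0 r) x" using le by simp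
    have "(\<lambda>x. (B * indicator (cball 0 r) x)\<^sup>2) = (\<lambda>x::real^'n. B\<^sup>2 * indicator (cball 0 r) x)"
      by (auto simp: indicator_def)
    then show "integrable lborel (\<lambda>x::real^'n. (B * indicator (cball 0 r) x)\<^sup>2)"
      by (simp only: integrable_indicator_cball)
  qed
  ultimately show ?thesis by (simp add: L12_def)
qed

lemma test_function_L12: "\<phi> \<in> test_functions \<Longrightarrow> L12 \<phi>"
  by (metis test_function_support test_function_continuous(1) L12_compact_support)

lemma test_function_square_integrable: "\<phi> \<in> test_functions \<Longrightarrow> square_integrable \<phi>"
  using test_function_L12 by (auto simp: L12_def)

text \<open>The classical derivative of a test function is also the L2 limit of the difference
  quotients, by dominated convergence on a fixed ball.\<close>

lemma test_function_has_dir: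
  fixes \<phi> :: "real^'n::finite \<Rightarrow> complex"
  assumes "\<phi> \<in> test_functions"
  shows "has_dir i (to_l2 \<phi>) (to_l2 (partial_deriv i \<phi>))"
proof -
  let ?T = "\<lambda>j x. x + axis i (inverse (real (Suc j)))"
  let ?d = "\<lambda>j x. real (Suc j) *\<^sub>R (\<phi> (?T j x) - \<phi> x)"
  have sq: "square_integrable \<phi>" using assms by (rule test_function_square_integrable)
  have sT: "square_integrable (\<lambda>x. \<phi> (?T j x))" for j
    by (rule mpres_square_integrable[OF mpres_translate sq])
  have dd: "dird i \<phi> (partial_deriv i \<phi>)"
    using test_function_continuous(2)[OF assms] by (rule differentiable_dird)
  obtain r where r: "0 \<le> r" "\<And>x. r < norm x \<Longrightarrow> \<phi> x = 0" using test_function_support[OF assms] by blast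
  obtain r' where r': "0 \<le> r'" "\<And>x. r' < norm x \<Longrightarrow> partial_deriv i \<phi> x = 0"
    using test_function_support[OF test_function_partial[OF assms]] by blast
  obtain B where B: "0 \<le> B" "\<And>x. cmod (partial_deriv i \<phi> x) \<le> B"
    using continuous_support_bounded[OF test_function_continuous(1)[OF test_function_partial[OF assms]] r'(2)] by blast
  \<comment> \<open>The steps are at most 1, so the quotients live in the ball enlarged by 1; there
    the mean value theorem bounds them by the bound of the derivative.\<close>
  have le: "cmod (?d j x) \<le> B * indicator (cball 0 (r + 1)) x" for j x
  proof (cases "norm x \<le> r + 1")
    case True then show ?thesis using dird_diffq_bound[OF dd B(2), of j x] by simp
  next
    case False
    have "norm (axis i (inverse (real (Suc j))) :: real^'n) \<le> 1"
      by (simp add: norm_axis_1 axis_scaleR[of i "inverse _"] inverse_le_1_iff)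
    then have "r < norm (?T j x)" using False norm_triangle_ineq2[of x "- axis i (inverse (real (Suc j)))"] by simp
    then show ?thesis using r(2) False by simp
  qed
  have "(\<lambda>j. to_l2 (?d j)) \<longlonglongrightarrow> to_l2 (partial_deriv i \<phi>)"
  proof (rule tendsto_to_l2_dominated(2))
    have "(\<lambda>x. (B * indicator (cball 0 (r + 1)) x)\<^sup>2) = (\<lambda>x::real^'n. B\<^sup>2 * indicator (cball 0 (r + 1)) x)"
      by (auto simp: indicator_def)
    then show "integrable lborel (\<lambda>x::real^'n. (B * indicator (cball 0 (r + 1)) x)\<^sup>2)"
      by (simp only: integrable_indicator_cball)
    show "?d j \<in> borel_measurable borel" for j
      using square_integrable_measurable[OF square_integrable_scaleR[OF square_integrable_minus[OF sT[of j] sq]]] .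
    show "partial_deriv i \<phi> \<in> borel_measurable borel"
      by (rule square_integrable_measurable[OF test_function_square_integrable[OF test_function_partial[OF assms]]])
  qed (use le dird_diffq_tendsto[OF dd] in auto)
  moreover have "to_l2 (?d j) = real (Suc j) *\<^sub>R (comp_l2 (?T j) (to_l2 \<phi>) - to_l2 \<phi>)" for j
    unfolding comp_l2_to_l2[OF mpres_translate sq] to_l2_scaleR[OF square_integrable_minus[OF sT sq]] to_l2_diff[OF sT sq] ..
  ultimately show ?thesis by (simp only: has_dir_def)
qed

text \<open>The Fourier multiplier of the partial derivative with multi-index \<alpha>.\<close>

definition msym :: "('n::finite \<Rightarrow> nat) \<Rightarrow> real^'n \<Rightarrow> complex" where
  "msym \<alpha> \<zeta> = (\<Prod>i\<in>UNIV. (\<i> * complex_of_real (\<zeta> $ i)) ^ \<alpha> i)"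

lemma msym_measurable [measurable]: "msym \<alpha> \<in> borel_measurable borel"
  unfolding msym_def[abs_def] by measurable

lemma fourier_iter_partial:
  assumes "\<phi> \<in> test_functions"
  shows "AE \<zeta> in lborel. fun_l2 (fourier (to_l2 (iter_partial is \<phi>))) \<zeta> =
    msym (count_list is) \<zeta> * fun_l2 (fourier (to_l2 \<phi>)) \<zeta>"
proof (induction "is")
  case Nil
  then show ?case by (simp add: iter_partial_def msym_def)
next
  case (Cons i "is")
  have m: "msym (count_list (i # is)) \<zeta> = \<i> * complex_of_real (\<zeta> $ i) * msym (count_list is) \<zeta>" for \<zeta>
  proof -
    have "msym (count_list (i # is)) \<zeta> = (\<Prod>k\<in>UNIV. (if k = i then \<i> * complex_of_real (\<zeta> $ i) else 1) * (\<i> * complex_of_real (\<zeta> $ k)) ^ count_list is k)"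
      unfolding msym_def by (rule prod.cong) auto
    then show ?thesis by (simp add: prod.distrib msym_def)
  qed
  have "iter_partial (i # is) \<phi> = partial_deriv i (iter_partial is \<phi>)" by (simp add: iter_partial_def)
  then have "AE \<zeta> in lborel. fun_l2 (fourier (to_l2 (iter_partial (i # is) \<phi>))) \<zeta> =
     \<i> * complex_of_real (\<zeta> $ i) * fun_l2 (fourier (to_l2 (iter_partial is \<phi>))) \<zeta>"
    using test_function_has_dir[OF test_function_iter[OF assms], of i "is"] by (simp add: has_dir_iff)
  with Cons show ?case
  proof eventually_elim
    case (elim \<zeta>)
    show ?case unfolding elim(2) elim(1) m by (simp only: mult.assoc)
  qed
qed

lemma ex_count_list: "\<exists>is. \<forall>i::'n::finite. count_list is i = \<alpha> i"
proof -
  have "\<exists>is. \<forall>i. count_list is i = (if i \<in> A then \<alpha> i else 0)" if "finite A" for A :: "'n set"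
    using that
  proof (induction A)
    case empty then show ?case by (intro exI[of _ "[]"]) auto
  next
    case (insert a A)
    then obtain l where l: "\<And>i. count_list l i = (if i \<in> A then \<alpha> i else 0)" by blast
    have "count_list (replicate (\<alpha> a) a) i = (if i = a then \<alpha> a else 0)" for i
      by (auto simp: count_list_eq_length_filter)
    then have "\<forall>i. count_list (replicate (\<alpha> a) a @ l) i = (if i \<in> insert a A then \<alpha> i else 0)"
      using insert l by (auto simp: count_list_append)
    then show ?case by blast
  qed
  from this[of UNIV] show ?thesis by simp
qed

text \<open>Whatever sequence of directions the choice in \<open>mi_partial\<close> returns, its
  counts are \<alpha>, and only the counts enter the symbol.\<close>

lemma mi_partial_iter: "\<exists>is. mi_partial \<alpha> = iter_partial is \<and> count_list is = \<alpha>"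
proof -
  have "\<forall>i. count_list (SOME is. \<forall>i. count_list is i = \<alpha> i) i = \<alpha> i"
    by (rule someI_ex[OF ex_count_list])
  then show ?thesis by (intro exI[of _ "SOME is. \<forall>i. count_list is i = \<alpha> i"]) (auto simp: mi_partial_def)
qed

lemma mi_partial_test:
  assumes "\<phi> \<in> test_functions"
  shows "mi_partial \<alpha> \<phi> \<in> test_functions"
    "AE \<zeta> in lborel. fun_l2 (fourier (to_l2 (mi_partial \<alpha> \<phi>))) \<zeta> = msym \<alpha> \<zeta> * fun_l2 (fourier (to_l2 \<phi>)) \<zeta>"
  using mi_partial_iter[of \<alpha>] test_function_iter[OF assms] fourier_iter_partial[OF assms] by auto

lemma msym_uminus: "msym \<alpha> (- \<zeta>) = (-1) ^ mi_order \<alpha> * msym \<alpha> \<zeta>"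
proof -
  have "msym \<alpha> (- \<zeta>) = (\<Prod>i\<in>UNIV. (-1) ^ \<alpha> i * (\<i> * complex_of_real (\<zeta> $ i)) ^ \<alpha> i)"
    unfolding msym_def by (rule prod.cong) (auto simp flip: power_mult_distrib)
  then show ?thesis by (simp add: prod.distrib msym_def mi_order_def power_sum)
qed

lemma ifourier_mi_partial:
  assumes "\<phi> \<in> test_functions"
  shows "AE \<zeta> in lborel. fun_l2 (ifourier (to_l2 (mi_partial \<alpha> \<phi>))) \<zeta> =
    (-1) ^ mi_order \<alpha> * msym \<alpha> \<zeta> * fun_l2 (ifourier (to_l2 \<phi>)) \<zeta>"
  using fun_l2_comp[OF mpres_uminus, of "fourier (to_l2 (mi_partial \<alpha> \<phi>))"]
    fun_l2_comp[OF mpres_uminus, of "fourier (to_l2 \<phi>)"] mpres_AE[OF mpres_uminus mi_partial_test(2)[OF assms, of \<alpha>]]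
  unfolding ifourier_def by eventually_elim (simp add: msym_uminus)

text \<open>Without conjugation a transform on one side is balanced by the inverse transform on the
  other. In this form the weak equation becomes multiplication by the symbol, with the sign produced
  by reflection.\<close>

lemma bil_ifourier: "bil v w = bil (fourier v) (ifourier w)"
  using bil_fourier[of v "ifourier w"] by simp

lemma integral_test_eq_bil:
  assumes "square_integrable \<phi>"
  shows "(\<integral>x. fun_l2 v x * \<phi> x \<partial>lborel) = bil (fourier v) (ifourier (to_l2 \<phi>))"
  using bil_to_l2[OF square_integrable_fun_l2 assms, of v] by (simp add: to_l2_fun_l2 flip: bil_ifourier)

lemma has_weak_partial_iff:
  "has_weak_partial \<alpha> v w \<longleftrightarrow> (\<forall>\<phi>\<in>test_functions.
     bil (fourier v) (ifourier (to_l2 (mi_partial \<alpha> \<phi>))) = (-1) ^ mi_order \<alpha> * bil (fourier w) (ifourier (to_l2 \<phi>)))"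
  unfolding has_weak_partial_def
  by (intro ball_cong refl) (simp add: integral_test_eq_bil test_function_square_integrable mi_partial_test(1))

lemma has_weak_partialI:
  assumes "AE \<zeta> in lborel. fun_l2 (fourier w) \<zeta> = msym \<alpha> \<zeta> * fun_l2 (fourier v) \<zeta>"
  shows "has_weak_partial \<alpha> v w"
  unfolding has_weak_partial_iff
proof
  fix \<phi> :: "real^'a \<Rightarrow> complex" assume \<phi>: "\<phi> \<in> test_functions"
  have "bil (fourier v) (ifourier (to_l2 (mi_partial \<alpha> \<phi>))) =
    (\<integral>\<zeta>. (-1) ^ mi_order \<alpha> * (fun_l2 (fourier w) \<zeta> * fun_l2 (ifourier (to_l2 \<phi>)) \<zeta>) \<partial>lborel)"
    by (rule bil_cong_AE, use assms ifourier_mi_partial[OF \<phi>, of \<alpha>] in eventually_elim) (simp_all add: mult_ac)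
  then show "bil (fourier v) (ifourier (to_l2 (mi_partial \<alpha> \<phi>))) = (-1) ^ mi_order \<alpha> * bil (fourier w) (ifourier (to_l2 \<phi>))"
    by (simp add: bil_def)
qed

text \<open>The class \<open>bumps\<close> is closed under differentiation and contains the standard bump, so tensor
  products of its members are test functions.\<close>

definition bumpd :: "(real \<Rightarrow> real) \<Rightarrow> nat \<Rightarrow> real \<Rightarrow> real" where
  "bumpd p j t = (if \<bar>t\<bar> < 1 then p t / (1 - t\<^sup>2) ^ j * exp (- (1 / (1 - t\<^sup>2))) else 0)"

definition bumps :: "(real \<Rightarrow> real) set" where
  "bumps = {bumpd p j | p j. real_polynomial_function p}"

text \<open>From \<open>(1 + x / n) ^ n \<le> exp x\<close> with \<open>x = 1 / y\<close> and
  \<open>n = Suc k\<close>, dropping the 1.\<close>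

lemma exp_inverse_bound:
  assumes "0 < y" shows "exp (- (1 / y)) \<le> real (Suc k) ^ Suc k * y ^ Suc k"
proof -
  have "(1 + (1 / y) / real (Suc k)) ^ Suc k \<le> exp (1 / y)"
  proof (rule exp_ge_one_plus_x_over_n_power_n)
    have "0 \<le> 1 / y" using assms by simp
    then show "- real (Suc k) \<le> 1 / y" by linarith
  qed simp
  moreover have "((1 / y) / real (Suc k)) ^ Suc k \<le> (1 + (1 / y) / real (Suc k)) ^ Suc k"
    using assms by (intro power_mono) auto
  ultimately have le: "((1 / y) / real (Suc k)) ^ Suc k \<le> exp (1 / y)" by (rule order_trans[rotated])
  have pos: "0 < ((1 / y) / real (Suc k)) ^ Suc k" using assms by (intro zero_less_power divide_pos_pos) auto
  have "exp (- (1 / y)) = inverse (exp (1 / y))" by (rule exp_minus)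
  also have "\<dots> \<le> inverse (((1 / y) / real (Suc k)) ^ Suc k)" by (rule le_imp_inverse_le[OF le pos])
  also have "\<dots> = (real (Suc k) * y) ^ Suc k"
    unfolding power_inverse[symmetric] using assms by (simp add: divide_simps del: of_nat_Suc power_Suc)
  finally show ?thesis by (simp only: power_mult_distrib)
qed

text \<open>The exponential absorbs the pole of order \<open>j\<close> and leaves two more powers of
  \<open>1 - t\<^sup>2\<close>. This quadratic decay is what gives the derivative 0 at the end
  points.\<close>

lemma bumpd_bound:
  assumes "real_polynomial_function p"
  shows "\<exists>C\<ge>0. \<forall>t. \<bar>bumpd p j t\<bar> \<le> C * (1 - t\<^sup>2)\<^sup>2"
proof -
  have "continuous_on {-1..1} p"
    using assms by (intro continuous_at_imp_continuous_on ballI continuous_real_polymonial_function)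
  then have "compact (p ` {-1..1})" by (intro compact_continuous_image) auto
  then obtain B where B: "\<And>y. y \<in> p ` {-1..1} \<Longrightarrow> norm y \<le> B" using compact_imp_bounded bounded_iff by metis
  have B0: "0 \<le> B" using B[of "p 0"] norm_ge_zero[of "p 0"] by force
  let ?C = "B * real (Suc (Suc j)) ^ Suc (Suc j)"
  have "\<bar>bumpd p j t\<bar> \<le> ?C * (1 - t\<^sup>2)\<^sup>2" for t
  proof (cases "\<bar>t\<bar> < 1")
    case True
    then have y: "0 < 1 - t\<^sup>2" by (simp add: abs_square_less_1)
    have "\<bar>bumpd p j t\<bar> = \<bar>p t\<bar> / (1 - t\<^sup>2) ^ j * exp (- (1 / (1 - t\<^sup>2)))"
      using True y by (simp add: bumpd_def abs_mult)
    have "- 1 \<le> t" "t \<le> 1" using True by linarith+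
    then have pB: "\<bar>p t\<bar> \<le> B" using B[OF imageI, of t] by auto
    note \<open>\<bar>bumpd p j t\<bar> = _\<close>
    also have "\<bar>p t\<bar> / (1 - t\<^sup>2) ^ j * exp (- (1 / (1 - t\<^sup>2))) \<le> B / (1 - t\<^sup>2) ^ j * (real (Suc (Suc j)) ^ Suc (Suc j) * (1 - t\<^sup>2) ^ Suc (Suc j))"
      using y B0 pB
      by (intro mult_mono divide_right_mono exp_inverse_bound) (auto intro!: divide_nonneg_nonneg)
    also have "\<dots> = ?C * (1 - t\<^sup>2)\<^sup>2"
      using y by (simp add: power2_eq_square)
    finally show ?thesis .
  next
    case False
    then show ?thesis using B0 by (simp add: bumpd_def)
  qed
  then show ?thesis using B0 by (intro exI[of _ ?C]) auto
qed

lemma bumpd_derivative: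
  assumes p: "real_polynomial_function p"
  shows "\<exists>q. real_polynomial_function q \<and> (\<forall>t. (bumpd p j has_real_derivative bumpd q (j + 2) t) (at t))"
proof -
  obtain p' where p': "real_polynomial_function p'" "\<And>x. (p has_real_derivative p' x) (at x)"
    using has_real_derivative_polynomial_function[OF p] by blast
  \<comment> \<open>The numerator of the derivative over the common denominator
    \<open>(1 - t\<^sup>2) ^ (j + 2)\<close>: the contributions of \<open>p\<close>, of the power
    and of the exponential.\<close>
  define q where "q t = p' t * (1 - t\<^sup>2)\<^sup>2 + 2 * real j * t * (1 - t\<^sup>2) * p t - 2 * t * p t" for t
  have idp: "real_polynomial_function (\<lambda>t::real. t)"
    using real_polynomial_function.intros(1)[OF bounded_linear_ident] .
  have q: "real_polynomial_function q"
    unfolding q_def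
    by (intro real_polynomial_function_diff real_polynomial_function.intros(3) real_polynomial_function.intros(4)
        real_polynomial_function_power real_polynomial_function.intros(2) p p' idp)
  have "(bumpd p j has_real_derivative bumpd q (j + 2) t) (at t)" for t
  proof -
    consider "\<bar>t\<bar> < 1" | "\<bar>t\<bar> > 1" | "\<bar>t\<bar> = 1" by linarith
    then show ?thesis
    proof cases
      case 1
      then have y: "0 < 1 - t\<^sup>2" by (simp add: abs_square_less_1)
      let ?y = "1 - t\<^sup>2"
      have dy: "((\<lambda>t. 1 - t\<^sup>2) has_real_derivative - (2 * t)) (at t)"
        by (auto intro!: derivative_eq_intros)
      have "((\<lambda>t. p t / (1 - t\<^sup>2) ^ j * exp (- (1 / (1 - t\<^sup>2)))) has_real_derivative
         (p' t * ?y ^ j - p t * (real j * ?y ^ (j - 1) * (- (2 * t)))) / (?y ^ j * ?y ^ j) * exp (- (1 / ?y))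
          + exp (- (1 / ?y)) * (- (2 * t) / (?y * ?y)) * (p t / ?y ^ j)) (at t)"
      proof (rule DERIV_mult)
        have "?y ^ j \<noteq> 0" using y by simp
        from DERIV_divide[OF p'(2) DERIV_power[OF dy, of j] this]
        show "((\<lambda>t. p t / (1 - t\<^sup>2) ^ j) has_real_derivative
          (p' t * ?y ^ j - p t * (real j * ?y ^ (j - 1) * (- (2 * t)))) / (?y ^ j * ?y ^ j)) (at t)"
          by (simp add: mult_ac)
        have "?y \<noteq> 0" using y by simp
        from DERIV_fun_exp[OF DERIV_minus[OF DERIV_divide[OF DERIV_const[of 1] dy this]]]
        show "((\<lambda>t. exp (- (1 / (1 - t\<^sup>2)))) has_real_derivative exp (- (1 / ?y)) * (- (2 * t) / (?y * ?y))) (at t)"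
          by simp
      qed
      also have "(p' t * ?y ^ j - p t * (real j * ?y ^ (j - 1) * (- (2 * t)))) / (?y ^ j * ?y ^ j) * exp (- (1 / ?y))
          + exp (- (1 / ?y)) * (- (2 * t) / (?y * ?y)) * (p t / ?y ^ j) = bumpd q (j + 2) t"
      proof -
        define z where "z = ?y"
        have z: "z > 0" using y by (simp add: z_def)
        have "(p' t * z ^ j - p t * (real j * z ^ (j - 1) * (- (2 * t)))) / (z ^ j * z ^ j)
            + (- (2 * t) / (z * z)) * (p t / z ^ j)
           = (p' t * z\<^sup>2 + 2 * real j * t * z * p t - 2 * t * p t) / z ^ (j + 2)"
          using z by (cases j) (simp_all add: divide_simps power2_eq_square, simp_all add: algebra_simps)
        from arg_cong[OF this, of "\<lambda>u. u * exp (- (1 / z))"] show ?thesis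
          using 1 by (simp add: bumpd_def q_def z_def algebra_simps)
      qed
      finally have d: "((\<lambda>t. p t / (1 - t\<^sup>2) ^ j * exp (- (1 / (1 - t\<^sup>2)))) has_real_derivative bumpd q (j + 2) t) (at t)" .
      show ?thesis
        by (rule has_field_derivative_transform_within_open[OF d, of "{-1<..<1}"]) (use 1 in \<open>auto simp: bumpd_def\<close>)
    next
      case 2
      have d: "((\<lambda>t. 0) has_real_derivative bumpd q (j + 2) t) (at t)" using 2 by (simp add: bumpd_def)
      show ?thesis
        by (rule has_field_derivative_transform_within_open[OF d, of "- {-1..1}"]) (use 2 in \<open>auto simp: bumpd_def\<close>)
    next
      \<comment> \<open>At an end point \<open>1 - (t + h)\<^sup>2 = - (h * (2 * t + h))\<close>, so
        for steps shorter than 1 the bound on the bump is \<open>9 * C * h\<^sup>2\<close> and the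
        difference quotient tends to 0.\<close>
      case 3
      obtain C where C: "0 \<le> C" "\<And>s. \<bar>bumpd p j s\<bar> \<le> C * (1 - s\<^sup>2)\<^sup>2" using bumpd_bound[OF p] by blast
      have t2: "t\<^sup>2 = 1" using 3 by (metis abs_1 power2_abs power_one)
      have "(\<lambda>h. (bumpd p j (t + h) - bumpd p j t) / h) \<midarrow>0\<rightarrow> 0"
      proof (rule Lim_null_comparison)
        have "norm ((bumpd p j (t + h) - bumpd p j t) / h) \<le> 9 * C * \<bar>h\<bar>" if "h \<noteq> 0" "\<bar>h\<bar> < 1" for h
        proof -
          have "1 - (t + h)\<^sup>2 = - (h * (2 * t + h))" using t2 by (simp add: power2_eq_square algebra_simps)
          then have "(1 - (t + h)\<^sup>2)\<^sup>2 = h\<^sup>2 * (2 * t + h)\<^sup>2" by (simp add: power_mult_distrib)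
          also have "\<dots> \<le> h\<^sup>2 * 3\<^sup>2"
          proof (intro mult_left_mono)
            have "\<bar>2 * t + h\<bar> \<le> 3" using 3 that by linarith
            then show "(2 * t + h)\<^sup>2 \<le> 3\<^sup>2" by (metis abs_le_square_iff abs_numeral)
          qed simp
          finally have "C * (1 - (t + h)\<^sup>2)\<^sup>2 \<le> C * (9 * h\<^sup>2)" using C(1) by (intro mult_left_mono) auto
          with C(2)[of "t + h"] have "\<bar>bumpd p j (t + h)\<bar> \<le> 9 * C * h\<^sup>2" by simp
          then show ?thesis using 3 that
            by (simp add: bumpd_def[of p j t] divide_le_eq power2_eq_square abs_mult mult.assoc)
        qed
        then show "\<forall>\<^sub>F h in at 0. norm ((bumpd p j (t + h) - bumpd p j t) / h) \<le> 9 * C * \<bar>h\<bar>"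
          unfolding eventually_at by (intro exI[of _ 1]) (auto simp: dist_real_def)
        have "((\<lambda>h. 9 * C * \<bar>h\<bar>) \<longlongrightarrow> 9 * C * \<bar>0\<bar>) (at (0::real))" by (intro tendsto_intros)
        then show "((\<lambda>h. 9 * C * \<bar>h\<bar>) \<longlongrightarrow> 0) (at (0::real))" by simp
      qed
      then show ?thesis using 3 by (simp add: DERIV_def bumpd_def[of q])
    qed
  qed
  then show ?thesis using q by blast
qed

lemma bumps_derivative: "g \<in> bumps \<Longrightarrow> \<exists>g'\<in>bumps. \<forall>t. (g has_real_derivative g' t) (at t)"
  using bumpd_derivative unfolding bumps_def by blast

text \<open>The scalar \<open>k\<close> collects the factors \<open>c\<close> from the chain rule,
  which makes the class closed under partial derivatives.\<close>

definition bprod :: "real \<Rightarrow> real \<Rightarrow> real^'n::finite \<Rightarrow> ('n \<Rightarrow> real \<Rightarrow> real) \<Rightarrow> real^'n \<Rightarrow> complex" where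
  "bprod k c y g x = complex_of_real (k * (\<Prod>i\<in>UNIV. g i (c * (x $ i - y $ i))))"

lemma bprod_derivative:
  fixes g :: "'n::finite \<Rightarrow> real \<Rightarrow> real"
  assumes "\<And>i. g i \<in> bumps"
  shows "bprod k c y g differentiable (at x)"
    "\<exists>k' g'. (\<forall>i. g' i \<in> bumps) \<and> partial_deriv j (bprod k c y g) = bprod k' c y g'"
proof -
  obtain g' where g': "\<And>i. g' i \<in> bumps" "\<And>i t. (g i has_real_derivative g' i t) (at t)"
    using bumps_derivative[OF assms] by metis
  define D where "D x h = complex_of_real (k * (\<Sum>i\<in>UNIV. (g' i (c * (x $ i - y $ i)) * (c * h $ i)) *
      (\<Prod>l\<in>UNIV - {i}. g l (c * (x $ l - y $ l)))))" for x h :: "real^'n"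
  have d: "(bprod k c y g has_derivative D x) (at x)" for x
  proof -
    have 1: "((\<lambda>x. g i (c * (x $ i - y $ i))) has_derivative (\<lambda>h. g' i (c * (x $ i - y $ i)) * (c * h $ i))) (at x)" for i
    proof -
      have a: "((\<lambda>x::real^'n. c * (x $ i - y $ i)) has_derivative (\<lambda>h. c * h $ i)) (at x)"
        by (auto intro!: derivative_eq_intros bounded_linear.has_derivative[OF bounded_linear_vec_nth])
      have b: "(g i has_derivative (*) (g' i (c * (x $ i - y $ i)))) (at (c * (x $ i - y $ i)))"
        using g'(2)[of i] by (simp add: has_field_derivative_def)
      show ?thesis by (rule has_derivative_compose[OF a b])
    qed
    have "((\<lambda>x. \<Prod>i\<in>UNIV. g i (c * (x $ i - y $ i))) has_derivative
      (\<lambda>h. \<Sum>i\<in>UNIV. (g' i (c * (x $ i - y $ i)) * (c * h $ i)) * (\<Prod>l\<in>UNIV - {i}. g l (c * (x $ l - y $ l))))) (at x)"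
      by (rule has_derivative_prod) (rule 1)
    from has_derivative_of_real[OF has_derivative_mult_right[OF this, of k]]
    show ?thesis unfolding bprod_def[abs_def] D_def .
  qed
  then show "bprod k c y g differentiable (at x)" by (auto simp: differentiable_def)
  have "partial_deriv j (bprod k c y g) = bprod (k * c) c y (g(j := g' j))"
  proof
    fix x
    have pd: "partial_deriv j (bprod k c y g) x = D x (axis j 1)"
      using frechet_derivative_at[OF d[of x]] by (simp add: partial_deriv_def)
    have "(\<Sum>i\<in>UNIV. (g' i (c * (x $ i - y $ i)) * (c * axis j 1 $ i)) * (\<Prod>l\<in>UNIV - {i}. g l (c * (x $ l - y $ l))))
       = (\<Sum>i\<in>{j}. (g' i (c * (x $ i - y $ i)) * (c * axis j 1 $ i)) * (\<Prod>l\<in>UNIV - {i}. g l (c * (x $ l - y $ l))))"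
      by (rule sum.mono_neutral_right) (auto simp: axis_def)
    also have "\<dots> = c * (g' j (c * (x $ j - y $ j)) * (\<Prod>l\<in>UNIV - {j}. g l (c * (x $ l - y $ l))))"
      by simp
    also have "(g' j (c * (x $ j - y $ j)) * (\<Prod>l\<in>UNIV - {j}. g l (c * (x $ l - y $ l)))) = (\<Prod>i\<in>UNIV. (g(j := g' j)) i (c * (x $ i - y $ i)))"
      by (subst prod.remove[of UNIV j]) (auto intro!: prod.cong)
    finally show "partial_deriv j (bprod k c y g) x = bprod (k * c) c y (g(j := g' j)) x"
      by (simp add: bprod_def D_def pd)
  qed
  moreover have "\<forall>i. (g(j := g' j)) i \<in> bumps" using assms g' by simp
  ultimately show "\<exists>k' g'. (\<forall>i. g' i \<in> bumps) \<and> partial_deriv j (bprod k c y g) = bprod k' c y g'" by blast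
qed

lemma bprod_iter_partial:
  assumes "\<And>i. g i \<in> bumps"
  shows "\<exists>k' g'. (\<forall>i. g' i \<in> bumps) \<and> iter_partial is (bprod k c y g) = bprod k' c y g'"
proof (induction "is")
  case Nil
  then show ?case using assms by (auto simp: iter_partial_def)
next
  case (Cons j "is")
  then obtain k' g' where "\<forall>i. g' i \<in> bumps" "iter_partial is (bprod k c y g) = bprod k' c y g'" by blast
  then show ?case using bprod_derivative(2)[of g' j k' c y] by (simp add: iter_partial_def)
qed

definition bump :: "real \<Rightarrow> real^'n::finite \<Rightarrow> real^'n \<Rightarrow> complex" where
  "bump c y = bprod 1 c y (\<lambda>_. bumpd (\<lambda>_. 1) 0)"

lemma bump_eq: "bump c y x = complex_of_real (\<Prod>i\<in>UNIV. bumpd (\<lambda>_. 1) 0 (c * (x $ i - y $ i)))"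
  by (simp add: bump_def bprod_def)

text \<open>The function vanishes outside a cube of half side \<open>1 / c\<close>; comparison of
  the norm with the sum of the components places the cube in this ball.\<close>

lemma bump_eq_0:
  fixes x y :: "real^'n::finite"
  assumes "0 < c" "real CARD('n) / c < norm (x - y)" shows "bump c y x = 0"
proof -
  have "\<exists>i. 1 / c < \<bar>x $ i - y $ i\<bar>"
  proof (rule ccontr)
    assume "\<not> ?thesis"
    then have "\<And>i. \<bar>(x - y) $ i\<bar> \<le> 1 / c" by (auto simp: not_less)
    then have "(\<Sum>i\<in>UNIV. \<bar>(x - y) $ i\<bar>) \<le> (\<Sum>i\<in>(UNIV :: 'n set). 1 / c)" by (intro sum_mono)
    then show False using norm_le_l1_cart[of "x - y"] assms by simp
  qed
  then obtain i where "1 / c < \<bar>x $ i - y $ i\<bar>" by blast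
  then have "1 \<le> \<bar>c * (x $ i - y $ i)\<bar>" using assms by (simp add: abs_mult divide_less_eq mult.commute)
  then have "bumpd (\<lambda>_. 1) 0 (c * (x $ i - y $ i)) = 0" by (simp add: bumpd_def)
  then show ?thesis unfolding bump_eq by (metis (mono_tags, lifting) of_real_0 prod_zero finite UNIV_I)
qed

lemma bump_test_function:
  fixes y :: "real^'n::finite"
  assumes "0 < c" shows "bump c y \<in> test_functions"
proof -
  have b: "bumpd (\<lambda>_. 1) 0 \<in> bumps" unfolding bumps_def using real_polynomial_function.intros(2) by blast
  have "\<exists>k' g'. (\<forall>i. g' i \<in> bumps) \<and> iter_partial is (bump c y) = bprod k' c y g'" for "is"
    unfolding bump_def by (rule bprod_iter_partial) (rule b)
  then have "iter_partial is (bump c y) differentiable (at x)" for "is" x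
    using bprod_derivative(1) by metis
  then have "iter_partial is (bump c y) differentiable_on UNIV" for "is"
    by (simp add: differentiable_on_def)
  then have "class_C m (bump c y)" for m
    by (simp add: class_C_def differentiable_imp_continuous_on)
  moreover have "\<exists>K. compact K \<and> (\<forall>x. x \<notin> K \<longrightarrow> bump c y x = 0)"
    by (intro exI[of _ "cball y (real CARD('n) / c)"])
      (auto simp: dist_norm norm_minus_commute intro!: bump_eq_0[OF assms])
  ultimately show ?thesis by (simp add: test_functions_def)
qed

lemma bump_translate: "bump c y = (\<lambda>x. bump c 0 (x + (- y)))"
  by (auto simp: bump_eq)

lemma bumpd_nonneg: "0 \<le> bumpd (\<lambda>_. 1) 0 t"
  by (simp add: bumpd_def)

text \<open>For large \<open>c\<close> the support is so small that the cosine is positive on it. So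
  the Fourier transforms of the bumps have no common zero, which replaces the density of the test
  functions when a weak derivative is identified with a Fourier multiplier.\<close>

lemma fourier_integral_bump_nonzero:
  fixes \<zeta> :: "real^'n::finite"
  assumes c: "0 < c" "real CARD('n) * norm \<zeta> < c"
  shows "fourier_integral (bump c 0) \<zeta> \<noteq> 0"
proof
  assume "fourier_integral (bump c 0) \<zeta> = 0"
  then have I0: "(\<integral>x. exp (- (\<i> * complex_of_real (\<zeta> \<bullet> x))) * bump c 0 x \<partial>lborel) = 0"
    by (simp add: fourier_integral_def)
  define b where "b x = (\<Prod>i\<in>UNIV. bumpd (\<lambda>_. 1) 0 (c * (x $ i)))" for x :: "real^'n"
  have bb: "bump c 0 x = complex_of_real (b x)" for x by (simp add: bump_eq b_def)
  have b0: "0 \<le> b x" for x unfolding b_def by (intro prod_nonneg ballI bumpd_nonneg)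
  have i: "integrable lborel (\<lambda>x. exp (- (\<i> * complex_of_real (\<zeta> \<bullet> x))) * bump c 0 x)"
    using test_function_L12[OF bump_test_function[OF c(1), of "0::real^'n"]] by (intro integrable_phase) (simp add: L12_def)
  have R: "Re (exp (- (\<i> * complex_of_real (\<zeta> \<bullet> x))) * bump c 0 x) = cos (\<zeta> \<bullet> x) * b x" for x
    by (simp add: bb Re_exp)
  have ir: "integrable lborel (\<lambda>x. cos (\<zeta> \<bullet> x) * b x)" using integrable_Re[OF i] unfolding R .
  have Ir: "(\<integral>x. cos (\<zeta> \<bullet> x) * b x \<partial>lborel) = 0" using integral_Re[OF i] unfolding R I0 by simp
  have cpos: "0 < cos (\<zeta> \<bullet> x)" if "b x \<noteq> 0" for x
  proof -
    have "norm x \<le> real CARD('n) / c"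
      using bump_eq_0[OF c(1), of x 0] that bb[of x] by fastforce
    then have "\<bar>\<zeta> \<bullet> x\<bar> \<le> norm \<zeta> * (real CARD('n) / c)"
      by (intro order_trans[OF Cauchy_Schwarz_ineq2] mult_left_mono) auto
    also have "\<dots> < 1" using c by (simp add: divide_less_eq mult.commute)
    finally have "\<bar>\<zeta> \<bullet> x\<bar> < pi / 2" using pi_gt3 by linarith
    then show ?thesis by (intro cos_gt_zero_pi) auto
  qed
  have nn: "0 \<le> cos (\<zeta> \<bullet> x) * b x" for x
    using cpos[of x] b0[of x] by (cases "b x = 0") auto
  have "AE x in lborel. cos (\<zeta> \<bullet> x) * b x = 0"
    using integral_nonneg_eq_0_iff_AE[OF ir] nn Ir by auto
  then have "AE x in lborel. (x :: real^'n) \<notin> box (\<chi> i. - (1 / c)) (\<chi> i. 1 / c)"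
  proof eventually_elim
    case (elim x)
    show ?case
    proof
      assume "x \<in> box (\<chi> i. - (1 / c)) (\<chi> i. 1 / c)"
      then have "\<bar>c * (x $ i)\<bar> < 1" for i
        using c(1) by (auto simp: mem_box_cart abs_less_iff divide_simps mult.commute)
      then have "b x > 0" unfolding b_def by (intro prod_pos) (simp add: bumpd_def)
      then show False using elim cpos[of x] by auto
    qed
  qed
  then have "emeasure lborel (box (\<chi> i. - (1 / c)) (\<chi> i. 1 / c) :: (real^'n) set) = 0"
    by (subst (asm) AE_iff_measurable[OF _ refl]) auto
  moreover have "0 < emeasure lborel (box (\<chi> i. - (1 / c)) (\<chi> i. 1 / c) :: (real^'n) set)"
    using c(1) by (subst emeasure_lborel_box) (auto simp: Basis_vec_def inner_axis intro!: prod_pos)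
  ultimately show False by simp
qed

section \<open>Weak derivatives as Fourier multipliers\<close>

lemma ifourier_fourier_L12_AE:
  assumes "L12 f"
  shows "AE \<zeta> in lborel. fun_l2 (ifourier (to_l2 f)) \<zeta> = fourier_integral f (- \<zeta>)"
  using fun_l2_comp[OF mpres_uminus, of "fourier_L12 f"]
    mpres_AE[OF mpres_uminus fun_l2_to_l2[OF fourier_integral_square_integrable[OF assms]]]
  unfolding ifourier_def fourier_to_l2[OF assms] fourier_L12_def by eventually_elim simp

text \<open>Tested with all translates of one bump, the weak equation says that the multiplier
  defect times the transform of the bump has vanishing Fourier integral. Plancherel's identity makes
  that product 0 almost everywhere, and varying the scale removes the transform of the bump.\<close>

lemma has_weak_partialD:
  fixes v w :: "(real^'n::finite) l2"
  assumes weak: "has_weak_partial \<alpha> v w"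
  shows "AE \<zeta> in lborel. fun_l2 (fourier w) \<zeta> = msym \<alpha> \<zeta> * fun_l2 (fourier v) \<zeta>"
proof -
  define s where "s = ((-1) ^ mi_order \<alpha> :: complex)"
  have ss: "s * s = 1" by (simp add: s_def flip: power_add)
  have key: "AE \<zeta> in lborel. (msym \<alpha> \<zeta> * fun_l2 (fourier v) \<zeta> - fun_l2 (fourier w) \<zeta>) * fourier_integral (bump c 0) (- \<zeta>) = 0"
    if c: "0 < c" for c
  proof -
    let ?\<phi> = "bump c (0::real^'n)"
    have t: "?\<phi> \<in> test_functions" by (rule bump_test_function[OF c])
    note sq = test_function_square_integrable[OF t]
    define B where "B = fun_l2 (ifourier (to_l2 ?\<phi>))"
    define q where "q = fun_l2 (ifourier (to_l2 (mi_partial \<alpha> ?\<phi>)))"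
    have Bm [measurable]: "B \<in> borel_measurable borel" "q \<in> borel_measurable borel" by (simp_all add: B_def q_def)
    have qB: "AE \<zeta> in lborel. q \<zeta> = s * msym \<alpha> \<zeta> * B \<zeta>"
      using ifourier_mi_partial[OF t, of \<alpha>] by (simp add: q_def B_def s_def)
    \<comment> \<open>The transform of an integrable function is bounded. So the two terms of
      \<open>p\<close> are square integrable, besides being integrable as products of L2 functions,
      and Plancherel's identity applies to \<open>p\<close>.\<close>
    have bdd: "\<exists>C. AE \<zeta> in lborel. cmod (fun_l2 (ifourier (to_l2 \<psi>)) \<zeta>) \<le> C" if "\<psi> \<in> test_functions" for \<psi> :: "real^'n \<Rightarrow> complex"
    proof
      show "AE \<zeta> in lborel. cmod (fun_l2 (ifourier (to_l2 \<psi>)) \<zeta>) \<le> fconst TYPE('n) * (\<integral>x. cmod (\<psi> x) \<partial>lborel)"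
        using ifourier_fourier_L12_AE[OF test_function_L12[OF that]]
      proof eventually_elim
        case (elim \<zeta>)
        show ?case unfolding elim by (rule fourier_integral_bound)
      qed
    qed
    obtain C1 C2 where C1: "AE \<zeta> in lborel. cmod (B \<zeta>) \<le> C1" and C2: "AE \<zeta> in lborel. cmod (q \<zeta>) \<le> C2"
      using bdd[OF t] bdd[OF mi_partial_test(1)[OF t, of \<alpha>]] unfolding B_def q_def by blast
    \<comment> \<open>The multiplier defect times the transform of one bump, in the form in which
      the weak equation tests it; the sign is undone by \<open>s * s = 1\<close>.\<close>
    define p where "p \<zeta> = s * (fun_l2 (fourier v) \<zeta> * q \<zeta>) - fun_l2 (fourier w) \<zeta> * B \<zeta>" for \<zeta>
    have i1: "integrable lborel (\<lambda>\<zeta>. fun_l2 (fourier v) \<zeta> * q \<zeta>)" "integrable lborel (\<lambda>\<zeta>. fun_l2 (fourier w) \<zeta> * B \<zeta>)"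
      unfolding q_def B_def by (rule integrable_bil)+
    have s1: "square_integrable (\<lambda>\<zeta>. fun_l2 (fourier v) \<zeta> * q \<zeta>)"
      by (rule square_integrable_bound[OF _ square_integrable_fun_l2, of _ C2 "fourier v"], measurable)
        (use C2 in eventually_elim, simp add: norm_mult mult.commute mult_left_mono mult_right_mono)
    have s2: "square_integrable (\<lambda>\<zeta>. fun_l2 (fourier w) \<zeta> * B \<zeta>)"
      by (rule square_integrable_bound[OF _ square_integrable_fun_l2, of _ C1 "fourier w"], measurable)
        (use C1 in eventually_elim, simp add: norm_mult mult.commute mult_left_mono mult_right_mono)
    have p12: "L12 p"
      unfolding p_def using i1 s1 s2 by (auto simp: L12_def intro!: square_integrable_minus square_integrable_bounded_symbol)
    \<comment> \<open>Translating the bump by \<open>- y\<close> multiplies its inverse transform by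
      the phase of the Fourier integral at \<open>y\<close>, so the weak equation for the translate
      is the claim.\<close>
    have "fourier_integral p y = 0" for y :: "real^'n"
    proof -
      let ?e = "\<lambda>\<zeta>. exp (- \<i> * complex_of_real (y \<bullet> \<zeta>))"
      have tb: "bump c (- y) \<in> test_functions" by (rule bump_test_function[OF c])
      have tr: "to_l2 (bump c (- y)) = comp_l2 (\<lambda>x. x + y) (to_l2 ?\<phi>)"
        unfolding comp_l2_to_l2[OF mpres_translate sq] bump_translate[of c "- y"] by simp
      have e1: "AE \<zeta> in lborel. fun_l2 (ifourier (to_l2 (bump c (- y)))) \<zeta> = ?e \<zeta> * B \<zeta>"
        using fun_l2_comp[OF mpres_uminus, of "fourier (to_l2 (bump c (- y)))"]
          fun_l2_comp[OF mpres_uminus, of "fourier (to_l2 ?\<phi>)"]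
          mpres_AE[OF mpres_uminus fun_l2_mul[OF bounded_symbol_phase, of y "fourier (to_l2 ?\<phi>)"]]
        unfolding ifourier_def B_def tr fourier_translate
        by eventually_elim (simp add: inner_commute)
      have "bil (fourier v) (ifourier (to_l2 (mi_partial \<alpha> (bump c (- y))))) = s * bil (fourier w) (ifourier (to_l2 (bump c (- y))))"
        using weak tb unfolding has_weak_partial_iff s_def by blast
      moreover have "bil (fourier v) (ifourier (to_l2 (mi_partial \<alpha> (bump c (- y))))) = (\<integral>\<zeta>. ?e \<zeta> * (fun_l2 (fourier v) \<zeta> * q \<zeta>) \<partial>lborel)"
        by (rule bil_cong_AE, use e1 qB ifourier_mi_partial[OF tb, of \<alpha>] in eventually_elim)
          (simp_all add: s_def mult_ac)
      moreover have "bil (fourier w) (ifourier (to_l2 (bump c (- y)))) = (\<integral>\<zeta>. ?e \<zeta> * (fun_l2 (fourier w) \<zeta> * B \<zeta>) \<partial>lborel)"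
        by (rule bil_cong_AE, use e1 in eventually_elim) (simp_all add: mult_ac)
      ultimately have eq: "(\<integral>\<zeta>. ?e \<zeta> * (fun_l2 (fourier v) \<zeta> * q \<zeta>) \<partial>lborel) = s * (\<integral>\<zeta>. ?e \<zeta> * (fun_l2 (fourier w) \<zeta> * B \<zeta>) \<partial>lborel)"
        by simp
      have "fourier_integral p y = s * fourier_integral (\<lambda>\<zeta>. fun_l2 (fourier v) \<zeta> * q \<zeta>) y - fourier_integral (\<lambda>\<zeta>. fun_l2 (fourier w) \<zeta> * B \<zeta>) y"
        unfolding p_def using i1 by (subst fourier_integral_diff) (simp_all add: fourier_integral_cmult)
      also have "\<dots> = 0"
        unfolding fourier_integral_def eq by (simp add: mult.assoc[symmetric] mult.commute ss)
      finally show ?thesis .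
    qed
    then have "fourier_integral p = (\<lambda>x. 0)" by (rule ext)
    then have "fourier_L12 p = to_l2 (\<lambda>x. 0)" by (simp add: fourier_L12_def)
    then have "norm (fourier (to_l2 p)) = 0" using fourier_to_l2[OF p12] by (simp add: to_l2_zero)
    then have "to_l2 p = 0" by simp
    then have "AE \<zeta> in lborel. p \<zeta> = 0"
      using fun_l2_to_l2[of p] p12 fun_l2_zero unfolding L12_def by auto
    with qB ifourier_fourier_L12_AE[OF test_function_L12[OF t]] show ?thesis
    proof eventually_elim
      case (elim \<zeta>)
      have "p \<zeta> = (s * s) * msym \<alpha> \<zeta> * fun_l2 (fourier v) \<zeta> * B \<zeta> - fun_l2 (fourier w) \<zeta> * B \<zeta>"
        using elim(1) by (simp add: p_def mult_ac)
      then show ?case using elim(2,3) ss by (simp add: left_diff_distrib B_def)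
    qed
  qed
  \<comment> \<open>Countably many scales, so that one null set serves all of them; at each
    frequency a large enough scale has a nonzero transform.\<close>
  have "AE \<zeta> in lborel. \<forall>j. (msym \<alpha> \<zeta> * fun_l2 (fourier v) \<zeta> - fun_l2 (fourier w) \<zeta>) * fourier_integral (bump (real (Suc j)) 0) (- \<zeta>) = 0"
    unfolding AE_all_countable by (intro allI key) simp
  then show ?thesis
  proof eventually_elim
    case (elim \<zeta>)
    obtain j where "real CARD('n) * norm \<zeta> < real j" using reals_Archimedean2 by blast
    then have "fourier_integral (bump (real (Suc j)) 0) (- \<zeta>) \<noteq> 0"
      by (intro fourier_integral_bump_nonzero) auto
    with elim show ?case by auto
  qed
qed

lemma weak_partial_eq: "has_weak_partial \<alpha> v w \<Longrightarrow> weak_partial \<alpha> v = w"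
  unfolding weak_partial_def
proof (rule the_equality)
  fix w' assume a: "has_weak_partial \<alpha> v w" "has_weak_partial \<alpha> v w'"
  have "fourier w' = fourier w"
    by (rule l2_eqI, use has_weak_partialD[OF a(1)] has_weak_partialD[OF a(2)] in eventually_elim) simp
  then show "w' = w" by (simp add: fourier_eq_iff)
qed

section \<open>Weighted Fourier norms against the Sobolev norm of the statement\<close>

lemma abs_component_le_bra: "\<bar>\<zeta> $ i\<bar> \<le> bra (\<zeta> :: real^'n::finite)"
proof -
  have "\<bar>\<zeta> $ i\<bar> \<le> norm \<zeta>" by (rule component_le_norm_cart)
  also have "\<dots> \<le> bra \<zeta>" unfolding bra_def by (rule real_le_rsqrt) simp
  finally show ?thesis .
qed

lemma cmod_msym_le: "cmod (msym \<alpha> \<zeta>) \<le> bra \<zeta> ^ mi_order \<alpha>"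
proof -
  have "cmod (msym \<alpha> \<zeta>) = (\<Prod>i\<in>UNIV. \<bar>\<zeta> $ i\<bar> ^ \<alpha> i)"
    by (simp add: msym_def norm_mult norm_power flip: prod_norm)
  also have "\<dots> \<le> (\<Prod>i\<in>UNIV. bra \<zeta> ^ \<alpha> i)"
    by (intro prod_mono conjI power_mono abs_component_le_bra) auto
  also have "\<dots> = bra \<zeta> ^ mi_order \<alpha>" by (simp add: mi_order_def power_sum)
  finally show ?thesis .
qed

lemma Hs_weak_partial:
  assumes v: "v \<in> Hs m" and \<alpha>: "mi_order \<alpha> \<le> m"
  shows "has_weak_partial \<alpha> v (weak_partial \<alpha> v)" "norm (weak_partial \<alpha> v) \<le> hs_norm m v"
proof -
  let ?f = "\<lambda>\<zeta>. msym \<alpha> \<zeta> * fun_l2 (fourier v) \<zeta>"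
  have le: "cmod (?f \<zeta>) \<le> 1 * bra \<zeta> ^ m * cmod (fun_l2 (fourier v) \<zeta>)" for \<zeta>
  proof -
    have "cmod (msym \<alpha> \<zeta>) \<le> bra \<zeta> ^ m"
      by (rule order_trans[OF cmod_msym_le power_increasing[OF \<alpha> bra_ge1]])
    then show ?thesis by (simp add: norm_mult mult_right_mono)
  qed
  have s1: "square_integrable (\<lambda>\<zeta>. brapow m \<zeta> * fun_l2 (fourier v) \<zeta>)" using v by (simp add: Hs_def)
  have s: "square_integrable ?f"
    by (rule square_integrable_bound[OF _ s1, of _ 1], measurable) (use le in \<open>simp add: norm_mult\<close>)
  have w: "AE \<zeta> in lborel. fun_l2 (fourier (ifourier (to_l2 ?f))) \<zeta> = ?f \<zeta>"
    using fun_l2_to_l2[OF s] by simp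
  have h: "has_weak_partial \<alpha> v (ifourier (to_l2 ?f))" using w by (rule has_weak_partialI)
  have "AE \<zeta> in lborel. cmod (fun_l2 (fourier (ifourier (to_l2 ?f))) \<zeta>) \<le> 1 * bra \<zeta> ^ m * cmod (fun_l2 (fourier v) \<zeta>)"
    using w by eventually_elim (use le in simp)
  from Hs_dominated(2)[of v 0 m 1, OF _ _ this] v have "norm (ifourier (to_l2 ?f)) \<le> hs_norm m v" by simp
  with h show "has_weak_partial \<alpha> v (weak_partial \<alpha> v)" "norm (weak_partial \<alpha> v) \<le> hs_norm m v"
    using weak_partial_eq[OF h] by simp_all
qed

definition sob_const :: "'n::finite itself \<Rightarrow> nat \<Rightarrow> real" where
  "sob_const _ m = sqrt (real (card {\<alpha> :: 'n \<Rightarrow> nat. mi_order \<alpha> \<le> m}))"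

lemma sob_const_nonneg: "0 \<le> sob_const TYPE('n::finite) m"
  by (simp add: sob_const_def)

text \<open>Each derivative is bounded by the full weighted norm; the constant counts the
  multi-indices.\<close>

lemma sobolev_norm_le:
  fixes v :: "(real^'n::finite) l2"
  assumes v: "v \<in> Hs m"
  shows "sobolev_norm m v \<le> ennreal (sob_const TYPE('n) m * hs_norm m v)"
proof -
  have "v \<in> sobolev m" using Hs_weak_partial(1)[OF v] by (auto simp: sobolev_def)
  moreover have "sqrt (\<Sum>\<alpha>\<in>{\<alpha>. mi_order \<alpha> \<le> m}. (norm (weak_partial \<alpha> v))\<^sup>2) \<le> sob_const TYPE('n) m * hs_norm m v"
  proof (rule real_le_lsqrt)
    have "(\<Sum>\<alpha>\<in>{\<alpha>. mi_order \<alpha> \<le> m}. (norm (weak_partial \<alpha> v))\<^sup>2) \<le> (\<Sum>\<alpha>\<in>{\<alpha> :: 'n \<Rightarrow> nat. mi_order \<alpha> \<le> m}. (hs_norm m v)\<^sup>2)"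
      by (intro sum_mono power_mono Hs_weak_partial(2)[OF v]) auto
    also have "\<dots> = (sob_const TYPE('n) m * hs_norm m v)\<^sup>2" by (simp add: sob_const_def power_mult_distrib)
    finally show "(\<Sum>\<alpha>\<in>{\<alpha>. mi_order \<alpha> \<le> m}. (norm (weak_partial \<alpha> v))\<^sup>2) \<le> (sob_const TYPE('n) m * hs_norm m v)\<^sup>2" .
  qed (auto simp: sob_const_nonneg intro: mult_nonneg_nonneg)
  ultimately show ?thesis by (simp add: sobolev_norm_def ennreal_leI)
qed

text \<open>Everything is compared with the largest of 1 and the moduli of the components, whose
  power is one of the summands on the right.\<close>

lemma bra_pow_le:
  fixes \<zeta> :: "real^'n::finite"
  shows "bra \<zeta> ^ k \<le> real (Suc CARD('n)) ^ k * (1 + (\<Sum>i\<in>UNIV. \<bar>\<zeta> $ i\<bar> ^ k))"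
proof -
  define M where "M = Max (insert 1 ((\<lambda>i. \<bar>\<zeta> $ i\<bar>) ` UNIV))"
  have M: "1 \<le> M" "\<And>i. \<bar>\<zeta> $ i\<bar> \<le> M" unfolding M_def by (rule Max_ge; simp)+
  have "M \<in> insert 1 ((\<lambda>i. \<bar>\<zeta> $ i\<bar>) ` UNIV)" unfolding M_def by (rule Max_in) auto
  then have Mk: "M ^ k \<le> 1 + (\<Sum>i\<in>UNIV. \<bar>\<zeta> $ i\<bar> ^ k)"
  proof
    assume "M \<in> (\<lambda>i. \<bar>\<zeta> $ i\<bar>) ` UNIV"
    then obtain i where "M = \<bar>\<zeta> $ i\<bar>" by auto
    then have "M ^ k \<le> (\<Sum>i\<in>UNIV. \<bar>\<zeta> $ i\<bar> ^ k)"
      using member_le_sum[of i UNIV "\<lambda>i. \<bar>\<zeta> $ i\<bar> ^ k"] by simp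
    then show ?thesis by simp
  qed (simp add: sum_nonneg)
  have "bra \<zeta> \<le> 1 + norm \<zeta>"
    unfolding bra_def by (rule real_le_lsqrt) (auto simp: power2_eq_square algebra_simps)
  also have "\<dots> \<le> 1 + (\<Sum>i\<in>UNIV. \<bar>\<zeta> $ i\<bar>)" using norm_le_l1_cart[of \<zeta>] by simp
  also have "\<dots> \<le> M + (\<Sum>i\<in>(UNIV :: 'n set). M)" by (intro add_mono sum_mono M)
  also have "\<dots> = real (Suc CARD('n)) * M" by (simp add: algebra_simps)
  finally have "bra \<zeta> ^ k \<le> (real (Suc CARD('n)) * M) ^ k" by (intro power_mono) auto
  also have "\<dots> = real (Suc CARD('n)) ^ k * M ^ k" by (rule power_mult_distrib)
  also have "\<dots> \<le> real (Suc CARD('n)) ^ k * (1 + (\<Sum>i\<in>UNIV. \<bar>\<zeta> $ i\<bar> ^ k))"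
    by (rule mult_left_mono[OF Mk]) simp
  finally show ?thesis .
qed

text \<open>The pure derivatives of order \<open>k\<close> in the coordinate directions, together
  with \<open>v\<close> itself, dominate the weight by \<open>bra_pow_le\<close>.\<close>

lemma sobolev_subset_Hs: "sobolev k \<subseteq> Hs k"
proof
  fix v :: "(real^'n::finite) l2" assume v: "v \<in> sobolev k"
  define e where "e i = (\<lambda>l::'n. if l = i then k else 0)" for i :: 'n
  have "\<exists>w. has_weak_partial (e i) v w" for i
  proof -
    have "mi_order (e i) = k" by (simp add: mi_order_def e_def)
    then show ?thesis using v by (simp add: sobolev_def)
  qed
  then obtain w where w: "\<And>i. has_weak_partial (e i) v (w i)" by metis
  have ms: "msym (e i) \<zeta> = (\<i> * complex_of_real (\<zeta> $ i)) ^ k" for i \<zeta>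
  proof -
    have "msym (e i) \<zeta> = (\<Prod>l\<in>UNIV. if l = i then (\<i> * complex_of_real (\<zeta> $ i)) ^ k else 1)"
      unfolding msym_def by (rule prod.cong) (auto simp: e_def)
    then show ?thesis by simp
  qed
  have F: "AE \<zeta> in lborel. \<forall>i. fun_l2 (fourier (w i)) \<zeta> = (\<i> * complex_of_real (\<zeta> $ i)) ^ k * fun_l2 (fourier v) \<zeta>"
    using has_weak_partialD[OF w] unfolding ms by (subst AE_all_countable) simp
  let ?c = "real (Suc CARD('n)) ^ k"
  let ?g = "\<lambda>\<zeta>. complex_of_real (cmod (fun_l2 (fourier v) \<zeta>)) + (\<Sum>i\<in>UNIV. complex_of_real (cmod (fun_l2 (fourier (w i)) \<zeta>)))"
  have "square_integrable (\<lambda>\<zeta>. \<Sum>i\<in>I. complex_of_real (cmod (fun_l2 (fourier (w i)) \<zeta>)))" if "finite I" for I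
    using that by induction (auto intro!: square_integrable_zero square_integrable_add square_integrable_norm square_integrable_fun_l2)
  then have sg: "square_integrable ?g"
    by (intro square_integrable_add square_integrable_norm square_integrable_fun_l2) simp
  have "square_integrable (\<lambda>\<zeta>. brapow k \<zeta> * fun_l2 (fourier v) \<zeta>)"
  proof (rule square_integrable_bound[OF _ sg])
    show "AE \<zeta> in lborel. cmod (brapow k \<zeta> * fun_l2 (fourier v) \<zeta>) \<le> ?c * cmod (?g \<zeta>)"
      using F
    proof eventually_elim
      case (elim \<zeta>)
      have "cmod (brapow k \<zeta> * fun_l2 (fourier v) \<zeta>) \<le> ?c * (1 + (\<Sum>i\<in>UNIV. \<bar>\<zeta> $ i\<bar> ^ k)) * cmod (fun_l2 (fourier v) \<zeta>)"
        unfolding norm_mult cmod_brapow by (intro mult_right_mono bra_pow_le) auto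
      also have "\<dots> = ?c * (cmod (fun_l2 (fourier v) \<zeta>) + (\<Sum>i\<in>UNIV. cmod (fun_l2 (fourier (w i)) \<zeta>)))"
        using elim by (simp add: norm_mult norm_power distrib_left distrib_right sum_distrib_right sum_distrib_left mult.assoc)
      also have "cmod (fun_l2 (fourier v) \<zeta>) + (\<Sum>i\<in>UNIV. cmod (fun_l2 (fourier (w i)) \<zeta>)) = cmod (?g \<zeta>)"
      proof -
        have "?g \<zeta> = complex_of_real (cmod (fun_l2 (fourier v) \<zeta>) + (\<Sum>i\<in>UNIV. cmod (fun_l2 (fourier (w i)) \<zeta>)))" by simp
        then show ?thesis by (simp only: norm_of_real) (simp add: sum_nonneg add_nonneg_nonneg)
      qed
      finally show ?case .
    qed
  qed measurable
  then show "v \<in> Hs k" by (simp add: Hs_def)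
qed

text \<open>\<open>K\<close> bounds all iterated derivatives of order at most \<open>k\<close>.\<close>

primrec deriv_bounded :: "nat \<Rightarrow> real \<Rightarrow> (real^'n::finite \<Rightarrow> real) \<Rightarrow> bool" where
  "deriv_bounded 0 K W \<longleftrightarrow> W \<in> borel_measurable borel \<and> (\<forall>x. \<bar>W x\<bar> \<le> K)"
| "deriv_bounded (Suc k) K W \<longleftrightarrow> W \<in> borel_measurable borel \<and> (\<forall>x. \<bar>W x\<bar> \<le> K) \<and> (\<forall>i. \<exists>W'. dird i W W' \<and> deriv_bounded k K W')"

lemma deriv_bounded_bounded: "deriv_bounded k K W \<Longrightarrow> W \<in> borel_measurable borel" "deriv_bounded k K W \<Longrightarrow> \<bar>W x\<bar> \<le> K"
  by (cases k; simp)+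

lemma deriv_bounded_nonneg: "deriv_bounded k K W \<Longrightarrow> 0 \<le> K"
  using deriv_bounded_bounded(2) abs_ge_zero order_trans by blast

lemma deriv_bounded_Suc: "deriv_bounded (Suc k) K W \<Longrightarrow> deriv_bounded k K W"
proof (induction k arbitrary: W)
  case (Suc k)
  then show ?case by (meson deriv_bounded.simps(2))
qed simp

lemma deriv_bounded_mono_bound: "deriv_bounded k K W \<Longrightarrow> K \<le> L \<Longrightarrow> deriv_bounded k L W"
proof (induction k arbitrary: W)
  case 0 then show ?case by (auto intro: order_trans)
next
  case (Suc k) then show ?case by (auto intro: order_trans) blast
qed

section \<open>Multiplication by functions with bounded derivatives\<close>

definition rmul :: "('a::euclidean_space \<Rightarrow> real) \<Rightarrow> 'a l2 \<Rightarrow> 'a l2" where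
  "rmul W v = mul (\<lambda>x. complex_of_real (W x)) v"

lemma bounded_symbol_real: "W \<in> borel_measurable borel \<Longrightarrow> (\<And>x. \<bar>W x\<bar> \<le> K) \<Longrightarrow> bounded_symbol (\<lambda>x. complex_of_real (W x))"
  by (rule bsymI[of _ K]) auto

text \<open>The discrete product rule: the quotient of \<open>W v\<close> is the shifted
  \<open>W\<close> times the quotient of \<open>v\<close>, plus the quotient of \<open>W\<close>
  times \<open>v\<close>. Both multipliers are bounded by \<open>K\<close> and converge
  pointwise.\<close>

lemma has_dir_rmul:
  assumes W: "W \<in> borel_measurable borel" "\<And>x. \<bar>W x\<bar> \<le> K" and W': "W' \<in> borel_measurable borel" "\<And>x. \<bar>W' x\<bar> \<le> K"
    and d: "dird i W W'" and v: "has_dir i v v'"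
  shows "has_dir i (rmul W v) (rmul W v' + rmul W' v)"
proof -
  note [measurable] = W(1) W'(1)
  let ?h = "\<lambda>j. inverse (real (Suc j))"
  let ?T = "\<lambda>j x. x + axis i (?h j)"
  let ?d = "\<lambda>j. real (Suc j) *\<^sub>R (comp_l2 (?T j) v - v)"
  let ?D = "\<lambda>j x. real (Suc j) *\<^sub>R (W (?T j x) - W x)"
  have DK: "\<bar>?D j x\<bar> \<le> K" for j x using dird_diffq_bound[OF d, of K j x] W'(2) by simp
  have sW: "(\<lambda>j. W (?T j x)) \<longlonglongrightarrow> W x" for x
  proof (rule LIM_zero_cancel, rule Lim_null_comparison)
    have "\<bar>W (?T j x) - W x\<bar> \<le> K * ?h j" for j
    proof -
      have "real (Suc j) * \<bar>W (?T j x) - W x\<bar> \<le> K" using DK[of j x] by (simp add: abs_mult del: of_nat_Suc)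
      then show ?thesis by (simp add: field_simps del: of_nat_Suc)
    qed
    then show "\<forall>\<^sub>F j in sequentially. norm (W (?T j x) - W x) \<le> K * ?h j" by simp
    have "(\<lambda>j. K * ?h j) \<longlonglongrightarrow> K * 0" by (intro tendsto_mult tendsto_const LIMSEQ_inverse_real_of_nat)
    then show "(\<lambda>j. K * ?h j) \<longlonglongrightarrow> 0" by simp
  qed
  have mT: "(\<lambda>x. W (?T j x)) \<in> borel_measurable borel" for j by measurable
  have b1: "bounded_symbol (\<lambda>x. complex_of_real (W (?T j x)))" for j by (rule bounded_symbol_real[OF mT W(2)])
  have b2: "bounded_symbol (\<lambda>x. complex_of_real (?D j x))" for j by (rule bounded_symbol_real[OF _ DK]) measurable
  have bW: "bounded_symbol (\<lambda>x. complex_of_real (W x))" by (rule bounded_symbol_real[OF W])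
  have l1: "(\<lambda>j. mul (\<lambda>x. complex_of_real (W (?T j x))) (?d j)) \<longlonglongrightarrow> rmul W v'"
    unfolding rmul_def
    by (rule mul_tendsto[where c = K]) (use v W(2) sW mT in \<open>auto simp: has_dir_def intro!: tendsto_of_real\<close>)
  have l2: "(\<lambda>j. mul (\<lambda>x. complex_of_real (?D j x)) v) \<longlonglongrightarrow> rmul W' v"
    unfolding rmul_def
  proof (rule mul_tendsto_fixed[where c = K])
    show "(\<lambda>j. complex_of_real (?D j x)) \<longlonglongrightarrow> complex_of_real (W' x)" for x
      by (intro tendsto_of_real dird_diffq_tendsto[OF d])
    show "cmod (complex_of_real (?D j x)) \<le> K" for j x using DK[of j x] by (simp only: norm_of_real)
  qed measurable
  have eq: "real (Suc j) *\<^sub>R (comp_l2 (?T j) (rmul W v) - rmul W v) =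
      mul (\<lambda>x. complex_of_real (W (?T j x))) (?d j) + mul (\<lambda>x. complex_of_real (?D j x)) v" for j
  proof (rule l2_eqI, use fun_l2_scaleR[of "real (Suc j)" "comp_l2 (?T j) (rmul W v) - rmul W v"]
      fun_l2_diff[of "comp_l2 (?T j) (rmul W v)" "rmul W v"] fun_l2_comp[OF mpres_translate, of "axis i (?h j)" "rmul W v"]
      fun_l2_mul[OF bW, of v] mpres_AE[OF mpres_translate fun_l2_mul[OF bW, of v], of "axis i (?h j)"]
      fun_l2_add[of "mul (\<lambda>x. complex_of_real (W (?T j x))) (?d j)" "mul (\<lambda>x. complex_of_real (?D j x)) v"]
      fun_l2_mul[OF b1, of j "?d j"] fun_l2_mul[OF b2, of j v] fun_l2_scaleR[of "real (Suc j)" "comp_l2 (?T j) v - v"]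
      fun_l2_diff[of "comp_l2 (?T j) v" v] fun_l2_comp[OF mpres_translate, of "axis i (?h j)" v] in eventually_elim)
    case (elim x)
    then show ?case
      unfolding rmul_def
      by (simp only: scaleR_conv_of_real of_real_mult of_real_diff real_scaleR_def) (simp add: algebra_simps)
  qed
  show ?thesis unfolding has_dir_def eq by (intro tendsto_add l1 l2)
qed

text \<open>One step of the induction below produces the factor \<open>1 + 2 * n\<close> in front of
  \<open>v\<close>, with \<open>n\<close> the dimension, and 2 in front of its derivatives; this
  constant exceeds both.\<close>

definition mul_step_const :: "'n::finite itself \<Rightarrow> real" where
  "mul_step_const _ = 3 + 2 * real CARD('n)"

text \<open>Induction over the order: each first derivative of the product is a sum of two products
  of one order less. The bound is kept in squares because \<open>Hs_Suc\<close> is additive in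
  squares.\<close>

lemma Hs_rmul_sq:
  fixes v :: "(real^'n::finite) l2"
  assumes "deriv_bounded k K W" "v \<in> Hs k"
  shows "rmul W v \<in> Hs k \<and> (hs_norm k (rmul W v))\<^sup>2 \<le> mul_step_const TYPE('n) ^ k * (K\<^sup>2 * (hs_norm k v)\<^sup>2)"
  using assms
proof (induction k arbitrary: W v)
  case 0
  then have "norm (rmul W v) \<le> K * norm v"
    unfolding rmul_def by (intro norm_mul_le) auto
  then have "(norm (rmul W v))\<^sup>2 \<le> (K * norm v)\<^sup>2" by (rule power_mono) simp
  then show ?case by (simp add: power_mult_distrib)
next
  case (Suc k)
  let ?c = "mul_step_const TYPE('n) ^ k * K\<^sup>2"
  have c0: "0 \<le> ?c" by (simp add: mul_step_const_def)
  have v: "v \<in> Hs k" using Hs_mono(1)[OF _ Suc.prems(2), of k] by simp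
  have W: "deriv_bounded k K W" using Suc.prems(1) by (rule deriv_bounded_Suc)
  obtain W' where W': "\<And>i. dird i W (W' i)" "\<And>i. deriv_bounded k K (W' i)" using Suc.prems(1) by (auto, metis)
  obtain v' where v': "\<And>i. has_dir i v (v' i)" "\<And>i. v' i \<in> Hs k" using has_dir_ex[OF Suc.prems(2)] by metis
  define u where "u i = rmul W (v' i) + rmul (W' i) v" for i
  have dir: "has_dir i (rmul W v) (u i)" for i
    unfolding u_def by (rule has_dir_rmul[where K = K])
      (use deriv_bounded_bounded[OF W] deriv_bounded_bounded[OF W'(2)] W'(1) v'(1) in auto)
  have A: "rmul W v \<in> Hs k" "(hs_norm k (rmul W v))\<^sup>2 \<le> ?c * (hs_norm k v)\<^sup>2"
    using Suc.IH[OF W v] by (simp_all add: mult.assoc)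
  have B: "rmul W (v' i) \<in> Hs k" "(hs_norm k (rmul W (v' i)))\<^sup>2 \<le> ?c * (hs_norm k (v' i))\<^sup>2" for i
    using Suc.IH[OF W v'(2)] by (simp_all add: mult.assoc)
  have C: "rmul (W' i) v \<in> Hs k" "(hs_norm k (rmul (W' i) v))\<^sup>2 \<le> ?c * (hs_norm k v)\<^sup>2" for i
    using Suc.IH[OF W'(2) v] by (simp_all add: mult.assoc)
  have uH: "u i \<in> Hs k" for i unfolding u_def by (intro Hs_add B C)
  have u2: "(hs_norm k (u i))\<^sup>2 \<le> 2 * (?c * (hs_norm k (v' i))\<^sup>2) + 2 * (?c * (hs_norm k v)\<^sup>2)" for i
  proof -
    have "(hs_norm k (u i))\<^sup>2 \<le> (hs_norm k (rmul W (v' i)) + hs_norm k (rmul (W' i) v))\<^sup>2"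
      unfolding u_def by (intro power_mono hs_norm_triangle B C) simp
    also have "\<dots> \<le> 2 * (hs_norm k (rmul W (v' i)))\<^sup>2 + 2 * (hs_norm k (rmul (W' i) v))\<^sup>2"
      using sum_squares_bound[of "hs_norm k (rmul W (v' i))" "hs_norm k (rmul (W' i) v)"] by (simp add: power2_sum)
    finally show ?thesis using B(2)[of i] C(2)[of i] by linarith
  qed
  have "(hs_norm (Suc k) (rmul W v))\<^sup>2 = (hs_norm k (rmul W v))\<^sup>2 + (\<Sum>i\<in>UNIV. (hs_norm k (u i))\<^sup>2)"
    by (rule Hs_Suc(2)[OF A(1) dir uH])
  also have "\<dots> \<le> ?c * (hs_norm k v)\<^sup>2 + (\<Sum>i\<in>UNIV. 2 * (?c * (hs_norm k (v' i))\<^sup>2) + 2 * (?c * (hs_norm k v)\<^sup>2))"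
    by (intro add_mono A sum_mono u2)
  also have "\<dots> = ?c * ((1 + 2 * real CARD('n)) * (hs_norm k v)\<^sup>2 + 2 * (\<Sum>i\<in>UNIV. (hs_norm k (v' i))\<^sup>2))"
    by (simp add: sum.distrib sum_distrib_left algebra_simps)
  also have "\<dots> \<le> ?c * (mul_step_const TYPE('n) * ((hs_norm k v)\<^sup>2 + (\<Sum>i\<in>UNIV. (hs_norm k (v' i))\<^sup>2)))"
  proof (rule mult_left_mono[OF _ c0])
    have "0 \<le> (\<Sum>i\<in>UNIV. (hs_norm k (v' i))\<^sup>2)" by (rule sum_nonneg) simp
    then show "(1 + 2 * real CARD('n)) * (hs_norm k v)\<^sup>2 + 2 * (\<Sum>i\<in>UNIV. (hs_norm k (v' i))\<^sup>2)
       \<le> mul_step_const TYPE('n) * ((hs_norm k v)\<^sup>2 + (\<Sum>i\<in>UNIV. (hs_norm k (v' i))\<^sup>2))"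
      unfolding distrib_left by (intro add_mono mult_right_mono) (auto simp: mul_step_const_def)
  qed
  also have "(hs_norm k v)\<^sup>2 + (\<Sum>i\<in>UNIV. (hs_norm k (v' i))\<^sup>2) = (hs_norm (Suc k) v)\<^sup>2"
    by (rule Hs_Suc(2)[OF v v', symmetric])
  finally show ?case using Hs_Suc(1)[OF A(1) dir uH] by (simp add: mult_ac)
qed

definition mul_const_bound :: "'n::finite itself \<Rightarrow> nat \<Rightarrow> real" where
  "mul_const_bound _ k = sqrt (mul_step_const TYPE('n) ^ k)"

lemma mul_const_bound_nonneg: "0 \<le> mul_const_bound TYPE('n::finite) k"
  by (simp add: mul_const_bound_def mul_step_const_def)

lemma Hs_rmul:
  fixes v :: "(real^'n::finite) l2"
  assumes "deriv_bounded k K W" "v \<in> Hs k"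
  shows "rmul W v \<in> Hs k" "hs_norm k (rmul W v) \<le> mul_const_bound TYPE('n) k * K * hs_norm k v"
proof -
  show "rmul W v \<in> Hs k" using Hs_rmul_sq[OF assms] by blast
  have "(hs_norm k (rmul W v))\<^sup>2 \<le> (mul_const_bound TYPE('n) k * K * hs_norm k v)\<^sup>2"
    using Hs_rmul_sq[OF assms] by (simp add: mul_const_bound_def power_mult_distrib mul_step_const_def mult.assoc)
  then show "hs_norm k (rmul W v) \<le> mul_const_bound TYPE('n) k * K * hs_norm k v"
    by (rule power2_le_imp_le) (intro mult_nonneg_nonneg mul_const_bound_nonneg deriv_bounded_nonneg[OF assms(1)] hs_norm_nonneg)
qed

section \<open>Convolution with a potential of class C m\<close>

definition rconv :: "('a::euclidean_space \<Rightarrow> real) \<Rightarrow> ('a \<Rightarrow> real) \<Rightarrow> 'a \<Rightarrow> real" where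
  "rconv g \<rho> x = (\<integral>y. g (x - y) * \<rho> y \<partial>lborel)"

lemma rconv_bounded:
  assumes [measurable]: "g \<in> borel_measurable borel" and g: "\<And>x. \<bar>g x\<bar> \<le> K" and r: "integrable lborel \<rho>"
  shows "integrable lborel (\<lambda>y. g (x - y) * \<rho> y)" "\<bar>rconv g \<rho> x\<bar> \<le> K * (\<integral>y. \<bar>\<rho> y\<bar> \<partial>lborel)"
    "rconv g \<rho> \<in> borel_measurable borel"
proof -
  have [measurable]: "\<rho> \<in> borel_measurable borel" using r by auto
  have ir: "integrable lborel (\<lambda>y. K * \<bar>\<rho> y\<bar>)" using r by simp
  have le: "norm (g (x - y) * \<rho> y) \<le> K * \<bar>\<rho> y\<bar>" for y
    using mult_right_mono[OF g[of "x - y"], of "\<bar>\<rho> y\<bar>"] by (simp add: abs_mult)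
  show i: "integrable lborel (\<lambda>y. g (x - y) * \<rho> y)"
    by (rule Bochner_Integration.integrable_bound[OF ir]) (use le order_trans[OF _ abs_ge_self] in auto)
  have "\<bar>rconv g \<rho> x\<bar> \<le> (\<integral>y. norm (g (x - y) * \<rho> y) \<partial>lborel)"
    unfolding rconv_def using integral_norm_bound[of lborel "\<lambda>y. g (x - y) * \<rho> y"] by simp
  also have "\<dots> \<le> (\<integral>y. K * \<bar>\<rho> y\<bar> \<partial>lborel)" by (rule integral_mono[OF integrable_norm[OF i] ir le])
  finally show "\<bar>rconv g \<rho> x\<bar> \<le> K * (\<integral>y. \<bar>\<rho> y\<bar> \<partial>lborel)" by simp
  show "rconv g \<rho> \<in> borel_measurable borel" unfolding rconv_def[abs_def]
    by (rule lborel.borel_measurable_lebesgue_integral) measurable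
qed

text \<open>Differentiation under the integral; the difference quotients of \<open>g\<close> are
  bounded by \<open>K\<close> through the mean value theorem, so \<open>K\<close> times the modulus
  of \<rho> dominates.\<close>

lemma dird_rconv:
  fixes g g' :: "real^'n::finite \<Rightarrow> real"
  assumes d: "dird i g g'" and m [measurable]: "g \<in> borel_measurable borel" "g' \<in> borel_measurable borel"
    and g: "\<And>x. \<bar>g x\<bar> \<le> K" and g': "\<And>x. \<bar>g' x\<bar> \<le> K" and r: "integrable lborel \<rho>"
  shows "dird i (rconv g \<rho>) (rconv g' \<rho>)"
  unfolding dird_def
proof
  fix x
  have [measurable]: "\<rho> \<in> borel_measurable borel" using r by auto
  let ?e = "axis i 1 :: real^'n"
  have "(\<lambda>h. (rconv g \<rho> (x + (0 + h) *\<^sub>R ?e) - rconv g \<rho> (x + 0 *\<^sub>R ?e)) / h) \<midarrow>0\<rightarrow> rconv g' \<rho> x"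
    unfolding tendsto_at_iff_sequentially comp_def
  proof (intro allI impI)
    fix X :: "nat \<Rightarrow> real" assume X: "\<forall>n. X n \<in> UNIV - {0}" "X \<longlonglongrightarrow> 0"
    then have X0: "X n \<noteq> 0" for n by auto
    have Xf: "filterlim X (at 0) sequentially" using X by (intro filterlim_atI) auto
    let ?q = "\<lambda>n y. (g (x + X n *\<^sub>R ?e - y) - g (x - y)) / X n"
    have qb: "\<bar>?q n y\<bar> \<le> K" for n y
    proof -
      have "norm (g ((x - y) + X n *\<^sub>R ?e) - g ((x - y) + 0 *\<^sub>R ?e)) \<le> K * norm (X n - 0)"
      proof (rule differentiable_bound[where S = UNIV and f = "\<lambda>t. g ((x - y) + t *\<^sub>R ?e)" and f' = "\<lambda>t h. h *\<^sub>R g' ((x - y) + t *\<^sub>R ?e)"])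
        show "((\<lambda>t. g (x - y + t *\<^sub>R ?e)) has_derivative (\<lambda>h. h *\<^sub>R g' (x - y + t *\<^sub>R ?e))) (at t within UNIV)" for t
          using dird_at[OF d, of "x - y" t] by (simp add: has_vector_derivative_def)
        show "onorm (\<lambda>h. h *\<^sub>R g' (x - y + t *\<^sub>R ?e)) \<le> K" for t
        proof (rule onorm_le)
          show "norm (h *\<^sub>R g' (x - y + t *\<^sub>R ?e)) \<le> K * norm h" for h
            using mult_right_mono[OF g'[of "x - y + t *\<^sub>R ?e"], of "\<bar>h\<bar>"] by (simp add: mult.commute abs_mult)
        qed
      qed auto
      then have "\<bar>g ((x - y) + X n *\<^sub>R ?e) - g (x - y)\<bar> / \<bar>X n\<bar> \<le> K" using X0[of n] by (simp add: divide_le_eq)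
      moreover have "x + X n *\<^sub>R ?e - y = (x - y) + X n *\<^sub>R ?e" by simp
      ultimately show ?thesis by (simp only: abs_divide)
    qed
    have "(\<lambda>n. \<integral>y. ?q n y * \<rho> y \<partial>lborel) \<longlonglongrightarrow> (\<integral>y. g' (x - y) * \<rho> y \<partial>lborel)"
    proof (rule integral_dominated_convergence[where w = "\<lambda>y. K * \<bar>\<rho> y\<bar>"])
      have "(\<lambda>n. ?q n y) \<longlonglongrightarrow> g' (x - y)" for y
      proof -
        have "((\<lambda>t. g ((x - y) + t *\<^sub>R ?e)) has_real_derivative g' (x - y)) (at 0)"
          using d by (simp add: dird_def has_real_derivative_iff_has_vector_derivative)
        then have "(\<lambda>h. (g ((x - y) + (0 + h) *\<^sub>R ?e) - g ((x - y) + 0 *\<^sub>R ?e)) / h) \<midarrow>0\<rightarrow> g' (x - y)"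
          by (simp add: DERIV_def)
        from filterlim_compose[OF this Xf] show ?thesis by (simp add: algebra_simps)
      qed
      then show "AE y in lborel. (\<lambda>n. ?q n y * \<rho> y) \<longlonglongrightarrow> g' (x - y) * \<rho> y"
        by (intro AE_I2 tendsto_mult tendsto_const)
      show "AE y in lborel. norm (?q n y * \<rho> y) \<le> K * \<bar>\<rho> y\<bar>" for n
        using mult_right_mono[OF qb[of n]] by (simp add: abs_mult)
    qed (use r in \<open>measurable, auto\<close>)
    moreover have "(\<integral>y. ?q n y * \<rho> y \<partial>lborel) = (rconv g \<rho> (x + (0 + X n) *\<^sub>R ?e) - rconv g \<rho> (x + 0 *\<^sub>R ?e)) / X n" for n
    proof -
      have "(\<integral>y. ?q n y * \<rho> y \<partial>lborel) = (\<integral>y. (g (x + X n *\<^sub>R ?e - y) * \<rho> y - g (x - y) * \<rho> y) / X n \<partial>lborel)"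
        by (simp add: left_diff_distrib diff_divide_distrib)
      then show ?thesis
        using rconv_bounded(1)[OF m(1) g r] by (simp add: rconv_def)
    qed
    ultimately show "(\<lambda>n. (rconv g \<rho> (x + (0 + X n) *\<^sub>R ?e) - rconv g \<rho> (x + 0 *\<^sub>R ?e)) / X n) \<longlonglongrightarrow> rconv g' \<rho> x"
      unfolding rconv_def[of g' \<rho> x] by (simp only:)
  qed
  then show "((\<lambda>t. rconv g \<rho> (x + t *\<^sub>R ?e)) has_vector_derivative rconv g' \<rho> x) (at 0)"
    by (simp add: has_real_derivative_iff_has_vector_derivative[symmetric] DERIV_def)
qed

text \<open>One constant serves all derivatives because there are finitely many index lists of
  bounded length.\<close>

lemma bounded_C_bound:
  fixes V :: "real^'n::finite \<Rightarrow> real"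
  assumes "V \<in> bounded_C m"
  shows "\<exists>K\<ge>0. \<forall>is x. length is \<le> m \<longrightarrow> \<bar>iter_partial is V x\<bar> \<le> K"
proof -
  have "finite {is :: 'n list. set is \<subseteq> UNIV \<and> length is \<le> m}" by (rule finite_lists_length_le) simp
  then have fin: "finite {is :: 'n list. length is \<le> m}" by simp
  have "bounded (\<Union>is\<in>{is. length is \<le> m}. range (iter_partial is V))"
    using assms by (intro bounded_UN fin) (auto simp: bounded_C_def)
  then obtain K where K: "\<And>y. y \<in> (\<Union>is\<in>{is. length is \<le> m}. range (iter_partial is V)) \<Longrightarrow> norm y \<le> K"
    using bounded_iff by metis
  have "\<bar>iter_partial is V x\<bar> \<le> max 0 K" if "length is \<le> m" for "is" x
  proof -
    have "iter_partial is V x \<in> (\<Union>is\<in>{is. length is \<le> m}. range (iter_partial is V))" using that by blast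
    from K[OF this] show ?thesis by simp
  qed
  then show ?thesis by (intro exI[of _ "max 0 K"]) auto
qed

text \<open>Every derivative falls on \<open>V\<close>, so the density enters only through its L1
  norm. For densities built from two L2 functions this is a product of L2 norms, whatever the
  order.\<close>

lemma deriv_bounded_rconv:
  fixes V :: "real^'n::finite \<Rightarrow> real"
  assumes V: "V \<in> bounded_C m" and K: "\<And>is x. length is \<le> m \<Longrightarrow> \<bar>iter_partial is V x\<bar> \<le> K"
    and r: "integrable lborel \<rho>"
  shows "length is + k \<le> m \<Longrightarrow> deriv_bounded k (K * (\<integral>y. \<bar>\<rho> y\<bar> \<partial>lborel)) (rconv (iter_partial is V) \<rho>)"
proof (induction k arbitrary: "is")
  case (0 "is")
  have "iter_partial is V \<in> borel_measurable borel"
    using V 0 by (intro borel_measurable_continuous_onI) (auto simp: bounded_C_def class_C_def)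
  then show ?case using rconv_bounded(2,3)[OF _ K r] 0 by auto
next
  case (Suc k "is")
  have m: "iter_partial l V \<in> borel_measurable borel" if "length l \<le> m" for l
    using V that by (intro borel_measurable_continuous_onI) (auto simp: bounded_C_def class_C_def)
  have "dird i (rconv (iter_partial is V) \<rho>) (rconv (iter_partial (i # is) V) \<rho>)" for i
  proof (rule dird_rconv[OF _ m m K K r])
    have "iter_partial is V differentiable (at x)" for x
      using V Suc.prems by (auto simp: bounded_C_def class_C_def differentiable_on_def)
    from differentiable_dird[OF this] show "dird i (iter_partial is V) (iter_partial (i # is) V)"
      by (simp add: iter_partial_def)
  qed (use Suc.prems in auto)
  moreover have "deriv_bounded k (K * (\<integral>y. \<bar>\<rho> y\<bar> \<partial>lborel)) (rconv (iter_partial (i # is) V) \<rho>)" for i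
    by (rule Suc.IH) (use Suc.prems in simp)
  moreover have "rconv (iter_partial is V) \<rho> \<in> borel_measurable borel"
    "\<bar>rconv (iter_partial is V) \<rho> x\<bar> \<le> K * (\<integral>y. \<bar>\<rho> y\<bar> \<partial>lborel)" for x
    using rconv_bounded(2,3)[OF m K r, of "is"] Suc.prems by auto
  ultimately show ?case by (simp only: deriv_bounded.simps) blast
qed

section \<open>The nonlinear flow\<close>

text \<open>The convolution potential in polarized form; the real inner product makes it
  symmetric.\<close>

definition cpot :: "(real^'n::finite \<Rightarrow> real) \<Rightarrow> (real^'n) l2 \<Rightarrow> (real^'n) l2 \<Rightarrow> real^'n \<Rightarrow> real" where
  "cpot V v w = rconv V (\<lambda>y. fun_l2 v y \<bullet> fun_l2 w y)"

lemma integrable_l2_inner: "integrable lborel (\<lambda>y. fun_l2 v y \<bullet> fun_l2 w y)"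
  by (intro square_integrable_inner square_integrable_fun_l2)

lemma integral_abs_inner_le: "(\<integral>y. \<bar>fun_l2 v y \<bullet> fun_l2 w y\<bar> \<partial>lborel) \<le> norm v * norm w"
proof -
  have "(\<integral>y. \<bar>fun_l2 v y \<bullet> fun_l2 w y\<bar> \<partial>lborel) \<le> (\<integral>y. cmod (fun_l2 v y) * cmod (fun_l2 w y) \<partial>lborel)"
  proof (rule integral_mono)
    show "integrable lborel (\<lambda>y. \<bar>fun_l2 v y \<bullet> fun_l2 w y\<bar>)"
      using integrable_norm[OF integrable_l2_inner[of v w]] by simp
    show "integrable lborel (\<lambda>y. cmod (fun_l2 v y) * cmod (fun_l2 w y))"
      using integrable_norm[OF integrable_bil[of v w]] by (simp add: norm_mult)
  qed (rule Cauchy_Schwarz_ineq2)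
  also have "\<dots> \<le> norm v * norm w"
    using integral_norm_mult_le[OF square_integrable_fun_l2 square_integrable_fun_l2, of v w] by (simp add: to_l2_fun_l2)
  finally show ?thesis .
qed

lemma conv_potential_cpot: "conv_potential V u = cpot V u u"
  by (rule ext) (simp add: conv_potential_def cpot_def rconv_def power2_norm_eq_inner)

lemma cpot_commute: "cpot V v w = cpot V w v"
  by (simp add: cpot_def inner_commute)

text \<open>A real trilinear map with the nonlinearity on its diagonal, so that multilinear
  expansion replaces derivatives of the nonlinearity. The first two slots are measured in L2, the
  last one in the Sobolev norm.\<close>

definition trilinear :: "(real^'n::finite \<Rightarrow> real) \<Rightarrow> (real^'n) l2 \<Rightarrow> (real^'n) l2 \<Rightarrow> (real^'n) l2 \<Rightarrow> (real^'n) l2" where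
  "trilinear V u v w = rmul (cpot V u v) w"

lemma nonlinearity_trilinear: "nonlinearity V u = trilinear V u u u"
  by (simp add: nonlinearity_def trilinear_def rmul_def mul_def conv_potential_cpot)

text \<open>\<open>p\<close> limits the order of the Sobolev estimates; their constants depend on
  \<open>V\<close> through \<open>K\<close>.\<close>

locale potential =
  fixes V :: "real^'n::finite \<Rightarrow> real" and p :: nat and K :: real
  assumes V: "V \<in> bounded_C p" and K: "\<And>is x. length is \<le> p \<Longrightarrow> \<bar>iter_partial is V x\<bar> \<le> K"
begin

lemma V_measurable [measurable]: "V \<in> borel_measurable borel" and V_bound: "\<bar>V x\<bar> \<le> K"
proof -
  have "continuous_on UNIV (iter_partial [] V)"
    using V unfolding bounded_C_def class_C_def by (metis (mono_tags, lifting) list.size(3) mem_Collect_eq zero_le)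
  then show "V \<in> borel_measurable borel" by (intro borel_measurable_continuous_onI) (simp add: iter_partial_def)
  show "\<bar>V x\<bar> \<le> K" using K[of "[]" x] by (simp add: iter_partial_def)
qed

lemma K_nonneg: "0 \<le> K"
  using V_bound[of 0] by linarith

lemma deriv_bounded_cpot: assumes "k \<le> p" shows "deriv_bounded k (K * (norm v * norm w)) (cpot V v w)"
proof -
  have "deriv_bounded k (K * (\<integral>y. \<bar>fun_l2 v y \<bullet> fun_l2 w y\<bar> \<partial>lborel)) (rconv (iter_partial [] V) (\<lambda>y. fun_l2 v y \<bullet> fun_l2 w y))"
    by (rule deriv_bounded_rconv[OF V K integrable_l2_inner]) (use assms in auto)
  from deriv_bounded_mono_bound[OF this mult_left_mono[OF integral_abs_inner_le K_nonneg]]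
  have "deriv_bounded k (K * (norm v * norm w)) (rconv (iter_partial [] V) (\<lambda>y. fun_l2 v y \<bullet> fun_l2 w y))" .
  moreover have "iter_partial [] V = V" by (simp add: iter_partial_def)
  ultimately show ?thesis by (simp only: cpot_def)
qed

lemma cpot_measurable [measurable]: "cpot V v w \<in> borel_measurable borel"
  using deriv_bounded_bounded(1)[OF deriv_bounded_cpot[of 0]] by simp

lemma cpot_bound: "\<bar>cpot V v w x\<bar> \<le> K * (norm v * norm w)"
  using deriv_bounded_bounded(2)[OF deriv_bounded_cpot[of 0]] by simp

lemma bounded_symbol_cpot: "bounded_symbol (\<lambda>x. complex_of_real (cpot V v w x))"
  by (rule bounded_symbol_real[OF cpot_measurable cpot_bound])

lemma cpot_add: "cpot V (v + v') w x = cpot V v w x + cpot V v' w x"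
proof -
  have i: "integrable lborel (\<lambda>y. V (x - y) * (fun_l2 v y \<bullet> fun_l2 w y))" for v w
    by (rule rconv_bounded(1)[OF V_measurable V_bound integrable_l2_inner])
  have "cpot V (v + v') w x = (\<integral>y. V (x - y) * (fun_l2 v y \<bullet> fun_l2 w y) + V (x - y) * (fun_l2 v' y \<bullet> fun_l2 w y) \<partial>lborel)"
    unfolding cpot_def rconv_def
  proof (rule integral_cong_AE)
    show "AE y in lborel. V (x - y) * (fun_l2 (v + v') y \<bullet> fun_l2 w y) = V (x - y) * (fun_l2 v y \<bullet> fun_l2 w y) + V (x - y) * (fun_l2 v' y \<bullet> fun_l2 w y)"
      using fun_l2_add[of v v'] by eventually_elim (simp add: inner_add_left distrib_left)
  qed measurable
  then show ?thesis using i by (simp add: cpot_def rconv_def)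
qed

lemma cpot_add_right: "cpot V w (v + v') x = cpot V w v x + cpot V w v' x"
  using cpot_add by (simp add: cpot_commute[of V w])

lemma trilinear_add1: "trilinear V (u + u') v w = trilinear V u v w + trilinear V u' v w"
  unfolding trilinear_def rmul_def cpot_add of_real_add by (rule mul_add_sym[OF bounded_symbol_cpot bounded_symbol_cpot])

lemma trilinear_add2: "trilinear V u (v + v') w = trilinear V u v w + trilinear V u v' w"
  unfolding trilinear_def rmul_def cpot_add_right of_real_add by (rule mul_add_sym[OF bounded_symbol_cpot bounded_symbol_cpot])

lemma trilinear_add3: "trilinear V u v (w + w') = trilinear V u v w + trilinear V u v w'"
  unfolding trilinear_def rmul_def by (rule mul_add[OF bounded_symbol_cpot])

definition tri_const :: "nat \<Rightarrow> real" where "tri_const k = mul_const_bound TYPE('n) k * K"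

lemma tri_const_nonneg: "0 \<le> tri_const k"
  by (simp add: tri_const_def mul_const_bound_nonneg K_nonneg)

lemma tri_const_mono: "k \<le> l \<Longrightarrow> tri_const k \<le> tri_const l"
  unfolding tri_const_def mul_const_bound_def
  by (intro mult_right_mono real_sqrt_le_mono power_increasing K_nonneg) (auto simp: mul_step_const_def)

lemma trilinear_Hs:
  assumes "w \<in> Hs k" "k \<le> p"
  shows "trilinear V u v w \<in> Hs k" "hs_norm k (trilinear V u v w) \<le> tri_const k * norm u * norm v * hs_norm k w"
  using Hs_rmul[OF deriv_bounded_cpot[OF assms(2), of u v] assms(1)] by (simp_all add: trilinear_def tri_const_def mult_ac)

text \<open>Each factor \<open>W\<close> costs one application of \<open>Hs_rmul\<close>, so the
  terms of the series are bounded by those of a real exponential.\<close>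

lemma exp_term_Hs:
  fixes W :: "real^'n \<Rightarrow> real"
  assumes W: "deriv_bounded k \<kappa> W" and v: "v \<in> Hs k"
  shows "mul (\<lambda>x. (\<i> * complex_of_real (h * W x)) ^ j / fact j) v \<in> Hs k \<and>
    hs_norm k (mul (\<lambda>x. (\<i> * complex_of_real (h * W x)) ^ j / fact j) v) \<le> (\<bar>h\<bar> * (mul_const_bound TYPE('n) k * \<kappa>)) ^ j / fact j * hs_norm k v"
proof (induction j)
  case 0
  then show ?case using v by (simp add: mul_one)
next
  case (Suc j)
  let ?s = "\<lambda>j x. (\<i> * complex_of_real (h * W x)) ^ j / fact j"
  let ?y = "\<bar>h\<bar> * (mul_const_bound TYPE('n) k * \<kappa>)"
  have bW: "bounded_symbol (\<lambda>x. complex_of_real (W x))" by (rule bounded_symbol_real[OF deriv_bounded_bounded[OF W]])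
  have bs: "bounded_symbol (?s j)"
  proof -
    have "?s j = (\<lambda>x. (\<i> ^ j * complex_of_real h ^ j / fact j) * complex_of_real (W x) ^ j)"
      by (auto simp: power_mult_distrib)
    then show ?thesis by (simp only:) (intro bounded_symbol_mult bounded_symbol_const bounded_symbol_power bW)
  qed
  have "?s (Suc j) = (\<lambda>x. (\<i> * complex_of_real h / of_nat (Suc j)) * (complex_of_real (W x) * ?s j x))"
    by (auto simp: divide_simps mult_ac)
  then have "mul (?s (Suc j)) v = mul (\<lambda>x. \<i> * complex_of_real h / of_nat (Suc j)) (mul (\<lambda>x. complex_of_real (W x) * ?s j x) v)"
    by (simp only: mul_mul[OF bounded_symbol_const bounded_symbol_mult[OF bW bs]])
  also have "mul (\<lambda>x. complex_of_real (W x) * ?s j x) v = rmul W (mul (?s j) v)"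
    unfolding rmul_def by (rule mul_mul[OF bW bs, symmetric])
  finally have eq: "mul (?s (Suc j)) v = mul (\<lambda>x. \<i> * complex_of_real h / of_nat (Suc j)) (rmul W (mul (?s j) v))" .
  note R = Hs_rmul[OF W conjunct1[OF Suc]]
  have "hs_norm k (mul (?s (Suc j)) v) = \<bar>h\<bar> / real (Suc j) * hs_norm k (rmul W (mul (?s j) v))"
    unfolding eq hs_norm_mul_const[OF R(1)] by (simp add: norm_mult norm_divide del: of_nat_Suc)
  also have "\<dots> \<le> \<bar>h\<bar> / real (Suc j) * (mul_const_bound TYPE('n) k * \<kappa> * (?y ^ j / fact j * hs_norm k v))"
    using R(2) conjunct2[OF Suc] deriv_bounded_nonneg[OF W]
    by (intro mult_left_mono order_trans[OF R(2)]) (auto intro!: mult_nonneg_nonneg mul_const_bound_nonneg)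
  also have "\<dots> = ?y ^ Suc j / fact (Suc j) * hs_norm k v"
    by (simp add: divide_simps mult_ac)
  finally show ?case using Hs_mul_const(1)[OF R(1)] eq by simp
qed

text \<open>The remainder of the exponential series as a multiplier is bounded by the same remainder
  of the real exponential, without differentiating a composed exponential. \<open>N = 0\<close>,
  \<open>1\<close> and \<open>2\<close> give the bound for the flow, the smallness of a phase minus
  1, and the second order remainder.\<close>

lemma exp_tail_Hs:
  fixes W :: "real^'n \<Rightarrow> real" and h :: real
  assumes W: "deriv_bounded k \<kappa> W" and v: "v \<in> Hs k"
  defines "y \<equiv> \<bar>h\<bar> * (mul_const_bound TYPE('n) k * \<kappa>)"
  shows "mul (\<lambda>x. iexp (h * W x) - (\<Sum>j<N. (\<i> * complex_of_real (h * W x)) ^ j / fact j)) v \<in> Hs k"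
    "hs_norm k (mul (\<lambda>x. iexp (h * W x) - (\<Sum>j<N. (\<i> * complex_of_real (h * W x)) ^ j / fact j)) v)
      \<le> (exp y - (\<Sum>j<N. y ^ j / fact j)) * hs_norm k v"
proof -
  let ?s = "\<lambda>j x. (\<i> * complex_of_real (h * W x)) ^ j / fact j"
  have [measurable]: "W \<in> borel_measurable borel" using deriv_bounded_bounded(1)[OF W] .
  have y0: "0 \<le> y" unfolding y_def by (intro mult_nonneg_nonneg mul_const_bound_nonneg deriv_bounded_nonneg[OF W]) simp
  have bW: "bounded_symbol (\<lambda>x. complex_of_real (W x))" by (rule bounded_symbol_real[OF deriv_bounded_bounded[OF W]])
  have bs: "bounded_symbol (?s j)" for j
  proof -
    have "?s j = (\<lambda>x. (\<i> ^ j * complex_of_real h ^ j / fact j) * complex_of_real (W x) ^ j)"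
      by (auto simp: power_mult_distrib)
    then show ?thesis by (simp only:) (intro bounded_symbol_mult bounded_symbol_const bounded_symbol_power bW)
  qed
  have fin: "mul (\<lambda>x. \<Sum>j\<in>I. ?s j x) v = (\<Sum>j\<in>I. mul (?s j) v)" if "finite I" for I
    using that
  proof induction
    case empty
    then show ?case using mul_of_real[of 0 v] by simp
  next
    case (insert a I)
    then show ?case using mul_add_sym[OF bs[of a] bounded_symbol_sum[of I ?s, OF bs]] by simp
  qed
  \<comment> \<open>Partial sums from index \<open>N\<close> on: bounded in the Sobolev norm and
    convergent in L2, so \<open>Hs_limit\<close> yields the bound for the tail.\<close>
  define P where "P J = mul (\<lambda>x. \<Sum>j\<in>{N..<N + J}. ?s j x) v" for J
  have PH: "P J \<in> Hs k \<and> hs_norm k (P J) \<le> (exp y - (\<Sum>j<N. y ^ j / fact j)) * hs_norm k v" for J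
  proof -
    have S: "(\<Sum>j\<in>{N..<N + J}. mul (?s j) v) \<in> Hs k \<and> hs_norm k (\<Sum>j\<in>{N..<N + J}. mul (?s j) v) \<le> (\<Sum>j\<in>{N..<N + J}. hs_norm k (mul (?s j) v))"
      by (rule Hs_sum) (use exp_term_Hs[OF W v] in blast)
    have "(\<Sum>j\<in>{N..<N + J}. hs_norm k (mul (?s j) v)) \<le> (\<Sum>j\<in>{N..<N + J}. y ^ j / fact j * hs_norm k v)"
      unfolding y_def by (intro sum_mono) (use exp_term_Hs[OF W v] in blast)
    also have "\<dots> = (\<Sum>j\<in>{N..<N + J}. y ^ j / fact j) * hs_norm k v" by (rule sum_distrib_right[symmetric])
    also have "\<dots> \<le> (exp y - (\<Sum>j<N. y ^ j / fact j)) * hs_norm k v"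
    proof (rule mult_right_mono)
      have "(\<Sum>j<N + J. y ^ j / fact j) \<le> exp y"
      proof -
        have "(\<Sum>j<N + J. y ^ j /\<^sub>R fact j) \<le> (\<Sum>j. y ^ j /\<^sub>R fact j)"
          by (rule sum_le_suminf) (use summable_exp_generic[of y] y0 in auto)
        then show ?thesis by (simp add: exp_def divide_inverse mult.commute)
      qed
      moreover have "(\<Sum>j<N + J. y ^ j / fact j) = (\<Sum>j<N. y ^ j / fact j) + (\<Sum>j\<in>{N..<N + J}. y ^ j / fact j)"
        by (metis atLeast0LessThan le_add1 sum.atLeastLessThan_concat zero_le)
      ultimately show "(\<Sum>j\<in>{N..<N + J}. y ^ j / fact j) \<le> exp y - (\<Sum>j<N. y ^ j / fact j)" by linarith
    qed simp
    finally show ?thesis using S unfolding P_def fin[OF finite_atLeastLessThan] by auto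
  qed
  have lim: "P \<longlonglongrightarrow> mul (\<lambda>x. iexp (h * W x) - (\<Sum>j<N. ?s j x)) v"
    unfolding P_def
  proof (rule mul_tendsto_fixed)
    define M where "M = \<bar>h\<bar> * \<kappa>"
    show "cmod (\<Sum>j\<in>{N..<N + J}. ?s j x) \<le> exp M" for J x
    proof -
      have "cmod (?s j x) \<le> M ^ j /\<^sub>R fact j" for j
      proof -
        have "cmod (?s j x) = (\<bar>h\<bar> * \<bar>W x\<bar>) ^ j / fact j"
          by (simp add: norm_divide norm_power norm_mult abs_mult)
        also have "\<dots> \<le> M ^ j / fact j"
          unfolding M_def using deriv_bounded_bounded(2)[OF W, of x]
          by (intro divide_right_mono power_mono mult_left_mono) auto
        finally show ?thesis by (simp add: divide_inverse mult.commute)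
      qed
      then have "cmod (\<Sum>j\<in>{N..<N + J}. ?s j x) \<le> (\<Sum>j\<in>{N..<N + J}. M ^ j /\<^sub>R fact j)"
        by (intro order_trans[OF norm_sum] sum_mono)
      also have "\<dots> \<le> (\<Sum>j. M ^ j /\<^sub>R fact j)"
        by (rule sum_le_suminf) (use summable_exp_generic[of M] deriv_bounded_nonneg[OF W] in \<open>auto simp: M_def\<close>)
      finally show ?thesis by (simp add: exp_def)
    qed
    show "(\<lambda>J. \<Sum>j\<in>{N..<N + J}. ?s j x) \<longlonglongrightarrow> iexp (h * W x) - (\<Sum>j<N. ?s j x)" for x
    proof -
      have "(\<lambda>j. ?s j x) sums iexp (h * W x)"
        using exp_converges[of "\<i> * complex_of_real (h * W x)"] by (simp add: scaleR_conv_of_real divide_inverse mult.commute)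
      then have "(\<lambda>J. \<Sum>j<J + N. ?s j x) \<longlonglongrightarrow> iexp (h * W x)"
        unfolding sums_def by (rule LIMSEQ_ignore_initial_segment)
      then have "(\<lambda>J. (\<Sum>j<J + N. ?s j x) - (\<Sum>j<N. ?s j x)) \<longlonglongrightarrow> iexp (h * W x) - (\<Sum>j<N. ?s j x)"
        by (intro tendsto_diff tendsto_const)
      moreover have "(\<Sum>j<J + N. ?s j x) - (\<Sum>j<N. ?s j x) = (\<Sum>j\<in>{N..<N + J}. ?s j x)" for J
      proof -
        have "(\<Sum>j<N + J. ?s j x) = (\<Sum>j<N. ?s j x) + (\<Sum>j\<in>{N..<N + J}. ?s j x)"
          using sum.atLeastLessThan_concat[of 0 N "N + J" "\<lambda>j. ?s j x"] by (simp only: atLeast0LessThan le0 le_add1 simp_thms)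
        then show ?thesis by (simp only: add.commute[of J N] add_diff_cancel_left')
      qed
      ultimately show ?thesis by (simp only:)
    qed
    show "(\<lambda>x. \<Sum>j\<in>{N..<N + J}. ?s j x) \<in> borel_measurable borel" for J
      using bounded_symbol_sum[of "{N..<N + J}" ?s, OF bs] by (simp only: bounded_symbol_def)
    have "bounded_symbol (\<lambda>x. iexp (h * W x))" by (rule bsymI[of _ 1]) auto
    then show "(\<lambda>x. iexp (h * W x) - (\<Sum>j<N. ?s j x)) \<in> borel_measurable borel"
      using bounded_symbol_diff[OF _ bounded_symbol_sum[of "{..<N}" ?s, OF bs]] by (simp only: bounded_symbol_def)
  qed
  show "mul (\<lambda>x. iexp (h * W x) - (\<Sum>j<N. ?s j x)) v \<in> Hs k"
    "hs_norm k (mul (\<lambda>x. iexp (h * W x) - (\<Sum>j<N. ?s j x)) v) \<le> (exp y - (\<Sum>j<N. y ^ j / fact j)) * hs_norm k v"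
    using Hs_limit[OF lim] PH by blast+
qed

end

definition mul_i :: "(real^'n::finite) l2 \<Rightarrow> (real^'n) l2" where
  "mul_i v = mul (\<lambda>x. \<i>) v"

lemma norm_mul_i [simp]: "norm (mul_i v) = norm v"
  by (simp add: mul_i_def norm_mul_const)

lemma mul_i_Hs: "v \<in> Hs k \<Longrightarrow> mul_i v \<in> Hs k" "v \<in> Hs k \<Longrightarrow> hs_norm k (mul_i v) = hs_norm k v"
  by (simp_all add: mul_i_def Hs_mul_const hs_norm_mul_const)

lemma mul_i_add: "mul_i (v + w) = mul_i v + mul_i w" and mul_i_diff: "mul_i (v - w) = mul_i v - mul_i w"
  by (simp_all add: mul_i_def mul_add mul_diff)

lemma free_group_mul_i: "free_group a (mul_i v) = mul_i (free_group a v)"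
  by (simp add: mul_i_def free_group_mul_const)

lemma free_group_add: "free_group a (v + w) = free_group a v + free_group a w"
  using bounded_linear_free_group by (rule linear_add[OF bounded_linear.linear])

lemma free_group_diff: "free_group a (v - w) = free_group a v - free_group a w"
  using bounded_linear_free_group by (rule linear_diff[OF bounded_linear.linear])

lemma free_group_scaleR: "free_group a (r *\<^sub>R v) = r *\<^sub>R free_group a v"
  using bounded_linear_free_group by (rule linear_scale[OF bounded_linear.linear])

lemma hs_norm_add_bound:
  assumes "v \<in> Hs k \<and> hs_norm k v \<le> x" "w \<in> Hs k \<and> hs_norm k w \<le> y"
  shows "v + w \<in> Hs k \<and> hs_norm k (v + w) \<le> x + y"
  using assms Hs_add(1)[of v k w] hs_norm_triangle[of v k w] by auto

lemma hs_norm_diff_bound: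
  assumes "v \<in> Hs k \<and> hs_norm k v \<le> x" "w \<in> Hs k \<and> hs_norm k w \<le> y"
  shows "v - w \<in> Hs k \<and> hs_norm k (v - w) \<le> x + y"
  using assms Hs_diff(1)[of v k w] hs_norm_triangle_diff[of v k w] by auto

lemma exp_minus_1_le: assumes "0 \<le> (y::real)" shows "exp y - 1 \<le> y * exp y"
proof -
  have "1 - y \<le> exp (- y)" using exp_ge_add_one_self[of "- y"] by simp
  then have "(1 - y) * exp y \<le> exp (- y) * exp y" by (rule mult_right_mono) simp
  then show ?thesis by (simp add: algebra_simps flip: exp_add)
qed

lemma exp_minus_2_le: assumes "0 \<le> (y::real)" shows "exp y - 1 - y \<le> y\<^sup>2 * exp y"
proof -
  have "exp y - 1 - y \<le> y * (exp y - 1)" using exp_minus_1_le[OF assms] by (simp add: algebra_simps)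
  also have "\<dots> \<le> y * (y * exp y)" by (rule mult_left_mono[OF exp_minus_1_le[OF assms] assms])
  finally show ?thesis by (simp add: power2_eq_square)
qed

context potential
begin

abbreviation "flow h v \<equiv> nonlinear_flow V h v"
abbreviation "NN v \<equiv> nonlinearity V v"

lemma flow_eq: "flow h v = mul (\<lambda>x. iexp (h * cpot V v v x)) v"
  by (simp add: nonlinear_flow_def mul_def conv_potential_cpot)

lemma bounded_symbol_iexp: "W \<in> borel_measurable borel \<Longrightarrow> bounded_symbol (\<lambda>x. iexp (h * W x))"
  by (rule bsymI[of _ 1]) auto

lemma norm_flow [simp]: "norm (flow h v) = norm v"
  unfolding flow_eq by (rule norm_mul_unimodular) (use bounded_symbol_iexp[OF cpot_measurable] in \<open>auto simp: bounded_symbol_def\<close>)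

text \<open>The flow multiplies by a phase and leaves the modulus, hence the potential, unchanged.
  This gives the group property of the explicit formula.\<close>

lemma cpot_flow: "cpot V (flow h v) (flow h v) = cpot V v v"
proof
  fix x
  show "cpot V (flow h v) (flow h v) x = cpot V v v x"
    unfolding cpot_def rconv_def
  proof (rule integral_cong_AE)
    have "AE y in lborel. fun_l2 (flow h v) y = iexp (h * cpot V v v y) * fun_l2 v y"
      unfolding flow_eq by (rule fun_l2_mul[OF bounded_symbol_iexp]) measurable
    then show "AE y in lborel. V (x - y) * (fun_l2 (flow h v) y \<bullet> fun_l2 (flow h v) y) = V (x - y) * (fun_l2 v y \<bullet> fun_l2 v y)"
      by eventually_elim (simp add: norm_mult flip: power2_norm_eq_inner)
  qed measurable
qed

lemma flow_flow: "flow h (flow g v) = flow (h + g) v"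
proof -
  have "flow h (flow g v) = mul (\<lambda>x. iexp (h * cpot V v v x)) (flow g v)"
    unfolding flow_eq[of h] cpot_flow ..
  also have "\<dots> = mul (\<lambda>x. iexp (h * cpot V v v x) * iexp (g * cpot V v v x)) v"
    unfolding flow_eq by (rule mul_mul[OF bounded_symbol_iexp bounded_symbol_iexp]) measurable
  also have "(\<lambda>x. iexp (h * cpot V v v x) * iexp (g * cpot V v v x)) = (\<lambda>x. iexp ((h + g) * cpot V v v x))"
    by (auto simp: distrib_left distrib_right simp flip: exp_add)
  finally show ?thesis unfolding flow_eq[of "h + g"] .
qed

lemma mul_iexp_Hs:
  fixes W :: "real^'n \<Rightarrow> real"
  assumes W: "deriv_bounded k \<kappa> W" and v: "v \<in> Hs k"
  shows "mul (\<lambda>x. iexp (h * W x)) v \<in> Hs k"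
    "hs_norm k (mul (\<lambda>x. iexp (h * W x)) v) \<le> exp (\<bar>h\<bar> * (mul_const_bound TYPE('n) k * \<kappa>)) * hs_norm k v"
  using exp_tail_Hs[OF W v, where N = 0 and h = h] by simp_all

lemma mul_iexp_minus_1_Hs:
  fixes W :: "real^'n \<Rightarrow> real"
  assumes W: "deriv_bounded k \<kappa> W" and v: "v \<in> Hs k"
  shows "mul (\<lambda>x. iexp (h * W x) - 1) v \<in> Hs k"
    "hs_norm k (mul (\<lambda>x. iexp (h * W x) - 1) v) \<le> (exp (\<bar>h\<bar> * (mul_const_bound TYPE('n) k * \<kappa>)) - 1) * hs_norm k v"
  using exp_tail_Hs[OF W v, where N = 1 and h = h] by simp_all

lemma mul_const_bound_deriv_bounded: "mul_const_bound TYPE('n) k * (K * (norm v * norm w)) = tri_const k * (norm v * norm w)"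
  by (simp add: tri_const_def)

lemma flow_Hs:
  assumes "v \<in> Hs k" "k \<le> p"
  shows "flow h v \<in> Hs k" "hs_norm k (flow h v) \<le> exp (\<bar>h\<bar> * (tri_const k * (norm v * norm v))) * hs_norm k v"
  using mul_iexp_Hs[OF deriv_bounded_cpot[OF assms(2), of v v] assms(1), of h] unfolding flow_eq mul_const_bound_deriv_bounded .

text \<open>The Taylor remainder of the flow after its linear term in \<open>h\<close>.\<close>

definition flow_rem :: "real \<Rightarrow> (real^'n) l2 \<Rightarrow> (real^'n) l2" where
  "flow_rem h v = flow h v - v - h *\<^sub>R mul_i (NN v)"

lemma flow_rem_Hs:
  fixes h :: real
  assumes "v \<in> Hs k" "k \<le> p"
  defines "y \<equiv> \<bar>h\<bar> * (tri_const k * (norm v * norm v))"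
  shows "flow_rem h v \<in> Hs k" "hs_norm k (flow_rem h v) \<le> y\<^sup>2 * exp y * hs_norm k v"
proof -
  let ?W = "cpot V v v"
  have "(\<lambda>x. iexp (h * ?W x) - (\<Sum>j<2. (\<i> * complex_of_real (h * ?W x)) ^ j / fact j))
     = (\<lambda>x. iexp (h * ?W x) - 1 - complex_of_real h * (\<i> * complex_of_real (?W x)))"
    by (auto simp: numeral_2_eq_2)
  moreover have "mul (\<lambda>x. iexp (h * ?W x) - 1 - complex_of_real h * (\<i> * complex_of_real (?W x))) v = flow_rem h v"
  proof -
    have b: "bounded_symbol (\<lambda>x. iexp (h * ?W x))" by (rule bounded_symbol_iexp) measurable
    have "h *\<^sub>R mul_i (NN v) = mul (\<lambda>x. complex_of_real h * (\<i> * complex_of_real (?W x))) v"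
      unfolding mul_i_def nonlinearity_trilinear trilinear_def rmul_def mul_of_real[symmetric]
      by (simp only: mul_mul[OF bounded_symbol_const bounded_symbol_cpot] mul_mul[OF bounded_symbol_const bounded_symbol_mult[OF bounded_symbol_const bounded_symbol_cpot]])
    then show ?thesis
      unfolding flow_rem_def flow_eq
      by (simp only: mul_diff_sym[OF bounded_symbol_diff[OF b bounded_symbol_const] bounded_symbol_mult[OF bounded_symbol_const bounded_symbol_mult[OF bounded_symbol_const bounded_symbol_cpot]]]
          mul_diff_sym[OF b bounded_symbol_const] mul_one)
  qed
  ultimately have R: "flow_rem h v \<in> Hs k" "hs_norm k (flow_rem h v) \<le> (exp y - (\<Sum>j<2. y ^ j / fact j)) * hs_norm k v"
    using exp_tail_Hs[OF deriv_bounded_cpot[OF assms(2), of v v] assms(1), where N = 2 and h = h] unfolding mul_const_bound_deriv_bounded y_def by simp_all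
  show "flow_rem h v \<in> Hs k" by (rule R)
  have "0 \<le> y" unfolding y_def by (intro mult_nonneg_nonneg tri_const_nonneg) auto
  then have "exp y - (\<Sum>j<2. y ^ j / fact j) \<le> y\<^sup>2 * exp y"
    using exp_minus_2_le[of y] by (simp add: numeral_2_eq_2)
  from mult_right_mono[OF this, of "hs_norm k v"] R(2) show "hs_norm k (flow_rem h v) \<le> y\<^sup>2 * exp y * hs_norm k v" by simp
qed

text \<open>The two potentials differ by the polarized potential of \<open>u - v\<close> and
  \<open>u + v\<close>. So the difference is the phase of \<open>u\<close> acting on
  \<open>u - v\<close>, plus the phase of \<open>v\<close> acting on a second phase minus 1 applied
  to \<open>v\<close>; that second phase is small with \<open>h\<close> and
  \<open>u - v\<close>.\<close>

lemma flow_lipschitz: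
  assumes k: "k \<le> p" and u: "u \<in> Hs k" "hs_norm k u \<le> B" and v: "v \<in> Hs k" "hs_norm k v \<le> B" and h: "0 \<le> h" "h \<le> H"
  defines "y \<equiv> tri_const k * (B * B)"
  shows "flow h u - flow h v \<in> Hs k"
    "hs_norm k (flow h u - flow h v) \<le> (1 + h * (3 * y * exp (H * (5 * y)))) * hs_norm k (u - v)"
proof -
  have nu: "norm u \<le> B" "norm v \<le> B" using norm_le_hs_norm[OF u(1)] norm_le_hs_norm[OF v(1)] u v by linarith+
  have B0: "0 \<le> B" using nu(1) norm_ge_zero order_trans by blast
  have y0: "0 \<le> y" unfolding y_def by (intro mult_nonneg_nonneg tri_const_nonneg B0)
  let ?Wu = "cpot V u u" and ?Wv = "cpot V v v" and ?Wd = "cpot V (u - v) (u + v)"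
  have Wd: "?Wu x = ?Wv x + ?Wd x" for x
  proof -
    have "?Wu x = cpot V (v + (u - v)) u x" by simp
    also have "\<dots> = cpot V v u x + cpot V (u - v) u x" by (rule cpot_add)
    also have "cpot V v u x = cpot V u v x" by (simp add: cpot_commute)
    also have "cpot V u v x = cpot V (v + (u - v)) v x" by simp
    also have "\<dots> = cpot V v v x + cpot V (u - v) v x" by (rule cpot_add)
    finally show ?thesis by (simp add: cpot_add_right)
  qed
  let ?d = "u - v"
  have dH: "?d \<in> Hs k" by (rule Hs_diff(1)[OF u(1) v(1)])
  define A where "A = mul (\<lambda>x. iexp (h * ?Wu x)) ?d"
  define E where "E = mul (\<lambda>x. iexp (h * ?Wd x) - 1) v"
  have bu: "bounded_symbol (\<lambda>x. iexp (h * ?Wu x))" and bv: "bounded_symbol (\<lambda>x. iexp (h * ?Wv x))" and bd: "bounded_symbol (\<lambda>x. iexp (h * ?Wd x))"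
    by (rule bounded_symbol_iexp, measurable)+
  have eq: "flow h u - flow h v = A + mul (\<lambda>x. iexp (h * ?Wv x)) E"
  proof -
    have "mul (\<lambda>x. iexp (h * ?Wv x)) E = mul (\<lambda>x. iexp (h * ?Wv x) * (iexp (h * ?Wd x) - 1)) v"
      unfolding E_def by (rule mul_mul[OF bv bounded_symbol_diff[OF bd bounded_symbol_const]])
    also have "(\<lambda>x. iexp (h * ?Wv x) * (iexp (h * ?Wd x) - 1)) = (\<lambda>x. iexp (h * ?Wu x) - iexp (h * ?Wv x))"
      unfolding Wd by (auto simp: right_diff_distrib distrib_left exp_add)
    also have "mul \<dots> v = mul (\<lambda>x. iexp (h * ?Wu x)) v - flow h v"
      unfolding flow_eq by (rule mul_diff_sym[OF bu bv])
    finally have F: "mul (\<lambda>x. iexp (h * ?Wv x)) E = mul (\<lambda>x. iexp (h * ?Wu x)) v - flow h v" .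
    show ?thesis unfolding A_def F mul_diff[OF bu] flow_eq[of h u] by simp
  qed
  have au: "tri_const k * (norm u * norm u) \<le> y" "tri_const k * (norm v * norm v) \<le> y"
    unfolding y_def by (auto intro!: mult_left_mono mult_mono tri_const_nonneg B0 nu)
  have Ey: "exp (\<bar>h\<bar> * t) \<le> exp (h * y)" if "t \<le> y" for t
    using h mult_left_mono[OF that h(1)] by simp
  have A: "A \<in> Hs k" "hs_norm k A \<le> exp (h * y) * hs_norm k ?d"
  proof -
    note M = mul_iexp_Hs[OF deriv_bounded_cpot[OF k, of u u] dH, of h]
    show "A \<in> Hs k" unfolding A_def by (rule M)
    show "hs_norm k A \<le> exp (h * y) * hs_norm k ?d"
      using M(2) mult_right_mono[OF Ey[OF au(1)] hs_norm_nonneg, of k ?d] unfolding A_def mul_const_bound_deriv_bounded by linarith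
  qed
  define yd where "yd = h * (tri_const k * (2 * B * norm ?d))"
  have yd0: "0 \<le> yd" unfolding yd_def using h B0 by (intro mult_nonneg_nonneg tri_const_nonneg) auto
  have sum: "norm (u + v) \<le> 2 * B" using norm_triangle_ineq[of u v] nu by linarith
  have dif: "norm ?d \<le> 2 * B" using norm_triangle_ineq4[of u v] nu by linarith
  have E: "E \<in> Hs k" "hs_norm k E \<le> (exp yd - 1) * B"
  proof -
    note M = mul_iexp_minus_1_Hs[OF deriv_bounded_cpot[OF k, of ?d "u + v"] v(1), of h]
    show "E \<in> Hs k" unfolding E_def by (rule M)
    have "\<bar>h\<bar> * (tri_const k * (norm ?d * norm (u + v))) \<le> yd"
      unfolding yd_def using h sum by (simp add: mult.commute[of "norm ?d"]) (intro mult_left_mono mult_right_mono tri_const_nonneg; simp)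
    then have le: "exp (\<bar>h\<bar> * (tri_const k * (norm ?d * norm (u + v)))) - 1 \<le> exp yd - 1" by simp
    have "hs_norm k E \<le> (exp (\<bar>h\<bar> * (tri_const k * (norm ?d * norm (u + v)))) - 1) * hs_norm k v"
      using M(2) unfolding E_def mul_const_bound_deriv_bounded .
    also have "\<dots> \<le> (exp yd - 1) * B"
      using yd0 by (intro mult_mono le v hs_norm_nonneg) auto
    finally show "hs_norm k E \<le> (exp yd - 1) * B" .
  qed
  have E2: "hs_norm k E \<le> h * (2 * y) * exp (H * (4 * y)) * hs_norm k ?d"
  proof -
    have "yd \<le> h * (tri_const k * (2 * B * (2 * B)))"
      unfolding yd_def by (intro mult_left_mono dif h(1) tri_const_nonneg) (use B0 in simp)
    also have "\<dots> = h * (4 * y)" by (simp add: y_def)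
    also have "\<dots> \<le> H * (4 * y)" using h y0 by (intro mult_right_mono) auto
    finally have "exp yd \<le> exp (H * (4 * y))" by simp
    then have "(exp yd - 1) \<le> yd * exp (H * (4 * y))"
      using exp_minus_1_le[OF yd0] mult_left_mono[OF _ yd0] by (meson order_trans)
    then have "(exp yd - 1) * B \<le> yd * exp (H * (4 * y)) * B" by (rule mult_right_mono) (rule B0)
    also have "\<dots> = h * (2 * y) * exp (H * (4 * y)) * norm ?d"
      by (simp add: yd_def y_def)
    also have "\<dots> \<le> h * (2 * y) * exp (H * (4 * y)) * hs_norm k ?d"
      using h y0 by (intro mult_left_mono norm_le_hs_norm dH) auto
    finally show ?thesis using E(2) by linarith
  qed
  note M = mul_iexp_Hs[OF deriv_bounded_cpot[OF k, of v v] E(1), of h]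
  show "flow h u - flow h v \<in> Hs k" unfolding eq by (rule Hs_add[OF A(1) M(1)])
  have "hs_norm k (flow h u - flow h v) \<le> hs_norm k A + hs_norm k (mul (\<lambda>x. iexp (h * ?Wv x)) E)"
    unfolding eq by (rule hs_norm_triangle[OF A(1) M(1)])
  also have "\<dots> \<le> exp (h * y) * hs_norm k ?d + exp (h * y) * (h * (2 * y) * exp (H * (4 * y)) * hs_norm k ?d)"
  proof (rule add_mono[OF A(2)])
    have "hs_norm k (mul (\<lambda>x. iexp (h * ?Wv x)) E) \<le> exp (h * y) * hs_norm k E"
      using M(2) mult_right_mono[OF Ey[OF au(2)] hs_norm_nonneg, of k E] unfolding mul_const_bound_deriv_bounded by linarith
    also have "\<dots> \<le> exp (h * y) * (h * (2 * y) * exp (H * (4 * y)) * hs_norm k ?d)" by (rule mult_left_mono[OF E2]) simp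
    finally show "hs_norm k (mul (\<lambda>x. iexp (h * ?Wv x)) E) \<le> exp (h * y) * (h * (2 * y) * exp (H * (4 * y)) * hs_norm k ?d)" .
  qed
  also have "\<dots> = (exp (h * y) + h * (2 * y) * (exp (h * y) * exp (H * (4 * y)))) * hs_norm k ?d" by (simp add: algebra_simps)
  \<comment> \<open>The factor \<open>3 * y\<close> is \<open>y\<close> from
    \<open>exp (h * y) - 1\<close> and \<open>2 * y\<close> from the phase difference. The exponent
    \<open>5 * y\<close> is \<open>y\<close> from the phase of \<open>v\<close> and
    \<open>4 * y\<close> from bounding both \<open>u - v\<close> and \<open>u + v\<close> by
    \<open>2 * B\<close>.\<close>
  also have "\<dots> \<le> (1 + h * (3 * y * exp (H * (5 * y)))) * hs_norm k ?d"
  proof (rule mult_right_mono)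
    have hH: "h * y \<le> H * y" using h y0 by (intro mult_right_mono) auto
    have "exp (h * y) * exp (H * (4 * y)) \<le> exp (H * (5 * y))" using hH by (simp flip: exp_add)
    then have 1: "h * (2 * y) * (exp (h * y) * exp (H * (4 * y))) \<le> h * (2 * y) * exp (H * (5 * y))"
      using h y0 by (intro mult_left_mono) auto
    have "0 \<le> h * y" using h y0 by simp
    moreover have "H * (5 * y) = 5 * (H * y)" by simp
    ultimately have "h * y \<le> H * (5 * y)" using hH by linarith
    then have "exp (h * y) \<le> exp (H * (5 * y))" by simp
    then have "h * y * exp (h * y) \<le> h * y * exp (H * (5 * y))" using h y0 by (intro mult_left_mono) auto
    then have 2: "exp (h * y) \<le> 1 + h * y * exp (H * (5 * y))"
      using exp_minus_1_le[of "h * y"] h y0 by simp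
    show "exp (h * y) + h * (2 * y) * (exp (h * y) * exp (H * (4 * y))) \<le> 1 + h * (3 * y * exp (H * (5 * y)))"
      using 1 2 by (simp add: algebra_simps)
  qed simp
  finally show "hs_norm k (flow h u - flow h v) \<le> (1 + h * (3 * y * exp (H * (5 * y)))) * hs_norm k (u - v)" .
qed

text \<open>The commutator of the nonlinearity and the free group at \<open>a\<close>, pulled back
  by the group.\<close>

definition conj_defect :: "real \<Rightarrow> (real^'n) l2 \<Rightarrow> (real^'n) l2" where
  "conj_defect a z = free_group (- a) (NN (free_group a z)) - NN z"

text \<open>The constant is taken at the higher order \<open>q\<close>, so that estimates at
  different orders can be added with one constant.\<close>

lemma trilinear_bound:
  assumes "w \<in> Hs l" "l \<le> q" "q \<le> p" "norm u \<le> x" "norm v \<le> y" "hs_norm l w \<le> z"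
  shows "trilinear V u v w \<in> Hs l" "hs_norm l (trilinear V u v w) \<le> tri_const q * (x * y * z)"
proof -
  have lp: "l \<le> p" using assms by simp
  show "trilinear V u v w \<in> Hs l" by (rule trilinear_Hs(1)[OF assms(1) lp])
  have x: "0 \<le> x" and y: "0 \<le> y" using assms(4,5) norm_ge_zero order_trans by blast+
  have "hs_norm l (trilinear V u v w) \<le> tri_const l * (norm u * norm v * hs_norm l w)"
    using trilinear_Hs(2)[OF assms(1) lp] by (simp add: mult.assoc)
  also have "\<dots> \<le> tri_const q * (x * y * z)"
    using assms x y by (intro mult_mono tri_const_mono tri_const_nonneg mult_nonneg_nonneg) auto
  finally show "hs_norm l (trilinear V u v w) \<le> tri_const q * (x * y * z)" .
qed

text \<open>To first order there is one group difference and three trilinear differences, hence the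
  factor 4. In the even part what remains are second differences and products of two first
  differences, each quadratic in \<open>a\<close> and costing at most four derivatives.\<close>

lemma conj_defect_bounds:
  assumes k: "k + 4 \<le> p" and z: "z \<in> Hs (k + 4)" "hs_norm (k + 4) z \<le> B"
  defines "c \<equiv> tri_const (k + 4) * (B * B * B)"
  shows "conj_defect a z \<in> Hs k" "hs_norm k (conj_defect a z) \<le> \<bar>a\<bar> * (4 * c)" "hs_norm k (conj_defect a z + conj_defect (- a) z) \<le> a\<^sup>2 * (20 * c)"
proof -
  have B0: "0 \<le> B" using z(2) hs_norm_nonneg order_trans by blast
  let ?f = "\<lambda>a. free_group a z"
  let ?d = "\<lambda>a. ?f a - z"
  have lvl: "w \<in> Hs l" if "w \<in> Hs (k + 4)" "l \<le> k + 4" for w :: "(real^'n) l2" and l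
    using Hs_mono(1)[OF that(2,1)] .
  have zl: "z \<in> Hs l" "hs_norm l z \<le> B" if "l \<le> k + 4" for l
    using Hs_mono[OF that z(1)] z(2) by auto
  have fl: "?f a \<in> Hs l" "hs_norm l (?f a) \<le> B" if "l \<le> k + 4" for a l
    using free_group_Hs[OF zl(1)[OF that]] zl(2)[OF that] by auto
  have nz: "norm z \<le> B" "norm (?f a) \<le> B" for a using zl(2)[of 0] by simp_all
  have e4: "k + 2 + 2 = k + 4" by simp
  have z2: "z \<in> Hs (k + 2 + 2)" using z(1) unfolding e4 .
  have d2: "?d a \<in> Hs (k + 2)" "hs_norm (k + 2) (?d a) \<le> \<bar>a\<bar> * B" for a
    using free_group_diff_Hs[OF z2, of a] mult_left_mono[OF z(2), of "\<bar>a\<bar>"] unfolding e4 by auto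
  have dk: "?d a \<in> Hs k" "hs_norm k (?d a) \<le> \<bar>a\<bar> * B" for a
    using Hs_mono[OF _ d2(1)[of a], of k] d2(2)[of a] by auto
  have nd: "norm (?d a) \<le> \<bar>a\<bar> * B" for a using norm_le_hs_norm[OF dk(1)[of a]] dk(2)[of a] by linarith
  \<comment> \<open>A bound without \<open>a\<close> for one factor of the cubic terms below, which
    keeps them quadratic in \<open>a\<close> however large \<open>a\<close> is.\<close>
  have nd2: "norm (?d a) \<le> 2 * B" for a using norm_triangle_ineq4[of "?f a" z] nz by (smt (verit))
  let ?s = "?d a + ?d (- a)"
  have seq: "?s = ?f a + ?f (- a) - 2 *\<^sub>R z" by (simp add: scaleR_2)
  have s: "?s \<in> Hs k" "hs_norm k ?s \<le> a\<^sup>2 * B"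
    using free_group_second_diff_Hs[OF z(1), of a] mult_left_mono[OF z(2), of "a\<^sup>2"] unfolding seq by auto
  have ns: "norm ?s \<le> a\<^sup>2 * B" using norm_le_hs_norm[OF s(1)] s(2) by linarith
  let ?q = "\<lambda>a. NN (?f a)"
  have q: "?q a \<in> Hs l" "hs_norm l (?q a) \<le> c" if "l \<le> k + 4" for a l
    unfolding nonlinearity_trilinear c_def
    by (rule trilinear_bound[OF fl(1)[OF that] that k nz(2) nz(2) fl(2)[OF that]])+
  have q0: "NN z \<in> Hs l" "hs_norm l (NN z) \<le> c" if "l \<le> k + 4" for l
    using q[OF that, of 0] by simp_all
  have fz: "?f b = z + ?d b" for b by simp
  have qd: "?q b - NN z = trilinear V (?d b) (?f b) (?f b) + trilinear V z (?d b) (?f b) + trilinear V z z (?d b)" for b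
  proof -
    have "?q b = trilinear V (z + ?d b) (?f b) (?f b)" unfolding nonlinearity_trilinear by simp
    also have "\<dots> = trilinear V z (z + ?d b) (?f b) + trilinear V (?d b) (?f b) (?f b)" unfolding trilinear_add1 by simp
    also have "trilinear V z (z + ?d b) (?f b) = trilinear V z z (z + ?d b) + trilinear V z (?d b) (?f b)" unfolding trilinear_add2 by simp
    also have "trilinear V z z (z + ?d b) = NN z + trilinear V z z (?d b)" unfolding trilinear_add3 nonlinearity_trilinear ..
    finally show ?thesis by simp
  qed
  have qd2: "?q b - NN z \<in> Hs (k + 2)" "hs_norm (k + 2) (?q b - NN z) \<le> \<bar>b\<bar> * (3 * c)" for b
  proof -
    note t1 = trilinear_bound[OF fl(1) _ k nd nz(2) fl(2), of "k + 2" b b b]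
    note t2 = trilinear_bound[OF fl(1) _ k nz(1) nd fl(2), of "k + 2" b b]
    note t3 = trilinear_bound[OF d2(1) _ k nz(1) nz(1) d2(2), of b]
    show "?q b - NN z \<in> Hs (k + 2)" unfolding qd using t1 t2 t3 by (intro Hs_add) auto
    have "hs_norm (k + 2) (?q b - NN z) \<le> tri_const (k + 4) * (\<bar>b\<bar> * B * B * B) + tri_const (k + 4) * (B * (\<bar>b\<bar> * B) * B) + tri_const (k + 4) * (B * B * (\<bar>b\<bar> * B))"
      unfolding qd using t1 t2 t3
      by (intro order_trans[OF hs_norm_triangle] add_mono Hs_add order_trans[OF hs_norm_triangle]) auto
    also have "\<dots> = \<bar>b\<bar> * (3 * c)" by (simp add: c_def algebra_simps)
    finally show "hs_norm (k + 2) (?q b - NN z) \<le> \<bar>b\<bar> * (3 * c)" .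
  qed
  have qdk: "?q b - NN z \<in> Hs k" "hs_norm k (?q b - NN z) \<le> \<bar>b\<bar> * (3 * c)" for b
    using Hs_mono[OF _ qd2(1)[of b], of k] qd2(2)[of b] by auto
  have Geq: "conj_defect b z = (free_group (- b) (?q b) - ?q b) + (?q b - NN z)" for b by (simp add: conj_defect_def)
  have G1: "conj_defect b z \<in> Hs k \<and> hs_norm k (conj_defect b z) \<le> \<bar>b\<bar> * (4 * c)" for b
  proof -
    note f = free_group_diff_Hs[OF q(1)[of "k + 2" b], of "- b"]
    have "hs_norm k (conj_defect b z) \<le> \<bar>b\<bar> * c + \<bar>b\<bar> * (3 * c)"
      unfolding Geq using f qdk[of b] mult_left_mono[OF q(2)[of "k + 2" b], of "\<bar>b\<bar>"]
      by (intro order_trans[OF hs_norm_triangle] add_mono) auto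
    moreover have "conj_defect b z \<in> Hs k" unfolding Geq by (rule Hs_add(1)[OF _ qdk(1)]) (rule f(1), simp)
    ultimately show ?thesis by (simp add: algebra_simps)
  qed
  then show "conj_defect a z \<in> Hs k" "hs_norm k (conj_defect a z) \<le> \<bar>a\<bar> * (4 * c)" by blast+
  \<comment> \<open>The second difference of the nonlinearity along the group. Expanded around
    \<open>z\<close> it has 3 terms with the second difference of \<open>z\<close>, 6 quadratic
    ones, and 2 cubic ones with the factor 2 of \<open>nd2\<close>, together 3 + 6 + 4 = 13.\<close>
  let ?Q = "?q a + ?q (- a) - 2 *\<^sub>R NN z"
  define c4 where "c4 = tri_const (k + 4)"
  have expand: "?q b - NN z = (trilinear V (?d b) z z + trilinear V z (?d b) z + trilinear V z z (?d b))
      + (trilinear V (?d b) (?d b) z + trilinear V (?d b) z (?d b) + trilinear V z (?d b) (?d b)) + trilinear V (?d b) (?d b) (?d b)" for b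
  proof -
    have f3: "trilinear V u v (?f b) = trilinear V u v z + trilinear V u v (?d b)" for u v
      using trilinear_add3[of u v z "?d b"] by simp
    have f2: "trilinear V u (?f b) w = trilinear V u z w + trilinear V u (?d b) w" for u w
      using trilinear_add2[of u z "?d b"] by simp
    show ?thesis unfolding qd f2 f3 by (simp add: algebra_simps)
  qed
  have "?Q = (?q a - NN z) + (?q (- a) - NN z)" by (simp add: scaleR_2)
  also have "\<dots> = (trilinear V ?s z z + trilinear V z ?s z + trilinear V z z ?s)
      + ((trilinear V (?d a) (?d a) z + trilinear V (?d a) z (?d a) + trilinear V z (?d a) (?d a))
      + (trilinear V (?d (-a)) (?d (-a)) z + trilinear V (?d (-a)) z (?d (-a)) + trilinear V z (?d (-a)) (?d (-a))))
      + (trilinear V (?d a) (?d a) (?d a) + trilinear V (?d (-a)) (?d (-a)) (?d (-a)))"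
    unfolding expand trilinear_add1[of "?d a"] trilinear_add2[of _ "?d a"] trilinear_add3[of _ _ "?d a"] by (simp add: algebra_simps)
  finally have Qeq: "?Q = (trilinear V ?s z z + trilinear V z ?s z + trilinear V z z ?s)
      + ((trilinear V (?d a) (?d a) z + trilinear V (?d a) z (?d a) + trilinear V z (?d a) (?d a))
      + (trilinear V (?d (-a)) (?d (-a)) z + trilinear V (?d (-a)) z (?d (-a)) + trilinear V z (?d (-a)) (?d (-a))))
      + (trilinear V (?d a) (?d a) (?d a) + trilinear V (?d (-a)) (?d (-a)) (?d (-a)))" .
  have k4: "k \<le> k + 4" by simp
  have Q: "?Q \<in> Hs k" "hs_norm k ?Q \<le> a\<^sup>2 * (13 * c)"
  proof -
    have aa: "\<bar>b\<bar> * \<bar>b\<bar> = b\<^sup>2" for b :: real by (simp add: power2_eq_square)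
    have l: "trilinear V ?s z z \<in> Hs k \<and> hs_norm k (trilinear V ?s z z) \<le> a\<^sup>2 * c" "trilinear V z ?s z \<in> Hs k \<and> hs_norm k (trilinear V z ?s z) \<le> a\<^sup>2 * c"
      "trilinear V z z ?s \<in> Hs k \<and> hs_norm k (trilinear V z z ?s) \<le> a\<^sup>2 * c"
      using trilinear_bound[OF zl(1)[OF k4] k4 k ns nz(1) zl(2)[OF k4]] trilinear_bound[OF zl(1)[OF k4] k4 k nz(1) ns zl(2)[OF k4]]
        trilinear_bound[OF s(1) k4 k nz(1) nz(1) s(2)] by (simp_all add: c_def mult_ac)
    have qu: "trilinear V (?d b) (?d b) z \<in> Hs k \<and> hs_norm k (trilinear V (?d b) (?d b) z) \<le> b\<^sup>2 * c"
      "trilinear V (?d b) z (?d b) \<in> Hs k \<and> hs_norm k (trilinear V (?d b) z (?d b)) \<le> b\<^sup>2 * c"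
      "trilinear V z (?d b) (?d b) \<in> Hs k \<and> hs_norm k (trilinear V z (?d b) (?d b)) \<le> b\<^sup>2 * c"
      "trilinear V (?d b) (?d b) (?d b) \<in> Hs k \<and> hs_norm k (trilinear V (?d b) (?d b) (?d b)) \<le> b\<^sup>2 * (2 * c)" for b
      using trilinear_bound[OF zl(1)[OF k4] k4 k nd nd zl(2)[OF k4], of b b] trilinear_bound[OF dk(1) k4 k nd nz(1) dk(2), of b b]
        trilinear_bound[OF dk(1) k4 k nz(1) nd dk(2), of b b] trilinear_bound[OF dk(1) k4 k nd2 nd dk(2), of b b b]
      by (simp_all add: c_def mult_ac aa[symmetric])
    show "?Q \<in> Hs k" unfolding Qeq using l qu by (intro Hs_add) auto
    have "hs_norm k ?Q \<le> ((a\<^sup>2 * c + a\<^sup>2 * c + a\<^sup>2 * c) + ((a\<^sup>2 * c + a\<^sup>2 * c + a\<^sup>2 * c) + ((-a)\<^sup>2 * c + (-a)\<^sup>2 * c + (-a)\<^sup>2 * c)) + (a\<^sup>2 * (2 * c) + (-a)\<^sup>2 * (2 * c)))"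
      unfolding Qeq using l qu[of a] qu[of "- a"]
      by (intro order_trans[OF hs_norm_triangle] add_mono Hs_add; (elim conjE)?; assumption?) auto
    then show "hs_norm k ?Q \<le> a\<^sup>2 * (13 * c)" by (simp add: algebra_simps)
  qed
  \<comment> \<open>A discrete Leibniz rule for second differences: of the group, of the
    nonlinearity, and mixed terms with a first difference of each. The factors add up to 1 + 13 + 3
    + 3 = 20.\<close>
  have GGeq: "conj_defect a z + conj_defect (- a) z = (free_group a (NN z) + free_group (- a) (NN z) - 2 *\<^sub>R NN z)
     + free_group (- a) ?Q + ((free_group a (?q (- a) - NN z) - (?q (- a) - NN z)) - (free_group (- a) (?q (- a) - NN z) - (?q (- a) - NN z)))"
    unfolding conj_defect_def by (simp add: free_group_add free_group_diff free_group_scaleR scaleR_2 algebra_simps)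
  have P1: "free_group a (NN z) + free_group (- a) (NN z) - 2 *\<^sub>R NN z \<in> Hs k"
    "hs_norm k (free_group a (NN z) + free_group (- a) (NN z) - 2 *\<^sub>R NN z) \<le> a\<^sup>2 * c"
    using free_group_second_diff_Hs[OF q0(1)[of "k + 4"], of a] mult_left_mono[OF q0(2)[of "k + 4"], of "a\<^sup>2"] by auto
  have P2: "free_group (- a) ?Q \<in> Hs k" "hs_norm k (free_group (- a) ?Q) \<le> a\<^sup>2 * (13 * c)"
    using free_group_Hs[OF Q(1)] Q(2) by auto
  have P3: "free_group b (?q (- a) - NN z) - (?q (- a) - NN z) \<in> Hs k \<and>
     hs_norm k (free_group b (?q (- a) - NN z) - (?q (- a) - NN z)) \<le> a\<^sup>2 * (3 * c)" if "\<bar>b\<bar> = \<bar>a\<bar>" for b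
  proof -
    have "hs_norm k (free_group b (?q (- a) - NN z) - (?q (- a) - NN z)) \<le> \<bar>b\<bar> * (\<bar>- a\<bar> * (3 * c))"
      using free_group_diff_Hs(2)[OF qd2(1)[of "- a"], of b] mult_left_mono[OF qd2(2)[of "- a"], of "\<bar>b\<bar>"] by linarith
    also have "\<dots> = a\<^sup>2 * (3 * c)" using that by (simp add: power2_eq_square)
    finally show ?thesis using free_group_diff_Hs(1)[OF qd2(1)[of "- a"], of b] by blast
  qed
  have "conj_defect a z + conj_defect (- a) z \<in> Hs k \<and> hs_norm k (conj_defect a z + conj_defect (- a) z) \<le> (a\<^sup>2 * c + a\<^sup>2 * (13 * c)) + (a\<^sup>2 * (3 * c) + a\<^sup>2 * (3 * c))"
    unfolding GGeq by (rule hs_norm_add_bound[OF hs_norm_add_bound[OF conjI[OF P1] conjI[OF P2]]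
      hs_norm_diff_bound[OF P3[OF refl] P3[OF abs_minus_cancel]]])
  then show "hs_norm k (conj_defect a z + conj_defect (- a) z) \<le> a\<^sup>2 * (20 * c)" by (simp add: algebra_simps)
qed

end

section \<open>One coarse step against two fine steps\<close>

instance l2 :: (euclidean_space) banach ..

text \<open>A remainder of order \<open>h\<^sup>2\<close> paired with the error is split so that the
  squared error carries a factor \<open>h\<close>, as Gronwall requires, and the rest is of order
  \<open>h ^ 3\<close>, which sums to \<open>h\<^sup>2\<close>.\<close>

lemma weighted_young:
  fixes h d r s \<rho> :: real
  assumes "0 < h" "0 \<le> d" "r \<le> h\<^sup>2 * \<rho>" "s \<le> d * r"
  shows "2 * s \<le> h * d\<^sup>2 + h ^ 3 * \<rho>\<^sup>2"
proof -
  have "d * r \<le> d * (h\<^sup>2 * \<rho>)" by (rule mult_left_mono[OF assms(3,2)])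
  then have "2 * s \<le> h * (2 * d * (h * \<rho>))" using assms(4) by (simp add: power2_eq_square mult_ac)
  also have "\<dots> \<le> h * (d\<^sup>2 + (h * \<rho>)\<^sup>2)" using assms(1) by (intro mult_left_mono sum_squares_bound) simp
  also have "\<dots> = h * d\<^sup>2 + h ^ 3 * \<rho>\<^sup>2" by (simp add: distrib_left power_mult_distrib power2_eq_square power3_eq_cube)
  finally show ?thesis .
qed

context potential
begin

definition flow_diff :: "real \<Rightarrow> (real^'n) l2 \<Rightarrow> (real^'n) l2 \<Rightarrow> (real^'n) l2" where
  "flow_diff h x y = flow (2 * h) x - flow (2 * h) y"

text \<open>The part of the expanded square that is linear in the defect. \<open>x\<close> is the
  coarse iterate, \<open>y\<close> the fine one, and \<open>a\<close> the first of the two fine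
  increments.\<close>

definition cross_term :: "nat \<Rightarrow> real \<Rightarrow> (real^'n) l2 \<Rightarrow> (real^'n) l2 \<Rightarrow> real \<Rightarrow> real" where
  "cross_term k h x y a = wfourier k (flow_diff h x y) \<bullet> wfourier k (mul_i (conj_defect a (flow h y)))"

lemma flow_expand: "flow h v = v + h *\<^sub>R mul_i (NN v) + flow_rem h v"
  by (simp add: flow_rem_def)

text \<open>Both steps are pulled back by the total increment, an isometry. What remains is the
  propagated difference minus the local error at \<open>y\<close>, and \<open>b\<close> drops out of
  the local error.\<close>

lemma step_identity:
  "free_group (a + b) (flow (2 * h) x) - free_group b (flow h (free_group a (flow h y)))
    = free_group (a + b) (flow_diff h x y - (h *\<^sub>R mul_i (conj_defect a (flow h y)) + (free_group (- a) (flow_rem h (free_group a (flow h y))) - flow_rem h (flow h y))))"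
proof -
  let ?z = "flow h y"
  have "free_group (- a) (flow h (free_group a ?z)) = ?z + h *\<^sub>R mul_i (free_group (- a) (NN (free_group a ?z))) + free_group (- a) (flow_rem h (free_group a ?z))"
    unfolding flow_expand[of h "free_group a ?z"] free_group_add free_group_scaleR free_group_mul_i free_group_free_group by simp
  moreover have "flow (2 * h) y = ?z + h *\<^sub>R mul_i (NN ?z) + flow_rem h ?z"
    unfolding flow_expand[of h ?z, symmetric] flow_flow by simp
  ultimately have "free_group (- a) (flow h (free_group a ?z)) - flow (2 * h) y
     = h *\<^sub>R mul_i (conj_defect a ?z) + (free_group (- a) (flow_rem h (free_group a ?z)) - flow_rem h ?z)"
    unfolding conj_defect_def mul_i_diff by (simp add: scaleR_diff_right)
  then have eq: "flow_diff h x y - (h *\<^sub>R mul_i (conj_defect a ?z) + (free_group (- a) (flow_rem h (free_group a ?z)) - flow_rem h ?z))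
     = flow (2 * h) x - free_group (- a) (flow h (free_group a ?z))"
    unfolding flow_diff_def by (simp add: algebra_simps)
  show ?thesis unfolding eq free_group_diff free_group_free_group by simp
qed

text \<open>The term with \<open>cross_term\<close> is the only one of order lower than \<open>h\<^sup>2\<close> in mean square; its even part
  in \<open>a\<close> is controlled by the second claim, its odd part vanishes in expectation.\<close>

lemma step_bound:
  assumes k: "k + 4 \<le> p" and T: "0 < T" and B: "0 \<le> B"
  shows "\<exists>C\<ge>0. \<forall>h x y a b. 0 < h \<and> h \<le> T \<and> x \<in> Hs (k + 4) \<and> y \<in> Hs (k + 4) \<and> hs_norm (k + 4) x \<le> B \<and> hs_norm (k + 4) y \<le> B \<longrightarrow>
    (hs_norm k (free_group (a + b) (flow (2 * h) x) - free_group b (flow h (free_group a (flow h y)))))\<^sup>2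
      \<le> (1 + C * h) * (hs_norm k (x - y))\<^sup>2 + C * h\<^sup>2 * a\<^sup>2 + C * h ^ 3 - 2 * h * cross_term k h x y a \<and>
    \<bar>cross_term k h x y a + cross_term k h x y (- a)\<bar> \<le> C * (hs_norm k (x - y))\<^sup>2 + C * a ^ 4"
proof -
  \<comment> \<open>The bound for the fine iterate after its first nonlinear step, where the defect
    is evaluated; \<open>c\<close>, \<open>Y\<close> and \<open>r0\<close> are the earlier constants
    at this bound.\<close>
  define B' where "B' = exp (T * (tri_const (k + 4) * (B * B))) * B"
  define L where "L = 3 * (tri_const k * (B * B)) * exp (2 * T * (5 * (tri_const k * (B * B))))"
  define c where "c = tri_const (k + 4) * (B' * B' * B')"
  define Y where "Y = tri_const k * (B' * B')"
  define r0 where "r0 = Y\<^sup>2 * exp (T * Y) * B'"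
  \<comment> \<open>From expanding \<open>(1 + h) * (1 + 2 * h * L)\<^sup>2\<close> and replacing
    the excess powers of \<open>h\<close> by powers of \<open>T\<close>.\<close>
  define ca where "ca = 1 + 4 * L + 4 * T * L\<^sup>2 + 4 * T * L + 4 * T\<^sup>2 * L\<^sup>2"
  define C where "C = ca + (32 * c\<^sup>2 + 8 * T * r0\<^sup>2 + 4 * r0\<^sup>2) + ((1 + 2 * T * L)\<^sup>2 + 400 * c\<^sup>2)"
  have B'0: "0 \<le> B'" using B by (simp add: B'_def)
  have nn: "0 \<le> L" "0 \<le> c" "0 \<le> Y" "0 \<le> r0"
    using B B'0 by (auto simp: L_def c_def Y_def r0_def intro!: mult_nonneg_nonneg tri_const_nonneg)
  have ca0: "0 \<le> ca" using nn T by (auto simp: ca_def intro!: add_nonneg_nonneg mult_nonneg_nonneg)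
  have C: "0 \<le> C" "ca \<le> C" "32 * c\<^sup>2 \<le> C" "8 * T * r0\<^sup>2 + 4 * r0\<^sup>2 \<le> C" "(1 + 2 * T * L)\<^sup>2 \<le> C" "400 * c\<^sup>2 \<le> C"
  proof -
    have "0 \<le> 32 * c\<^sup>2" "0 \<le> 8 * T * r0\<^sup>2" "0 \<le> 4 * r0\<^sup>2" "0 \<le> (1 + 2 * T * L)\<^sup>2" using T by auto
    then show "0 \<le> C" "ca \<le> C" "32 * c\<^sup>2 \<le> C" "8 * T * r0\<^sup>2 + 4 * r0\<^sup>2 \<le> C" "(1 + 2 * T * L)\<^sup>2 \<le> C" "400 * c\<^sup>2 \<le> C"
      unfolding C_def using ca0 by auto
  qed
  show ?thesis
  proof (intro exI[of _ C] conjI allI impI C(1); (elim conjE)?)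
    fix h a b :: real and x y :: "(real^'n) l2"
    assume h: "0 < h" "h \<le> T" and x: "x \<in> Hs (k + 4)" "hs_norm (k + 4) x \<le> B" and y: "y \<in> Hs (k + 4)" "hs_norm (k + 4) y \<le> B"
    let ?z = "flow h y" and ?e = "hs_norm k (x - y)" and ?D = "flow_diff h x y"
    have kp: "k \<le> p" using k by simp
    have k4: "k \<le> k + 4" by simp
    have xk: "x \<in> Hs k" "hs_norm k x \<le> B" and yk: "y \<in> Hs k" "hs_norm k y \<le> B"
      using Hs_mono[OF k4 x(1)] Hs_mono[OF k4 y(1)] x(2) y(2) by auto
    have ny: "norm y \<le> B" using norm_le_hs_norm[OF y(1)] y(2) by linarith
    have z: "?z \<in> Hs (k + 4)" "hs_norm (k + 4) ?z \<le> B'"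
    proof -
      show "?z \<in> Hs (k + 4)" by (rule flow_Hs(1)[OF y(1) k])
      have "\<bar>h\<bar> * (tri_const (k + 4) * (norm y * norm y)) \<le> T * (tri_const (k + 4) * (B * B))"
        using h ny B T by (intro mult_mono mult_nonneg_nonneg tri_const_nonneg) auto
      then have "exp (\<bar>h\<bar> * (tri_const (k + 4) * (norm y * norm y))) * hs_norm (k + 4) y \<le> B'"
        unfolding B'_def using y(2) by (intro mult_mono) auto
      then show "hs_norm (k + 4) ?z \<le> B'" using flow_Hs(2)[OF y(1) k, of h] by linarith
    qed
    have D: "?D \<in> Hs k" "hs_norm k ?D \<le> (1 + 2 * h * L) * ?e"
      using flow_lipschitz[OF kp xk yk, of "2 * h" "2 * T"] h unfolding flow_diff_def L_def by simp_all
    note G = conj_defect_bounds[OF k z, folded c_def]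
    have remz: "flow_rem h w \<in> Hs k \<and> hs_norm k (flow_rem h w) \<le> h\<^sup>2 * r0" if w: "w \<in> Hs (k + 4)" "hs_norm (k + 4) w \<le> B'" for w
    proof -
      have wk: "w \<in> Hs k" "hs_norm k w \<le> B'" using Hs_mono[OF k4 w(1)] w(2) by auto
      have nw: "norm w \<le> B'" using norm_le_hs_norm[OF w(1)] w(2) by linarith
      let ?y = "\<bar>h\<bar> * (tri_const k * (norm w * norm w))"
      have y0: "0 \<le> ?y" by (intro mult_nonneg_nonneg tri_const_nonneg) auto
      have yY: "?y \<le> h * Y" unfolding Y_def using h nw B'0 by (auto intro!: mult_left_mono mult_mono tri_const_nonneg)
      have "h * Y \<le> T * Y" using h nn by (intro mult_right_mono) auto
      with yY have "exp ?y \<le> exp (T * Y)" by simp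
      moreover have "?y\<^sup>2 \<le> (h * Y)\<^sup>2" using yY y0 by (rule power_mono)
      ultimately have "?y\<^sup>2 * exp ?y * hs_norm k w \<le> (h * Y)\<^sup>2 * exp (T * Y) * B'"
        using wk(2) by (intro mult_mono) auto
      also have "\<dots> = h\<^sup>2 * r0" by (simp add: r0_def power_mult_distrib)
      finally show ?thesis using flow_rem_Hs[OF wk(1) kp, of h] by auto
    qed
    have fz: "free_group a ?z \<in> Hs (k + 4)" "hs_norm (k + 4) (free_group a ?z) \<le> B'"
      using free_group_Hs[OF z(1)] z(2) by auto
    define R where "R = free_group (- a) (flow_rem h (free_group a ?z)) - flow_rem h ?z"
    have R1: "free_group (- a) (flow_rem h (free_group a ?z)) \<in> Hs k" "hs_norm k (free_group (- a) (flow_rem h (free_group a ?z))) \<le> h\<^sup>2 * r0"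
      using free_group_Hs[of "flow_rem h (free_group a ?z)" k "- a"] remz[OF fz] by auto
    have R: "R \<in> Hs k" "hs_norm k R \<le> h\<^sup>2 * (2 * r0)"
    proof -
      show "R \<in> Hs k" unfolding R_def using R1 remz[OF z] by (intro Hs_diff) auto
      have "hs_norm k R \<le> h\<^sup>2 * r0 + h\<^sup>2 * r0"
        unfolding R_def using R1 remz[OF z] by (intro order_trans[OF hs_norm_triangle_diff] add_mono) auto
      then show "hs_norm k R \<le> h\<^sup>2 * (2 * r0)" by (simp only: mult_2[of r0] distrib_left)
    qed
    define g where "g = mul_i (conj_defect a ?z)"
    have g: "g \<in> Hs k" "hs_norm k g \<le> \<bar>a\<bar> * (4 * c)" unfolding g_def using mul_i_Hs[OF G(1)] G(2) by auto
    have hg: "h *\<^sub>R g \<in> Hs k" "wfourier k (h *\<^sub>R g) = h *\<^sub>R wfourier k g" using Hs_scaleR[OF g(1)] by auto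
    have sum: "h *\<^sub>R g + R \<in> Hs k" "wfourier k (h *\<^sub>R g + R) = h *\<^sub>R wfourier k g + wfourier k R" using Hs_add[OF hg(1) R(1)] hg(2) by auto
    have dif: "?D - (h *\<^sub>R g + R) \<in> Hs k" "wfourier k (?D - (h *\<^sub>R g + R)) = wfourier k ?D - (h *\<^sub>R wfourier k g + wfourier k R)"
      using Hs_diff[OF D(1) sum(1)] sum(2) by auto
    have e0: "0 \<le> ?e" by simp
    have d2: "(hs_norm k ?D)\<^sup>2 \<le> (1 + 2 * h * L)\<^sup>2 * ?e\<^sup>2"
      using power_mono[OF D(2) hs_norm_nonneg, of 2] by (simp add: power_mult_distrib)
    have "(hs_norm k (free_group (a + b) (flow (2 * h) x) - free_group b (flow h (free_group a ?z))))\<^sup>2 = (norm (wfourier k ?D - (h *\<^sub>R wfourier k g + wfourier k R)))\<^sup>2"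
      unfolding step_identity g_def[symmetric] R_def[symmetric] free_group_Hs(3)[OF dif(1)]
      by (simp only: hs_norm_def dif(2))
    also have "\<dots> = (norm (wfourier k ?D))\<^sup>2 + (norm (h *\<^sub>R wfourier k g + wfourier k R))\<^sup>2 - 2 * h * (wfourier k ?D \<bullet> wfourier k g) - 2 * (wfourier k ?D \<bullet> wfourier k R)"
    proof -
      have "(norm (u - v))\<^sup>2 = (norm u)\<^sup>2 + (norm v)\<^sup>2 - 2 * (u \<bullet> v)" for u v :: "(real^'n) l2"
        by (simp add: power2_norm_eq_inner inner_diff_left inner_diff_right inner_commute)
      then show ?thesis by (simp only: inner_add_right inner_scaleR_right) (simp add: distrib_left mult.assoc)
    qed
    also have "\<dots> \<le> (1 + C * h) * ?e\<^sup>2 + C * h\<^sup>2 * a\<^sup>2 + C * h ^ 3 - 2 * h * cross_term k h x y a"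
    proof -
      have t1: "(norm (h *\<^sub>R wfourier k g + wfourier k R))\<^sup>2 \<le> 2 * (h\<^sup>2 * (a\<^sup>2 * (16 * c\<^sup>2))) + 2 * (h ^ 3 * (T * (4 * r0\<^sup>2)))"
      proof -
        have "(norm (h *\<^sub>R wfourier k g + wfourier k R))\<^sup>2 \<le> (h * hs_norm k g + hs_norm k R)\<^sup>2"
          using norm_triangle_ineq[of "h *\<^sub>R wfourier k g" "wfourier k R"] h by (intro power_mono) (auto simp: hs_norm_def)
        also have "\<dots> \<le> 2 * (h * hs_norm k g)\<^sup>2 + 2 * (hs_norm k R)\<^sup>2"
          using sum_squares_bound[of "h * hs_norm k g" "hs_norm k R"] by (simp add: power2_sum)
        finally have s1: "(norm (h *\<^sub>R wfourier k g + wfourier k R))\<^sup>2 \<le> 2 * (h * hs_norm k g)\<^sup>2 + 2 * (hs_norm k R)\<^sup>2" .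
        have "(h * hs_norm k g)\<^sup>2 \<le> (h * (\<bar>a\<bar> * (4 * c)))\<^sup>2" using g(2) h by (intro power_mono mult_left_mono) auto
        also have "\<dots> = h\<^sup>2 * (a\<^sup>2 * (16 * c\<^sup>2))" by (simp add: power_mult_distrib)
        finally have s2: "(h * hs_norm k g)\<^sup>2 \<le> h\<^sup>2 * (a\<^sup>2 * (16 * c\<^sup>2))" .
        have "(hs_norm k R)\<^sup>2 \<le> (h\<^sup>2 * (2 * r0))\<^sup>2" using R(2) by (intro power_mono) auto
        also have "\<dots> = h ^ 3 * (h * (4 * r0\<^sup>2))" by (simp add: power_mult_distrib power2_eq_square power3_eq_cube)
        also have "\<dots> \<le> h ^ 3 * (T * (4 * r0\<^sup>2))" using h by (intro mult_left_mono mult_right_mono) auto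
        finally have s3: "(hs_norm k R)\<^sup>2 \<le> h ^ 3 * (T * (4 * r0\<^sup>2))" .
        show ?thesis using s1 s2 s3 by linarith
      qed
      have t2: "- 2 * (wfourier k ?D \<bullet> wfourier k R) \<le> h * (hs_norm k ?D)\<^sup>2 + h ^ 3 * (4 * r0\<^sup>2)"
      proof -
        have "- (wfourier k ?D \<bullet> wfourier k R) \<le> hs_norm k ?D * hs_norm k R"
          using Cauchy_Schwarz_ineq2[of "wfourier k ?D" "wfourier k R"] unfolding hs_norm_def by linarith
        from weighted_young[OF h(1) hs_norm_nonneg R(2) this]
        have "2 * - (wfourier k ?D \<bullet> wfourier k R) \<le> h * (hs_norm k ?D)\<^sup>2 + h ^ 3 * (2 * r0)\<^sup>2" .
        moreover have "(2 * r0)\<^sup>2 = 4 * r0\<^sup>2" by (simp add: power_mult_distrib)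
        ultimately show ?thesis by simp
      qed
      have t3: "(1 + h) * (hs_norm k ?D)\<^sup>2 \<le> (1 + C * h) * ?e\<^sup>2"
      proof -
        have "(1 + h) * (hs_norm k ?D)\<^sup>2 \<le> (1 + h) * ((1 + 2 * h * L)\<^sup>2 * ?e\<^sup>2)" using d2 h by (intro mult_left_mono) auto
        also have "\<dots> = ((1 + h) * (1 + 2 * h * L)\<^sup>2) * ?e\<^sup>2" by simp
        also have "\<dots> \<le> (1 + ca * h) * ?e\<^sup>2"
        proof (rule mult_right_mono)
          have "(1 + h) * (1 + 2 * h * L)\<^sup>2 = 1 + h * (1 + 4 * L + 4 * h * L\<^sup>2 + 4 * h * L + 4 * h\<^sup>2 * L\<^sup>2)"
            by (simp add: power2_eq_square algebra_simps)
          also have "\<dots> \<le> 1 + h * ca"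
            unfolding ca_def using h nn by (intro add_mono mult_left_mono mult_right_mono power_mono order_refl) auto
          finally show "(1 + h) * (1 + 2 * h * L)\<^sup>2 \<le> 1 + ca * h" by (simp add: mult.commute)
        qed simp
        also have "\<dots> \<le> (1 + C * h) * ?e\<^sup>2" using C(2) h by (intro mult_right_mono add_mono) auto
        finally show ?thesis .
      qed
      have t4: "32 * c\<^sup>2 * (h\<^sup>2 * a\<^sup>2) \<le> C * (h\<^sup>2 * a\<^sup>2)" by (rule mult_right_mono[OF C(3)]) simp
      have t5: "(8 * T * r0\<^sup>2 + 4 * r0\<^sup>2) * h ^ 3 \<le> C * h ^ 3" using h by (intro mult_right_mono C(4)) simp
      have IIg: "cross_term k h x y a = wfourier k ?D \<bullet> wfourier k g" by (simp add: cross_term_def g_def)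
      have nD: "(norm (wfourier k ?D))\<^sup>2 = (hs_norm k ?D)\<^sup>2" by (simp add: hs_norm_def)
      have "(1 + h) * (hs_norm k ?D)\<^sup>2 = (hs_norm k ?D)\<^sup>2 + h * (hs_norm k ?D)\<^sup>2" by (simp add: distrib_right)
      moreover have "2 * (h\<^sup>2 * (a\<^sup>2 * (16 * c\<^sup>2))) = 32 * c\<^sup>2 * (h\<^sup>2 * a\<^sup>2)" by simp
      moreover have "2 * (h ^ 3 * (T * (4 * r0\<^sup>2))) + h ^ 3 * (4 * r0\<^sup>2) = (8 * T * r0\<^sup>2 + 4 * r0\<^sup>2) * h ^ 3"
        by (simp add: distrib_right)
      moreover have "C * h\<^sup>2 * a\<^sup>2 = C * (h\<^sup>2 * a\<^sup>2)" by simp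
      ultimately show ?thesis using t1 t2 t3 t4 t5 unfolding IIg nD by linarith
    qed
    finally show "(hs_norm k (free_group (a + b) (flow (2 * h) x) - free_group b (flow h (free_group a ?z))))\<^sup>2
      \<le> (1 + C * h) * ?e\<^sup>2 + C * h\<^sup>2 * a\<^sup>2 + C * h ^ 3 - 2 * h * cross_term k h x y a" .
    have Gm: "conj_defect (- a) ?z \<in> Hs k" using G(1) .
    have "cross_term k h x y a + cross_term k h x y (- a) = wfourier k ?D \<bullet> wfourier k (mul_i (conj_defect a ?z + conj_defect (- a) ?z))"
      unfolding cross_term_def mul_i_add Hs_add(2)[OF mul_i_Hs(1)[OF G(1)] mul_i_Hs(1)[OF G(1)]] inner_add_right ..
    then have "\<bar>cross_term k h x y a + cross_term k h x y (- a)\<bar> \<le> hs_norm k ?D * hs_norm k (mul_i (conj_defect a ?z + conj_defect (- a) ?z))"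
      using Cauchy_Schwarz_ineq2[of "wfourier k ?D" "wfourier k (mul_i (conj_defect a ?z + conj_defect (- a) ?z))"] by (simp add: hs_norm_def)
    also have "hs_norm k (mul_i (conj_defect a ?z + conj_defect (- a) ?z)) = hs_norm k (conj_defect a ?z + conj_defect (- a) ?z)"
      by (rule mul_i_Hs(2)[OF Hs_add(1)[OF G(1) G(1)]])
    also have "hs_norm k ?D * \<dots> \<le> hs_norm k ?D * (a\<^sup>2 * (20 * c))" by (intro mult_left_mono G(3)) simp
    also have "\<dots> \<le> (hs_norm k ?D)\<^sup>2 + (a\<^sup>2 * (20 * c))\<^sup>2"
    proof -
      have "0 \<le> hs_norm k ?D * (a\<^sup>2 * (20 * c))" using nn by simp
      then show ?thesis using sum_squares_bound[of "hs_norm k ?D" "a\<^sup>2 * (20 * c)"] unfolding mult.assoc by linarith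
    qed
    also have "\<dots> \<le> C * ?e\<^sup>2 + C * a ^ 4"
    proof (rule add_mono)
      have "(hs_norm k ?D)\<^sup>2 \<le> (1 + 2 * T * L)\<^sup>2 * ?e\<^sup>2"
        using h nn by (intro order_trans[OF d2] mult_right_mono power_mono add_mono) auto
      also have "\<dots> \<le> C * ?e\<^sup>2" by (rule mult_right_mono[OF C(5)]) simp
      finally show "(hs_norm k ?D)\<^sup>2 \<le> C * ?e\<^sup>2" .
      have "(a\<^sup>2 * (20 * c))\<^sup>2 = 400 * c\<^sup>2 * a ^ 4" by (simp add: power_mult_distrib)
      also have "\<dots> \<le> C * a ^ 4" by (rule mult_right_mono[OF C(6)]) simp
      finally show "(a\<^sup>2 * (20 * c))\<^sup>2 \<le> C * a ^ 4" .
    qed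
    finally show "\<bar>cross_term k h x y a + cross_term k h x y (- a)\<bar> \<le> C * ?e\<^sup>2 + C * a ^ 4" .
  qed
qed

text \<open>The splitting scheme as a function of the increments \<open>g\<close> of the path.\<close>

primrec dsplit :: "real \<Rightarrow> (real^'n) l2 \<Rightarrow> (nat \<Rightarrow> real) \<Rightarrow> nat \<Rightarrow> (real^'n) l2" where
  "dsplit h u g 0 = u"
| "dsplit h u g (Suc n) = free_group (g n) (flow h (dsplit h u g n))"

lemma splitting_dsplit: "splitting V b \<tau> u n = dsplit \<tau> u (\<lambda>j. b (real (Suc j) * \<tau>) - b (real j * \<tau>)) n"
  by (induction n) (simp_all add: propagator_def)

lemma dsplit_cong: "(\<And>j. j < n \<Longrightarrow> g j = g' j) \<Longrightarrow> dsplit h u g n = dsplit h u g' n"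
  by (induction n) simp_all

lemma norm_dsplit [simp]: "norm (dsplit h u g n) = norm u"
  by (induction n) simp_all

text \<open>No constant is lost per step: the exponents add up, so the bound depends on the elapsed
  time \<open>real n * h\<close> and not on the number of steps separately.\<close>

lemma dsplit_Hs:
  assumes "u \<in> Hs k" "k \<le> p" "0 \<le> h"
  shows "dsplit h u g n \<in> Hs k \<and> hs_norm k (dsplit h u g n) \<le> exp (real n * h * (tri_const k * (norm u * norm u))) * hs_norm k u"
proof (induction n)
  case (Suc n)
  let ?v = "dsplit h u g n"
  have v: "?v \<in> Hs k" using Suc by blast
  note F = flow_Hs[OF v assms(2), of h]
  have "hs_norm k (dsplit h u g (Suc n)) = hs_norm k (flow h ?v)" by (simp add: free_group_Hs(3)[OF F(1)])
  also have "\<dots> \<le> exp (h * (tri_const k * (norm u * norm u))) * hs_norm k ?v" using F(2) assms(3) by simp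
  also have "\<dots> \<le> exp (h * (tri_const k * (norm u * norm u))) * (exp (real n * h * (tri_const k * (norm u * norm u))) * hs_norm k u)"
    by (rule mult_left_mono) (use Suc in auto)
  also have "\<dots> = exp (real (Suc n) * h * (tri_const k * (norm u * norm u))) * hs_norm k u"
  proof -
    have "real (Suc n) * h * (tri_const k * (norm u * norm u)) = h * (tri_const k * (norm u * norm u)) + real n * h * (tri_const k * (norm u * norm u))"
      by (simp add: algebra_simps)
    then show ?thesis by (simp only: exp_add mult.assoc)
  qed
  finally show ?case using free_group_Hs(1)[OF F(1)] by simp
qed (use assms in simp)

lemma flow_tendsto:
  assumes "v \<longlonglongrightarrow> w" "0 \<le> h"
  shows "(\<lambda>j. flow h (v j)) \<longlonglongrightarrow> flow h w"
proof -
  obtain B where B: "0 < B" "\<And>j. norm (v j) \<le> B"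
    using convergent_imp_Bseq[of v] assms(1) by (auto simp: convergent_def Bseq_def)
  have w: "norm w \<le> B" by (rule LIMSEQ_le_const2[OF tendsto_norm[OF assms(1)]]) (use B in auto)
  let ?c = "1 + h * (3 * (tri_const 0 * (B * B)) * exp (h * (5 * (tri_const 0 * (B * B)))))"
  have le: "norm (flow h (v j) - flow h w) \<le> ?c * norm (v j - w)" for j
    using flow_lipschitz(2)[of 0 "v j" B w h h] B w assms(2) by simp
  show ?thesis
  proof (rule LIM_zero_cancel, rule Lim_null_comparison)
    show "\<forall>\<^sub>F j in sequentially. norm (flow h (v j) - flow h w) \<le> ?c * norm (v j - w)" using le by simp
    have "(\<lambda>j. ?c * norm (v j - w)) \<longlonglongrightarrow> ?c * norm (w - w)" by (intro tendsto_intros assms)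
    then show "(\<lambda>j. ?c * norm (v j - w)) \<longlonglongrightarrow> 0" by simp
  qed
qed

lemma continuous_on_flow:
  fixes f :: "'b::metric_space \<Rightarrow> (real^'n) l2"
  assumes "continuous_on S f" "0 \<le> h" shows "continuous_on S (\<lambda>x. flow h (f x))"
  unfolding continuous_on_sequentially comp_def
proof (intro allI ballI impI, elim conjE)
  fix x a assume x: "\<forall>n. x n \<in> S" and a: "a \<in> S" and l: "x \<longlonglongrightarrow> a"
  have "(\<lambda>n. f (x n)) \<longlonglongrightarrow> f a"
    using assms x a l unfolding continuous_on_sequentially comp_def by simp
  then show "(\<lambda>n. flow h (f (x n))) \<longlonglongrightarrow> flow h (f a)" by (rule flow_tendsto[OF _ assms(2)])
qed

lemma trilinear_bound0: "norm (trilinear V u v w) \<le> tri_const 0 * (norm u * norm v * norm w)"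
  using trilinear_bound(2)[of w 0 0 u "norm u" v "norm v" "norm w"] by simp

lemma NN_diff: "NN u - NN v = trilinear V (u - v) u u + trilinear V v (u - v) u + trilinear V v v (u - v)"
proof -
  have "NN u = trilinear V (v + (u - v)) u u" by (simp add: nonlinearity_trilinear)
  also have "\<dots> = trilinear V v (v + (u - v)) u + trilinear V (u - v) u u" unfolding trilinear_add1 by simp
  also have "trilinear V v (v + (u - v)) u = trilinear V v v (v + (u - v)) + trilinear V v (u - v) u" unfolding trilinear_add2 by simp
  also have "trilinear V v v (v + (u - v)) = NN v + trilinear V v v (u - v)" unfolding trilinear_add3 by (simp add: nonlinearity_trilinear)
  finally show ?thesis by simp
qed

lemma NN_tendsto:
  assumes "v \<longlonglongrightarrow> w"
  shows "(\<lambda>j. NN (v j)) \<longlonglongrightarrow> NN w"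
proof (rule LIM_zero_cancel, rule Lim_null_comparison)
  let ?b = "\<lambda>j. tri_const 0 * (norm (v j - w) * norm (v j) * norm (v j)) + tri_const 0 * (norm w * norm (v j - w) * norm (v j)) + tri_const 0 * (norm w * norm w * norm (v j - w))"
  have "norm (NN (v j) - NN w) \<le> ?b j" for j
    unfolding NN_diff by (intro norm_triangle_mono trilinear_bound0)
  then show "\<forall>\<^sub>F j in sequentially. norm (NN (v j) - NN w) \<le> ?b j" by simp
  have "?b \<longlonglongrightarrow> tri_const 0 * (norm (w - w) * norm w * norm w) + tri_const 0 * (norm w * norm (w - w) * norm w) + tri_const 0 * (norm w * norm w * norm (w - w))"
    by (intro tendsto_intros assms)
  then show "?b \<longlonglongrightarrow> 0" by simp
qed

lemma continuous_on_NN: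
  fixes f :: "'b::metric_space \<Rightarrow> (real^'n) l2"
  assumes "continuous_on S f" shows "continuous_on S (\<lambda>x. NN (f x))"
  unfolding continuous_on_sequentially comp_def
proof (intro allI ballI impI, elim conjE)
  fix x a assume x: "\<forall>n. x n \<in> S" and a: "a \<in> S" and l: "x \<longlonglongrightarrow> a"
  have "(\<lambda>n. f (x n)) \<longlonglongrightarrow> f a"
    using assms x a l unfolding continuous_on_sequentially comp_def by simp
  then show "(\<lambda>n. NN (f (x n))) \<longlonglongrightarrow> NN (f a)" by (rule NN_tendsto)
qed

end

section \<open>Convergence along a path\<close>

context potential
begin

text \<open>The mild equation restarted at \<open>s\<close>. The group law identifies the two
  integrals up to time \<open>s\<close>, and pulling the rest back to \<open>s\<close> gives the
  shape of a splitting step: a transport by the increment after a nonlinear update.\<close>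

lemma mild_duhamel:
  assumes mild: "\<And>t. t \<in> {0..T} \<Longrightarrow> \<exists>J. ((\<lambda>r. propagator b t r (NN (w r))) has_integral J) {0..t} \<and>
      w t = propagator b t 0 u + to_l2 (\<lambda>x. \<i> * fun_l2 J x)"
    and st: "0 \<le> s" "s \<le> t" "t \<le> T"
  shows "\<exists>J. ((\<lambda>r. free_group (b s - b r) (NN (w r))) has_integral J) {s..t} \<and>
      w t = free_group (b t - b s) (w s + mul_i J)"
proof -
  define f where "f t r = free_group (b t - b r) (NN (w r))" for t r
  have shift: "free_group (b t - b s) (f s r) = f t r" for s t r
    by (simp add: f_def free_group_free_group)
  have m: "\<exists>J. (f t has_integral J) {0..t} \<and> w t = free_group (b t - b 0) u + mul_i J" if "0 \<le> t" "t \<le> T" for t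
    using mild[of t] that by (simp add: propagator_def f_def[abs_def] mul_i_def mul_def)
  obtain Js where Js: "(f s has_integral Js) {0..s}" "w s = free_group (b s - b 0) u + mul_i Js"
    using m[of s] st by auto
  obtain Jt where Jt: "(f t has_integral Jt) {0..t}" "w t = free_group (b t - b 0) u + mul_i Jt"
    using m[of t] st by auto
  have "(free_group (b t - b s) \<circ> f s has_integral free_group (b t - b s) Js) {0..s}"
    by (rule has_integral_linear[OF Js(1) bounded_linear_free_group])
  moreover have "free_group (b t - b s) \<circ> f s = f t" by (auto simp: shift)
  ultimately have I1: "(f t has_integral free_group (b t - b s) Js) {0..s}" by simp
  have "f t integrable_on {0..t}" using Jt(1) by (rule has_integral_integrable)
  then have "f t integrable_on {s..t}" by (rule integrable_subinterval_real) (use st in auto)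
  then obtain L where I2: "(f t has_integral L) {s..t}" by (auto simp: integrable_on_def)
  have "(f t has_integral free_group (b t - b s) Js + L) {0..t}"
    by (rule has_integral_combine[OF st(1,2) I1 I2])
  then have JtL: "Jt = free_group (b t - b s) Js + L" using Jt(1) has_integral_unique by blast
  define J where "J = free_group (b s - b t) L"
  have "(free_group (b s - b t) \<circ> f t has_integral J) {s..t}"
    unfolding J_def by (rule has_integral_linear[OF I2 bounded_linear_free_group])
  moreover have "free_group (b s - b t) \<circ> f t = f s" by (auto simp: shift)
  ultimately have "(f s has_integral J) {s..t}" by simp
  moreover have "w t = free_group (b t - b s) (w s + mul_i J)"
    unfolding Jt(2) JtL Js(2) J_def by (simp add: free_group_add free_group_mul_i free_group_free_group mul_i_add)
  ultimately show ?thesis unfolding f_def by blast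
qed

text \<open>\<open>w + mul_i J\<close> is the exact step before the transport. The error consists of
  the stability of the flow, its Taylor remainder, and the rectangle rule for \<open>J\<close>,
  whose error per unit time is \<eta>.\<close>

lemma splitting_local_error:
  assumes S: "norm S \<le> B" and w: "norm w \<le> B" and \<tau>: "0 \<le> \<tau>" "\<tau> \<le> T"
    and J: "norm (J - \<tau> *\<^sub>R NN w) \<le> \<eta> * \<tau>"
  defines "y \<equiv> tri_const 0 * (B * B)"
  shows "norm (free_group a (flow \<tau> S) - free_group a (w + mul_i J)) \<le>
    (1 + \<tau> * (3 * y * exp (T * (5 * y)))) * norm (S - w) + \<tau> * (\<tau> * (y\<^sup>2 * exp (T * y) * B) + \<eta>)"
proof -
  have B0: "0 \<le> B" using w norm_ge_zero order_trans by blast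
  have y0: "0 \<le> y" unfolding y_def by (intro mult_nonneg_nonneg tri_const_nonneg B0)
  have E: "flow \<tau> S - (w + mul_i J) = (flow \<tau> S - flow \<tau> w) + flow_rem \<tau> w - mul_i (J - \<tau> *\<^sub>R NN w)"
    unfolding flow_rem_def mul_i_diff by (simp add: mul_i_def mul_scaleR)
  have "norm (free_group a (flow \<tau> S) - free_group a (w + mul_i J)) = norm ((flow \<tau> S - flow \<tau> w) + flow_rem \<tau> w - mul_i (J - \<tau> *\<^sub>R NN w))"
    by (simp only: free_group_diff[symmetric] norm_free_group E)
  also have "\<dots> \<le> norm (flow \<tau> S - flow \<tau> w) + norm (flow_rem \<tau> w) + norm (mul_i (J - \<tau> *\<^sub>R NN w))"
    using norm_triangle_ineq4[of "(flow \<tau> S - flow \<tau> w) + flow_rem \<tau> w" "mul_i (J - \<tau> *\<^sub>R NN w)"]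
      norm_triangle_ineq[of "flow \<tau> S - flow \<tau> w" "flow_rem \<tau> w"] by linarith
  also have "\<dots> \<le> (1 + \<tau> * (3 * y * exp (T * (5 * y)))) * norm (S - w) + \<tau> * (\<tau> * (y\<^sup>2 * exp (T * y) * B)) + \<eta> * \<tau>"
  proof (intro add_mono)
    show "norm (flow \<tau> S - flow \<tau> w) \<le> (1 + \<tau> * (3 * y * exp (T * (5 * y)))) * norm (S - w)"
      using flow_lipschitz(2)[of 0 S B w \<tau> T] S w \<tau> by (simp add: y_def)
    show "norm (mul_i (J - \<tau> *\<^sub>R NN w)) \<le> \<eta> * \<tau>" using J by simp
    let ?y = "\<bar>\<tau>\<bar> * (tri_const 0 * (norm w * norm w))"
    have yy: "?y \<le> \<tau> * y" unfolding y_def using \<tau> w B0 by (auto intro!: mult_left_mono mult_mono tri_const_nonneg)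
    have "\<tau> * y \<le> T * y" using \<tau> y0 by (intro mult_right_mono) auto
    with yy have "exp ?y \<le> exp (T * y)" by simp
    moreover have "?y\<^sup>2 \<le> (\<tau> * y)\<^sup>2" using yy by (intro power_mono mult_nonneg_nonneg tri_const_nonneg) auto
    ultimately have "?y\<^sup>2 * exp ?y * norm w \<le> (\<tau> * y)\<^sup>2 * exp (T * y) * B" using w by (intro mult_mono) auto
    also have "\<dots> = \<tau> * (\<tau> * (y\<^sup>2 * exp (T * y) * B))" by (simp add: power_mult_distrib power2_eq_square)
    finally show "norm (flow_rem \<tau> w) \<le> \<tau> * (\<tau> * (y\<^sup>2 * exp (T * y) * B))"
      using flow_rem_Hs(2)[of w 0 \<tau>] by simp
  qed
  finally show ?thesis by (simp add: algebra_simps)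
qed

lemma gronwall_discrete:
  fixes e :: "nat \<Rightarrow> real"
  assumes e0: "e 0 \<le> 0" and step: "\<And>j. j < n \<Longrightarrow> e (Suc j) \<le> (1 + a) * e j + c" and a: "0 \<le> a" and c: "0 \<le> c"
  shows "e n \<le> real n * c * exp (real n * a)"
proof -
  have "j \<le> n \<Longrightarrow> e j \<le> real j * c * (1 + a) ^ j" for j
  proof (induction j)
    case 0 then show ?case using e0 by simp
  next
    case (Suc j)
    have "e (Suc j) \<le> (1 + a) * e j + c" using step Suc by simp
    also have "\<dots> \<le> (1 + a) * (real j * c * (1 + a) ^ j) + c * (1 + a) ^ Suc j"
    proof (rule add_mono)
      show "(1 + a) * e j \<le> (1 + a) * (real j * c * (1 + a) ^ j)" using Suc a by (intro mult_left_mono) auto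
      have "1 \<le> (1 + a) ^ Suc j" using a by (intro one_le_power) simp
      from mult_left_mono[OF this c] show "c \<le> c * (1 + a) ^ Suc j" by simp
    qed
    also have "\<dots> = real (Suc j) * c * (1 + a) ^ Suc j" by (simp add: algebra_simps)
    finally show ?case .
  qed
  then have "e n \<le> real n * c * (1 + a) ^ n" by simp
  also have "(1 + a) ^ n \<le> exp a ^ n" using a by (intro power_mono) auto
  also have "exp a ^ n = exp (real n * a)" by (rule exp_of_nat_mult[symmetric])
  finally show ?thesis using c by (simp add: mult_left_mono)
qed

text \<open>Consistency without a rate: uniform continuity makes the local errors small compared
  with the step, and Gronwall sums them. Any continuous mild solution along the path is identified
  in this way, without a separate uniqueness argument.\<close>

lemma pathwise_convergence:
  assumes T: "0 < T" and b: "continuous_on {0..T} b" and w: "continuous_on {0..T} w"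
    and mild: "\<And>t. t \<in> {0..T} \<Longrightarrow> \<exists>J. ((\<lambda>r. propagator b t r (NN (w r))) has_integral J) {0..t} \<and>
      w t = propagator b t 0 u + to_l2 (\<lambda>x. \<i> * fun_l2 J x)"
  shows "(\<lambda>n. splitting V b (T / real (Suc n)) u (Suc n)) \<longlonglongrightarrow> w T"
proof -
  \<comment> \<open>Over a degenerate interval the integral vanishes, so the mild equation contains
    the initial condition.\<close>
  have w0: "w 0 = u"
  proof -
    obtain J where J: "((\<lambda>r. propagator b 0 r (NN (w r))) has_integral J) {0..0}"
      "w 0 = propagator b 0 0 u + to_l2 (\<lambda>x. \<i> * fun_l2 J x)" using mild[of 0] T by auto
    have "((\<lambda>r. propagator b 0 r (NN (w r))) has_integral 0) {0..0}" by (rule has_integral_null_real) simp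
    from has_integral_unique[OF J(1) this] have J0: "J = 0" .
    have "mul_i (0 :: (real^'n) l2) = 0" using mul_scaleR[OF bounded_symbol_const, of \<i> 0 0] by (simp add: mul_i_def)
    moreover have "to_l2 (\<lambda>x. \<i> * fun_l2 J x) = mul_i J" by (simp add: mul_i_def mul_def)
    ultimately show ?thesis using J(2) J0 by (simp add: propagator_def)
  qed
  have "compact (w ` {0..T})" by (intro compact_continuous_image w) simp
  then obtain B where B: "\<And>t. 0 \<le> t \<Longrightarrow> t \<le> T \<Longrightarrow> norm (w t) \<le> B"
    using compact_imp_bounded bounded_iff by (metis atLeastAtMost_iff image_eqI)
  have uB: "norm u \<le> B" using B[of 0] T w0 by simp
  have B0: "0 \<le> B" using uB norm_ge_zero order_trans by blast
  define y where "y = tri_const 0 * (B * B)"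
  define L where "L = 3 * y * exp (T * (5 * y))"
  define r0 where "r0 = y\<^sup>2 * exp (T * y) * B"
  have y0: "0 \<le> y" unfolding y_def by (intro mult_nonneg_nonneg tri_const_nonneg B0)
  have L0: "0 \<le> L" "0 \<le> r0" using y0 B0 by (auto simp: L_def r0_def)
  \<comment> \<open>The pulled back integrand as a function of both times; on the compact square it
    has one modulus of continuity for all steps.\<close>
  define Q where "Q p = free_group (b (fst p) - b (snd p)) (NN (w (snd p)))" for p :: "real \<times> real"
  have cQ: "continuous_on ({0..T} \<times> {0..T}) Q"
    unfolding Q_def
    by (intro continuous_on_free_group continuous_on_NN continuous_on_diff
        continuous_on_compose2[OF b] continuous_on_compose2[OF w] continuous_intros) auto
  have uc: "uniformly_continuous_on ({0..T} \<times> {0..T}) Q"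
    by (rule compact_uniformly_continuous[OF cQ]) (intro compact_Times compact_Icc)
  have main: "\<exists>no. \<forall>n\<ge>no. norm (splitting V b (T / real (Suc n)) u (Suc n) - w T) < \<epsilon>" if e: "0 < \<epsilon>" for \<epsilon>
  proof -
    \<comment> \<open>Chosen so that the final bound
      \<open>T * (\<eta> + \<eta>) * exp (T * L)\<close> is half of \<epsilon>.\<close>
    define \<eta> where "\<eta> = \<epsilon> / (4 * T * exp (T * L))"
    have \<eta>: "0 < \<eta>" using e T by (simp add: \<eta>_def)
    obtain \<delta> where \<delta>: "0 < \<delta>" "\<And>p q. p \<in> {0..T} \<times> {0..T} \<Longrightarrow> q \<in> {0..T} \<times> {0..T} \<Longrightarrow> dist q p < \<delta> \<Longrightarrow> dist (Q q) (Q p) < \<eta>"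
      using uc \<eta> unfolding uniformly_continuous_on_def by metis
    obtain no where no: "T / \<delta> < real no" "r0 * T / \<eta> < real no"
      using reals_Archimedean2[of "max (T / \<delta>) (r0 * T / \<eta>)"] by auto
    have "norm (splitting V b (T / real (Suc n)) u (Suc n) - w T) < \<epsilon>" if n: "no \<le> n" for n
    proof -
      define \<tau> where "\<tau> = T / real (Suc n)"
      have \<tau>: "0 < \<tau>" "\<tau> \<le> T" "real (Suc n) * \<tau> = T" using T by (auto simp: \<tau>_def divide_simps mult_left_mono)
      have "T / \<delta> < real (Suc n)" "r0 * T / \<eta> < real (Suc n)" using no n by linarith+
      then have \<tau>s: "\<tau> < \<delta>" "\<tau> * r0 < \<eta>" using \<delta>(1) \<eta> by (simp_all add: \<tau>_def divide_less_eq mult.commute del: of_nat_Suc)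
      let ?S = "splitting V b \<tau> u"
      define er where "er j = norm (?S j - w (real j * \<tau>))" for j
      have nS: "norm (?S j) \<le> B" for j unfolding splitting_dsplit using uB by simp
      have "er (Suc j) \<le> (1 + \<tau> * L) * er j + \<tau> * (\<tau> * r0 + \<eta>)" if j: "j < Suc n" for j
      proof -
        let ?s = "real j * \<tau>" and ?t = "real (Suc j) * \<tau>"
        have st: "0 \<le> ?s" "?s \<le> ?t" "?t \<le> T"
        proof -
          have "?t \<le> real (Suc n) * \<tau>" using j \<tau> by (intro mult_right_mono) auto
          then show "?t \<le> T" using \<tau>(3) by simp
        qed (use \<tau> in \<open>auto intro!: mult_right_mono\<close>)
        have ts: "?t - ?s = \<tau>" by (simp add: algebra_simps)
        obtain J where J: "((\<lambda>r. free_group (b ?s - b r) (NN (w r))) has_integral J) {?s..?t}"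
          "w ?t = free_group (b ?t - b ?s) (w ?s + mul_i J)"
          using mild_duhamel[OF mild st] by blast
        have "((\<lambda>r. free_group (b ?s - b r) (NN (w r)) - NN (w ?s)) has_integral J - (?t - ?s) *\<^sub>R NN (w ?s)) {?s..?t}"
          using has_integral_diff[OF J(1) has_integral_const_real[of "NN (w ?s)" ?s ?t]] st by simp
        then have "norm (J - (?t - ?s) *\<^sub>R NN (w ?s)) \<le> \<eta> * measure lborel {?s..?t}"
        proof (rule has_integral_bound_real[rotated 2, where S = "{}"])
          fix r assume r: "r \<in> {?s..?t} - {}"
          have "dist (?s, r) (?s, ?s) < \<delta>"
            using r \<tau>s ts by (simp add: dist_Pair_Pair dist_real_def)
          then have "dist (Q (?s, r)) (Q (?s, ?s)) < \<eta>"
            by (intro \<delta>(2)) (use r st in auto)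
          then show "norm (free_group (b ?s - b r) (NN (w r)) - NN (w ?s)) \<le> \<eta>"
            by (simp add: Q_def dist_norm)
        qed (use \<eta> in auto)
        then have Jb: "norm (J - \<tau> *\<^sub>R NN (w ?s)) \<le> \<eta> * \<tau>" 
          unfolding measure_lborel_Icc[OF st(2)] ts .
        have "w ?t = free_group (b ?t - b ?s) (w ?s + mul_i J)" by (rule J(2))
        then have "er (Suc j) = norm (free_group (b ?t - b ?s) (flow \<tau> (?S j)) - free_group (b ?t - b ?s) (w ?s + mul_i J))"
          unfolding er_def splitting.simps propagator_def by (simp only:)
        also have "\<dots> \<le> (1 + \<tau> * L) * er j + \<tau> * (\<tau> * r0 + \<eta>)"
          unfolding er_def L_def r0_def y_def
          by (rule splitting_local_error[OF nS B _ _ Jb]) (use st \<tau> in auto)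
        finally show ?thesis .
      qed
      then have "er (Suc n) \<le> real (Suc n) * (\<tau> * (\<tau> * r0 + \<eta>)) * exp (real (Suc n) * (\<tau> * L))"
        by (intro gronwall_discrete) (use \<tau> L0 \<eta> w0 in \<open>auto simp: er_def intro!: mult_nonneg_nonneg add_nonneg_nonneg\<close>)
      also have "\<dots> = T * (\<tau> * r0 + \<eta>) * exp (T * L)"
      proof -
        have "real (Suc n) * (\<tau> * X) = T * X" for X by (simp only: mult.assoc[symmetric] \<tau>(3))
        then show ?thesis by (simp only: mult.assoc)
      qed
      also have "\<dots> \<le> T * (\<eta> + \<eta>) * exp (T * L)"
        using T \<tau>s by (intro mult_right_mono mult_left_mono) auto
      also have "\<dots> = \<epsilon> / 2" using T by (simp add: \<eta>_def)
      also have "\<dots> < \<epsilon>" using e by simp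
      finally show ?thesis unfolding er_def \<tau>(3) unfolding \<tau>_def .
    qed
    then show ?thesis by blast
  qed
  then show ?thesis unfolding LIMSEQ_def dist_norm by blast
qed

end

section \<open>Mean square estimate for doubling the number of steps\<close>

lemma usual_conditionsD:
  assumes "usual_conditions M F"
  shows "prob_space M" "0 \<le> t \<Longrightarrow> subalgebra M (F t)" "0 \<le> s \<Longrightarrow> s \<le> t \<Longrightarrow> sets (F s) \<subseteq> sets (F t)"
proof -
  note c = assms[unfolded usual_conditions_def]
  show "prob_space M" by (rule conjunct1[OF c])
  show "subalgebra M (F t)" if "0 \<le> t"
    using conjunct1[OF conjunct2[OF conjunct2[OF c]]] that by (elim allE[of _ t] impE)
  show "sets (F s) \<subseteq> sets (F t)" if "0 \<le> s" "s \<le> t"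
    using conjunct1[OF conjunct2[OF conjunct2[OF conjunct2[OF c]]]] that by (elim allE[of _ s] allE[of _ t] impE) (rule conjI)
qed

lemma space_filtration: "usual_conditions M F \<Longrightarrow> 0 \<le> t \<Longrightarrow> space (F t) = space M"
  using usual_conditionsD(2) by (auto simp: subalgebra_def)

lemma measurable_subfiltration:
  assumes "usual_conditions M F" "0 \<le> t" "f \<in> borel_measurable (F t)"
  shows "f \<in> borel_measurable M"
  by (rule measurable_from_subalg[OF usual_conditionsD(2)[OF assms(1,2)] assms(3)])

text \<open>The second moment serves the term with \<open>h\<^sup>2 * a\<^sup>2\<close> of
  \<open>step_bound\<close>, the fourth moment the bound on the even part of the cross term; both
  contribute order \<open>h ^ 3\<close> per step.\<close>

lemma brownian_increment:
  assumes uc: "usual_conditions M F" and bm: "brownian_motion M F \<beta>" and st: "0 \<le> s" "s < t"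
  shows "(\<lambda>\<omega>. \<beta> t \<omega> - \<beta> s \<omega>) \<in> borel_measurable M"
    and "integrable M (\<lambda>\<omega>. (\<beta> t \<omega> - \<beta> s \<omega>)\<^sup>2)" "(\<integral>\<omega>. (\<beta> t \<omega> - \<beta> s \<omega>)\<^sup>2 \<partial>M) = t - s"
    and "integrable M (\<lambda>\<omega>. (\<beta> t \<omega> - \<beta> s \<omega>) ^ 4)" "(\<integral>\<omega>. (\<beta> t \<omega> - \<beta> s \<omega>) ^ 4 \<partial>M) = 3 * (t - s)\<^sup>2"
proof -
  let ?X = "\<lambda>\<omega>. \<beta> t \<omega> - \<beta> s \<omega>"
  have d: "distributed M lborel ?X (\<lambda>x. ennreal (normal_density 0 (sqrt (t - s)) x))"
    using bm st by (simp add: brownian_motion_def)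
  have sg: "0 < sqrt (t - s)" using st by simp
  show "?X \<in> borel_measurable M" using distributed_measurable[OF d] by simp
  have m: "has_bochner_integral lborel (\<lambda>x. normal_density 0 (sqrt (t - s)) x * x ^ (2 * k)) (fact (2 * k) / ((2 / (sqrt (t - s))\<^sup>2) ^ k * fact k))" for k
    using normal_moment_even[OF sg, of 0 k] by simp
  have i: "integrable M (\<lambda>\<omega>. (?X \<omega>) ^ (2 * k))" "(\<integral>\<omega>. (?X \<omega>) ^ (2 * k) \<partial>M) = fact (2 * k) / ((2 / (t - s)) ^ k * fact k)" for k
    using distributed_integrable[OF d, of "\<lambda>x. x ^ (2 * k)"] distributed_integral[OF d, of "\<lambda>x. x ^ (2 * k)"]
      has_bochner_integral_integral_eq[OF m[of k]] integrable.intros[OF m[of k]] st by simp_all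
  show "integrable M (\<lambda>\<omega>. (?X \<omega>)\<^sup>2)" using i(1)[of 1] by simp
  show "(\<integral>\<omega>. (?X \<omega>)\<^sup>2 \<partial>M) = t - s" using i(2)[of 1] st by (simp add: fact_numeral)
  show "integrable M (\<lambda>\<omega>. (?X \<omega>) ^ 4)" using i(1)[of 2] by simp
  show "(\<integral>\<omega>. (?X \<omega>) ^ 4 \<partial>M) = 3 * (t - s)\<^sup>2" using i(2)[of 2] st
    by (simp add: fact_numeral power2_eq_square)
qed

text \<open>The past and the increment are independent and the increment has an even density, so
  changing its sign does not change the joint law.\<close>

lemma increment_symmetric:
  fixes \<xi> :: "'w \<Rightarrow> nat \<Rightarrow> real" and f :: "(nat \<Rightarrow> real) \<times> real \<Rightarrow> real"
  assumes uc: "usual_conditions M F" and bm: "brownian_motion M F \<beta>" and st: "0 \<le> s" "s < t"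
    and \<xi>: "\<xi> \<in> borel_measurable (F s)" and f: "f \<in> borel_measurable (borel \<Otimes>\<^sub>M borel)"
  shows "(\<integral>\<omega>. f (\<xi> \<omega>, \<beta> t \<omega> - \<beta> s \<omega>) \<partial>M) = (\<integral>\<omega>. f (\<xi> \<omega>, - (\<beta> t \<omega> - \<beta> s \<omega>)) \<partial>M)"
proof -
  interpret prob_space M by (rule usual_conditionsD(1)[OF uc])
  let ?X = "\<lambda>\<omega>. \<beta> t \<omega> - \<beta> s \<omega>"
  have X: "?X \<in> borel_measurable M" by (rule brownian_increment(1)[OF uc bm st])
  have \<xi>M: "\<xi> \<in> borel_measurable M" by (rule measurable_subfiltration[OF uc st(1) \<xi>])
  have sp: "space (F s) = space M" by (rule space_filtration[OF uc st(1)])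
  have d: "distributed M lborel ?X (\<lambda>x. ennreal (normal_density 0 (sqrt (t - s)) x))"
    and ind: "indep_set (sets (F s)) (sets (vimage_algebra (space M) ?X borel))"
    using bm st by (simp_all add: brownian_motion_def)
  have sv: "sets (vimage_algebra (space M) ?X borel) = sigma_sets (space M) {?X -` A \<inter> space M | A. A \<in> sets borel}"
    by (simp add: sets_vimage_algebra)
  have sx: "sigma_sets (space M) {\<xi> -` A \<inter> space M | A. A \<in> sets borel} \<subseteq> sets (F s)"
    using \<xi> by (subst sp[symmetric], intro sets.sigma_sets_subset) (auto simp: measurable_sets sp[symmetric])
  \<comment> \<open>\<open>indep_var\<close> takes two variables of one type, so the real increment
    is embedded as a constant sequence and read off again at coordinate 0.\<close>
  define e :: "real \<Rightarrow> nat \<Rightarrow> real" where "e r = (\<lambda>_. r)" for r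
  have e [measurable]: "e \<in> borel_measurable borel"
    unfolding e_def by (intro measurable_coordinatewise_then_product) simp
  have eX: "(\<lambda>\<omega>. e (?X \<omega>)) \<in> borel_measurable M" "(\<lambda>\<omega>. e (- ?X \<omega>)) \<in> borel_measurable M"
    using X by measurable
  \<comment> \<open>The factor \<open>c\<close> stands for 1 and -1: the increment and its
    reflection are treated at once.\<close>
  have iv: "indep_var borel \<xi> borel (\<lambda>\<omega>. e (c * ?X \<omega>))" for c
  proof -
    have ce: "(\<lambda>r. e (c * r)) \<in> borel_measurable borel" by measurable
    have eX: "(\<lambda>\<omega>. e (c * ?X \<omega>)) \<in> borel_measurable M" using measurable_compose[OF X ce] .
    have "{(\<lambda>\<omega>. e (c * ?X \<omega>)) -` A \<inter> space M | A. A \<in> sets borel} \<subseteq> {?X -` A \<inter> space M | A. A \<in> sets borel}"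
    proof safe
      fix A :: "(nat \<Rightarrow> real) set" assume "A \<in> sets borel"
      then have "(\<lambda>r. e (c * r)) -` A \<in> sets borel" using measurable_sets[OF ce, of A] by simp
      then show "\<exists>A'. (\<lambda>\<omega>. e (c * ?X \<omega>)) -` A \<inter> space M = ?X -` A' \<inter> space M \<and> A' \<in> sets borel"
        by (intro exI[of _ "(\<lambda>r. e (c * r)) -` A"]) auto
    qed
    then have se: "sigma_sets (space M) {(\<lambda>\<omega>. e (c * ?X \<omega>)) -` A \<inter> space M | A. A \<in> sets borel}
        \<subseteq> sets (vimage_algebra (space M) ?X borel)"
      unfolding sv by (rule sigma_sets_mono')
    show ?thesis unfolding indep_var_eq
    proof (intro conjI \<xi>M eX indep_setI)
      show "sigma_sets (space M) {\<xi> -` A \<inter> space M | A. A \<in> sets borel} \<subseteq> events"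
        using sx indep_setD_ev1[OF ind] by blast
      show "sigma_sets (space M) {(\<lambda>\<omega>. e (c * ?X \<omega>)) -` A \<inter> space M | A. A \<in> sets borel} \<subseteq> events"
        using indep_setD_ev2[OF ind] se by blast
      fix a b assume "a \<in> sigma_sets (space M) {\<xi> -` A \<inter> space M | A. A \<in> sets borel}"
        "b \<in> sigma_sets (space M) {(\<lambda>\<omega>. e (c * ?X \<omega>)) -` A \<inter> space M | A. A \<in> sets borel}"
      then show "prob (a \<inter> b) = prob a * prob b"
        using indep_setD[OF ind] sx se by blast
    qed
  qed
  have dx: "distr M lborel ?X = density lborel (\<lambda>x. ennreal (normal_density 0 (sqrt (t - s)) x))"
    using d by (simp add: distributed_distr_eq_density)
  have "distr M borel (\<lambda>\<omega>. - ?X \<omega>) = distr (distr M borel ?X) borel uminus"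
    by (subst distr_distr) (use X in \<open>auto simp: comp_def\<close>)
  also have "distr M borel ?X = density lborel (\<lambda>x. ennreal (normal_density 0 (sqrt (t - s)) x))"
    using dx by (metis distr_cong sets_lborel)
  also have "distr (density lborel (\<lambda>x. ennreal (normal_density 0 (sqrt (t - s)) x))) borel uminus
      = density lborel (\<lambda>x. ennreal (normal_density 0 (sqrt (t - s)) x))"
  proof (rule measure_eqI)
    fix A assume "A \<in> sets (distr (density lborel (\<lambda>x. ennreal (normal_density 0 (sqrt (t - s)) x))) borel uminus)"
    then have A [measurable]: "A \<in> sets borel" by simp
    let ?g = "\<lambda>x. ennreal (normal_density 0 (sqrt (t - s)) x)"
    have "emeasure (distr (density lborel ?g) borel uminus) A = (\<integral>\<^sup>+x. ?g x * indicator A (- x) \<partial>lborel)"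
    proof -
      have "uminus -` A \<in> sets (borel :: real measure)" using measurable_sets[of uminus borel borel A] A by simp
      then show ?thesis
        by (subst emeasure_distr) (auto simp: emeasure_density indicator_def intro!: nn_integral_cong)
    qed
    also have "\<dots> = (\<integral>\<^sup>+x. ?g (- x) * indicator A (- x) \<partial>lborel)" by (simp add: normal_density_def)
    also have "\<dots> = (\<integral>\<^sup>+x. ?g x * indicator A x \<partial>distr lborel borel uminus)"
      by (subst nn_integral_distr) auto
    also have "\<dots> = emeasure (density lborel ?g) A" by (simp add: lborel_distr_uminus emeasure_density)
    finally show "emeasure (distr (density lborel ?g) borel uminus) A = emeasure (density lborel ?g) A" .
  qed simp
  also have "\<dots> = distr M borel ?X" using dx by (metis distr_cong sets_lborel)
  finally have neg: "distr M borel (\<lambda>\<omega>. - ?X \<omega>) = distr M borel ?X" .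
  have eY: "distr M borel (\<lambda>\<omega>. e (Y \<omega>)) = distr (distr M borel Y) borel e" if "Y \<in> borel_measurable M" for Y
    using distr_distr[OF e that] by (simp only: comp_def)
  have eneg: "distr M borel (\<lambda>\<omega>. e (- ?X \<omega>)) = distr M borel (\<lambda>\<omega>. e (?X \<omega>))"
    using eY[OF X] eY[OF borel_measurable_uminus[OF X]] unfolding neg by (rule trans[OF _ sym, rotated])
  have pr: "distr M borel \<xi> \<Otimes>\<^sub>M distr M borel (\<lambda>\<omega>. e (c * ?X \<omega>)) = distr M (borel \<Otimes>\<^sub>M borel) (\<lambda>\<omega>. (\<xi> \<omega>, e (c * ?X \<omega>)))" for c
    using iv[of c] unfolding indep_var_distribution_eq by (elim conjE)
  have law: "distr M (borel \<Otimes>\<^sub>M borel) (\<lambda>\<omega>. (\<xi> \<omega>, e (- ?X \<omega>))) = distr M (borel \<Otimes>\<^sub>M borel) (\<lambda>\<omega>. (\<xi> \<omega>, e (?X \<omega>)))"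
    using pr[of 1] pr[of "-1"] eneg by (simp only: mult_1 mult_minus1)
  have e0: "e r 0 = r" for r by (simp add: e_def)
  have "(\<lambda>g::nat \<Rightarrow> real. g 0) \<in> borel_measurable borel"
    by (intro borel_measurable_continuous_onI continuous_on_product_coordinates)
  then have "(\<lambda>p. (fst p, snd p 0)) \<in> (borel :: (nat \<Rightarrow> real) measure) \<Otimes>\<^sub>M (borel :: (nat \<Rightarrow> real) measure) \<rightarrow>\<^sub>M borel \<Otimes>\<^sub>M borel"
    by (intro measurable_Pair measurable_fst measurable_compose[OF measurable_snd])
  then have f': "(\<lambda>p. f (fst p, snd p 0)) \<in> borel_measurable ((borel :: (nat \<Rightarrow> real) measure) \<Otimes>\<^sub>M (borel :: (nat \<Rightarrow> real) measure))"
    by (rule measurable_compose[OF _ f])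
  have mp: "(\<lambda>\<omega>. (\<xi> \<omega>, e (?X \<omega>))) \<in> M \<rightarrow>\<^sub>M borel \<Otimes>\<^sub>M borel" "(\<lambda>\<omega>. (\<xi> \<omega>, e (- ?X \<omega>))) \<in> M \<rightarrow>\<^sub>M borel \<Otimes>\<^sub>M borel"
    by (intro measurable_Pair \<xi>M eX)+
  have "(\<integral>\<omega>. f (\<xi> \<omega>, ?X \<omega>) \<partial>M) = (\<integral>p. f (fst p, snd p 0) \<partial>distr M (borel \<Otimes>\<^sub>M borel) (\<lambda>\<omega>. (\<xi> \<omega>, e (?X \<omega>))))"
    by (subst integral_distr[OF mp(1) f']) (simp only: fst_conv snd_conv e0)
  also have "\<dots> = (\<integral>p. f (fst p, snd p 0) \<partial>distr M (borel \<Otimes>\<^sub>M borel) (\<lambda>\<omega>. (\<xi> \<omega>, e (- ?X \<omega>))))"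
    by (simp only: law)
  also have "\<dots> = (\<integral>\<omega>. f (\<xi> \<omega>, - ?X \<omega>) \<partial>M)"
    by (subst integral_distr[OF mp(2) f']) (simp only: fst_conv snd_conv e0)
  finally show ?thesis .
qed

text \<open>\<open>wfourier\<close> is not continuous for the L2 norm, but it is the pointwise limit
  of the bounded operators \<open>wfourier_trunc\<close>, so the pairing is a limit of continuous
  functions.\<close>

lemma continuous_on_inner_wfourier_measurable:
  fixes v w :: "'b::topological_space \<Rightarrow> (real^'n::finite) l2"
  assumes "continuous_on UNIV v" "continuous_on UNIV w" "\<And>x. v x \<in> Hs k" "\<And>x. w x \<in> Hs k"
  shows "(\<lambda>x. wfourier k (v x) \<bullet> wfourier k (w x)) \<in> borel_measurable borel"
proof (rule borel_measurable_LIMSEQ_real)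
  show "(\<lambda>R. wfourier_trunc k R (v x) \<bullet> wfourier_trunc k R (w x)) \<longlonglongrightarrow> wfourier k (v x) \<bullet> wfourier k (w x)" for x
    by (intro tendsto_inner wfourier_trunc_tendsto assms)
  show "(\<lambda>x. wfourier_trunc k R (v x) \<bullet> wfourier_trunc k R (w x)) \<in> borel_measurable borel" for R
    by (intro borel_measurable_continuous_onI continuous_on_inner
        bounded_linear.continuous_on[OF bounded_linear_wfourier_trunc] assms)
qed

context potential
begin

lemma continuous_on_dsplit:
  fixes G :: "'b::metric_space \<Rightarrow> nat \<Rightarrow> real"
  assumes "\<And>j. continuous_on UNIV (\<lambda>x. G x j)" "0 \<le> h"
  shows "continuous_on UNIV (\<lambda>x. dsplit h u (G x) n)"
proof (induction n)
  case (Suc n)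
  then show ?case by (simp add: continuous_on_free_group continuous_on_flow assms)
qed simp

text \<open>Coarse and fine scheme after \<open>n\<close> coarse steps, driven by the fine increments.\<close>

definition coarse_steps :: "real \<Rightarrow> (real^'n) l2 \<Rightarrow> nat \<Rightarrow> (nat \<Rightarrow> real) \<Rightarrow> (real^'n) l2" where
  "coarse_steps h u n g = dsplit (2 * h) u (\<lambda>j. g (2 * j) + g (2 * j + 1)) n"

definition fine_steps :: "real \<Rightarrow> (real^'n) l2 \<Rightarrow> nat \<Rightarrow> (nat \<Rightarrow> real) \<Rightarrow> (real^'n) l2" where
  "fine_steps h u n g = dsplit h u g (2 * n)"

lemma coarse_steps_fine_steps_Suc:
  "coarse_steps h u (Suc n) g - fine_steps h u (Suc n) g =
    free_group (g (2 * n) + g (2 * n + 1)) (flow (2 * h) (coarse_steps h u n g)) -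
    free_group (g (2 * n + 1)) (flow h (free_group (g (2 * n)) (flow h (fine_steps h u n g))))"
  by (simp add: coarse_steps_def fine_steps_def)

lemma coarse_steps_fine_steps_cong:
  assumes "\<And>j. j < 2 * n \<Longrightarrow> g j = g' j"
  shows "coarse_steps h u n g = coarse_steps h u n g'" "fine_steps h u n g = fine_steps h u n g'"
  unfolding coarse_steps_def fine_steps_def by (intro dsplit_cong; simp add: assms)+

lemma continuous_coarse_steps_fine_steps:
  fixes G :: "'b::metric_space \<Rightarrow> nat \<Rightarrow> real"
  assumes "\<And>j. continuous_on UNIV (\<lambda>x. G x j)" "0 \<le> h"
  shows "continuous_on UNIV (\<lambda>x. coarse_steps h u n (G x))" "continuous_on UNIV (\<lambda>x. fine_steps h u n (G x))"
  unfolding coarse_steps_def fine_steps_def by (intro continuous_on_dsplit continuous_intros assms; use assms in simp)+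

text \<open>The mean square after \<open>n\<close> coarse steps obeys a recursion with factor
  \<open>1 + 2 * C * h\<close> and source \<open>5 * C * h ^ 3\<close>; over a number of steps of
  order \<open>1 / h\<close> the sources sum to order \<open>h\<^sup>2\<close>.\<close>

lemma doubling_estimate:
  assumes uc: "usual_conditions M F" and bm: "brownian_motion M F \<beta>" and T: "0 < T"
    and k: "k + 4 \<le> p" and u: "u \<in> Hs (k + 4)"
  shows "\<exists>A\<ge>0. \<forall>N>0.
    integrable M (\<lambda>\<omega>. (hs_norm k (splitting V (\<lambda>t. \<beta> t \<omega>) (T / real N) u N - splitting V (\<lambda>t. \<beta> t \<omega>) (T / real (2 * N)) u (2 * N)))\<^sup>2) \<and>
    (\<integral>\<omega>. (hs_norm k (splitting V (\<lambda>t. \<beta> t \<omega>) (T / real N) u N - splitting V (\<lambda>t. \<beta> t \<omega>) (T / real (2 * N)) u (2 * N)))\<^sup>2 \<partial>M) \<le> A * (T / real N)\<^sup>2"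
proof -
  interpret prob_space M by (rule usual_conditionsD(1)[OF uc])
  define B where "B = exp (T * (tri_const (k + 4) * (norm u * norm u))) * hs_norm (k + 4) u"
  have B0: "0 \<le> B" by (simp add: B_def)
  obtain C where C: "0 \<le> C" and step: "\<And>h x y a b. 0 < h \<Longrightarrow> h \<le> T \<Longrightarrow> x \<in> Hs (k + 4) \<Longrightarrow> y \<in> Hs (k + 4) \<Longrightarrow>
      hs_norm (k + 4) x \<le> B \<Longrightarrow> hs_norm (k + 4) y \<le> B \<Longrightarrow>
    (hs_norm k (free_group (a + b) (flow (2 * h) x) - free_group b (flow h (free_group a (flow h y)))))\<^sup>2
      \<le> (1 + C * h) * (hs_norm k (x - y))\<^sup>2 + C * h\<^sup>2 * a\<^sup>2 + C * h ^ 3 - 2 * h * cross_term k h x y a \<and>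
    \<bar>cross_term k h x y a + cross_term k h x y (- a)\<bar> \<le> C * (hs_norm k (x - y))\<^sup>2 + C * a ^ 4"
    using step_bound[OF k T B0] by blast
  \<comment> \<open>The source and the growth of the recursion, with slack in the numerical factors;
    the target is expressed by the coarse step \<open>T / real N = 2 * h\<close>.\<close>
  define A where "A = 5 * C * T * exp (2 * C * T)"
  have A0: "0 \<le> A" using C T by (simp add: A_def)
  have kk: "k \<le> k + 4" by simp
  show ?thesis
  proof (intro exI[of _ A] conjI allI impI A0)
    fix N :: nat assume N: "0 < N"
    define h where "h = T / real (2 * N)"
    have h: "0 < h" "h \<le> T" "real N * (2 * h) = T"
      using T N by (auto simp: h_def divide_le_eq intro: order_trans[OF _ mult_left_mono[of 1 "2 * real N" T]])
    define \<gamma> where "\<gamma> \<omega> j = \<beta> (real (Suc j) * h) \<omega> - \<beta> (real j * h) \<omega>" for \<omega> j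
    \<comment> \<open>The increments before the current coarse step, padded with zeros. They produce
      the same iterates as the full sequence but are measurable with respect to the past, hence
      independent of the next increment.\<close>
    define \<xi> where "\<xi> n \<omega> j = (if j < 2 * n then \<gamma> \<omega> j else 0)" for n \<omega> and j :: nat
    have st: "0 \<le> real j * h" "real j * h < real (Suc j) * h" "real (Suc j) * h - real j * h = h" for j
      using h by (auto simp: algebra_simps)
    note inc = brownian_increment[OF uc bm st(1,2), folded \<gamma>_def, unfolded st(3)]
    define X where "X n \<omega> = coarse_steps h u n (\<gamma> \<omega>)" for n \<omega>
    define Y where "Y n \<omega> = fine_steps h u n (\<gamma> \<omega>)" for n \<omega>
    have XY\<xi>: "X n \<omega> = coarse_steps h u n (\<xi> n \<omega>)" "Y n \<omega> = fine_steps h u n (\<xi> n \<omega>)" for n \<omega>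
      unfolding X_def Y_def by (rule coarse_steps_fine_steps_cong; simp add: \<xi>_def)+
    have Xk: "coarse_steps h u n g \<in> Hs (k + 4)" "fine_steps h u n g \<in> Hs (k + 4)" for n g
      unfolding coarse_steps_def fine_steps_def using dsplit_Hs[OF u k] h by auto
    have bnd: "hs_norm (k + 4) (coarse_steps h u n g) \<le> B \<and> hs_norm (k + 4) (fine_steps h u n g) \<le> B" if "n \<le> N" for n g
    proof -
      have nT: "real n * (2 * h) \<le> T" using mult_right_mono[of "real n" "real N" "2 * h"] that h by simp
      then have e: "exp (real n * (2 * h) * (tri_const (k + 4) * (norm u * norm u))) * hs_norm (k + 4) u \<le> B"
        unfolding B_def by (intro mult_right_mono) (auto intro!: mult_right_mono mult_nonneg_nonneg tri_const_nonneg)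
      have "hs_norm (k + 4) (coarse_steps h u n g) \<le> B"
        unfolding coarse_steps_def using dsplit_Hs[OF u k, of "2 * h" "\<lambda>j. g (2 * j) + g (2 * j + 1)" n] h e by linarith
      moreover have e2: "real (2 * n) * h = real n * (2 * h)" by simp
      have "hs_norm (k + 4) (dsplit h u g (2 * n)) \<le> exp (real n * (2 * h) * (tri_const (k + 4) * (norm u * norm u))) * hs_norm (k + 4) u"
        using conjunct2[OF dsplit_Hs[OF u k less_imp_le[OF h(1)], of g "2 * n"]] unfolding e2 .
      then have "hs_norm (k + 4) (fine_steps h u n g) \<le> B"
        unfolding fine_steps_def using e by (rule order_trans)
      ultimately show ?thesis by blast
    qed
    have lvl: "coarse_steps h u n g \<in> Hs k" "fine_steps h u n g \<in> Hs k" for n g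
      using Hs_mono(1)[OF kk Xk(1)] Hs_mono(1)[OF kk Xk(2)] .
    define \<phi> where "\<phi> n g = (hs_norm k (coarse_steps h u n g - fine_steps h u n g))\<^sup>2" for n g
    define \<iota> where "\<iota> n q = cross_term k h (coarse_steps h u n (fst q)) (fine_steps h u n (fst q)) (snd q)" for n and q :: "(nat \<Rightarrow> real) \<times> real"
    have \<phi>B: "\<phi> n g \<le> (2 * B)\<^sup>2" if "n \<le> N" for n g
    proof -
      have "hs_norm k (coarse_steps h u n g - fine_steps h u n g) \<le> hs_norm k (coarse_steps h u n g) + hs_norm k (fine_steps h u n g)" by (rule hs_norm_triangle_diff[OF lvl])
      also have "\<dots> \<le> 2 * B" using Hs_mono(2)[OF kk Xk(1)[of n g]] Hs_mono(2)[OF kk Xk(2)[of n g]] bnd[OF that, of g] by linarith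
      finally show ?thesis unfolding \<phi>_def by (rule power_mono) simp
    qed
    have \<phi>0: "0 \<le> \<phi> n g" for n g by (simp add: \<phi>_def)
    have cc1: "continuous_on UNIV (\<lambda>g::nat \<Rightarrow> real. g j)" for j by (rule continuous_on_product_coordinates)
    have cc2: "continuous_on UNIV (\<lambda>q::(nat \<Rightarrow> real) \<times> real. fst q j)" for j
      by (rule continuous_on_compose2[OF cc1[of j]]) (auto intro: continuous_intros)
    have \<phi>m [measurable]: "\<phi> n \<in> borel_measurable borel" for n
      unfolding \<phi>_def[abs_def] hs_norm_def power2_norm_eq_inner
      by (rule continuous_on_inner_wfourier_measurable) (use h lvl in \<open>auto intro!: continuous_on_diff continuous_coarse_steps_fine_steps cc1 Hs_diff\<close>)
    have \<iota>m: "\<iota> n \<in> borel_measurable (borel \<Otimes>\<^sub>M borel)" if n: "n \<le> N" for n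
    proof -
      have kp: "k \<le> p" using k by simp
      have z: "flow h (fine_steps h u n g) \<in> Hs (k + 4)" for g by (rule flow_Hs(1)[OF Xk(2) k])
      note cX = continuous_coarse_steps_fine_steps[of "fst :: (nat \<Rightarrow> real) \<times> real \<Rightarrow> nat \<Rightarrow> real", OF cc2]
      have "\<iota> n \<in> borel_measurable borel"
        unfolding \<iota>_def[abs_def] cross_term_def
      proof (rule continuous_on_inner_wfourier_measurable)
        show "continuous_on UNIV (\<lambda>q::(nat \<Rightarrow> real) \<times> real. flow_diff h (coarse_steps h u n (fst q)) (fine_steps h u n (fst q)))"
          unfolding flow_diff_def by (intro continuous_on_diff continuous_on_flow[OF cX(1)] continuous_on_flow[OF cX(2)]) (use h in auto)
        have cY: "continuous_on UNIV (\<lambda>q::(nat \<Rightarrow> real) \<times> real. flow h (fine_steps h u n (fst q)))"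
          using h by (intro continuous_on_flow cX) auto
        show "continuous_on UNIV (\<lambda>q::(nat \<Rightarrow> real) \<times> real. mul_i (conj_defect (snd q) (flow h (fine_steps h u n (fst q)))))"
          unfolding mul_i_def conj_defect_def
          by (intro bounded_linear.continuous_on[OF bounded_linear_mul[OF bounded_symbol_const]] continuous_on_diff
              continuous_on_free_group continuous_on_NN cY continuous_on_minus continuous_on_snd continuous_on_id)
        show "flow_diff h (coarse_steps h u n (fst q)) (fine_steps h u n (fst q)) \<in> Hs k" for q :: "(nat \<Rightarrow> real) \<times> real"
          unfolding flow_diff_def by (intro Hs_diff(1) flow_Hs(1) lvl kp)
        show "mul_i (conj_defect (snd q) (flow h (fine_steps h u n (fst q)))) \<in> Hs k" for q :: "(nat \<Rightarrow> real) \<times> real"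
          by (rule mul_i_Hs(1)[OF conj_defect_bounds(1)[OF k z order_refl]])
      qed
      then show ?thesis by (simp add: borel_prod)
    qed
    have \<gamma>m: "(\<lambda>\<omega>. \<gamma> \<omega>) \<in> borel_measurable M"
      by (rule measurable_coordinatewise_then_product) (use inc(1) in simp)
    have i\<phi>: "integrable M (\<lambda>\<omega>. \<phi> n (\<gamma> \<omega>))" if "n \<le> N" for n
      by (rule integrable_const_bound[of _ "(2 * B)\<^sup>2"])
        (use \<phi>B[OF that] \<phi>0 \<gamma>m in \<open>auto intro!: measurable_compose[OF \<gamma>m \<phi>m]\<close>)
    have rec: "(\<integral>\<omega>. \<phi> (Suc n) (\<gamma> \<omega>) \<partial>M) \<le> (1 + 2 * C * h) * (\<integral>\<omega>. \<phi> n (\<gamma> \<omega>) \<partial>M) + 5 * C * h ^ 3" if n: "Suc n \<le> N" for n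
    proof -
      have nN: "n \<le> N" using n by simp
      let ?a = "\<lambda>\<omega>. \<gamma> \<omega> (2 * n)"
      have \<phi>\<xi>: "\<phi> n (\<gamma> \<omega>) = \<phi> n (\<xi> n \<omega>)" for \<omega>
        unfolding \<phi>_def using XY\<xi>[of n \<omega>] by (simp add: X_def Y_def)
      have st1: "\<phi> (Suc n) (\<gamma> \<omega>) \<le> (1 + C * h) * \<phi> n (\<gamma> \<omega>) + C * h\<^sup>2 * (?a \<omega>)\<^sup>2 + C * h ^ 3 - 2 * h * \<iota> n (\<xi> n \<omega>, ?a \<omega>)"
        and st2: "\<bar>\<iota> n (\<xi> n \<omega>, ?a \<omega>) + \<iota> n (\<xi> n \<omega>, - ?a \<omega>)\<bar> \<le> C * \<phi> n (\<gamma> \<omega>) + C * (?a \<omega>) ^ 4"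
        and st3: "0 \<le> (1 + C * h) * \<phi> n (\<gamma> \<omega>) + C * h\<^sup>2 * (?a \<omega>)\<^sup>2 + C * h ^ 3 - 2 * h * \<iota> n (\<xi> n \<omega>, - ?a \<omega>)" for \<omega>
      proof -
        have bb: "hs_norm (k + 4) (coarse_steps h u n (\<gamma> \<omega>)) \<le> B" "hs_norm (k + 4) (fine_steps h u n (\<gamma> \<omega>)) \<le> B" using bnd[OF nN] by auto
        note S = step[OF h(1,2) Xk(1) Xk(2) bb]
        have \<iota>e: "\<iota> n (\<xi> n \<omega>, a) = cross_term k h (coarse_steps h u n (\<gamma> \<omega>)) (fine_steps h u n (\<gamma> \<omega>)) a" for a
          unfolding \<iota>_def fst_conv snd_conv using XY\<xi>[of n \<omega>] by (simp add: X_def Y_def)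
        show "\<phi> (Suc n) (\<gamma> \<omega>) \<le> (1 + C * h) * \<phi> n (\<gamma> \<omega>) + C * h\<^sup>2 * (?a \<omega>)\<^sup>2 + C * h ^ 3 - 2 * h * \<iota> n (\<xi> n \<omega>, ?a \<omega>)"
          unfolding \<iota>e \<phi>_def coarse_steps_fine_steps_Suc using S by blast
        show "\<bar>\<iota> n (\<xi> n \<omega>, ?a \<omega>) + \<iota> n (\<xi> n \<omega>, - ?a \<omega>)\<bar> \<le> C * \<phi> n (\<gamma> \<omega>) + C * (?a \<omega>) ^ 4"
          unfolding \<iota>e \<phi>_def using S by blast
        \<comment> \<open>The step estimate at the reflected increment with \<open>b = 0\<close>:
          its left side is a square, which bounds the reflected cross term from above.\<close>
        have "0 \<le> (1 + C * h) * \<phi> n (\<gamma> \<omega>) + C * h\<^sup>2 * (- ?a \<omega>)\<^sup>2 + C * h ^ 3 - 2 * h * \<iota> n (\<xi> n \<omega>, - ?a \<omega>)"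
          unfolding \<iota>e \<phi>_def using S[of "- ?a \<omega>" 0] order_trans[OF zero_le_power2] by blast
        then show "0 \<le> (1 + C * h) * \<phi> n (\<gamma> \<omega>) + C * h\<^sup>2 * (?a \<omega>)\<^sup>2 + C * h ^ 3 - 2 * h * \<iota> n (\<xi> n \<omega>, - ?a \<omega>)" by simp
      qed
      have \<xi>F: "\<xi> n \<in> borel_measurable (F (real (2 * n) * h))"
      proof (rule measurable_coordinatewise_then_product)
        fix j
        show "(\<lambda>\<omega>. \<xi> n \<omega> j) \<in> borel_measurable (F (real (2 * n) * h))"
        proof (cases "j < 2 * n")
          case True
          have sub: "\<beta> t \<in> borel_measurable (F (real (2 * n) * h))" if "0 \<le> t" "t \<le> real (2 * n) * h" for t
          proof -
            have a: "\<beta> t \<in> borel_measurable (F t)" using bm that by (simp add: brownian_motion_def)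
            have b: "sets (F t) \<subseteq> sets (F (real (2 * n) * h))" by (rule usual_conditionsD(3)[OF uc that])
            have c: "space (F t) = space (F (real (2 * n) * h))" using space_filtration[OF uc that(1)] space_filtration[OF uc order_trans[OF that]] by simp
            show ?thesis using a b c unfolding measurable_def by auto
          qed
          have "real (Suc j) * h \<le> real (2 * n) * h" "real j * h \<le> real (2 * n) * h"
            using True h by (auto intro!: mult_right_mono simp del: of_nat_Suc)
          then show ?thesis using True h by (simp add: \<xi>_def \<gamma>_def del: of_nat_Suc of_nat_mult) (intro borel_measurable_diff sub; simp)
        qed (simp add: \<xi>_def)
      qed
      have sym: "(\<integral>\<omega>. \<iota> n (\<xi> n \<omega>, ?a \<omega>) \<partial>M) = (\<integral>\<omega>. \<iota> n (\<xi> n \<omega>, - ?a \<omega>) \<partial>M)"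
        unfolding \<gamma>_def by (rule increment_symmetric[OF uc bm st(1,2) \<xi>F \<iota>m[OF nN]])
      have \<xi>M: "\<xi> n \<in> borel_measurable M" by (rule measurable_subfiltration[OF uc _ \<xi>F]) (use h in simp)
      have im: "(\<lambda>\<omega>. \<iota> n (\<xi> n \<omega>, ?a \<omega>)) \<in> borel_measurable M" "(\<lambda>\<omega>. \<iota> n (\<xi> n \<omega>, - ?a \<omega>)) \<in> borel_measurable M"
        using inc(1)[of "2 * n"] by (auto intro!: measurable_compose[OF measurable_Pair[OF \<xi>M] \<iota>m[OF nN]])
      \<comment> \<open>An integrable majorant of both cross terms. Each is bounded above because
        the right side of its step estimate is nonnegative, and below by the bound on the even part
        together with the upper bound of its partner.\<close>
      define W where "W \<omega> = ((1 + C * h) * \<phi> n (\<gamma> \<omega>) + C * h\<^sup>2 * (?a \<omega>)\<^sup>2 + C * h ^ 3) / (2 * h) + (C * \<phi> n (\<gamma> \<omega>) + C * (?a \<omega>) ^ 4)" for \<omega>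
      have iW: "integrable M W"
        unfolding W_def[abs_def]
        by (intro Bochner_Integration.integrable_add integrable_divide integrable_mult_right integrable_const
            i\<phi>[OF nN] inc(2) inc(4))
      have st1': "0 \<le> (1 + C * h) * \<phi> n (\<gamma> \<omega>) + C * h\<^sup>2 * (?a \<omega>)\<^sup>2 + C * h ^ 3 - 2 * h * \<iota> n (\<xi> n \<omega>, ?a \<omega>)" for \<omega>
        using st1[of \<omega>] \<phi>0[of "Suc n" "\<gamma> \<omega>"] by linarith
      have dom: "\<bar>\<iota> n (\<xi> n \<omega>, ?a \<omega>)\<bar> \<le> W \<omega>" "\<bar>\<iota> n (\<xi> n \<omega>, - ?a \<omega>)\<bar> \<le> W \<omega>" for \<omega>
      proof -
        let ?U = "(1 + C * h) * \<phi> n (\<gamma> \<omega>) + C * h\<^sup>2 * (?a \<omega>)\<^sup>2 + C * h ^ 3"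
        have "\<iota> n (\<xi> n \<omega>, ?a \<omega>) \<le> ?U / (2 * h)" "\<iota> n (\<xi> n \<omega>, - ?a \<omega>) \<le> ?U / (2 * h)"
          using st1'[of \<omega>] st3[of \<omega>] h by (simp_all add: le_divide_eq mult.commute)
        moreover have "0 \<le> C * \<phi> n (\<gamma> \<omega>) + C * (?a \<omega>) ^ 4" using C \<phi>0 by simp
        ultimately show "\<bar>\<iota> n (\<xi> n \<omega>, ?a \<omega>)\<bar> \<le> W \<omega>" "\<bar>\<iota> n (\<xi> n \<omega>, - ?a \<omega>)\<bar> \<le> W \<omega>"
          using st2[of \<omega>] unfolding W_def by linarith+
      qed
      have "norm (\<iota> n (\<xi> n \<omega>, ?a \<omega>)) \<le> norm (W \<omega>)" "norm (\<iota> n (\<xi> n \<omega>, - ?a \<omega>)) \<le> norm (W \<omega>)" for \<omega>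
        using dom[of \<omega>] by auto
      note nb = this
      have ii1: "integrable M (\<lambda>\<omega>. \<iota> n (\<xi> n \<omega>, ?a \<omega>))" and ii2: "integrable M (\<lambda>\<omega>. \<iota> n (\<xi> n \<omega>, - ?a \<omega>))"
        using Bochner_Integration.integrable_bound[OF iW im(1) AE_I2[OF nb(1)]]
          Bochner_Integration.integrable_bound[OF iW im(2) AE_I2[OF nb(2)]] .
      have i4: "integrable M (\<lambda>\<omega>. C * \<phi> n (\<gamma> \<omega>) + C * (?a \<omega>) ^ 4)" by (intro Bochner_Integration.integrable_add integrable_mult_right i\<phi>[OF nN] inc(4))
      have i2: "integrable M (\<lambda>\<omega>. (1 + C * h) * \<phi> n (\<gamma> \<omega>) + C * h\<^sup>2 * (?a \<omega>)\<^sup>2 + C * h ^ 3 - 2 * h * \<iota> n (\<xi> n \<omega>, ?a \<omega>))"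
        by (intro Bochner_Integration.integrable_add Bochner_Integration.integrable_diff integrable_mult_right integrable_const
            i\<phi>[OF nN] inc(2) ii1)
      have "- (\<integral>\<omega>. \<iota> n (\<xi> n \<omega>, ?a \<omega>) + \<iota> n (\<xi> n \<omega>, - ?a \<omega>) \<partial>M) \<le> (\<integral>\<omega>. C * \<phi> n (\<gamma> \<omega>) + C * (?a \<omega>) ^ 4 \<partial>M)"
        unfolding integral_minus[symmetric]
        by (rule integral_mono) (use ii1 ii2 i4 st2 in \<open>auto simp: abs_le_iff\<close>)
      \<comment> \<open>By \<open>sym\<close>, twice the mean of the cross term is the mean of its
        even part; the 3 is the fourth moment of the normal law.\<close>
      then have J: "- 2 * (\<integral>\<omega>. \<iota> n (\<xi> n \<omega>, ?a \<omega>) \<partial>M) \<le> C * (\<integral>\<omega>. \<phi> n (\<gamma> \<omega>) \<partial>M) + C * (3 * h\<^sup>2)"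
        using ii1 ii2 i\<phi>[OF nN] inc(4,5)[of "2 * n"] sym by simp
      have "(\<integral>\<omega>. \<phi> (Suc n) (\<gamma> \<omega>) \<partial>M) \<le> (\<integral>\<omega>. (1 + C * h) * \<phi> n (\<gamma> \<omega>) + C * h\<^sup>2 * (?a \<omega>)\<^sup>2 + C * h ^ 3 - 2 * h * \<iota> n (\<xi> n \<omega>, ?a \<omega>) \<partial>M)"
        by (rule integral_mono[OF i\<phi>[OF n] i2 st1])
      also have "\<dots> = (1 + C * h) * (\<integral>\<omega>. \<phi> n (\<gamma> \<omega>) \<partial>M) + C * h\<^sup>2 * h + C * h ^ 3 - 2 * h * (\<integral>\<omega>. \<iota> n (\<xi> n \<omega>, ?a \<omega>) \<partial>M)"
        using i\<phi>[OF nN] inc(2,3)[of "2 * n"] ii1 by (simp add: prob_space)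
      also have "\<dots> \<le> (1 + C * h) * (\<integral>\<omega>. \<phi> n (\<gamma> \<omega>) \<partial>M) + C * h\<^sup>2 * h + C * h ^ 3 + h * (C * (\<integral>\<omega>. \<phi> n (\<gamma> \<omega>) \<partial>M) + C * (3 * h\<^sup>2))"
        using mult_left_mono[OF J, of h] h by simp
      also have "\<dots> = (1 + 2 * C * h) * (\<integral>\<omega>. \<phi> n (\<gamma> \<omega>) \<partial>M) + 5 * C * h ^ 3"
        by (simp add: power2_eq_square power3_eq_cube algebra_simps)
      finally show ?thesis .
    qed
    have "(\<integral>\<omega>. \<phi> N (\<gamma> \<omega>) \<partial>M) \<le> real N * (5 * C * h ^ 3) * exp (real N * (2 * C * h))"
    proof (rule gronwall_discrete[of "\<lambda>n. \<integral>\<omega>. \<phi> n (\<gamma> \<omega>) \<partial>M"])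
      show "(\<integral>\<omega>. \<phi> 0 (\<gamma> \<omega>) \<partial>M) \<le> 0" by (simp add: \<phi>_def coarse_steps_def fine_steps_def)
    qed (use rec C h in auto)
    also have "\<dots> \<le> A * (T / real N)\<^sup>2"
    proof -
      have e1: "real N * (2 * C * h) = C * T" using h(3) by (metis mult.assoc mult.commute)
      have e2: "T / real N = 2 * h" using N by (simp add: h_def)
      have "real N * (5 * C * h ^ 3) = 5 * C * h\<^sup>2 * (T / 2)"
        unfolding h(3)[symmetric] by (simp add: power2_eq_square power3_eq_cube mult_ac)
      also have "\<dots> * exp (C * T) \<le> 5 * C * h\<^sup>2 * (4 * T) * exp (2 * C * T)"
        using C T h by (intro mult_mono mult_left_mono) auto
      also have "\<dots> = A * (2 * h)\<^sup>2" by (simp add: A_def power_mult_distrib)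
      finally show ?thesis unfolding e1 e2 .
    qed
    finally have fin: "(\<integral>\<omega>. \<phi> N (\<gamma> \<omega>) \<partial>M) \<le> A * (T / real N)\<^sup>2" .
    have eq: "\<phi> N (\<gamma> \<omega>) = (hs_norm k (splitting V (\<lambda>t. \<beta> t \<omega>) (T / real N) u N - splitting V (\<lambda>t. \<beta> t \<omega>) (T / real (2 * N)) u (2 * N)))\<^sup>2" for \<omega>
    proof -
      have e2: "T / real N = 2 * h" using N by (simp add: h_def)
      have "(\<lambda>j. \<gamma> \<omega> (2 * j) + \<gamma> \<omega> (2 * j + 1)) = (\<lambda>j. \<beta> (real (Suc j) * (2 * h)) \<omega> - \<beta> (real j * (2 * h)) \<omega>)"
      proof
        fix j
        have "real (Suc (2 * j + 1)) * h = real (Suc j) * (2 * h)" "real (2 * j) * h = real j * (2 * h)"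
          "real (Suc (2 * j)) * h = real (2 * j + 1) * h" by (simp_all add: algebra_simps)
        then show "\<gamma> \<omega> (2 * j) + \<gamma> \<omega> (2 * j + 1) = \<beta> (real (Suc j) * (2 * h)) \<omega> - \<beta> (real j * (2 * h)) \<omega>"
          unfolding \<gamma>_def by (simp only:)
      qed
      then have "coarse_steps h u N (\<gamma> \<omega>) = splitting V (\<lambda>t. \<beta> t \<omega>) (T / real N) u N"
        unfolding coarse_steps_def splitting_dsplit e2 by (simp only:)
      moreover have "fine_steps h u N (\<gamma> \<omega>) = splitting V (\<lambda>t. \<beta> t \<omega>) (T / real (2 * N)) u (2 * N)"
        unfolding fine_steps_def splitting_dsplit h_def[symmetric] \<gamma>_def ..
      ultimately show ?thesis by (simp add: \<phi>_def)
    qed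
    show "integrable M (\<lambda>\<omega>. (hs_norm k (splitting V (\<lambda>t. \<beta> t \<omega>) (T / real N) u N - splitting V (\<lambda>t. \<beta> t \<omega>) (T / real (2 * N)) u (2 * N)))\<^sup>2)"
      using i\<phi>[OF order_refl] unfolding eq .
    show "(\<integral>\<omega>. (hs_norm k (splitting V (\<lambda>t. \<beta> t \<omega>) (T / real N) u N - splitting V (\<lambda>t. \<beta> t \<omega>) (T / real (2 * N)) u (2 * N)))\<^sup>2 \<partial>M) \<le> A * (T / real N)\<^sup>2"
      using fin unfolding eq .
  qed
qed

end

section \<open>Telescoping and conclusion\<close>

text \<open>The factor 2 is the sum of the geometric series that Cauchy-Schwarz leaves. The bound is
  uniform over the partial telescopes and passes to the L2 limit by \<open>Hs_limit\<close>.\<close>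

lemma telescoping_bound:
  fixes x :: "nat \<Rightarrow> (real^'n::finite) l2"
  assumes lim: "x \<longlonglongrightarrow> w" and x: "\<And>j. x j \<in> Hs k"
    and S: "\<And>n. (\<Sum>j<n. 2 ^ j * (hs_norm k (x j - x (Suc j)))\<^sup>2) \<le> S"
  shows "x 0 - w \<in> Hs k" "(hs_norm k (x 0 - w))\<^sup>2 \<le> 2 * S"
proof -
  have S0: "0 \<le> S" using S[of 0] by simp
  have b: "hs_norm k (x 0 - x n) \<le> sqrt (2 * S)" for n
  proof (rule real_le_rsqrt)
    let ?d = "\<lambda>j. hs_norm k (x j - x (Suc j))"
    have "x 0 - x n = (\<Sum>j<n. x j - x (Suc j))" by (rule sum_lessThan_telescope'[symmetric])
    then have "hs_norm k (x 0 - x n) \<le> (\<Sum>j<n. ?d j)"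
      using conjunct2[OF Hs_sum[of "{..<n}" "\<lambda>j. x j - x (Suc j)" k]] Hs_diff(1)[OF x x] by simp
    \<comment> \<open>The factor \<open>1 = (1 / sqrt 2) ^ j * sqrt 2 ^ j\<close> prepares
      Cauchy-Schwarz.\<close>
    also have "\<dots> = (\<Sum>j<n. (1 / sqrt 2) ^ j * (sqrt 2 ^ j * ?d j))"
      by (intro sum.cong refl) (simp add: power_divide)
    finally have "(hs_norm k (x 0 - x n))\<^sup>2 \<le> (\<Sum>j<n. (1 / sqrt 2) ^ j * (sqrt 2 ^ j * ?d j))\<^sup>2"
      by (rule power_mono) simp
    also have "\<dots> \<le> (\<Sum>j<n. ((1 / sqrt 2) ^ j)\<^sup>2) * (\<Sum>j<n. (sqrt 2 ^ j * ?d j)\<^sup>2)"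
      by (rule Cauchy_Schwarz_ineq_sum)
    also have "(\<lambda>j. ((1 / sqrt 2) ^ j)\<^sup>2) = (\<lambda>j. (1 / 2 :: real) ^ j)"
      by (simp add: power_mult[symmetric] mult.commute[of _ 2] power_mult power_divide)
    also have "(\<lambda>j. (sqrt 2 ^ j * ?d j)\<^sup>2) = (\<lambda>j. 2 ^ j * (?d j)\<^sup>2)"
      by (simp add: power_mult_distrib power_mult[symmetric] mult.commute[of _ 2] power_mult)
    also have "(\<Sum>j<n. (1 / 2) ^ j) * (\<Sum>j<n. 2 ^ j * (?d j)\<^sup>2) \<le> 2 * S"
    proof (rule mult_mono[OF _ S])
      show "(\<Sum>j<n. (1 / 2 :: real) ^ j) \<le> 2" by (simp add: sum_gp_strict)
    qed (auto intro!: sum_nonneg)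
    finally show "(hs_norm k (x 0 - x n))\<^sup>2 \<le> 2 * S" .
  qed
  have l: "(\<lambda>n. x 0 - x n) \<longlonglongrightarrow> x 0 - w" by (intro tendsto_intros lim)
  show "x 0 - w \<in> Hs k" by (rule Hs_limit(1)[OF l Hs_diff(1)[OF x x] b])
  have "hs_norm k (x 0 - w) \<le> sqrt (2 * S)" by (rule Hs_limit(2)[OF l Hs_diff(1)[OF x x] b])
  then have "(hs_norm k (x 0 - w))\<^sup>2 \<le> (sqrt (2 * S))\<^sup>2" by (rule power_mono) simp
  then show "(hs_norm k (x 0 - w))\<^sup>2 \<le> 2 * S" using S0 by simp
qed

context potential
begin

text \<open>\<open>Q\<close> is a measurable majorant of the squared error: a series of squared
  norms between schemes, whose measurability is known from \<open>doubling_estimate\<close>. The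
  error itself enters through an almost sure comparison.\<close>

lemma error_dominated:
  fixes U :: "'w \<Rightarrow> (real^'n) l2"
  assumes uc: "usual_conditions M F" and bm: "brownian_motion M F \<beta>" and T: "0 < T"
    and k: "k + 4 \<le> p" and u: "u \<in> Hs (k + 4)"
    and U: "AE \<omega> in M. (\<lambda>n. splitting V (\<lambda>t. \<beta> t \<omega>) (T / real (Suc n)) u (Suc n)) \<longlonglongrightarrow> U \<omega>"
  obtains A Q where "0 \<le> A" "\<And>N. 0 < N \<Longrightarrow> Q N \<in> borel_measurable M"
    "\<And>N. 0 < N \<Longrightarrow> (\<integral>\<^sup>+\<omega>. Q N \<omega> \<partial>M) \<le> ennreal (A * (T / real N)\<^sup>2)"
    "AE \<omega> in M. \<forall>N>0. (sobolev_norm k (splitting V (\<lambda>t. \<beta> t \<omega>) (T / real N) u N - U \<omega>))\<^sup>2 \<le> Q N \<omega>"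
proof -
  define x where "x \<omega> N = splitting V (\<lambda>t. \<beta> t \<omega>) (T / real N) u N" for \<omega> N
  obtain A where A: "0 \<le> A" and dbl: "\<And>N. 0 < N \<Longrightarrow> integrable M (\<lambda>\<omega>. (hs_norm k (x \<omega> N - x \<omega> (2 * N)))\<^sup>2)"
      "\<And>N. 0 < N \<Longrightarrow> (\<integral>\<omega>. (hs_norm k (x \<omega> N - x \<omega> (2 * N)))\<^sup>2 \<partial>M) \<le> A * (T / real N)\<^sup>2"
    using doubling_estimate[OF uc bm T k u, folded x_def] by auto
  have xk: "x \<omega> N \<in> Hs k" for \<omega> N
  proof -
    have "x \<omega> N \<in> Hs (k + 4)"
      unfolding x_def splitting_dsplit using dsplit_Hs[OF u k, of "T / real N"] T by simp
    then show ?thesis using Hs_mono(1)[of k "k + 4"] by simp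
  qed
  \<comment> \<open>The weight \<open>2 ^ j\<close> against a mean square of order
    \<open>4 ^ (- j)\<close> leaves \<open>2 ^ (- j)\<close>.\<close>
  define q where "q N j \<omega> = 2 ^ j * (hs_norm k (x \<omega> (N * 2 ^ j) - x \<omega> (2 * (N * 2 ^ j))))\<^sup>2" for N j \<omega>
  have q0: "0 \<le> q N j \<omega>" for N j \<omega> by (simp add: q_def)
  have qi: "integrable M (q N j)" "(\<integral>\<omega>. q N j \<omega> \<partial>M) \<le> A * (T / real N)\<^sup>2 * (1 / 2) ^ j" if "0 < N" for N j
  proof -
    have N: "0 < N * 2 ^ j" using that by simp
    show "integrable M (q N j)" unfolding q_def[abs_def] using dbl(1)[OF N] by simp
    have "(\<integral>\<omega>. q N j \<omega> \<partial>M) = 2 ^ j * (\<integral>\<omega>. (hs_norm k (x \<omega> (N * 2 ^ j) - x \<omega> (2 * (N * 2 ^ j))))\<^sup>2 \<partial>M)"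
      by (simp add: q_def)
    also have "\<dots> \<le> 2 ^ j * (A * (T / real (N * 2 ^ j))\<^sup>2)"
      by (intro mult_left_mono dbl(2)[OF N]) simp
    also have "\<dots> = A * (T / real N)\<^sup>2 * (1 / 2) ^ j"
      by (simp add: power2_eq_square power_divide)
    finally show "(\<integral>\<omega>. q N j \<omega> \<partial>M) \<le> A * (T / real N)\<^sup>2 * (1 / 2) ^ j" .
  qed
  \<comment> \<open>The 2 comes from \<open>telescoping_bound\<close> and the square from the
    comparison of norms; the summand 1 keeps \<open>c\<close> positive, so that an infinite series
    stays infinite.\<close>
  define c where "c = 1 + 2 * (sob_const TYPE('n) k)\<^sup>2"
  have c: "0 < c" by (simp add: c_def add_pos_nonneg)
  define Q where "Q N \<omega> = ennreal c * (\<Sum>j. ennreal (q N j \<omega>))" for N \<omega>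
  show ?thesis
  proof (rule that[of "c * (2 * A)" Q])
    show "0 \<le> c * (2 * A)" using A c by simp
    fix N :: nat assume N: "0 < N"
    have m [measurable]: "q N j \<in> borel_measurable M" for j using qi(1)[OF N] by (rule borel_measurable_integrable)
    show "Q N \<in> borel_measurable M" unfolding Q_def[abs_def] by measurable
    have "(\<integral>\<^sup>+\<omega>. Q N \<omega> \<partial>M) = ennreal c * (\<Sum>j. (\<integral>\<^sup>+\<omega>. ennreal (q N j \<omega>) \<partial>M))"
      unfolding Q_def by (simp add: nn_integral_cmult nn_integral_suminf)
    also have "\<dots> = ennreal c * (\<Sum>j. ennreal (\<integral>\<omega>. q N j \<omega> \<partial>M))"
      using nn_integral_eq_integral[OF qi(1)[OF N]] q0 by simp
    also have "\<dots> \<le> ennreal c * (\<Sum>j. ennreal (A * (T / real N)\<^sup>2 * (1 / 2) ^ j))"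
      by (intro mult_left_mono suminf_le ennreal_leI qi(2)[OF N]) auto
    also have "(\<Sum>j. ennreal (A * (T / real N)\<^sup>2 * (1 / 2) ^ j)) = ennreal (A * (T / real N)\<^sup>2 * 2)"
      using sums_mult[OF geometric_sums[of "1 / 2 :: real"], of "A * (T / real N)\<^sup>2"] A
      by (intro suminf_ennreal_eq) auto
    also have "ennreal c * \<dots> = ennreal (c * (2 * A) * (T / real N)\<^sup>2)"
      using c A by (simp add: ennreal_mult[symmetric] mult_ac)
    finally show "(\<integral>\<^sup>+\<omega>. Q N \<omega> \<partial>M) \<le> ennreal (c * (2 * A) * (T / real N)\<^sup>2)" .
  next
    show "AE \<omega> in M. \<forall>N>0. (sobolev_norm k (splitting V (\<lambda>t. \<beta> t \<omega>) (T / real N) u N - U \<omega>))\<^sup>2 \<le> Q N \<omega>"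
      using U
    proof eventually_elim
      case (elim \<omega>)
      then have l: "x \<omega> \<longlonglongrightarrow> U \<omega>" using LIMSEQ_imp_Suc[of "x \<omega>" "U \<omega>"] by (simp add: x_def)
      show ?case unfolding x_def[symmetric]
      proof (intro allI impI)
        fix N :: nat assume N: "0 < N"
        show "(sobolev_norm k (x \<omega> N - U \<omega>))\<^sup>2 \<le> Q N \<omega>"
        proof (cases "(\<Sum>j. ennreal (q N j \<omega>)) = \<infinity>")
          case True
          then show ?thesis using c by (simp add: Q_def ennreal_mult_top)
        next
          case False
          then obtain S where S: "0 \<le> S" "(\<Sum>j. ennreal (q N j \<omega>)) = ennreal S"
            by (cases "\<Sum>j. ennreal (q N j \<omega>)") auto
          have part: "(\<Sum>j<n. q N j \<omega>) \<le> S" for n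
          proof -
            have "ennreal (\<Sum>j<n. q N j \<omega>) = (\<Sum>j<n. ennreal (q N j \<omega>))" using q0 by (simp add: sum_ennreal)
            also have "\<dots> \<le> ennreal S" unfolding S(2)[symmetric] by (rule sum_le_suminf) auto
            finally show ?thesis using S(1) by simp
          qed
          have "filterlim (\<lambda>j. N * 2 ^ j) sequentially sequentially"
          proof (rule filterlim_at_top_mono[OF filterlim_ident] always_eventually allI)+
            fix j :: nat
            have "j \<le> 2 ^ j" by (rule less_imp_le[OF less_exp])
            also have "\<dots> \<le> N * 2 ^ j" using N by simp
            finally show "j \<le> N * 2 ^ j" .
          qed
          then have l2: "(\<lambda>j. x \<omega> (N * 2 ^ j)) \<longlonglongrightarrow> U \<omega>" by (rule filterlim_compose[OF l])
          have dj: "N * 2 ^ Suc j = 2 * (N * 2 ^ j)" for j by simp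
          have part': "(\<Sum>j<n. 2 ^ j * (hs_norm k (x \<omega> (N * 2 ^ j) - x \<omega> (N * 2 ^ Suc j)))\<^sup>2) \<le> S" for n
            using part[of n] unfolding q_def dj .
          note tb = telescoping_bound[OF l2 xk part']
          have h: "x \<omega> N - U \<omega> \<in> Hs k" "(hs_norm k (x \<omega> N - U \<omega>))\<^sup>2 \<le> 2 * S" using tb by simp_all
          have "(sobolev_norm k (x \<omega> N - U \<omega>))\<^sup>2 \<le> (ennreal (sob_const TYPE('n) k * hs_norm k (x \<omega> N - U \<omega>)))\<^sup>2"
            by (intro power_mono sobolev_norm_le h) simp
          also have "\<dots> = ennreal ((sob_const TYPE('n) k)\<^sup>2 * (hs_norm k (x \<omega> N - U \<omega>))\<^sup>2)"
            using sob_const_nonneg[where 'n='n, of k] by (subst ennreal_power) (simp_all add: power_mult_distrib)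
          also have "\<dots> \<le> ennreal (c * S)"
          proof (rule ennreal_leI)
            have "(sob_const TYPE('n) k)\<^sup>2 * (hs_norm k (x \<omega> N - U \<omega>))\<^sup>2 \<le> (sob_const TYPE('n) k)\<^sup>2 * (2 * S)"
              using h(2) by (rule mult_left_mono) simp
            also have "\<dots> \<le> c * S" using S(1) by (simp add: c_def algebra_simps)
            finally show "(sob_const TYPE('n) k)\<^sup>2 * (hs_norm k (x \<omega> N - U \<omega>))\<^sup>2 \<le> c * S" .
          qed
          also have "\<dots> = Q N \<omega>" using c S by (simp add: Q_def ennreal_mult)
          finally show ?thesis .
        qed
      qed
    qed
  qed
qed

end

text \<open>\<open>1 + R\<close> takes the place of the square root of \<open>R\<close>: it is
  larger, finite whenever \<open>R\<close> is, and covers the infinite case without a separate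
  convention.\<close>

lemma ennreal_le_of_square_le:
  fixes s R :: ennreal
  assumes p: "0 < p" and s: "s\<^sup>2 \<le> ennreal (p\<^sup>2) * R"
  shows "s \<le> (1 + R) * ennreal p"
proof (cases R)
  case top
  then show ?thesis using p by (simp add: ennreal_top_mult)
next
  case (real r)
  then have s': "s\<^sup>2 \<le> ennreal (p\<^sup>2 * r)" using s by (simp add: ennreal_mult)
  then have "s \<noteq> \<infinity>" by (auto simp: top_unique)
  then obtain y where y: "0 \<le> y" "s = ennreal y" by (cases s) auto
  have "y\<^sup>2 \<le> p\<^sup>2 * r" using s' y real by (simp add: ennreal_power)
  also have "\<dots> \<le> p\<^sup>2 * (1 + r)\<^sup>2" by (intro mult_left_mono) (use real in \<open>auto simp: power2_eq_square algebra_simps\<close>)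
  finally have "y\<^sup>2 \<le> ((1 + r) * p)\<^sup>2" by (simp add: power_mult_distrib mult.commute)
  then have "y \<le> (1 + r) * p" by (rule power2_le_imp_le) (use p real in auto)
  then have "ennreal y \<le> ennreal ((1 + r) * p)" by (rule ennreal_leI)
  also have "\<dots> = (1 + R) * ennreal p" using real p by (simp add: ennreal_mult ennreal_plus)
  finally show ?thesis using y by simp
qed

text \<open>Markov's inequality for the majorant: the squared step cancels, and
  \<open>A / C\<^sup>2\<close> bounds the probabilities for all \<open>N\<close> at once.\<close>

lemma convergence_in_probability:
  fixes E :: "nat \<Rightarrow> 'w \<Rightarrow> ennreal"
  assumes M: "prob_space M" and T: "0 < T" and A: "0 \<le> A" and Q: "\<And>N. 0 < N \<Longrightarrow> Q N \<in> borel_measurable M"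
    and iQ: "\<And>N. 0 < N \<Longrightarrow> (\<integral>\<^sup>+\<omega>. Q N \<omega> \<partial>M) \<le> ennreal (A * (T / real N)\<^sup>2)"
    and E: "AE \<omega> in M. \<forall>N>0. (E N \<omega>)\<^sup>2 \<le> Q N \<omega>"
  shows "((\<lambda>C::real. SUP N\<in>{N::nat. 0 < N \<and> T / real N < 1}.
      measure M {\<omega> \<in> space M. E N \<omega> \<ge> ennreal (C * (T / real N))}) \<longlongrightarrow> 0) at_top"
proof -
  interpret prob_space M by (rule M)
  let ?I = "{N::nat. 0 < N \<and> T / real N < 1}"
  let ?S = "\<lambda>C N. {\<omega> \<in> space M. E N \<omega> \<ge> ennreal (C * (T / real N))}"
  have le: "measure M (?S C N) \<le> A / C\<^sup>2" if C: "0 < C" and N: "0 < N" for C N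
  \<comment> \<open>The event involves the error, for which only an almost sure majorant is given.
    If it is not measurable, \<open>measure\<close> assigns it 0 and the bound is trivial.\<close>
  proof (cases "?S C N \<in> sets M")
    case False
    then show ?thesis using A by (simp add: measure_notin_sets)
  next
    case True
    let ?c = "(C * (T / real N))\<^sup>2"
    have c: "0 < C * (T / real N)" using C T N by simp
    have "ennreal (?c * measure M (?S C N)) = ennreal ?c * emeasure M (?S C N)"
      by (simp add: ennreal_mult emeasure_eq_measure)
    also have "\<dots> = (\<integral>\<^sup>+\<omega>. ennreal ?c * indicator (?S C N) \<omega> \<partial>M)"
      using True by (rule nn_integral_cmult_indicator[symmetric])
    also have "\<dots> \<le> (\<integral>\<^sup>+\<omega>. Q N \<omega> \<partial>M)"
    proof (rule nn_integral_mono_AE)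
      show "AE \<omega> in M. ennreal ?c * indicator (?S C N) \<omega> \<le> Q N \<omega>" using E
      proof eventually_elim
        case (elim \<omega>)
        show ?case
        proof (cases "\<omega> \<in> ?S C N")
          case True
          then have "(ennreal (C * (T / real N)))\<^sup>2 \<le> (E N \<omega>)\<^sup>2" by (intro power_mono) auto
          also have "\<dots> \<le> Q N \<omega>" using elim N by blast
          finally show ?thesis using True c by (simp only: ennreal_power[OF less_imp_le[OF c]] indicator_simps mult_1_right)
        qed (simp only: indicator_simps not_False_eq_True mult_zero_right zero_le)
      qed
    qed
    also have "\<dots> \<le> ennreal (A * (T / real N)\<^sup>2)" by (rule iQ[OF N])
    finally have "?c * measure M (?S C N) \<le> A * (T / real N)\<^sup>2"
      using A by (simp add: ennreal_le_iff)
    then have "(T / real N)\<^sup>2 * (C\<^sup>2 * measure M (?S C N)) \<le> (T / real N)\<^sup>2 * A"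
      by (simp only: power_mult_distrib mult_ac)
    then have "C\<^sup>2 * measure M (?S C N) \<le> A"
      by (rule mult_left_le_imp_le) (use T N in simp)
    then show ?thesis using C by (simp add: pos_le_divide_eq mult.commute)
  qed
  \<comment> \<open>A member of the index set: the supremum of reals is taken over a nonempty
    bounded family.\<close>
  obtain N0 where "T < real N0" using reals_Archimedean2 by blast
  then have N0: "N0 \<in> ?I" using T by (cases "N0 = 0") auto
  show ?thesis
  proof (rule tendsto_sandwich)
    show "\<forall>\<^sub>F C in at_top. 0 \<le> (SUP N\<in>?I. measure M (?S C N))"
      by (intro always_eventually allI cSUP_upper2[OF _ N0] bdd_aboveI2[where M=1]) auto
    show "\<forall>\<^sub>F C in at_top. (SUP N\<in>?I. measure M (?S C N)) \<le> A / C\<^sup>2"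
      using eventually_gt_at_top[of "0::real"]
      by eventually_elim (intro cSUP_least, use N0 le in auto)
    show "((\<lambda>C. A / C\<^sup>2) \<longlongrightarrow> 0) at_top" by (intro tendsto_divide_0[OF tendsto_const] filterlim_at_top_imp_at_infinity filterlim_pow_at_top filterlim_ident) simp
  qed simp
qed

text \<open>Along the powers of 2 the majorants divided by the squared rates have means bounded by a
  geometric series. Their sum \<open>R\<close> is therefore finite almost surely, and
  \<open>1 + R\<close> is the random constant.\<close>

lemma almost_sure_rate:
  fixes E :: "nat \<Rightarrow> 'w \<Rightarrow> ennreal" and T A \<epsilon> :: real
  assumes T: "0 < T" and A: "0 \<le> A" and Q: "\<And>N. 0 < N \<Longrightarrow> Q N \<in> borel_measurable M"
    and iQ: "\<And>N. 0 < N \<Longrightarrow> (\<integral>\<^sup>+\<omega>. Q N \<omega> \<partial>M) \<le> ennreal (A * (T / real N)\<^sup>2)"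
    and E: "AE \<omega> in M. \<forall>N>0. (E N \<omega>)\<^sup>2 \<le> Q N \<omega>" and \<epsilon>: "0 < \<epsilon>"
  shows "\<exists>C :: 'w \<Rightarrow> ennreal. C \<in> borel_measurable M \<and> (AE \<omega> in M. C \<omega> < \<infinity>) \<and>
    (AE \<omega> in M. \<forall>L. E (2 ^ L) \<omega> \<le> C \<omega> * ennreal ((T / 2 ^ L) powr (1 - \<epsilon>)))"
proof -
  define r where "r L = (T / 2 ^ L) powr (1 - \<epsilon>)" for L :: nat
  have r: "0 < r L" for L using T by (simp add: r_def)
  define R where "R \<omega> = (\<Sum>L. ennreal (1 / (r L)\<^sup>2) * Q (2 ^ L) \<omega>)" for \<omega>
  have [measurable]: "Q (2 ^ L) \<in> borel_measurable M" for L by (rule Q) simp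
  have Rm [measurable]: "R \<in> borel_measurable M" unfolding R_def[abs_def] by measurable
  \<comment> \<open>The ratio of that series: the squared step over the squared rate is the step to
    the power \<open>2 * \<epsilon>\<close>, and the step halves from one level to the next.\<close>
  define s where "s = (1 / 2 :: real) powr (2 * \<epsilon>)"
  have s: "0 < s" "s < 1" using \<epsilon> by (simp_all add: s_def powr_def ln_div)
  have tm: "1 / (r L)\<^sup>2 * (A * (T / 2 ^ L)\<^sup>2) = A * T powr (2 * \<epsilon>) * s ^ L" for L
  proof -
    have p: "0 < T / 2 ^ L" using T by simp
    have "(r L)\<^sup>2 = (T / 2 ^ L) powr (2 * (1 - \<epsilon>))"
      unfolding r_def power2_eq_square powr_add[symmetric] by (simp only: mult_2)
    then have "(T / 2 ^ L)\<^sup>2 / (r L)\<^sup>2 = (T / 2 ^ L) powr 2 / (T / 2 ^ L) powr (2 * (1 - \<epsilon>))"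
      using p by (simp add: powr_numeral)
    also have "\<dots> = (T / 2 ^ L) powr (2 * \<epsilon>)"
      by (simp add: powr_diff[symmetric] algebra_simps)
    also have "\<dots> = (T * (1 / 2) powr real L) powr (2 * \<epsilon>)"
      by (simp add: powr_realpow power_divide)
    also have "\<dots> = T powr (2 * \<epsilon>) * s ^ L"
      using T by (simp add: powr_mult s_def powr_powr powr_power mult.commute)
    finally have f: "(T / 2 ^ L)\<^sup>2 / (r L)\<^sup>2 = T powr (2 * \<epsilon>) * s ^ L" .
    have "1 / (r L)\<^sup>2 * (A * (T / 2 ^ L)\<^sup>2) = A * ((T / 2 ^ L)\<^sup>2 / (r L)\<^sup>2)" by simp
    then show ?thesis by (simp only: f mult.assoc)
  qed
  have "(\<integral>\<^sup>+\<omega>. R \<omega> \<partial>M) = (\<Sum>L. ennreal (1 / (r L)\<^sup>2) * (\<integral>\<^sup>+\<omega>. Q (2 ^ L) \<omega> \<partial>M))"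
    unfolding R_def by (simp add: nn_integral_suminf nn_integral_cmult)
  also have "\<dots> \<le> (\<Sum>L. ennreal (A * T powr (2 * \<epsilon>) * s ^ L))"
  proof (rule suminf_le)
    fix L :: nat
    have "ennreal (1 / (r L)\<^sup>2) * (\<integral>\<^sup>+\<omega>. Q (2 ^ L) \<omega> \<partial>M) \<le> ennreal (1 / (r L)\<^sup>2) * ennreal (A * (T / 2 ^ L)\<^sup>2)"
      using iQ[of "2 ^ L"] by (intro mult_left_mono) auto
    also have "\<dots> = ennreal (A * T powr (2 * \<epsilon>) * s ^ L)"
      using A by (simp only: ennreal_mult''[symmetric] tm zero_le_power2 mult_nonneg_nonneg)
    finally show "ennreal (1 / (r L)\<^sup>2) * (\<integral>\<^sup>+\<omega>. Q (2 ^ L) \<omega> \<partial>M) \<le> ennreal (A * T powr (2 * \<epsilon>) * s ^ L)" .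
  qed auto
  also have "\<dots> = ennreal (A * T powr (2 * \<epsilon>) * (1 / (1 - s)))"
    using s A by (intro suminf_ennreal_eq sums_mult geometric_sums) auto
  finally have "(\<integral>\<^sup>+\<omega>. R \<omega> \<partial>M) \<noteq> \<infinity>" by (auto simp: top_unique)
  then have fin: "AE \<omega> in M. R \<omega> \<noteq> \<infinity>" by (rule nn_integral_PInf_AE[OF Rm])
  show ?thesis
  proof (intro exI[of _ "\<lambda>\<omega>. 1 + R \<omega>"] conjI)
    show "(\<lambda>\<omega>. 1 + R \<omega>) \<in> borel_measurable M" by measurable
    show "AE \<omega> in M. 1 + R \<omega> < \<infinity>" using fin by eventually_elim (simp add: less_top)
    show "AE \<omega> in M. \<forall>L. E (2 ^ L) \<omega> \<le> (1 + R \<omega>) * ennreal ((T / 2 ^ L) powr (1 - \<epsilon>))"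
      using E
    proof eventually_elim
      case (elim \<omega>)
      show ?case unfolding r_def[symmetric]
      proof
        fix L
        have "(E (2 ^ L) \<omega>)\<^sup>2 \<le> Q (2 ^ L) \<omega>" using elim by simp
        also have "\<dots> = ennreal ((r L)\<^sup>2) * (ennreal (1 / (r L)\<^sup>2) * Q (2 ^ L) \<omega>)"
          using r[of L] by (simp add: mult.assoc[symmetric] ennreal_mult''[symmetric])
        also have "\<dots> \<le> ennreal ((r L)\<^sup>2) * R \<omega>"
          unfolding R_def using sum_le_suminf[of "\<lambda>L. ennreal (1 / (r L)\<^sup>2) * Q (2 ^ L) \<omega>" "{L}"]
          by (intro mult_left_mono) auto
        finally show "E (2 ^ L) \<omega> \<le> (1 + R \<omega>) * ennreal (r L)" by (rule ennreal_le_of_square_le[OF r])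
      qed
    qed
  qed
qed

theorem corollary11:
  fixes M :: "'w measure"
    and F :: "real \<Rightarrow> 'w measure"
    and \<beta> :: "real \<Rightarrow> 'w \<Rightarrow> real"
    and V :: "real^'n::finite \<Rightarrow> real"
    and u\<^sub>0 :: "(real^'n) l2"
    and u :: "real \<Rightarrow> 'w \<Rightarrow> (real^'n) l2"
    and m :: nat
    and T :: real
  assumes "usual_conditions M F"
    and "brownian_motion M F \<beta>"
    and "0 < T"
    and "V \<in> bounded_C (m + 4)"
    and "u\<^sub>0 \<in> sobolev (m + 4)"
    and "mild_solution M F \<beta> V T u\<^sub>0 u"
  shows "((\<lambda>C::real. SUP N\<in>{N::nat. 0 < N \<and> T / real N < 1}.
             measure M {\<omega> \<in> space M.
               sobolev_norm m (splitting V (\<lambda>t. \<beta> t \<omega>) (T / real N) u\<^sub>0 N - u T \<omega>)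
                 \<ge> ennreal (C * (T / real N))}) \<longlongrightarrow> 0) at_top
    \<and> (\<forall>\<epsilon>::real. 0 < \<epsilon> \<and> \<epsilon> < 1 \<longrightarrow>
        (\<exists>C :: 'w \<Rightarrow> ennreal. C \<in> borel_measurable M \<and> (AE \<omega> in M. C \<omega> < \<infinity>) \<and>
           (AE \<omega> in M. \<forall>L::nat. 0 < L \<longrightarrow>
              sobolev_norm m (splitting V (\<lambda>t. \<beta> t \<omega>) (T / 2 ^ L) u\<^sub>0 (2 ^ L) - u T \<omega>)
                \<le> C \<omega> * ennreal ((T / 2 ^ L) powr (1 - \<epsilon>)))))"
proof -
  obtain K where "0 \<le> K" "\<And>is x. length is \<le> m + 4 \<Longrightarrow> \<bar>iter_partial is V x\<bar> \<le> K"
    using bounded_C_bound[OF assms(4)] by blast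
  then interpret potential V "m + 4" K
    using assms(4) by unfold_locales auto
  have u0: "u\<^sub>0 \<in> Hs (m + 4)" using sobolev_subset_Hs assms(5) by blast
  have M: "prob_space M" by (rule usual_conditionsD(1)[OF assms(1)])
  have "AE \<omega> in M. continuous_on {0..} (\<lambda>t. \<beta> t \<omega>)" using assms(2) by (simp add: brownian_motion_def)
  moreover have "AE \<omega> in M. continuous_on {0..T} (\<lambda>t. u t \<omega>) \<and> (\<forall>t\<in>{0..T}. \<exists>J.
      ((\<lambda>r. propagator (\<lambda>t. \<beta> t \<omega>) t r (nonlinearity V (u r \<omega>))) has_integral J) {0..t} \<and>
      u t \<omega> = propagator (\<lambda>t. \<beta> t \<omega>) t 0 u\<^sub>0 + to_l2 (\<lambda>x. \<i> * fun_l2 J x))"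
    using assms(6) unfolding mild_solution_def by blast
  ultimately have conv: "AE \<omega> in M. (\<lambda>n. splitting V (\<lambda>t. \<beta> t \<omega>) (T / real (Suc n)) u\<^sub>0 (Suc n)) \<longlonglongrightarrow> u T \<omega>"
  proof eventually_elim
    case (elim \<omega>)
    have "continuous_on {0..T} (\<lambda>t. \<beta> t \<omega>)" using elim(1) by (rule continuous_on_subset) auto
    then show ?case using elim(2) by (intro pathwise_convergence[OF assms(3)]) auto
  qed
  obtain A Q where A: "0 \<le> A" and Q: "\<And>N. 0 < N \<Longrightarrow> Q N \<in> borel_measurable M"
    and iQ: "\<And>N. 0 < N \<Longrightarrow> (\<integral>\<^sup>+\<omega>. Q N \<omega> \<partial>M) \<le> ennreal (A * (T / real N)\<^sup>2)"
    and E: "AE \<omega> in M. \<forall>N>0. (sobolev_norm m (splitting V (\<lambda>t. \<beta> t \<omega>) (T / real N) u\<^sub>0 N - u T \<omega>))\<^sup>2 \<le> Q N \<omega>"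
    using error_dominated[OF assms(1-3) order_refl u0 conv] by blast
  show ?thesis
  proof (intro conjI allI impI)
    show "((\<lambda>C::real. SUP N\<in>{N::nat. 0 < N \<and> T / real N < 1}.
             measure M {\<omega> \<in> space M.
               sobolev_norm m (splitting V (\<lambda>t. \<beta> t \<omega>) (T / real N) u\<^sub>0 N - u T \<omega>)
                 \<ge> ennreal (C * (T / real N))}) \<longlongrightarrow> 0) at_top"
      by (rule convergence_in_probability[OF M assms(3) A Q iQ E])
    fix \<epsilon> :: real assume "0 < \<epsilon> \<and> \<epsilon> < 1"
    then obtain C where C: "C \<in> borel_measurable M" "AE \<omega> in M. C \<omega> < \<infinity>"
      and b: "AE \<omega> in M. \<forall>L. sobolev_norm m (splitting V (\<lambda>t. \<beta> t \<omega>) (T / real (2 ^ L)) u\<^sub>0 (2 ^ L) - u T \<omega>)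
        \<le> C \<omega> * ennreal ((T / 2 ^ L) powr (1 - \<epsilon>))"
      using almost_sure_rate[OF assms(3) A Q iQ E, of \<epsilon>] by blast
    show "\<exists>C :: 'w \<Rightarrow> ennreal. C \<in> borel_measurable M \<and> (AE \<omega> in M. C \<omega> < \<infinity>) \<and>
           (AE \<omega> in M. \<forall>L::nat. 0 < L \<longrightarrow>
              sobolev_norm m (splitting V (\<lambda>t. \<beta> t \<omega>) (T / 2 ^ L) u\<^sub>0 (2 ^ L) - u T \<omega>)
                \<le> C \<omega> * ennreal ((T / 2 ^ L) powr (1 - \<epsilon>)))"
    proof (intro exI[of _ C] conjI C)
      show "AE \<omega> in M. \<forall>L::nat. 0 < L \<longrightarrow>
              sobolev_norm m (splitting V (\<lambda>t. \<beta> t \<omega>) (T / 2 ^ L) u\<^sub>0 (2 ^ L) - u T \<omega>)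
                \<le> C \<omega> * ennreal ((T / 2 ^ L) powr (1 - \<epsilon>))"
        using b by eventually_elim simp
    qed
  qed
qed

end
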